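(* Let $n\ge2$ and $\mathfrak g=\mathrm{Der}(\mathbb C[t_1,\dots,t_n])$. Consider the following list of $\mathfrak g$-modules: (1) $F(P_0,M)$, where $M$ is a simple $\mathfrak{gl}_n$-module with $M\not\cong V(\delta_r,r)$ for all $r\in\{0,1,\dots,n\}$; (2) $F(P_0,V(\delta_0,0))=P_0$; (3) $F(P_0,V(\delta_r,r))/\tilde L_n(P_0,r)$ for $r=1,\dots,n-1$; (4) $F(P_0,V(\delta_n,n))/L_n(P_0,n)$, which is a $1$-dimensional module. Any simple smooth $\mathfrak g$-module $V$ with height $\ell_V=1$ is isomorphic to a module in this list. Furthermore, the nontrivial modules in this list are all simple smooth $\mathfrak g$-modules with height $1$.
   Context: All vector spaces are over $\mathbb C$; $\mathbb Z_+$ denotes the non-negative integers. Write $\partial_i=\partial/\partial t_i$, $t^\alpha=t_1^{\alpha_1}\cdots t_n^{\alpha_n}$, $|\alpha|=\alpha_1+\dots+\alpha_n$ for $\alpha\in\mathbb Z_+^n$. $\mathfrak g$ is $\mathbb Z$-graded: $\mathfrak g=\bigoplus_{k\ge-1}\mathfrak g_k$, $\mathfrak g_k=\mathrm{Span}\{t^\alpha\partial_i\mid |\alpha|=k+1,\ 1\le i\le n\}$, and $\mathfrak g_{\ge r}=\bigoplus_{k\ge r}\mathfrak g_k$. A $\mathfrak g$-module $V$ is smooth if for every $v\in V$ there is $m\in\mathbb Z_+$ with $\mathfrak g_i v=0$ for all $i\ge m$. For smooth $V$ and $r\in\mathbb Z_+$, $V^{(r)}=\{v\in V\mid \mathfrak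 g_{\ge r}v=0\}$, and the height is $\ell_V=\min\{r\in\mathbb Z_+\mid V^{(r)}\ne0\}$. A module is trivial if $\mathfrak g$ acts by zero. $E_{ij}$ are the matrix units of $\mathfrak{gl}_n$. $\mathcal K_n^+=\mathbb C[t_1,\dots,t_n,\partial_1,\dots,\partial_n]$ is the Weyl algebra, and $P_0=\mathcal K_n^+/\sum_{i=1}^n\mathcal K_n^+t_i$, a (simple left) $\mathcal K_n^+$-module. For a $\mathcal K_n^+$-module $P$ and a $\mathfrak{gl}_n$-module $M$, $F(P,M)=P\otimes_{\mathbb C}M$ is the $\mathfrak g$-module with action $$(t^\alpha\partial_j)\circ(g\otimes v)=((t^\alpha\partial_j)g)\otimes v+\sum_{i=1}^n(\partial_i(t^\alpha)g)\otimes E_{ij}v$$ for $\alpha\in\mathbb Z_+^n$, $1\le j\le n$, $g\in P$, $v\in M$. For $h_i=E_{ii}-E_{i+1,i+1}$ ($1\le i\le n-1$) and $\mathfrak h=\mathrm{Span}\{h_i\}$, let $\delta_i\in\mathfrak h^*$ be given by $\delta_i(h_j)=\delta_{i,j}$ for $1\le i,j\le n-1$, and $\delta_0=\delta_n=0$. $V(\varphi,b)$ is the simple highest weight $\mathfrak{sl}_n$-module of highest weight $\varphi$, made into a $\mathfrak{gl}_n$-module by letting the identity matrix act as the scalar $b$. One has $V(\delta_r,r)\cong\bigwedge^r(\mathbb C^n)$ for $0\le r\le n$, and these are identified. Let $\epsilon_1,\dots,\epsilon_n$ be the standard basis of $\mathbb C^n$. Put $L_n(P_0,0)=0$, for $1\le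 r\le n$ $$L_n(P_0,r)=\mathrm{Span}\Big\{\sum_{k=1}^n(\partial_k p)\otimes(\epsilon_k\wedge\epsilon_{i_2}\wedge\cdots\wedge\epsilon_{i_r})\ \Big|\ p\in P_0,\ 1\le i_2,\dots,i_r\le n\Big\},$$ and for $0\le r\le n$, $\tilde L_n(P_0,r)=\{v\in F(P_0,V(\delta_r,r))\mid \mathfrak g v\subseteq L_n(P_0,r)\}$. *)

theory Defs
  imports
    "HOL-Analysis.Determinants"
    "HOL-Library.Poly_Mapping"
    "HOL-Algebra.AbelCoset"
    "Jordan_Normal_Form.Missing_VectorSpace"
begin

section \<open>Lie algebras and their modules over the complex numbers\<close>

definition complex_ring :: "complex ring" where
  "complex_ring = \<lparr>carrier = UNIV, mult = (*), one = 1, zero = 0, add = (+)\<rparr>"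

text \<open>Vector spaces are modules in the sense of HOL-Algebra; the fields \<open>mult\<close> and \<open>one\<close>,
  which the record \<open>module\<close> inherits from \<open>ring\<close>, play no role there and are left unspecified.\<close>

record 'x lie_alg = "(complex, 'x) module" +
  bracket :: "'x \<Rightarrow> 'x \<Rightarrow> 'x"

text \<open>A vector space on which the elements of \<open>'x\<close> act. Only the action of the elements of the
  Lie algebra (or associative algebra) under consideration is meaningful.\<close>

record ('x, 'v) rep = "(complex, 'v) module" +
  act :: "'x \<Rightarrow> 'v \<Rightarrow> 'v"

locale lie_module = vectorspace complex_ring V
  for L :: "'x lie_alg" and V :: "('x, 'v) rep" (structure) +
  assumes act_closed: "\<lbrakk>x \<in> carrier L; v \<in> carrier V\<rbrakk> \<Longrightarrow> act V x v \<in> carrier V"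
    and act_add: "\<lbrakk>x \<in> carrier L; v \<in> carrier V; w \<in> carrier V\<rbrakk>
      \<Longrightarrow> act V x (v \<oplus>\<^bsub>V\<^esub> w) = act V x v \<oplus>\<^bsub>V\<^esub> act V x w"
    and act_smult: "\<lbrakk>x \<in> carrier L; v \<in> carrier V\<rbrakk>
      \<Longrightarrow> act V x (c \<odot>\<^bsub>V\<^esub> v) = c \<odot>\<^bsub>V\<^esub> act V x v"
    and add_act: "\<lbrakk>x \<in> carrier L; y \<in> carrier L; v \<in> carrier V\<rbrakk>
      \<Longrightarrow> act V (x \<oplus>\<^bsub>L\<^esub> y) v = act V x v \<oplus>\<^bsub>V\<^esub> act V y v"
    and smult_act: "\<lbrakk>x \<in> carrier L; v \<in> carrier V\<rbrakk>
      \<Longrightarrow> act V (c \<odot>\<^bsub>L\<^esub> x) v = c \<odot>\<^bsub>V\<^esub> act V x v"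
    and bracket_act: "\<lbrakk>x \<in> carrier L; y \<in> carrier L; v \<in> carrier V\<rbrakk>
      \<Longrightarrow> act V (bracket L x y) v = act V x (act V y v) \<ominus>\<^bsub>V\<^esub> act V y (act V x v)"

definition lie_submodule :: "'x lie_alg \<Rightarrow> ('x, 'v) rep \<Rightarrow> 'v set \<Rightarrow> bool" where
  "lie_submodule L V N \<longleftrightarrow> subspace complex_ring N V \<and> (\<forall>x\<in>carrier L. \<forall>v\<in>N. act V x v \<in> N)"

definition simple_lie_module :: "'x lie_alg \<Rightarrow> ('x, 'v) rep \<Rightarrow> bool" where
  "simple_lie_module L V \<longleftrightarrow> lie_module L V \<and> carrier V \<noteq> {\<zero>\<^bsub>V\<^esub>} \<and>
     (\<forall>N. lie_submodule L V N \<longrightarrow> N = {\<zero>\<^bsub>V\<^esub>} \<or> N = carrier V)"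

definition lie_iso :: "'x lie_alg \<Rightarrow> ('x, 'v) rep \<Rightarrow> ('x, 'w) rep \<Rightarrow> bool" where
  "lie_iso L V W \<longleftrightarrow> (\<exists>f. f \<in> module_hom complex_ring V W \<and> bij_betw f (carrier V) (carrier W) \<and>
     (\<forall>x\<in>carrier L. \<forall>v\<in>carrier V. f (act V x v) = act W x (f v)))"

definition trivial_lie_module :: "'x lie_alg \<Rightarrow> ('x, 'v) rep \<Rightarrow> bool" where
  "trivial_lie_module L V \<longleftrightarrow> (\<forall>x\<in>carrier L. \<forall>v\<in>carrier V. act V x v = \<zero>\<^bsub>V\<^esub>)"

text \<open>The quotient by an invariant subspace, with elements the cosets.\<close>

definition quot_rep :: "('x, 'v) rep \<Rightarrow> 'v set \<Rightarrow> ('x, 'v set) rep" where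
  "quot_rep V N = \<lparr>carrier = a_rcosets\<^bsub>V\<^esub> N, mult = undefined, one = undefined,
     zero = N, add = set_add V,
     smult = (\<lambda>c X. \<Union>v\<in>X. N +>\<^bsub>V\<^esub> (c \<odot>\<^bsub>V\<^esub> v)),
     act = (\<lambda>x X. \<Union>v\<in>X. N +>\<^bsub>V\<^esub> (act V x v))\<rparr>"



section \<open>Polynomials, the Weyl algebra and the module \<open>P\<^sub>0\<close>\<close>

text \<open>The index set \<open>{1, \<dots>, n}\<close> is a finite linearly ordered type \<open>'n\<close>, so \<open>n = CARD('n)\<close>.
  A monomial \<open>t\<^sup>\<alpha>\<close> is represented by its exponent \<open>\<alpha> :: 'n \<Rightarrow>\<^sub>0 nat\<close>.\<close>

type_synonym 'n mpol = "('n \<Rightarrow>\<^sub>0 nat) \<Rightarrow>\<^sub>0 complex"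
type_synonym ('n, 'v) op_rep = "('n mpol \<Rightarrow> 'n mpol, 'v) rep"

abbreviation cst :: "complex \<Rightarrow> 'n mpol" where
  "cst c \<equiv> Poly_Mapping.single 0 c"

abbreviation mon :: "('n \<Rightarrow>\<^sub>0 nat) \<Rightarrow> 'n mpol" where
  "mon \<alpha> \<equiv> Poly_Mapping.single \<alpha> 1"

abbreviation tvar :: "'n \<Rightarrow> 'n mpol" where
  "tvar i \<equiv> mon (Poly_Mapping.single i 1)"

text \<open>The exponent \<open>\<alpha> - e\<^sub>i\<close> is truncated if \<open>\<alpha>\<^sub>i = 0\<close>, but then the coefficient vanishes.\<close>

definition pd :: "'n \<Rightarrow> 'n mpol \<Rightarrow> 'n mpol" where
  "pd i p = (\<Sum>\<alpha>\<in>Poly_Mapping.keys p.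
     Poly_Mapping.single (\<alpha> - Poly_Mapping.single i 1)
       (of_nat (Poly_Mapping.lookup \<alpha> i) * Poly_Mapping.lookup p \<alpha>))"

text \<open>The Weyl algebra \<open>\<complex>[t\<^sub>1, \<dots>, t\<^sub>n, \<partial>\<^sub>1, \<dots>, \<partial>\<^sub>n]\<close> as the algebra of differential operators
  on polynomials generated by the \<open>t\<^sub>i\<close> and \<open>\<partial>\<^sub>i\<close>.\<close>

inductive_set weyl :: "('n mpol \<Rightarrow> 'n mpol) set" where
  var: "(\<lambda>p. tvar i * p) \<in> weyl"
| pd: "pd i \<in> weyl"
| const: "(\<lambda>p. cst c * p) \<in> weyl"
| add: "\<lbrakk>A \<in> weyl; B \<in> weyl\<rbrakk> \<Longrightarrow> (\<lambda>p. A p + B p) \<in> weyl"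
| comp: "\<lbrakk>A \<in> weyl; B \<in> weyl\<rbrakk> \<Longrightarrow> A \<circ> B \<in> weyl"

definition weyl_regular :: "('n, 'n mpol \<Rightarrow> 'n mpol) op_rep" where
  "weyl_regular = \<lparr>carrier = weyl, mult = (\<circ>), one = id,
     zero = (\<lambda>_. 0), add = (\<lambda>A B p. A p + B p),
     smult = (\<lambda>c A p. cst c * A p),
     act = (\<circ>)\<rparr>"

definition weyl_ideal :: "('n::finite mpol \<Rightarrow> 'n mpol) set" where
  "weyl_ideal = {(\<lambda>p. \<Sum>i\<in>UNIV. A i (tvar i * p)) | A. \<forall>i. A i \<in> weyl}"

definition P0 :: "('n::finite, ('n mpol \<Rightarrow> 'n mpol) set) op_rep" where
  "P0 = quot_rep weyl_regular weyl_ideal"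


section \<open>The Lie algebra of polynomial vector fields\<close>

definition derivations :: "('n mpol \<Rightarrow> 'n mpol) lie_alg" where
  "derivations = \<lparr>carrier = {D. (\<forall>p q. D (p + q) = D p + D q) \<and>
       (\<forall>c p. D (cst c * p) = cst c * D p) \<and> (\<forall>p q. D (p * q) = D p * q + p * D q)},
     mult = undefined, one = undefined,
     zero = (\<lambda>_. 0), add = (\<lambda>D E p. D p + E p),
     smult = (\<lambda>c D p. cst c * D p),
     bracket = (\<lambda>D E p. D (E p) - E (D p))\<rparr>"

definition grade :: "int \<Rightarrow> ('n::finite mpol \<Rightarrow> 'n mpol) set" where
  "grade k = module.span complex_ring derivations
     {(\<lambda>p. mon \<alpha> * pd i p) | \<alpha> i. int (\<Sum>j\<in>UNIV. Poly_Mapping.lookup \<alpha> j) = k + 1}"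

definition grade_ge :: "int \<Rightarrow> ('n::finite mpol \<Rightarrow> 'n mpol) set" where
  "grade_ge r = module.span complex_ring derivations (\<Union>k\<in>{r..}. grade k)"

definition smooth :: "('n::finite, 'v) op_rep \<Rightarrow> bool" where
  "smooth V \<longleftrightarrow> (\<forall>v\<in>carrier V. \<exists>m::nat. \<forall>i\<ge>int m. \<forall>x\<in>grade i. act V x v = \<zero>\<^bsub>V\<^esub>)"

definition killed_ge :: "('n::finite, 'v) op_rep \<Rightarrow> nat \<Rightarrow> 'v set" where
  "killed_ge V r = {v \<in> carrier V. \<forall>x\<in>grade_ge (int r). act V x v = \<zero>\<^bsub>V\<^esub>}"

text \<open>For nonzero smooth modules the set of which the minimum is taken is nonempty.\<close>

definition height :: "('n::finite, 'v) op_rep \<Rightarrow> nat" where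
  "height V = (LEAST r. killed_ge V r \<noteq> {\<zero>\<^bsub>V\<^esub>})"


section \<open>\<open>gl\<^sub>n\<close>, highest weight modules and exterior powers\<close>

type_synonym 'n sq_matrix = "complex^'n^'n"
type_synonym ('n, 'v) gl_rep = "('n sq_matrix, 'v) rep"

definition gl :: "(complex^'n^'n) lie_alg" where
  "gl = \<lparr>carrier = UNIV, mult = undefined, one = undefined, zero = 0, add = (+),
     smult = (\<lambda>c A. \<chi> i j. c * A $ i $ j),
     bracket = (\<lambda>A B. A ** B - B ** A)\<rparr>"

definition sl :: "(complex^'n^'n) lie_alg" where
  "sl = gl\<lparr>carrier := {A. trace A = 0}\<rparr>"

definition matunit :: "'n \<Rightarrow> 'n \<Rightarrow> complex^'n^'n" where
  "matunit i j = (\<chi> a b. if a = i \<and> b = j then 1 else 0)"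

text \<open>The \<open>k\<close>-th element of the index type, for \<open>1 \<le> k \<le> n\<close>.\<close>

definition nth_index :: "nat \<Rightarrow> 'n::{finite,linorder}" where
  "nth_index k = sorted_list_of_set UNIV ! (k - 1)"

definition coroot :: "nat \<Rightarrow> 'n::{finite,linorder} sq_matrix" where
  "coroot k = matunit (nth_index k) (nth_index k) - matunit (nth_index (k + 1)) (nth_index (k + 1))"

text \<open>\<open>is_V \<phi> b M\<close> says that \<open>M\<close> is (isomorphic to) \<open>V(\<phi>, b)\<close>. A weight \<open>\<phi>\<close> is given by its
  values \<open>\<phi> k = \<phi>(h\<^sub>k)\<close>, \<open>1 \<le> k \<le> n - 1\<close>, on the basis of the Cartan subalgebra; other values of
  \<open>\<phi>\<close> are irrelevant.\<close>

definition is_V :: "(nat \<Rightarrow> complex) \<Rightarrow> complex \<Rightarrow> ('n::{finite,linorder}, 'v) gl_rep \<Rightarrow> bool"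
  where "is_V \<phi> b M \<longleftrightarrow> lie_module gl M \<and> simple_lie_module sl M \<and>
    (\<exists>v\<in>carrier M. v \<noteq> \<zero>\<^bsub>M\<^esub> \<and>
       (\<forall>i j. i < j \<longrightarrow> act M (matunit i j) v = \<zero>\<^bsub>M\<^esub>) \<and>
       (\<forall>k\<in>{1..CARD('n) - 1}. act M (coroot k) v = \<phi> k \<odot>\<^bsub>M\<^esub> v)) \<and>
    (\<forall>v\<in>carrier M. act M (mat 1) v = b \<odot>\<^bsub>M\<^esub> v)"

text \<open>The weight \<open>\<delta>\<^sub>r\<close>; on the indices \<open>1, \<dots>, n - 1\<close> both \<open>\<delta>\<^sub>0\<close> and \<open>\<delta>\<^sub>n\<close> vanish.\<close>

definition fundamental_weight :: "nat \<Rightarrow> nat \<Rightarrow> complex" where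
  "fundamental_weight r k = (if k = r then 1 else 0)"

text \<open>The exterior algebra of \<open>\<complex>\<^sup>n\<close> has the basis \<open>\<epsilon>\<^bsub>i\<^sub>1\<^esub> \<and> \<dots> \<and> \<epsilon>\<^bsub>i\<^sub>r\<^esub>\<close>, \<open>i\<^sub>1 < \<dots> < i\<^sub>r\<close>, indexed here
  by the sets \<open>{i\<^sub>1, \<dots>, i\<^sub>r}\<close>; the wedge of an arbitrary sequence of basis vectors of \<open>\<complex>\<^sup>n\<close> is
  brought to this form by counting inversions.\<close>

definition wedge :: "'n::linorder list \<Rightarrow> 'n set \<Rightarrow>\<^sub>0 complex" where
  "wedge xs = (if distinct xs then Poly_Mapping.single (set xs)
       ((-1) ^ card {(a, b). a < b \<and> b < length xs \<and> xs ! b < xs ! a}) else 0)"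

definition scale :: "complex \<Rightarrow> ('a \<Rightarrow>\<^sub>0 complex) \<Rightarrow> 'a \<Rightarrow>\<^sub>0 complex" where
  "scale c f = Poly_Mapping.map ((*) c) f"

text \<open>A matrix \<open>A\<close> acts on the exterior power by derivations:
  \<open>\<epsilon>\<^bsub>x\<^sub>1\<^esub> \<and> \<dots> \<and> \<epsilon>\<^bsub>x\<^sub>r\<^esub>\<close> goes to the sum over \<open>s\<close> of the same wedge with \<open>\<epsilon>\<^bsub>x\<^sub>s\<^esub>\<close> replaced by
  \<open>A \<epsilon>\<^bsub>x\<^sub>s\<^esub> = (\<Sum>i. A\<^bsub>i x\<^sub>s\<^esub> \<epsilon>\<^sub>i)\<close>. This is \<open>V(\<delta>\<^sub>r, r)\<close> under the usual identification.\<close>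

definition ext_power :: "nat \<Rightarrow> ('n::{finite,linorder}, 'n set \<Rightarrow>\<^sub>0 complex) gl_rep" where
  "ext_power r = \<lparr>carrier = {f. \<forall>S\<in>Poly_Mapping.keys f. card S = r},
     mult = undefined, one = undefined, zero = 0, add = (+), smult = scale,
     act = (\<lambda>A f. \<Sum>S\<in>Poly_Mapping.keys f. let xs = sorted_list_of_set S in
        \<Sum>s<r. \<Sum>i\<in>UNIV.
          scale (Poly_Mapping.lookup f S * A $ i $ (xs ! s)) (wedge (xs[s := i])))\<rparr>"


section \<open>The modules \<open>F(P, M)\<close>\<close>

text \<open>\<open>P \<otimes> M\<close> is the quotient of the free vector space on \<open>P \<times> M\<close> by the bilinear relations.
  Since a derivation is \<open>D = (\<Sum>j. D(t\<^sub>j) \<partial>\<^sub>j)\<close>, the linear extension to \<open>D\<close> of the action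
  \<open>t\<^sup>\<alpha>\<partial>\<^sub>j \<circ> (g \<otimes> v) = t\<^sup>\<alpha>\<partial>\<^sub>j g \<otimes> v + (\<Sum>i. \<partial>\<^sub>i(t\<^sup>\<alpha>) g \<otimes> E\<^bsub>ij\<^esub> v)\<close> is
  \<open>D \<circ> (g \<otimes> v) = D g \<otimes> v + (\<Sum>i j. \<partial>\<^sub>i(D(t\<^sub>j)) g \<otimes> E\<^bsub>ij\<^esub> v)\<close>. It is first defined on the free
  vector space.\<close>

definition F_free :: "('n::finite, 'p) op_rep \<Rightarrow> ('n, 'm) gl_rep \<Rightarrow>
    ('n, 'p \<times> 'm \<Rightarrow>\<^sub>0 complex) op_rep" where
  "F_free P M = \<lparr>carrier = {f. Poly_Mapping.keys f \<subseteq> carrier P \<times> carrier M},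
     mult = undefined, one = undefined, zero = 0, add = (+), smult = scale,
     act = (\<lambda>D f. \<Sum>(g, v)\<in>Poly_Mapping.keys f. scale (Poly_Mapping.lookup f (g, v))
        (Poly_Mapping.single (act P D g, v) 1 +
         (\<Sum>i\<in>UNIV. \<Sum>j\<in>UNIV.
            Poly_Mapping.single (act P (\<lambda>p. pd i (D (tvar j)) * p) g, act M (matunit i j) v) 1)))\<rparr>"

definition bilinear_relations ::
    "('x, 'p) rep \<Rightarrow> ('y, 'm) rep \<Rightarrow> ('p \<times> 'm \<Rightarrow>\<^sub>0 complex) set" where
  "bilinear_relations P M =
     {Poly_Mapping.single (g \<oplus>\<^bsub>P\<^esub> h, v) 1 - Poly_Mapping.single (g, v) 1 - Poly_Mapping.single (h, v) 1
        | g h v. g \<in> carrier P \<and> h \<in> carrier P \<and> v \<in> carrier M} \<union>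
     {Poly_Mapping.single (g, v \<oplus>\<^bsub>M\<^esub> w) 1 - Poly_Mapping.single (g, v) 1 - Poly_Mapping.single (g, w) 1
        | g v w. g \<in> carrier P \<and> v \<in> carrier M \<and> w \<in> carrier M} \<union>
     {Poly_Mapping.single (c \<odot>\<^bsub>P\<^esub> g, v) 1 - Poly_Mapping.single (g, v) c
        | c g v. g \<in> carrier P \<and> v \<in> carrier M} \<union>
     {Poly_Mapping.single (g, c \<odot>\<^bsub>M\<^esub> v) 1 - Poly_Mapping.single (g, v) c
        | c g v. g \<in> carrier P \<and> v \<in> carrier M}"

definition F_mod :: "('n::finite, 'p) op_rep \<Rightarrow> ('n, 'm) gl_rep \<Rightarrow>
    ('n, ('p \<times> 'm \<Rightarrow>\<^sub>0 complex) set) op_rep" where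
  "F_mod P M = quot_rep (F_free P M) (module.span complex_ring (F_free P M) (bilinear_relations P M))"

definition pure_tensor :: "('n::finite, 'p) op_rep \<Rightarrow> ('n, 'm) gl_rep \<Rightarrow>
    'p \<Rightarrow> 'm \<Rightarrow> ('p \<times> 'm \<Rightarrow>\<^sub>0 complex) set" where
  "pure_tensor P M g v =
     module.span complex_ring (F_free P M) (bilinear_relations P M)
       +>\<^bsub>F_free P M\<^esub> Poly_Mapping.single (g, v) 1"

type_synonym 'n F_ext = "(('n mpol \<Rightarrow> 'n mpol) set \<times> ('n set \<Rightarrow>\<^sub>0 complex) \<Rightarrow>\<^sub>0 complex) set"

abbreviation F_ext :: "nat \<Rightarrow> ('n::{finite,linorder}, 'n F_ext) op_rep" where
  "F_ext r \<equiv> F_mod P0 (ext_power r)"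

text \<open>For \<open>r = 0\<close> the spanning set is empty, so that \<open>L_sub 0\<close> is the zero subspace.\<close>

definition L_sub :: "nat \<Rightarrow> 'n::{finite,linorder} F_ext set" where
  "L_sub r = module.span complex_ring (F_ext r)
     {(\<Oplus>\<^bsub>F_ext r\<^esub>k\<in>UNIV. pure_tensor P0 (ext_power r) (act P0 (pd k) p) (wedge (k # is)))
        | p is. p \<in> carrier P0 \<and> Suc (length is) = r}"

definition L_tilde :: "nat \<Rightarrow> 'n::{finite,linorder} F_ext set" where
  "L_tilde r = {v \<in> carrier (F_ext r). \<forall>x\<in>carrier derivations. act (F_ext r) x v \<in> L_sub r}"

end

theory Submission
  imports Defs
begin

text \<open>Write \<open>V\<^sup>(\<^sup>1\<^sup>)\<close> for the vectors killed by \<open>g\<^sub>\<ge>\<^sub>1\<close>; it is a module over \<open>g\<^sub>0 = gl\<^sub>n\<close>, twisted here by the trace.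
  Elements of \<open>F(P\<^sub>0, M)\<close> are written \<open>\<Sum>\<^sub>\<beta> \<partial>\<^sup>\<beta> \<otimes> m\<^sub>\<beta>\<close>, and for a simple \<open>V\<close> of height 1 the map
  \<open>\<partial>\<^sup>\<beta> \<otimes> m \<mapsto> \<partial>\<^sup>\<beta> m\<close> is a surjection \<open>\<psi>\<close> from \<open>F(P\<^sub>0, V\<^sup>(\<^sup>1\<^sup>))\<close> onto \<open>V\<close>. A certain quadratic expression
  in the action on \<open>F(P\<^sub>0, M)\<close> equals \<open>u \<otimes> TT\<close>, where \<open>u\<close> is an arbitrary polynomial and \<open>TT\<close> ranges
  over quadratic elements of \<open>U(gl\<^sub>n)\<close>. If \<open>TT\<close> does not vanish on \<open>M\<close>, multiplication by polynomials
  produces a bottom vector in every nonzero submodule, so \<open>F(P\<^sub>0, M)\<close> is simple and \<open>\<psi>\<close> is an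
  isomorphism. If \<open>TT = 0\<close>, the diagonal matrix units act as commuting idempotents and \<open>M\<close> contains
  an exterior power \<open>\<And>\<^sup>r\<close>; the restriction of \<open>\<psi>\<close> to \<open>F(P\<^sub>0, \<And>\<^sup>r)\<close> is onto, and its kernel is that of
  the exterior derivative \<open>dext\<close>, by Cartan's formula and an Euler field argument. Finally \<open>TT = 0\<close> on a
  simple module characterizes the modules \<open>V(\<delta>\<^sub>r, r)\<close>.\<close>

text \<open>A coefficient module may be infinite-dimensional and without weight vectors, and
  \<open>V\<^sup>(\<^sup>1\<^sup>)\<close> is not known to be simple beforehand; so the argument
  cannot start from weights. The vanishing or non-vanishing of TT decides instead: if TT is nonzero,
  simplicity of \<open>V\<^sup>(\<^sup>1\<^sup>)\<close> comes out together with injectivity of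
  \<psi>; if TT vanishes, weight vectors exist because the diagonal units have become idempotent.

  The twist by the trace originates in t_i \<partial>_j 1 = -\<delta>_ij in P0.

  Height 1, as opposed to 0, enters by excluding the top exterior power: a vector of weight (1, ...,
  1) in \<open>V\<^sup>(\<^sup>1\<^sup>)\<close> is killed by all fields of non-negative degree.
  Hence the one-dimensional module of the list never arises from a module of height 1.

  The core arguments concern linear maps on whole types and invariant subspaces. Modules with
  carriers enter through linear bijections onto such subspaces.\<close>

declare One_nat_def [simp del]

section \<open>Complex vector spaces as a type class\<close>

text \<open>Vector spaces as types make all operators total, so their identities can be simplified
  without carrier conditions. Modules with carriers are later mapped linearly and bijectively onto
  subspaces of such types.\<close>

class cvs = ab_group_add +
  fixes scl :: "complex \<Rightarrow> 'a \<Rightarrow> 'a"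
  assumes scl_add_right: "scl c (x + y) = scl c x + scl c y"
    and scl_add_left: "scl (c + d) x = scl c x + scl d x"
    and scl_scl [simp]: "scl c (scl d x) = scl (c * d) x"
    and scl_one [simp]: "scl 1 x = x"

interpretation cvs: vector_space "scl :: complex \<Rightarrow> 'a \<Rightarrow> 'a::cvs"
  by unfold_locales (simp_all add: scl_add_right scl_add_left)

lemmas scl_zero_right [simp] = cvs.scale_zero_right
lemmas scl_zero_left [simp] = cvs.scale_zero_left
lemmas scl_minus_left [simp] = cvs.scale_minus_left
lemmas scl_minus_right [simp] = cvs.scale_minus_right
lemmas scl_sum = cvs.scale_sum_right
lemmas scl_eq_0_iff [simp] = cvs.scale_eq_0_iff

instantiation complex :: cvs
begin
definition scl_complex :: "complex \<Rightarrow> complex \<Rightarrow> complex" where "scl_complex = (*)"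
instance by standard (simp_all add: scl_complex_def algebra_simps)
end

instantiation poly_mapping :: (type, cvs) cvs
begin
definition scl_poly_mapping :: "complex \<Rightarrow> ('a \<Rightarrow>\<^sub>0 'b) \<Rightarrow> 'a \<Rightarrow>\<^sub>0 'b"
  where "scl_poly_mapping c f = Poly_Mapping.map (scl c) f"

lemma lookup_scl [simp]:
  "Poly_Mapping.lookup (scl c f) k = scl c (Poly_Mapping.lookup f k)"
  by (simp add: scl_poly_mapping_def Poly_Mapping.map.rep_eq when_def)

instance
  by standard (rule poly_mapping_eqI;
    simp add: lookup_add scl_add_right scl_add_left)+
end

lemma scl_complex [simp]: "scl c (z::complex) = c * z"
  by (simp add: scl_complex_def)

lemma scale_eq_scl: "scale = (scl :: complex \<Rightarrow> ('a \<Rightarrow>\<^sub>0 complex) \<Rightarrow> _)"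
  by (intro ext) (simp add: scale_def scl_poly_mapping_def scl_complex_def)

lemma scl_single [simp]: "scl c (Poly_Mapping.single k m) = Poly_Mapping.single k (scl c m)"
  by (rule poly_mapping_eqI) (simp add: lookup_single when_def)

definition clin :: "('a::cvs \<Rightarrow> 'b::cvs) \<Rightarrow> bool" where
  "clin f \<longleftrightarrow> (\<forall>x y. f (x + y) = f x + f y) \<and> (\<forall>c x. f (scl c x) = scl c (f x))"

lemma clinI: "(\<And>x y. f (x + y) = f x + f y) \<Longrightarrow> (\<And>c x. f (scl c x) = scl c (f x)) \<Longrightarrow> clin f"
  by (simp add: clin_def)

lemma clin_add: "clin f \<Longrightarrow> f (x + y) = f x + f y"
  and clin_scl: "clin f \<Longrightarrow> f (scl c x) = scl c (f x)"
  by (simp_all add: clin_def)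

lemma clin_0: "clin f \<Longrightarrow> f 0 = 0"
  using clin_scl[of f 0 0] by simp

lemma clin_minus: "clin f \<Longrightarrow> f (- x) = - f x"
  using clin_scl[of f "-1" x] by simp

lemma clin_diff: "clin f \<Longrightarrow> f (x - y) = f x - f y"
  using clin_add[of f x "- y"] by (simp add: clin_minus)

lemma clin_sum: "clin f \<Longrightarrow> f (sum g A) = (\<Sum>a\<in>A. f (g a))"
  by (induction A rule: infinite_finite_induct) (simp_all add: clin_0 clin_add)

lemmas clin_simps = clin_add clin_scl clin_0 clin_minus clin_diff clin_sum

lemma clin_comp: "clin f \<Longrightarrow> clin g \<Longrightarrow> clin (\<lambda>x. f (g x))"
  by (simp add: clin_def)

lemma clin_plus: "clin f \<Longrightarrow> clin g \<Longrightarrow> clin (\<lambda>x. f x + g x)"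
  and clin_sub: "clin f \<Longrightarrow> clin g \<Longrightarrow> clin (\<lambda>x. f x - g x)"
  and clin_scale: "clin f \<Longrightarrow> clin (\<lambda>x. scl c (f x))"
  by (simp_all add: clin_def scl_add_right cvs.scale_right_diff_distrib mult.commute)

lemma clin_zero: "clin (\<lambda>x. 0)"
  by (simp add: clin_def)

lemma clin_id: "clin (\<lambda>x. x)"
  by (simp add: clin_def)

lemma clin_sumf: "(\<And>a. a \<in> A \<Longrightarrow> clin (f a)) \<Longrightarrow> clin (\<lambda>x. \<Sum>a\<in>A. f a x)"
  by (rule clinI) (simp_all add: clin_simps scl_sum sum.distrib)

lemma clin_if: "clin f \<Longrightarrow> clin g \<Longrightarrow> clin (\<lambda>x. if b then f x else g x)"
  by (cases b) simp_all

definition csub :: "'a::cvs set \<Rightarrow> bool" where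
  "csub N \<longleftrightarrow> 0 \<in> N \<and> (\<forall>x\<in>N. \<forall>y\<in>N. x + y \<in> N) \<and> (\<forall>c. \<forall>x\<in>N. scl c x \<in> N)"

lemma csub_eq_subspace: "csub N \<longleftrightarrow> cvs.subspace N"
  by (auto simp: csub_def cvs.subspace_def)

lemma csub_0: "csub N \<Longrightarrow> 0 \<in> N"
  and csub_add: "csub N \<Longrightarrow> x \<in> N \<Longrightarrow> y \<in> N \<Longrightarrow> x + y \<in> N"
  and csub_scl: "csub N \<Longrightarrow> x \<in> N \<Longrightarrow> scl c x \<in> N"
  by (simp_all add: csub_def)

lemma csub_minus: "csub N \<Longrightarrow> x \<in> N \<Longrightarrow> - x \<in> N"
  using csub_scl[of N x "-1"] by simp

lemma csub_diff: "csub N \<Longrightarrow> x \<in> N \<Longrightarrow> y \<in> N \<Longrightarrow> x - y \<in> N"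
  using csub_add[of N x "- y"] csub_minus[of N y] by simp

lemma csub_sum: "csub N \<Longrightarrow> (\<And>a. a \<in> A \<Longrightarrow> f a \<in> N) \<Longrightarrow> sum f A \<in> N"
  by (induction A rule: infinite_finite_induct) (simp_all add: csub_0 csub_add)

lemma csub_sclD: "csub N \<Longrightarrow> scl c x \<in> N \<Longrightarrow> c \<noteq> 0 \<Longrightarrow> x \<in> N"
  using csub_scl[of N "scl c x" "inverse c"] by simp

lemmas csub_intros = csub_0 csub_add csub_scl csub_minus csub_diff csub_sum

lemma csub_image: "clin f \<Longrightarrow> csub N \<Longrightarrow> csub (f ` N)"
  unfolding csub_def
  by (auto simp: image_iff) (metis clin_0, metis clin_add, metis clin_scl)

lemma csub_vimage: "clin f \<Longrightarrow> csub N \<Longrightarrow> csub C \<Longrightarrow> csub {x \<in> C. f x \<in> N}"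
  by (auto simp: csub_def clin_simps)

lemma csub_zero: "csub {0}"
  by (simp add: csub_def)

lemma csub_UNIV: "csub UNIV"
  by (simp add: csub_def)

subsection \<open>Linear extension to finitely supported functions\<close>

lemma pm_induct [case_names zero single add]:
  assumes "P 0" "\<And>k m. P (Poly_Mapping.single k m)"
    "\<And>f g. P f \<Longrightarrow> P g \<Longrightarrow> P (f + g)"
  shows "P (f :: 'a \<Rightarrow>\<^sub>0 'b::comm_monoid_add)"
proof (induction f rule: update_induct)
  case const
  then show ?case using assms(1) by simp
next
  case (update f a b)
  have "Poly_Mapping.update a b f = f + Poly_Mapping.single a b"
    using update by (intro poly_mapping_eqI)
      (auto simp: lookup_update lookup_add lookup_single when_def in_keys_iff)
  then show ?case using assms update by simp
qed

text \<open>The additive extension of a map prescribed on monomials \<open>single k m\<close>.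
  Multiplication by t and \<partial>, the operators of the exterior algebra and the homomorphisms
  \<psi> are built from it, and \<open>clin_eqI\<close> reduces identities between them to
  monomials.\<close>

definition pext :: "('a \<Rightarrow> 'b \<Rightarrow> 'c) \<Rightarrow> ('a \<Rightarrow>\<^sub>0 'b::comm_monoid_add) \<Rightarrow> 'c::comm_monoid_add" where
  "pext \<phi> g = (\<Sum>k\<in>Poly_Mapping.keys g. \<phi> k (Poly_Mapping.lookup g k))"

lemma pext_superset:
  "finite A \<Longrightarrow> Poly_Mapping.keys g \<subseteq> A \<Longrightarrow> (\<And>k. \<phi> k 0 = 0) \<Longrightarrow>
    pext \<phi> g = (\<Sum>k\<in>A. \<phi> k (Poly_Mapping.lookup g k))"
  unfolding pext_def by (rule sum.mono_neutral_left) (auto simp: in_keys_iff)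

lemma pext_zero [simp]: "pext \<phi> 0 = 0"
  by (simp add: pext_def)

lemma pext_single [simp]: "\<phi> k 0 = 0 \<Longrightarrow> pext \<phi> (Poly_Mapping.single k m) = \<phi> k m"
  by (simp add: pext_def)

lemma pext_add:
  assumes "\<And>k. \<phi> k 0 = 0" "\<And>k m m'. \<phi> k (m + m') = \<phi> k m + \<phi> k m'"
  shows "pext \<phi> (f + g) = pext \<phi> f + pext \<phi> g"
proof -
  let ?A = "Poly_Mapping.keys f \<union> Poly_Mapping.keys g"
  have "Poly_Mapping.keys (f + g) \<subseteq> ?A" by (rule Poly_Mapping.keys_add)
  then show ?thesis
    using assms by (simp add: pext_superset[of ?A] lookup_add sum.distrib)
qed

lemma clin_pext:
  fixes \<phi> :: "'a \<Rightarrow> 'b::cvs \<Rightarrow> 'c::cvs"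
  assumes "\<And>k. clin (\<phi> k)"
  shows "clin (pext \<phi>)"
proof (rule clinI)
  fix c and f :: "'a \<Rightarrow>\<^sub>0 'b"
  have "Poly_Mapping.keys (scl c f) \<subseteq> Poly_Mapping.keys f"
    by (auto simp: in_keys_iff)
  then show "pext \<phi> (scl c f) = scl c (pext \<phi> f)"
    using assms by (simp add: pext_superset[of "Poly_Mapping.keys f"] clin_simps scl_sum)
qed (simp add: pext_add assms clin_simps)

lemma clin_single: "clin (Poly_Mapping.single k)"
  by (simp add: clin_def single_add)

lemma clin_eqI:
  assumes "clin f" "clin g" "\<And>k m. f (Poly_Mapping.single k m) = g (Poly_Mapping.single k m)"
  shows "f x = g x"
  by (induction x rule: pm_induct) (use assms in \<open>simp_all add: clin_simps\<close>)

lemma pm_expand: "g = (\<Sum>k\<in>Poly_Mapping.keys g. Poly_Mapping.single k (Poly_Mapping.lookup g k))"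
  by (rule poly_mapping_eqI) (auto simp: lookup_sum lookup_single when_def in_keys_iff)

text \<open>The operator 1 \<otimes> S on P0 \<otimes> W.\<close>

abbreviation pmap :: "('b \<Rightarrow> 'c) \<Rightarrow> ('a \<Rightarrow>\<^sub>0 'b::cvs) \<Rightarrow> 'a \<Rightarrow>\<^sub>0 'c::cvs" where
  "pmap S \<equiv> pext (\<lambda>k m. Poly_Mapping.single k (S m))"

lemma clin_pmap: "clin S \<Longrightarrow> clin (pmap S)"
  by (intro clin_pext) (rule clin_comp[OF clin_single])

lemma lookup_pmap: "clin S \<Longrightarrow> Poly_Mapping.lookup (pmap S g) k = S (Poly_Mapping.lookup g k)"
  unfolding pext_def
  by (auto simp: lookup_sum lookup_single when_def in_keys_iff clin_0)

section \<open>Derivations of the polynomial ring\<close>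

abbreviation e1 :: "'n \<Rightarrow> 'n \<Rightarrow>\<^sub>0 nat" where
  "e1 i \<equiv> Poly_Mapping.single i 1"

lemma pd_pext: "pd i = pext (\<lambda>\<alpha> c. Poly_Mapping.single (\<alpha> - e1 i)
    (of_nat (Poly_Mapping.lookup \<alpha> i) * c))"
  by (intro ext) (simp add: pd_def pext_def)

lemma clin_pd: "clin (pd i)"
  unfolding pd_pext
  by (rule clin_pext) (simp add: clin_def single_add[symmetric] algebra_simps)

lemma pd_add: "pd i (p + q) = pd i p + pd i q"
  and pd_0 [simp]: "pd i 0 = 0"
  by (simp_all add: clin_simps clin_pd)

lemma pd_single: "pd i (Poly_Mapping.single \<alpha> c) =
    Poly_Mapping.single (\<alpha> - e1 i) (of_nat (Poly_Mapping.lookup \<alpha> i) * c)"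
  unfolding pd_pext by simp

lemma cst_mult: "cst c * p = scl c p"
  by (simp add: mult_map_scale_conv_mult[symmetric] scl_poly_mapping_def scl_complex_def)

lemma scl_mult_left: "scl c (p :: 'n mpol) * q = scl c (p * q)"
  and scl_mult_right: "p * scl c (q :: 'n mpol) = scl c (p * q)"
  by (simp_all add: cst_mult[symmetric] ac_simps)

lemma minus_e1_add:
  assumes "Poly_Mapping.lookup \<alpha> i \<noteq> 0"
  shows "(\<alpha> + \<beta>) - e1 i = (\<alpha> - e1 i) + \<beta>" "(\<beta> + \<alpha>) - e1 i = \<beta> + (\<alpha> - e1 i)"
  using assms
  by (auto intro!: poly_mapping_eqI simp: lookup_add lookup_minus lookup_single when_def)

lemma pd_mult: "pd i (p * q) = pd i p * q + p * pd i q"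
proof (induction p rule: pm_induct)
  case (single \<alpha> c)
  show ?case
  proof (induction q rule: pm_induct)
    case (single \<beta> d)
    let ?s = "Poly_Mapping.single (\<alpha> + \<beta> - e1 i)"
    have 1: "pd i (Poly_Mapping.single \<alpha> c) * Poly_Mapping.single \<beta> d =
        ?s (of_nat (Poly_Mapping.lookup \<alpha> i) * (c * d))"
      by (cases "Poly_Mapping.lookup \<alpha> i = 0")
        (simp_all add: mult_single pd_single minus_e1_add mult.assoc)
    have 2: "Poly_Mapping.single \<alpha> c * pd i (Poly_Mapping.single \<beta> d) =
        ?s (of_nat (Poly_Mapping.lookup \<beta> i) * (c * d))"
      by (cases "Poly_Mapping.lookup \<beta> i = 0")
        (simp_all add: mult_single pd_single minus_e1_add mult.left_commute)
    show ?case
      unfolding 1 2 by (simp add: mult_single pd_single lookup_add single_add[symmetric] algebra_simps)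
  qed (simp_all add: pd_add algebra_simps)
qed (simp_all add: pd_add algebra_simps)

lemma pd_cst [simp]: "pd i (cst c) = 0"
  by (simp add: pd_single)

lemma pd_one [simp]: "pd i 1 = 0"
  using pd_cst[of i 1] by (simp add: single_one)

lemma pd_tvar: "pd i (tvar j) = (if i = j then 1 else 0)"
  by (simp add: pd_single lookup_single when_def)

text \<open>Induction over the ring generators suits statements that pass to products, such as
  Leibniz rules; for those, an induction over monomials would have to handle exponents.\<close>

lemma mpol_induct [case_names cst tvar add mult]:
  assumes "\<And>c. P (cst c)" "\<And>i. P (tvar i)" "\<And>p q. P p \<Longrightarrow> P q \<Longrightarrow> P (p + q)"
    "\<And>p q. P p \<Longrightarrow> P q \<Longrightarrow> P (p * q)"
  shows "P (p :: 'n mpol)"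
proof (induction p rule: pm_induct)
  case zero
  show ?case using assms(1)[of 0] by simp
next
  case (single \<alpha> c)
  have "P (mon \<alpha>)"
  proof (induction \<alpha> rule: pm_induct)
    case zero
    show ?case using assms(1)[of 1] by simp
  next
    case (single i k)
    show ?case
    proof (induction k)
      case 0
      show ?case using assms(1)[of 1] by simp
    next
      case (Suc k)
      have "mon (Poly_Mapping.single i (Suc k)) = tvar i * mon (Poly_Mapping.single i k)"
        by (simp only: mult_single single_add[symmetric] plus_1_eq_Suc mult_1)
      then show ?case using assms Suc by simp
    qed
  next
    case (add f g)
    have "mon (f + g) = mon f * mon g" by (simp add: mult_single)
    then show ?case using add assms by simp
  qed
  moreover have "Poly_Mapping.single \<alpha> c = cst c * mon \<alpha>" by (simp add: mult_single)
  ultimately show ?case using assms by simp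
qed (use assms in auto)

lemma pd_commute: "pd i (pd j p) = pd j (pd i p)"
  by (induction p rule: mpol_induct) (simp_all add: pd_add pd_mult pd_tvar algebra_simps)

abbreviation derivs :: "('n mpol \<Rightarrow> 'n mpol) set" where
  "derivs \<equiv> carrier derivations"

definition vf :: "('n \<Rightarrow> 'n mpol) \<Rightarrow> 'n::finite mpol \<Rightarrow> 'n mpol" where
  "vf f p = (\<Sum>j\<in>UNIV. f j * pd j p)"

lemma vf_tvar [simp]: "vf f (tvar j) = f j"
  by (simp add: vf_def pd_tvar if_distrib cong: if_cong)

lemma vf_add: "vf f (p + q) = vf f p + vf f q"
  by (simp add: vf_def pd_add algebra_simps sum.distrib)

lemma vf_cst: "vf f (cst c * p) = cst c * vf f p"
  by (simp add: vf_def cst_mult clin_scl[OF clin_pd] scl_mult_right scl_sum)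

lemma vf_mult: "vf f (p * q) = vf f p * q + p * vf f q"
  by (simp add: vf_def pd_mult algebra_simps sum.distrib sum_distrib_left sum_distrib_right)

lemma vf_derivs [simp]: "vf f \<in> derivs"
  using vf_add vf_cst vf_mult unfolding derivations_def by auto

text \<open>The product rule for 1 * 1 gives D 1 = 0, so a derivation kills constants and is
  determined by its values on the variables.\<close>

lemma derivs_vf: 
  assumes "D \<in> derivs"
  shows "D = vf (\<lambda>j. D (tvar j))"
proof -
  have D: "D (p + q) = D p + D q" "D (cst c * p) = cst c * D p" "D (p * q) = D p * q + p * D q"
    for p q c using assms unfolding derivations_def by auto
  have "D 1 = 0"
    using D(3)[of 1 1] by simp
  then have "D (cst c) = 0" for c
    using D(2)[of c 1] by (simp del: single_one)
  moreover have "vf f (cst c) = 0" for f :: "'a \<Rightarrow> 'a mpol" and c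
    by (simp add: vf_def)
  ultimately have "D p = vf (\<lambda>j. D (tvar j)) p" for p
    by (induction p rule: mpol_induct) (simp_all add: D vf_add vf_mult)
  then show ?thesis by (rule ext)
qed

lemma derivs_cases [cases set]:
  assumes "D \<in> derivs" obtains f where "D = vf f"
  using derivs_vf[OF assms] by blast

definition vbr :: "('n \<Rightarrow> 'n mpol) \<Rightarrow> ('n \<Rightarrow> 'n mpol) \<Rightarrow> 'n::finite \<Rightarrow> 'n mpol" where
  "vbr f h k = vf f (h k) - vf h (f k)"

lemma vf_diff: "vf f (p - q) = vf f p - vf f q"
  using vf_add[of f p "- q"] vf_cst[of f "-1" q] by (simp add: cst_mult)

lemma vf_vbr: "vf (vbr f h) p = vf f (vf h p) - vf h (vf f p)"
proof (induction p rule: mpol_induct)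
  case (cst c)
  show ?case by (simp add: vf_def)
next
  case (mult p q)
  show ?case
    by (simp only: vf_mult vf_add vf_diff mult algebra_simps)
qed (simp_all add: vf_add vbr_def)

lemma bracket_derivs: "bracket derivations (vf f) (vf h) = vf (vbr f h)"
  by (intro ext) (simp add: derivations_def vf_vbr)

lemma add_derivs: "vf f \<oplus>\<^bsub>derivations\<^esub> vf h = vf (\<lambda>j. f j + h j)"
  by (intro ext) (simp add: derivations_def vf_def algebra_simps sum.distrib)

lemma smult_derivs: "c \<odot>\<^bsub>derivations\<^esub> vf f = vf (\<lambda>j. scl c (f j))"
  by (intro ext) (simp add: derivations_def vf_def cst_mult scl_mult_left scl_sum)

lemma zero_derivs: "\<zero>\<^bsub>derivations\<^esub> = vf (\<lambda>j. 0)"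
  by (intro ext) (simp add: derivations_def vf_def)

lemma pd_vf: "pd i = vf (\<lambda>j. if j = i then 1 else 0)"
  by (intro ext) (simp add: vf_def if_distrib[of "\<lambda>x. x * _"] cong: if_cong)

section \<open>The module \<open>P\<^sub>0\<close> with coefficients\<close>

text \<open>Elements of \<open>('n \<Rightarrow>\<^sub>0 nat) \<Rightarrow>\<^sub>0 'w\<close> stand for \<open>\<Sum>\<^sub>\<beta> \<partial>\<^sup>\<beta> \<otimes> m\<^sub>\<beta>\<close>. The factor \<open>fct n k\<close> comes from
  \<open>t\<^sup>k \<partial>\<^sup>n = (-1)\<^sup>k n(n-1)\<dots>(n-k+1) \<partial>\<^sup>n\<^sup>-\<^sup>k\<close> modulo the left ideal generated by \<open>t\<close>; it vanishes for
  \<open>k > n\<close>.\<close>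

definition fct :: "nat \<Rightarrow> nat \<Rightarrow> complex" where
  "fct n k = (\<Prod>j<k. - of_nat (n - j))"

text \<open>Truncated subtraction satisfies n - (k + j) = (n - k) - j, so the product splits without
  a case distinction.\<close>

lemma fct_add: "fct n (k + l) = fct n k * fct (n - k) l"
  by (induction l) (simp_all add: fct_def)

lemma fct_eq_0_iff: "fct n k = 0 \<longleftrightarrow> n < k"
  by (auto simp: fct_def)

definition cf :: "('n::finite \<Rightarrow>\<^sub>0 nat) \<Rightarrow> ('n \<Rightarrow>\<^sub>0 nat) \<Rightarrow> complex" where
  "cf \<alpha> \<beta> = (\<Prod>i\<in>UNIV. fct (Poly_Mapping.lookup \<beta> i) (Poly_Mapping.lookup \<alpha> i))"

lemma cf_add: "cf (\<alpha> + \<alpha>') \<beta> = cf \<alpha> \<beta> * cf \<alpha>' (\<beta> - \<alpha>)"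
  by (simp add: cf_def fct_add lookup_add lookup_minus prod.distrib)

lemma cf_zero [simp]: "cf 0 \<beta> = 1"
  by (simp add: cf_def fct_def)

lemma cf_eq_0_iff: "cf \<alpha> \<beta> = 0 \<longleftrightarrow> (\<exists>i. Poly_Mapping.lookup \<beta> i < Poly_Mapping.lookup \<alpha> i)"
  by (simp add: cf_def fct_eq_0_iff)

lemma cf_e1: "cf (e1 i) \<beta> = - of_nat (Poly_Mapping.lookup \<beta> i)"
proof -
  have "cf (e1 i) \<beta> = (\<Prod>j\<in>UNIV. if j = i then - of_nat (Poly_Mapping.lookup \<beta> i) else 1)"
    unfolding cf_def
    by (rule prod.cong) (simp_all add: lookup_single fct_def when_def One_nat_def)
  then show ?thesis by simp
qed

text \<open>\<open>tm \<alpha>\<close>, \<open>T f\<close> and \<open>dd i\<close> are left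
  multiplication by t^\<alpha>, f and \<partial>_i on P0 \<otimes> W in the basis
  \<partial>^\<beta>; \<open>dd_T\<close> below is the commutation relation of the Weyl
  algebra.\<close>

definition tm :: "('n::finite \<Rightarrow>\<^sub>0 nat) \<Rightarrow> (('n \<Rightarrow>\<^sub>0 nat) \<Rightarrow>\<^sub>0 'w::cvs) \<Rightarrow> ('n \<Rightarrow>\<^sub>0 nat) \<Rightarrow>\<^sub>0 'w" where
  "tm \<alpha> = pext (\<lambda>\<beta> m. Poly_Mapping.single (\<beta> - \<alpha>) (scl (cf \<alpha> \<beta>) m))"

definition T :: "'n::finite mpol \<Rightarrow> (('n \<Rightarrow>\<^sub>0 nat) \<Rightarrow>\<^sub>0 'w::cvs) \<Rightarrow> ('n \<Rightarrow>\<^sub>0 nat) \<Rightarrow>\<^sub>0 'w" where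
  "T f g = pext (\<lambda>\<alpha> c. scl c (tm \<alpha> g)) f"

definition dd :: "'n \<Rightarrow> (('n \<Rightarrow>\<^sub>0 nat) \<Rightarrow>\<^sub>0 'w::cvs) \<Rightarrow> ('n \<Rightarrow>\<^sub>0 nat) \<Rightarrow>\<^sub>0 'w" where
  "dd i = pext (\<lambda>\<beta> m. Poly_Mapping.single (\<beta> + e1 i) m)"

lemma clin_tm: "clin (tm \<alpha>)"
  unfolding tm_def by (rule clin_pext) (simp add: clin_def single_add scl_add_right mult.commute)

lemma clin_dd: "clin (dd i)"
  unfolding dd_def by (rule clin_pext) (rule clin_single)

lemma tm_single: "tm \<alpha> (Poly_Mapping.single \<beta> m) = Poly_Mapping.single (\<beta> - \<alpha>) (scl (cf \<alpha> \<beta>) m)"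
  by (simp add: tm_def)

lemma dd_single: "dd i (Poly_Mapping.single \<beta> m) = Poly_Mapping.single (\<beta> + e1 i) m"
  by (simp add: dd_def)

lemma clin_T: "clin (T f)"
  unfolding T_def pext_def by (intro clin_sumf clin_scale clin_tm)

lemma clin_T_left: "clin (\<lambda>f. T f g)"
  unfolding T_def by (rule clin_pext) (simp add: clin_def scl_add_left)

lemmas T_simps = clin_simps[OF clin_T] clin_simps[OF clin_T_left]
lemmas dd_simps = clin_simps[OF clin_dd]
lemmas pmap_simps = clin_simps[OF clin_pmap]

lemma T_single: "T (Poly_Mapping.single \<alpha> c) g = scl c (tm \<alpha> g)"
  by (simp add: T_def)

lemma tm_zero [simp]: "tm 0 g = g"
  by (rule clin_eqI[OF clin_tm clin_id]) (simp add: tm_single)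

lemma T_cst: "T (cst c) g = scl c g"
  by (simp add: T_single)

lemma T_one [simp]: "T 1 g = g"
  using T_cst[of 1 g] by simp

lemma tm_tm: "tm \<alpha> (tm \<beta> g) = tm (\<alpha> + \<beta>) g"
  by (rule clin_eqI[OF clin_comp[OF clin_tm clin_tm] clin_tm])
    (simp add: tm_single diff_diff_add add.commute[of \<alpha>] cf_add mult.commute)

lemma T_mult: "T (f * h) g = T f (T h g)"
proof (induction f rule: pm_induct)
  case (single \<alpha> c)
  show ?case
  proof (induction h rule: pm_induct)
    case (single \<beta> d)
    show ?case by (simp add: mult_single T_single tm_tm clin_simps[OF clin_tm])
  qed (simp_all add: T_simps algebra_simps)
qed (simp_all add: T_simps algebra_simps)

lemma T_commute: "T f (T h g) = T h (T f g)"
  by (metis T_mult mult.commute)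

lemma dd_commute: "dd i (dd j g) = dd j (dd i g)"
  by (rule clin_eqI[OF clin_comp[OF clin_dd clin_dd] clin_comp[OF clin_dd clin_dd]])
    (simp add: dd_single ac_simps)

lemma T_tvar_single: "T (tvar i) (Poly_Mapping.single \<beta> m) =
    Poly_Mapping.single (\<beta> - e1 i) (scl (- of_nat (Poly_Mapping.lookup \<beta> i)) m)"
  by (simp add: T_single tm_single cf_e1)

lemma dd_T_tvar: "dd i (T (tvar j) g) = T (tvar j) (dd i g) + (if i = j then g else 0)"
proof (rule clin_eqI[where f = "\<lambda>g. dd i (T (tvar j) g)"
      and g = "\<lambda>g. T (tvar j) (dd i g) + (if i = j then g else 0)"])
  show "clin (\<lambda>g. dd i (T (tvar j) g))" by (rule clin_comp[OF clin_dd clin_T])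
  show "clin (\<lambda>g. T (tvar j) (dd i g) + (if i = j then g else 0))"
    by (rule clin_plus[OF clin_comp[OF clin_T clin_dd] clin_if[OF clin_id clin_zero]])
  fix \<beta> :: "'a \<Rightarrow>\<^sub>0 nat" and m :: 'b
  have 1: "\<beta> - e1 j + e1 i = \<beta> + e1 i - e1 j" if "Poly_Mapping.lookup \<beta> j \<noteq> 0"
    using minus_e1_add(1)[OF that, of "e1 i"] by simp
  show "dd i (T (tvar j) (Poly_Mapping.single \<beta> m)) =
      T (tvar j) (dd i (Poly_Mapping.single \<beta> m)) + (if i = j then Poly_Mapping.single \<beta> m else 0)"
  \<comment> \<open>The exponents can be rearranged as in \<open>1\<close> only for positive
    \<beta>_j. For \<beta>_j = 0 the subtraction truncates, but there \<open>T (tvar j)\<close>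
    kills the monomial.\<close>
  proof (cases "Poly_Mapping.lookup \<beta> j = 0")
    case True
    then show ?thesis
      by (auto simp: T_tvar_single dd_single dd_simps lookup_add lookup_single when_def single_uminus)
  next
    case False
    then show ?thesis
      by (auto simp: T_tvar_single dd_single dd_simps lookup_add lookup_single when_def 1
          single_uminus cvs.scale_left_diff_distrib single_diff)
  qed
qed

lemma dd_T: "dd i (T f g) = T f (dd i g) + T (pd i f) g"
proof (induction f arbitrary: g rule: mpol_induct)
  case (cst c)
  show ?case by (simp add: T_cst dd_simps T_simps)
next
  case (tvar j)
  show ?case by (simp add: dd_T_tvar pd_tvar T_simps)
next
  case (mult p q)
  show ?case by (simp add: T_mult mult pd_mult T_simps T_commute[of "pd i p"])
qed (simp add: T_simps dd_simps pd_add)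

lemma pmap_T: "clin S \<Longrightarrow> pmap S (T f g) = T f (pmap S g)"
proof (induction f rule: pm_induct)
  case (single \<alpha> c)
  have "pmap S (tm \<alpha> g) = tm \<alpha> (pmap S g)"
    by (rule clin_eqI[OF clin_comp clin_comp, OF clin_pmap clin_tm clin_tm clin_pmap])
      (simp_all add: tm_single single clin_simps)
  then show ?case by (simp add: T_single single clin_simps clin_pmap)
qed (simp_all add: T_simps clin_simps clin_pmap)

lemma pmap_dd: "clin S \<Longrightarrow> pmap S (dd i g) = dd i (pmap S g)"
  by (rule clin_eqI[OF clin_comp clin_comp, OF clin_pmap clin_dd clin_dd clin_pmap])
    (simp_all add: dd_single clin_simps)

section \<open>Total degree and descent to bottom coefficients\<close>

definition deg :: "('n::finite \<Rightarrow>\<^sub>0 nat) \<Rightarrow> nat" where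
  "deg \<beta> = (\<Sum>i\<in>UNIV. Poly_Mapping.lookup \<beta> i)"

lemma deg_le_eq:
  assumes "\<And>i. Poly_Mapping.lookup \<gamma> i \<le> Poly_Mapping.lookup \<beta> i" "deg \<beta> \<le> deg \<gamma>"
  shows "\<beta> = \<gamma>"
proof (rule poly_mapping_eqI, rule ccontr)
  fix i assume "Poly_Mapping.lookup \<beta> i \<noteq> Poly_Mapping.lookup \<gamma> i"
  with assms(1)[of i] have "Poly_Mapping.lookup \<gamma> i < Poly_Mapping.lookup \<beta> i" by simp
  then have "deg \<gamma> < deg \<beta>"
    unfolding deg_def by (intro sum_strict_mono_ex1) (use assms(1) in auto)
  with assms(2) show False by simp
qed

lemma deg_zero [simp]: "deg 0 = 0"
  by (simp add: deg_def)

lemma deg_add: "deg (\<alpha> + \<beta>) = deg \<alpha> + deg \<beta>"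
  by (simp add: deg_def lookup_add sum.distrib)

lemma deg_e1 [simp]: "deg (e1 i) = 1"
  by (simp add: deg_def lookup_single when_def)

lemma deg_eq_0_iff: "deg \<beta> = 0 \<longleftrightarrow> \<beta> = 0"
  by (auto simp: deg_def intro!: poly_mapping_eqI)

text \<open>Let \<gamma> have maximal degree in the support of h. Then t^\<gamma> kills every other
  \<partial>^\<beta> in the support, since \<open>cf \<gamma> \<beta>\<close> vanishes unless
  \<beta> dominates \<gamma> in each coordinate, and it turns \<partial>^\<gamma> into a nonzero
  constant. Polynomial multiples are asked for h alone: in the applications N is stable under vector
  fields but not under multiplication by polynomials.\<close>

lemma T_lowers:
  assumes "h \<noteq> 0" "\<And>u. T u h \<in> N" "csub N"
  obtains \<gamma> where "Poly_Mapping.lookup h \<gamma> \<noteq> 0" "Poly_Mapping.single 0 (Poly_Mapping.lookup h \<gamma>) \<in> N"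
proof -
  let ?K = "Poly_Mapping.keys h"
  have "?K \<noteq> {}" using assms(1) by (metis keys_eq_empty)
  then have "Max (deg ` ?K) \<in> deg ` ?K" by (intro Max_in) auto
  then obtain \<gamma> where \<gamma>: "\<gamma> \<in> ?K" "deg \<gamma> = Max (deg ` ?K)" by auto
  have max: "deg \<beta> \<le> deg \<gamma>" if "\<beta> \<in> ?K" for \<beta>
    using that \<gamma>(2) by simp
  have "T (mon \<gamma>) h = (\<Sum>\<beta>\<in>?K. Poly_Mapping.single (\<beta> - \<gamma>) (scl (cf \<gamma> \<beta>) (Poly_Mapping.lookup h \<beta>)))"
    by (simp add: T_single tm_def pext_def)
  also have "\<dots> = (\<Sum>\<beta>\<in>?K. if \<beta> = \<gamma> then
      Poly_Mapping.single 0 (scl (cf \<gamma> \<gamma>) (Poly_Mapping.lookup h \<gamma>)) else 0)"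
  proof (rule sum.cong)
    fix \<beta> assume \<beta>: "\<beta> \<in> ?K"
    show "Poly_Mapping.single (\<beta> - \<gamma>) (scl (cf \<gamma> \<beta>) (Poly_Mapping.lookup h \<beta>)) =
      (if \<beta> = \<gamma> then Poly_Mapping.single 0 (scl (cf \<gamma> \<gamma>) (Poly_Mapping.lookup h \<gamma>)) else 0)"
    proof (cases "cf \<gamma> \<beta> = 0")
      case True
      then show ?thesis by auto
    next
      case False
      then have "\<beta> = \<gamma>"
        using deg_le_eq[of \<gamma> \<beta>] max[OF \<beta>] by (simp add: cf_eq_0_iff not_less)
      then show ?thesis by simp
    qed
  qed simp
  also have "\<dots> = scl (cf \<gamma> \<gamma>) (Poly_Mapping.single 0 (Poly_Mapping.lookup h \<gamma>))"
    using \<gamma>(1) by simp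
  finally have "scl (cf \<gamma> \<gamma>) (Poly_Mapping.single 0 (Poly_Mapping.lookup h \<gamma>)) \<in> N"
    using assms(2)[of "mon \<gamma>"] by simp
  moreover have "cf \<gamma> \<gamma> \<noteq> 0" by (simp add: cf_eq_0_iff)
  ultimately have "Poly_Mapping.single 0 (Poly_Mapping.lookup h \<gamma>) \<in> N"
    using csub_sclD[OF assms(3)] by blast
  with \<gamma>(1) that show ?thesis by (auto simp: in_keys_iff)
qed

section \<open>The action of vector fields\<close>

text \<open>The field f \<partial>_j acting on P0 \<otimes> W by the formula for F(P0, W), with
  \<open>E i j\<close> in place of the matrix units. Single components keep the commutator
  computation to two fields f \<partial>_j and h \<partial>_k.\<close>

definition X1 :: "('n \<Rightarrow> 'n \<Rightarrow> 'w \<Rightarrow> 'w) \<Rightarrow> 'n::finite mpol \<Rightarrow> 'n \<Rightarrow>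
    (('n \<Rightarrow>\<^sub>0 nat) \<Rightarrow>\<^sub>0 'w::cvs) \<Rightarrow> ('n \<Rightarrow>\<^sub>0 nat) \<Rightarrow>\<^sub>0 'w" where
  "X1 E f j g = T f (dd j g) + (\<Sum>i\<in>UNIV. T (pd i f) (pmap (E i j) g))"

definition X :: "('n \<Rightarrow> 'n \<Rightarrow> 'w \<Rightarrow> 'w) \<Rightarrow> ('n::finite \<Rightarrow> 'n mpol) \<Rightarrow>
    (('n \<Rightarrow>\<^sub>0 nat) \<Rightarrow>\<^sub>0 'w::cvs) \<Rightarrow> ('n \<Rightarrow>\<^sub>0 nat) \<Rightarrow>\<^sub>0 'w" where
  "X E f g = (\<Sum>j\<in>UNIV. X1 E (f j) j g)"

text \<open>Only the relations of the matrix units are imposed, on the whole type; the actual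
  gl_n-module is an invariant subspace C chosen separately.\<close>

locale glrep =
  fixes E :: "'n::finite \<Rightarrow> 'n \<Rightarrow> 'w::cvs \<Rightarrow> 'w"
  assumes clin_E: "clin (E i j)"
    and E_bracket: "E i j (E k l w) - E k l (E i j w) =
      (if j = k then E i l w else 0) - (if l = i then E k j w else 0)"
begin

lemmas clin_pE = clin_pmap[OF clin_E]
lemmas E_simps = clin_simps[OF clin_E]

lemma clin_X1: "clin (X1 E f j)"
  unfolding X1_def by (intro clin_plus clin_sumf clin_comp[OF clin_T] clin_dd clin_pE)

lemma clin_X1_left: "clin (\<lambda>f. X1 E f j g)"
  unfolding X1_def
  by (intro clin_plus clin_sumf clin_T_left clin_comp[OF clin_T_left] clin_pd)

lemma clin_X: "clin (X E f)"
  unfolding X_def by (intro clin_sumf clin_X1)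

lemmas X1_simps = clin_simps[OF clin_X1] clin_simps[OF clin_X1_left]
lemmas X_simps = clin_simps[OF clin_X]

lemma X_add_left: "X E (\<lambda>j. f j + h j) g = X E f g + X E h g"
  and X_scl_left: "X E (\<lambda>j. scl c (f j)) g = scl c (X E f g)"
  by (simp_all add: X_def X1_simps sum.distrib sum_subtractf scl_sum)

lemma pE_bracket: "pmap (E i j) (pmap (E k l) g) = pmap (E k l) (pmap (E i j) g) +
    ((if j = k then pmap (E i l) g else 0) - (if l = i then pmap (E k j) g else 0))"
proof (rule poly_mapping_eqI)
  fix \<beta>
  show "Poly_Mapping.lookup (pmap (E i j) (pmap (E k l) g)) \<beta> =
    Poly_Mapping.lookup (pmap (E k l) (pmap (E i j) g) +
      ((if j = k then pmap (E i l) g else 0) - (if l = i then pmap (E k j) g else 0))) \<beta>"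
    using E_bracket[of i j k l "Poly_Mapping.lookup g \<beta>"]
    by (auto simp: lookup_pmap clin_E lookup_add lookup_minus algebra_simps)
qed

lemma X1_mult: "X1 E (p * f) j g = T p (X1 E f j g) + (\<Sum>i\<in>UNIV. T (pd i p) (T f (pmap (E i j) g)))"
  by (simp add: X1_def pd_mult T_simps T_mult sum.distrib algebra_simps T_commute[of f])

lemma X1_T: "X1 E f j (T p g) = T p (X1 E f j g) + T (f * pd j p) g"
  by (simp add: X1_def dd_T pmap_T clin_E T_simps T_mult T_commute[of p] sum.distrib)

lemma X1_dd: "X1 E f j (dd k g) = dd k (X1 E f j g) - X1 E (pd k f) j g"
  by (simp add: X1_def dd_T dd_simps pmap_dd clin_E sum.distrib dd_commute[of k j] pd_commute[of k])

lemma X1_pE: "X1 E f j (pmap (E l k) g) = pmap (E l k) (X1 E f j g)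
    + (if j = l then \<Sum>i\<in>UNIV. T (pd i f) (pmap (E i k) g) else 0) - T (pd k f) (pmap (E l j) g)"
proof -
  have "(\<Sum>i\<in>UNIV. T (pd i f) (if k = i then pmap (E l j) g else 0)) =
      (\<Sum>i\<in>UNIV. if i = k then T (pd k f) (pmap (E l j) g) else 0)"
    by (rule sum.cong) (auto simp: T_simps)
  then have 1: "(\<Sum>i\<in>UNIV. T (pd i f) (if k = i then pmap (E l j) g else 0)) =
      T (pd k f) (pmap (E l j) g)" by simp
  show ?thesis
    by (simp add: X1_def pmap_T pmap_dd clin_E clin_simps[OF clin_pE] pE_bracket[of _ j l k]
        T_simps sum.distrib sum_subtractf 1)
qed

text \<open>\<open>X1 E f j\<close> commutes with multiplication, with \<open>dd\<close> and with
  the matrix units up to the corrections in \<open>X1_T\<close>, \<open>X1_dd\<close> and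
  \<open>X1_pE\<close>. Collecting these over the constituents of \<open>X1 E h k\<close> leaves the
  bracket of the two fields.\<close>

lemma X1_bracket: "X1 E f j (X1 E h k g) = X1 E h k (X1 E f j g) +
    X1 E (f * pd j h) k g - X1 E (h * pd k f) j g"
proof -
  let ?Y = "X1 E f j g"
  have 1: "X1 E f j (X1 E h k g) = T h (X1 E f j (dd k g)) + T (f * pd j h) (dd k g) +
      (\<Sum>l\<in>UNIV. T (pd l h) (X1 E f j (pmap (E l k) g)) + T (f * pd j (pd l h)) (pmap (E l k) g))"
    by (simp add: X1_def[of E h] X1_simps X1_T)
  have "(\<Sum>l\<in>UNIV. T (pd l h) (if j = l then \<Sum>i\<in>UNIV. T (pd i f) (pmap (E i k) g) else 0)) =
      (\<Sum>l\<in>UNIV. if l = j then \<Sum>i\<in>UNIV. T (pd j h) (T (pd i f) (pmap (E i k) g)) else 0)"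
    by (rule sum.cong) (auto simp: T_simps)
  then have 2: "(\<Sum>l\<in>UNIV. T (pd l h) (if j = l then \<Sum>i\<in>UNIV. T (pd i f) (pmap (E i k) g) else 0)) =
      (\<Sum>i\<in>UNIV. T (pd j h) (T (pd i f) (pmap (E i k) g)))" by simp
  have 3: "X1 E h k ?Y = T h (dd k ?Y) + (\<Sum>l\<in>UNIV. T (pd l h) (pmap (E l k) ?Y))"
    by (simp add: X1_def)
  have 4: "X1 E (f * pd j h) k g = T (f * pd j h) (dd k g) +
      (\<Sum>i\<in>UNIV. T (pd j h) (T (pd i f) (pmap (E i k) g)) + T (f * pd j (pd i h)) (pmap (E i k) g))"
    unfolding X1_def pd_mult
    by (simp add: T_simps T_mult T_commute[of "pd j h"] pd_commute[of _ j])
  show ?thesis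
    unfolding 1 3 4 X1_dd X1_pE X1_mult[of h "pd k f"]
    by (simp add: T_simps sum.distrib sum_subtractf 2)
qed

lemma X_bracket: "X E (vbr f h) g = X E f (X E h g) - X E h (X E f g)"
proof -
  have "X E f (X E h g) = (\<Sum>j\<in>UNIV. \<Sum>k\<in>UNIV. X1 E (h k) k (X1 E (f j) j g)) +
      (\<Sum>j\<in>UNIV. \<Sum>k\<in>UNIV. X1 E (f j * pd j (h k)) k g) -
      (\<Sum>j\<in>UNIV. \<Sum>k\<in>UNIV. X1 E (h k * pd k (f j)) j g)"
    unfolding X_def by (simp add: X1_simps X1_bracket[of "f _"] sum.distrib sum_subtractf)
  moreover have "X E h (X E f g) = (\<Sum>j\<in>UNIV. \<Sum>k\<in>UNIV. X1 E (h k) k (X1 E (f j) j g))"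
    unfolding X_def by (subst sum.swap) (simp add: X1_simps)
  moreover have "X E (vbr f h) g = (\<Sum>k\<in>UNIV. \<Sum>j\<in>UNIV. X1 E (f j * pd j (h k)) k g) -
      (\<Sum>j\<in>UNIV. \<Sum>k\<in>UNIV. X1 E (h k * pd k (f j)) j g)"
    by (simp add: X_def vbr_def vf_def X1_simps sum_subtractf)
  ultimately show ?thesis
    by (simp add: sum.swap[of "\<lambda>k j. X1 E (f j * pd j (h k)) k g"])
qed

lemma X_single_field: "X E (\<lambda>k. if k = j then f else 0) g = X1 E f j g"
  by (simp add: X_def if_distrib[of "\<lambda>f. X1 E f _ g"] X1_simps cong: if_cong)

lemma X1_one: "X1 E 1 j g = dd j g"
  by (simp add: X1_def T_simps)

lemma X1_tvar: "X1 E (tvar i) j g = T (tvar i) (dd j g) + pmap (E i j) g"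
proof -
  have "(\<Sum>k\<in>UNIV. T (pd k (tvar i)) (pmap (E k j) g)) =
      (\<Sum>k\<in>UNIV. if k = i then pmap (E i j) g else 0)"
    by (rule sum.cong) (auto simp: pd_tvar T_simps)
  then show ?thesis by (simp add: X1_def)
qed

section \<open>Quadratic operators in the matrix units\<close>

definition TT :: "'n \<Rightarrow> 'n \<Rightarrow> 'n \<Rightarrow> 'n \<Rightarrow> 'w \<Rightarrow> 'w" where
  "TT i l j k w = (if i = j then E l k w else 0) + (if l = j then E i k w else 0)
     - E i j (E l k w) - E l j (E i k w)"

lemma clin_TT: "clin (TT i l j k)"
  unfolding TT_def by (intro clin_plus clin_sub clin_if clin_zero clin_E clin_comp[OF clin_E])

text \<open>Under commutators with gl_n the operators TT transform like a tensor with upper indices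
  i, l and lower indices j, k. Consequently their common kernel is a submodule.\<close>

lemma TT_equivariant: "E a b (TT i l j k w) = TT i l j k (E a b w)
    + (if b = i then TT a l j k w else 0) + (if b = l then TT i a j k w else 0)
    - (if a = j then TT i l b k w else 0) - (if a = k then TT i l j b w else 0)"
proof -
  have c: "E a b (E i j w) = E i j (E a b w) + (if b = i then E a j w else 0) - (if a = j then E i b w else 0)"
    for i j w using E_bracket[of a b i j w] by (simp add: algebra_simps eq_commute)
  show ?thesis
    unfolding TT_def
    by (simp add: E_simps c if_distrib[of "E _ _"] cong: if_cong)
qed

text \<open>The coefficient of \<open>\<lambda>\<^sub>i \<lambda>\<^sub>l\<close> in the product of \<open>e\<^bsup>\<lambda>t\<^esup> \<partial>\<^sub>j\<close> and \<open>e\<^bsup>(\<nu>-\<lambda>)t\<^esup> \<partial>\<^sub>k\<close>, in which the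
  derivatives of the first factor \<open>P\<^sub>0\<close> cancel.\<close>

lemma T_TT:
  "T u (pmap (TT i l j k) g) =
     X1 E (tvar i * tvar l) j (X1 E u k g) - X1 E (tvar i) j (X1 E (tvar l * u) k g)
     - X1 E (tvar l) j (X1 E (tvar i * u) k g) + X1 E 1 j (X1 E (tvar i * tvar l * u) k g)"
proof -
  let ?Y = "X1 E u k g"
  have TTp: "pmap (TT i l j k) g = (if i = j then pmap (E l k) g else 0) + (if l = j then pmap (E i k) g else 0)
     - pmap (E i j) (pmap (E l k) g) - pmap (E l j) (pmap (E i k) g)"
  proof (rule poly_mapping_eqI)
    fix \<beta>
    have "Poly_Mapping.lookup (pmap (TT i l j k) g) \<beta> = TT i l j k (Poly_Mapping.lookup g \<beta>)"
      by (simp add: lookup_pmap clin_TT)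
    then show "Poly_Mapping.lookup (pmap (TT i l j k) g) \<beta> = Poly_Mapping.lookup
      ((if i = j then pmap (E l k) g else 0) + (if l = j then pmap (E i k) g else 0)
       - pmap (E i j) (pmap (E l k) g) - pmap (E l j) (pmap (E i k) g)) \<beta>"
      by (simp add: lookup_pmap clin_E lookup_add lookup_minus TT_def)
  qed
  have delta: "(\<Sum>a\<in>UNIV. T (pd a (tvar i)) (F a)) = F i" for i and F :: "'n \<Rightarrow> ('n \<Rightarrow>\<^sub>0 nat) \<Rightarrow>\<^sub>0 'w"
  proof -
    have "(\<Sum>a\<in>UNIV. T (pd a (tvar i)) (F a)) = (\<Sum>a\<in>UNIV. if a = i then F i else 0)"
      by (rule sum.cong) (auto simp: pd_tvar T_simps)
    then show ?thesis by simp
  qed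
  have 1: "X1 E (tvar i * u) k g = T (tvar i) ?Y + T u (pmap (E i k) g)" for i
    by (simp add: X1_mult delta)
  have 2: "X1 E (tvar i * tvar l * u) k g = T (tvar i) (T (tvar l) ?Y) + T (tvar l) (T u (pmap (E i k) g))
      + T (tvar i) (T u (pmap (E l k) g))"
    by (simp add: mult.assoc X1_mult[of "tvar i"] 1 delta T_simps T_mult)
  have 3: "X1 E (tvar i * tvar l) j y = T (tvar i) (T (tvar l) (dd j y)) + T (tvar i) (pmap (E l j) y)
     + T (tvar l) (pmap (E i j) y)" for y
    by (simp add: X1_mult delta X1_tvar T_simps)
  show ?thesis
    unfolding 1 2 3 X1_tvar X1_one TTp
    by (auto simp: T_simps dd_simps dd_T pd_tvar clin_simps[OF clin_pE] pmap_T[OF clin_E]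
        T_commute[of "tvar l" "tvar i"] T_commute[of u])
qed

end

lemma single_eq_0_iff [simp]: "Poly_Mapping.single k m = 0 \<longleftrightarrow> m = 0"
  by (metis lookup_single_eq lookup_zero single_zero)

section \<open>Invariant subspaces\<close>

definition inv_sub :: "('x \<Rightarrow> 'w::cvs \<Rightarrow> 'w) \<Rightarrow> 'w set \<Rightarrow> bool" where
  "inv_sub A S \<longleftrightarrow> csub S \<and> (\<forall>x. \<forall>v\<in>S. A x v \<in> S)"

definition irr :: "('x \<Rightarrow> 'w::cvs \<Rightarrow> 'w) \<Rightarrow> 'w set \<Rightarrow> bool" where
  "irr A C \<longleftrightarrow> inv_sub A C \<and> C \<noteq> {0} \<and> (\<forall>S\<subseteq>C. inv_sub A S \<longrightarrow> S = {0} \<or> S = C)"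

lemma irr_cases: "irr A C \<Longrightarrow> S \<subseteq> C \<Longrightarrow> inv_sub A S \<Longrightarrow> S = {0} \<or> S = C"
  by (auto simp: irr_def)

lemma inv_subD: "inv_sub A S \<Longrightarrow> csub S" "inv_sub A S \<Longrightarrow> v \<in> S \<Longrightarrow> A x v \<in> S"
  by (auto simp: inv_sub_def)

text \<open>The subspace P0 \<otimes> C of P0 \<otimes> W.\<close>

definition coeffs :: "'w::cvs set \<Rightarrow> ('b \<Rightarrow>\<^sub>0 'w) set" where
  "coeffs C = {g. \<forall>\<beta>. Poly_Mapping.lookup g \<beta> \<in> C}"

lemma csub_coeffs: "csub C \<Longrightarrow> csub (coeffs C)"
  by (auto simp: coeffs_def csub_def lookup_add)

lemma single_coeffs [simp]: "csub C \<Longrightarrow> Poly_Mapping.single \<beta> m \<in> coeffs C \<longleftrightarrow> m \<in> C"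
  by (auto simp: coeffs_def lookup_single when_def csub_0 split: if_splits)

lemma pext_coeffs:
  assumes "csub N" "g \<in> coeffs C" "\<And>\<beta> m. m \<in> C \<Longrightarrow> \<phi> \<beta> m \<in> N"
  shows "pext \<phi> g \<in> N"
  unfolding pext_def using assms by (intro csub_sum) (auto simp: coeffs_def)

lemma T_coeffs: "csub C \<Longrightarrow> g \<in> coeffs C \<Longrightarrow> T f g \<in> coeffs C"
  unfolding T_def pext_def[of _ f] tm_def
  by (intro csub_sum csub_scl csub_coeffs pext_coeffs) (auto simp: csub_scl)

lemma dd_coeffs: "csub C \<Longrightarrow> g \<in> coeffs C \<Longrightarrow> dd i g \<in> coeffs C"
  unfolding dd_def by (intro pext_coeffs csub_coeffs) auto

lemma pmap_coeffs: "clin S \<Longrightarrow> (\<And>m. m \<in> C \<Longrightarrow> S m \<in> C') \<Longrightarrow> g \<in> coeffs C \<Longrightarrow> pmap S g \<in> coeffs C'"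
  by (simp add: coeffs_def lookup_pmap)

lemma deg_Suc:
  assumes "deg \<beta> \<noteq> 0"
  obtains i \<beta>' where "\<beta> = \<beta>' + e1 i" "deg \<beta> = Suc (deg \<beta>')"
proof -
  from assms obtain i where "Poly_Mapping.lookup \<beta> i \<noteq> 0"
    by (auto simp: deg_def)
  then have "\<beta> = (\<beta> - e1 i) + e1 i"
    by (intro poly_mapping_eqI) (auto simp: lookup_add lookup_minus lookup_single when_def)
  then show ?thesis using that by (metis deg_add deg_e1 Suc_eq_plus1)
qed

lemma single_gen:
  fixes N :: "(('n::finite \<Rightarrow>\<^sub>0 nat) \<Rightarrow>\<^sub>0 'w::cvs) set"
  assumes dd: "\<And>i g. g \<in> N \<Longrightarrow> dd i g \<in> N" and m: "Poly_Mapping.single 0 m \<in> N"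
  shows "Poly_Mapping.single \<beta> m \<in> N"
proof (induction "deg \<beta>" arbitrary: \<beta>)
  case 0
  then show ?case using m by (simp add: deg_eq_0_iff)
next
  case (Suc k)
  then obtain i \<beta>' where \<beta>: "\<beta> = \<beta>' + e1 i" "k = deg \<beta>'"
    by (metis deg_Suc nat.simps(3) Suc_inject)
  then show ?case using dd[OF Suc(1)[OF \<beta>(2)], of i] by (simp add: dd_single)
qed

lemma coeffs_gen:
  fixes N :: "(('n::finite \<Rightarrow>\<^sub>0 nat) \<Rightarrow>\<^sub>0 'w::cvs) set"
  assumes "csub N" "\<And>i g. g \<in> N \<Longrightarrow> dd i g \<in> N" "\<And>m. m \<in> C \<Longrightarrow> Poly_Mapping.single 0 m \<in> N"
  shows "coeffs C \<subseteq> N"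
proof
  fix g :: "('n \<Rightarrow>\<^sub>0 nat) \<Rightarrow>\<^sub>0 'w" assume g: "g \<in> coeffs C"
  have "(\<Sum>\<beta>\<in>Poly_Mapping.keys g. Poly_Mapping.single \<beta> (Poly_Mapping.lookup g \<beta>)) \<in> N"
  proof (rule csub_sum[OF assms(1)])
    fix \<beta>
    have "Poly_Mapping.lookup g \<beta> \<in> C" using g by (simp add: coeffs_def)
    then have "Poly_Mapping.single 0 (Poly_Mapping.lookup g \<beta>) \<in> N" by (rule assms(3))
    with assms(2) show "Poly_Mapping.single \<beta> (Poly_Mapping.lookup g \<beta>) \<in> N"
      by (rule single_gen)
  qed
  then show "g \<in> N" unfolding pm_expand[symmetric] .
qed

lemma T_mon_single_0: "deg \<beta> < deg \<alpha> \<Longrightarrow> T (Poly_Mapping.single \<alpha> c) (Poly_Mapping.single \<beta> m) = 0"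
proof -
  assume "deg \<beta> < deg \<alpha>"
  then have "\<exists>i. Poly_Mapping.lookup \<beta> i < Poly_Mapping.lookup \<alpha> i"
    unfolding deg_def by (meson leD not_le_imp_less sum_mono)
  then have "cf \<alpha> \<beta> = 0" by (simp add: cf_eq_0_iff)
  then show ?thesis by (simp add: T_single tm_single)
qed

context glrep
begin

lemma inv_coeffs:
  assumes "inv_sub (case_prod E) C"
  shows "inv_sub (X E) (coeffs C)"
proof -
  have C: "csub C" "\<And>i j m. m \<in> C \<Longrightarrow> E i j m \<in> C"
    using assms by (auto simp: inv_sub_def)
  then show ?thesis
    unfolding inv_sub_def X_def X1_def
    by (auto intro!: csub_coeffs csub_sum[OF csub_coeffs] csub_add[OF csub_coeffs]
        T_coeffs dd_coeffs pmap_coeffs[OF clin_E, of C])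
qed

lemma X1_in: "inv_sub (X E) N \<Longrightarrow> g \<in> N \<Longrightarrow> X1 E f j g \<in> N"
  using inv_subD(2)[of "X E" N g "\<lambda>k. if k = j then f else 0"] by (simp add: X_single_field)

lemma dd_in: "inv_sub (X E) N \<Longrightarrow> g \<in> N \<Longrightarrow> dd j g \<in> N"
  using X1_in[of N g 1 j] by (simp add: X1_one)

lemma T_TT_in:
  assumes "inv_sub (X E) N" "g \<in> N"
  shows "T u (pmap (TT i l j k) g) \<in> N"
  unfolding T_TT
  by (intro csub_add[OF inv_subD(1)[OF assms(1)]] csub_diff[OF inv_subD(1)[OF assms(1)]]
      X1_in assms)

text \<open>The term -\<delta>_ij is t_i \<partial>_j 1 in P0; it is the origin of the trace twist
  in \<open>EV\<close>.\<close>

lemma X1_tvar_bottom: "X1 E (tvar i) j (Poly_Mapping.single 0 m) =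
    Poly_Mapping.single 0 (E i j m - (if i = j then m else 0))"
  by (simp add: X1_tvar dd_single T_tvar_single lookup_single when_def E_simps single_diff single_uminus)

lemma X1_bottom: "deg \<alpha> \<ge> 2 \<Longrightarrow> X1 E (Poly_Mapping.single \<alpha> c) j (Poly_Mapping.single 0 m) = 0"
proof -
  assume \<alpha>: "deg \<alpha> \<ge> 2"
  have "T (pd i (Poly_Mapping.single \<alpha> c)) (Poly_Mapping.single 0 m') = 0" for i and m' :: 'w
  proof (cases "Poly_Mapping.lookup \<alpha> i = 0")
    case True
    then show ?thesis by (simp add: pd_single T_simps)
  next
    case False
    then have "\<alpha> = (\<alpha> - e1 i) + e1 i"
      by (intro poly_mapping_eqI) (auto simp: lookup_add lookup_minus lookup_single when_def)
    then have "deg \<alpha> = deg (\<alpha> - e1 i) + 1" by (metis deg_add deg_e1)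
    with \<alpha> show ?thesis unfolding pd_single by (intro T_mon_single_0) simp
  qed
  moreover have "T (Poly_Mapping.single \<alpha> c) (Poly_Mapping.single (e1 j) m) = 0"
    using \<alpha> by (intro T_mon_single_0) simp
  ultimately show ?thesis by (simp add: X1_def dd_single E_simps)
qed

text \<open>Fields of degree 0 preserve 1 \<otimes> C and induce there the matrix units up to the
  scalar \<delta>_ij, so the bottom vectors of a submodule form a gl_n-submodule.\<close>

lemma bottom_inv:
  assumes "inv_sub (X E) N" "inv_sub (case_prod E) C"
  shows "inv_sub (case_prod E) {m \<in> C. Poly_Mapping.single 0 m \<in> N}"
proof -
  have N: "csub N" and C: "csub C" using assms by (auto simp: inv_sub_def)
  have "E i j m \<in> C \<and> Poly_Mapping.single 0 (E i j m) \<in> N"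
    if "m \<in> C" "Poly_Mapping.single 0 m \<in> N" for i j m
  proof
    show "E i j m \<in> C" using assms(2) that by (auto simp: inv_sub_def)
    have "X1 E (tvar i) j (Poly_Mapping.single 0 m) + (if i = j then Poly_Mapping.single 0 m else 0) \<in> N"
      using N that X1_in[OF assms(1)] by (intro csub_add) (auto simp: csub_0)
    then show "Poly_Mapping.single 0 (E i j m) \<in> N"
      by (simp add: X1_tvar_bottom single_diff split: if_splits)
  qed
  then show ?thesis
    unfolding inv_sub_def using csub_vimage[OF clin_single N C] by auto
qed

lemma bottom_full:
  assumes "inv_sub (X E) N" "\<And>m. m \<in> C \<Longrightarrow> Poly_Mapping.single 0 m \<in> N"
  shows "coeffs C \<subseteq> N"
  by (rule coeffs_gen) (use assms inv_subD dd_in in auto)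

lemma TT_in: "inv_sub (case_prod E) C \<Longrightarrow> m \<in> C \<Longrightarrow> TT i l j k m \<in> C"
  unfolding TT_def by (intro csub_add csub_diff) (auto simp: inv_sub_def csub_0)

lemma ker_TT_inv:
  assumes "inv_sub (case_prod E) C"
  shows "inv_sub (case_prod E) {m \<in> C. \<forall>i l j k. TT i l j k m = 0}"
proof -
  have "TT i l j k (E a b m) = 0" if "\<forall>i l j k. TT i l j k m = 0" for a b i l j k m
    using TT_equivariant[of a b i l j k m] that by (simp add: E_simps split: if_splits)
  with assms show ?thesis
    by (auto simp: inv_sub_def csub_def clin_simps[OF clin_TT])
qed

text \<open>Although N is not closed under multiplication by polynomials, \<open>T_TT\<close> writes
  every multiple of the image of g under TT as a combination of fields applied to g. So
  \<open>T_lowers\<close> applies to that image.\<close>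

lemma low_TT:
  assumes "inv_sub (X E) N" "inv_sub (case_prod E) C" "g \<in> N" "g \<in> coeffs C"
    "TT i l j k (Poly_Mapping.lookup g \<beta>) \<noteq> 0"
  obtains m where "m \<in> C" "m \<noteq> 0" "Poly_Mapping.single 0 m \<in> N"
proof -
  let ?h = "pmap (TT i l j k) g"
  have "?h \<noteq> 0"
    using assms(5) by (metis clin_TT lookup_pmap lookup_zero)
  moreover have "T u ?h \<in> N" for u by (rule T_TT_in[OF assms(1,3)])
  ultimately obtain \<gamma> where "Poly_Mapping.lookup ?h \<gamma> \<noteq> 0"
    "Poly_Mapping.single 0 (Poly_Mapping.lookup ?h \<gamma>) \<in> N"
    using T_lowers inv_subD(1)[OF assms(1)] by metis
  moreover have "Poly_Mapping.lookup ?h \<gamma> \<in> C"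
    using assms(4) TT_in[OF assms(2)] by (simp add: lookup_pmap clin_TT coeffs_def)
  ultimately show ?thesis using that by blast
qed

text \<open>The common kernel of the TT is a proper submodule of the irreducible C, hence zero. So
  some TT detects any nonzero coefficient of an element, every nonzero submodule has a bottom
  vector, and the bottom vectors generate P0 \<otimes> C.\<close>

lemma irr_coeffs:
  assumes "irr (case_prod E) C" "m \<in> C" "TT i l j k m \<noteq> 0"
  shows "irr (X E) (coeffs C)"
proof -
  have inv: "inv_sub (case_prod E) C" and C: "csub C" using assms by (auto simp: irr_def inv_sub_def)
  have "{m \<in> C. \<forall>i l j k. TT i l j k m = 0} = {0}"
    using irr_cases[OF assms(1) _ ker_TT_inv[OF inv]] assms(2,3) by blast
  then have TT: "\<exists>i l j k. TT i l j k m \<noteq> 0" if "m \<in> C" "m \<noteq> 0" for m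
    using that by blast
  have "S = {0} \<or> S = coeffs C" if S: "S \<subseteq> coeffs C" "inv_sub (X E) S" for S
  proof (cases "S = {0}")
    case False
    then obtain g where g: "g \<in> S" "g \<noteq> 0" using inv_subD(1)[OF S(2)] csub_0 by blast
    then obtain \<beta> where \<beta>: "Poly_Mapping.lookup g \<beta> \<noteq> 0" by (metis poly_mapping_eqI lookup_zero)
    with S g have "Poly_Mapping.lookup g \<beta> \<in> C" by (auto simp: coeffs_def)
    from TT[OF this \<beta>] obtain i l j k where "TT i l j k (Poly_Mapping.lookup g \<beta>) \<noteq> 0" by blast
    then obtain m where "m \<in> C" "m \<noteq> 0" "Poly_Mapping.single 0 m \<in> S"
      using low_TT[OF S(2) inv g(1)] g S by blast
    then have "{m \<in> C. Poly_Mapping.single 0 m \<in> S} = C"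
      using irr_cases[OF assms(1) _ bottom_inv[OF S(2) inv]] by blast
    then have "coeffs C \<subseteq> S" by (intro bottom_full[OF S(2)]) blast
    with S show ?thesis by blast
  qed simp
  moreover have "Poly_Mapping.single 0 m \<in> coeffs C" "Poly_Mapping.single 0 m \<noteq> 0"
    using assms(2,3) C clin_0[OF clin_TT] by (auto simp del: single_coeffs simp: single_coeffs[OF C])
  then have "coeffs C \<noteq> {0::('n \<Rightarrow>\<^sub>0 nat) \<Rightarrow>\<^sub>0 'w}" by blast
  ultimately show ?thesis
    unfolding irr_def using inv_coeffs[OF inv] by simp
qed

end

section \<open>Homomorphisms out of the tensor modules\<close>

definition fld :: "'n \<Rightarrow> 'n mpol \<Rightarrow> 'n \<Rightarrow> 'n mpol" where
  "fld j p = (\<lambda>k. if k = j then p else 0)"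

text \<open>Fields are given by their coefficient families. Every family is a field, so the Lie
  algebra needs no carrier here.\<close>

locale vfrep =
  fixes A :: "('n::finite \<Rightarrow> 'n mpol) \<Rightarrow> 'v::cvs \<Rightarrow> 'v"
  assumes clin_A: "clin (A f)"
    and A_add: "A (\<lambda>k. f k + h k) v = A f v + A h v"
    and A_scl: "A (\<lambda>k. scl c (f k)) v = scl c (A f v)"
    and A_bracket: "A (vbr f h) v = A f (A h v) - A h (A f v)"
begin

lemmas A_simps = clin_simps[OF clin_A]

lemma A_zero: "A (\<lambda>k. 0) v = 0"
  using A_scl[of 0 "\<lambda>k. 0" v] by simp

lemma A_sum: "A (\<lambda>k. \<Sum>a\<in>S. F a k) v = (\<Sum>a\<in>S. A (F a) v)"
  by (induction S rule: infinite_finite_induct) (simp_all add: A_zero A_add)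

definition A1 :: "'n mpol \<Rightarrow> 'n \<Rightarrow> 'v \<Rightarrow> 'v" where
  "A1 p j = A (fld j p)"

lemma A_eq_A1: "A f v = (\<Sum>j\<in>UNIV. A1 (f j) j v)"
proof -
  have "f = (\<lambda>k. \<Sum>j\<in>UNIV. fld j (f j) k)"
    by (intro ext) (simp add: fld_def)
  then show ?thesis unfolding A1_def by (metis A_sum)
qed

lemma clin_A1: "clin (A1 p j)"
  unfolding A1_def by (rule clin_A)

lemma clin_A1_left: "clin (\<lambda>p. A1 p j v)"
proof (rule clinI)
  have "fld j (p + q) = (\<lambda>k. fld j p k + fld j q k)" for p q
    by (intro ext) (simp add: fld_def)
  then show "A1 (p + q) j v = A1 p j v + A1 q j v" for p q by (simp add: A1_def A_add)
  have "fld j (scl c p) = (\<lambda>k. scl c (fld j p k))" for c p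
    by (intro ext) (simp add: fld_def)
  then show "A1 (scl c p) j v = scl c (A1 p j v)" for c p by (simp add: A1_def A_scl)
qed

lemmas A1_simps = clin_simps[OF clin_A1] clin_simps[OF clin_A1_left]

lemma A1_bracket: "A1 f j (A1 h k v) = A1 h k (A1 f j v) + A1 (f * pd j h) k v - A1 (h * pd k f) j v"
proof -
  have "vbr (fld j f) (fld k h) = (\<lambda>l. fld k (f * pd j h) l + scl (-1) (fld j (h * pd k f) l))"
    by (intro ext) (auto simp: vbr_def vf_def fld_def if_distrib[of "\<lambda>f. f * _"] cong: if_cong)
  then have "A (vbr (fld j f) (fld k h)) v = A (fld k (f * pd j h)) v + scl (-1) (A (fld j (h * pd k f)) v)"
    by (simp only: A_add A_scl)
  then show ?thesis
    using A_bracket[of "fld j f" "fld k h" v] unfolding A1_def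
    by (simp add: algebra_simps)
qed

abbreviation AD :: "'n \<Rightarrow> 'v \<Rightarrow> 'v" where
  "AD i \<equiv> A1 1 i"

lemma AD_commute: "AD i (AD j v) = AD j (AD i v)"
  by (simp add: A1_bracket[of 1 i 1 j] A1_simps)

text \<open>The operator \<partial>^\<beta> on an arbitrary representation; the fold over the index
  set is well defined because the \<partial>_i commute.\<close>

definition dpw :: "('n \<Rightarrow>\<^sub>0 nat) \<Rightarrow> 'v \<Rightarrow> 'v" where
  "dpw \<beta> v = Finite_Set.fold (\<lambda>i. AD i ^^ Poly_Mapping.lookup \<beta> i) v UNIV"

lemma AD_pow_commute: "(AD i ^^ k) ((AD j ^^ l) v) = (AD j ^^ l) ((AD i ^^ k) v)"
proof -
  have "AD i ((AD j ^^ l) v) = (AD j ^^ l) (AD i v)" for v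
    by (induction l) (simp_all add: AD_commute[of i])
  then show ?thesis by (induction k) simp_all
qed

lemma dpw_commute: "comp_fun_commute (\<lambda>i. AD i ^^ k i)"
  by (simp add: comp_fun_commute_def fun_eq_iff AD_pow_commute)

lemma dpw_fold_insert: "finite S \<Longrightarrow> i \<notin> S \<Longrightarrow>
    Finite_Set.fold (\<lambda>i. AD i ^^ k i) v (insert i S) =
    (AD i ^^ k i) (Finite_Set.fold (\<lambda>i. AD i ^^ k i) v S)"
proof -
  interpret comp_fun_commute "\<lambda>i. AD i ^^ k i" by (rule dpw_commute)
  show "finite S \<Longrightarrow> i \<notin> S \<Longrightarrow> ?thesis" by (rule fold_insert) auto
qed

lemma dpw_fold_rec: "Finite_Set.fold (\<lambda>i. AD i ^^ k i) v UNIV =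
    (AD i ^^ k i) (Finite_Set.fold (\<lambda>i. AD i ^^ k i) v (UNIV - {i}))"
  using dpw_fold_insert[of "UNIV - {i}" i k v] by (simp add: insert_absorb)

lemma dpw_fold_cong:
  "finite S \<Longrightarrow> (\<And>i. i \<in> S \<Longrightarrow> k i = l i) \<Longrightarrow>
    Finite_Set.fold (\<lambda>i. AD i ^^ k i) v S = Finite_Set.fold (\<lambda>i. AD i ^^ l i) v S"
  by (induction S rule: finite_induct) (simp_all add: dpw_fold_insert)

lemma dpw_zero [simp]: "dpw 0 v = v"
proof -
  have "finite S \<Longrightarrow> (\<And>i. i \<in> S \<Longrightarrow> k i = 0) \<Longrightarrow> Finite_Set.fold (\<lambda>i. AD i ^^ k i) v S = v"
    for S and k :: "'n \<Rightarrow> nat"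
    by (induction S rule: finite_induct) (simp_all add: dpw_fold_insert)
  from this[of UNIV "\<lambda>i. 0"] show ?thesis by (simp only: dpw_def lookup_zero finite)
qed

lemma dpw_add_e1: "dpw (\<beta> + e1 i) v = AD i (dpw \<beta> v)"
proof -
  have eq: "Finite_Set.fold (\<lambda>j. AD j ^^ Poly_Mapping.lookup (\<beta> + e1 i) j) v (UNIV - {i}) =
      Finite_Set.fold (\<lambda>j. AD j ^^ Poly_Mapping.lookup \<beta> j) v (UNIV - {i})"
    by (rule dpw_fold_cong) (auto simp: lookup_add lookup_single when_def)
  have k: "Poly_Mapping.lookup (\<beta> + e1 i) i = Suc (Poly_Mapping.lookup \<beta> i)"
    by (simp add: lookup_add)
  show ?thesis
    unfolding dpw_def dpw_fold_rec[where i = i] eq k by simp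
qed

lemma clin_dpw: "clin (dpw \<beta>)"
proof (induction "deg \<beta>" arbitrary: \<beta>)
  case 0
  then show ?case by (simp add: deg_eq_0_iff clin_id)
next
  case (Suc k)
  then obtain i \<beta>' where \<beta>: "\<beta> = \<beta>' + e1 i" "k = deg \<beta>'"
    by (metis deg_Suc nat.simps(3) Suc_inject)
  then have "dpw \<beta> = (\<lambda>x. AD i (dpw \<beta>' x))" by (intro ext) (simp add: dpw_add_e1)
  then show ?case by (simp only: clin_comp[OF clin_A1 Suc(1)[OF \<beta>(2)]])
qed

text \<open>As a module over the polynomials in the \<partial>_i, the space P0 \<otimes> W is free
  on 1 \<otimes> W, so every linear \<theta> on W extends.\<close>

definition \<psi> :: "('w::cvs \<Rightarrow> 'v) \<Rightarrow> (('n \<Rightarrow>\<^sub>0 nat) \<Rightarrow>\<^sub>0 'w) \<Rightarrow> 'v" where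
  "\<psi> \<theta> = pext (\<lambda>\<beta> m. dpw \<beta> (\<theta> m))"

lemma clin_\<psi>: "clin \<theta> \<Longrightarrow> clin (\<psi> \<theta>)"
  unfolding \<psi>_def by (intro clin_pext clin_comp[OF clin_dpw])

lemma \<psi>_single: "clin \<theta> \<Longrightarrow> \<psi> \<theta> (Poly_Mapping.single \<beta> m) = dpw \<beta> (\<theta> m)"
  unfolding \<psi>_def by (subst pext_single) (simp_all add: clin_simps clin_dpw)

lemma \<psi>_dd: "clin \<theta> \<Longrightarrow> \<psi> \<theta> (dd i g) = AD i (\<psi> \<theta> g)"
  by (rule clin_eqI[OF clin_comp clin_comp, OF clin_\<psi> clin_dd clin_A1 clin_\<psi>])
    (simp_all add: dd_single \<psi>_single dpw_add_e1)

lemma A1_dd: "A1 f j (AD k v) = AD k (A1 f j v) - A1 (pd k f) j v"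
  using A1_bracket[of f j 1 k v] by (simp add: A1_simps)

lemma deg_1: "deg \<alpha> = 1 \<Longrightarrow> \<exists>i. \<alpha> = e1 i"
proof -
  assume *: "deg \<alpha> = 1"
  then have "deg \<alpha> \<noteq> 0" by simp
  then obtain i \<beta>' where "\<alpha> = \<beta>' + e1 i" "deg \<alpha> = Suc (deg \<beta>')" by (rule deg_Suc)
  with * have "\<alpha> = e1 i" by (simp add: deg_eq_0_iff)
  then show ?thesis ..
qed

text \<open>The vectors on which \<psi> commutes with all fields are stable under each
  \<open>dd i\<close>, because the commutator of f \<partial>_j and \<partial>_i is again a field,
  namely -(\<partial>_i f) \<partial>_j. It remains to check bottom vectors, where monomials f of
  degree 0, 1 and at least 2 stand for \<partial>_j, for gl_n and for the fields killing \<theta>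
  m.\<close>

lemma \<psi>_hom:
  assumes "glrep E" "clin \<theta>"
    and E: "\<And>i j m. m \<in> C \<Longrightarrow> \<theta> (E i j m) = A1 (tvar i) j (\<theta> m) + (if i = j then \<theta> m else 0)"
    and killed: "\<And>\<alpha> j m. m \<in> C \<Longrightarrow> deg \<alpha> \<ge> 2 \<Longrightarrow> A1 (mon \<alpha>) j (\<theta> m) = 0"
    and g: "g \<in> coeffs C"
  shows "\<psi> \<theta> (X E f g) = A f (\<psi> \<theta> g)"
proof -
  interpret glrep E by fact
  note \<psi>_simps = clin_simps[OF clin_\<psi>[OF assms(2)]]
  let ?N = "{g. \<forall>f j. \<psi> \<theta> (X1 E f j g) = A1 f j (\<psi> \<theta> g)}"
  have "coeffs C \<subseteq> ?N"
  proof (rule coeffs_gen)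
    show "csub ?N" by (simp add: csub_def X1_simps \<psi>_simps A1_simps)
    show "dd i g \<in> ?N" if "g \<in> ?N" for i g
      using that by (simp add: X1_dd \<psi>_dd[OF assms(2)] A1_dd \<psi>_simps)
    show "Poly_Mapping.single 0 m \<in> ?N" if m: "m \<in> C" for m
    proof (intro CollectI allI)
      fix f j
      show "\<psi> \<theta> (X1 E f j (Poly_Mapping.single 0 m)) = A1 f j (\<psi> \<theta> (Poly_Mapping.single 0 m))"
      proof (induction f rule: pm_induct)
        case (single \<alpha> c)
        have *: "\<psi> \<theta> (X1 E (mon \<alpha>) j (Poly_Mapping.single 0 m)) = A1 (mon \<alpha>) j (\<psi> \<theta> (Poly_Mapping.single 0 m))"
        proof -
          consider "deg \<alpha> = 0" | "deg \<alpha> = 1" | "deg \<alpha> \<ge> 2" by linarith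
          then show ?thesis
          proof cases
            case 1
            then show ?thesis
              by (simp add: deg_eq_0_iff X1_one \<psi>_dd[OF assms(2)])
          next
            case 2
            then obtain i where "\<alpha> = e1 i" using deg_1 by blast
            then show ?thesis
              by (simp add: X1_tvar_bottom \<psi>_single assms(2) clin_simps[OF assms(2)] E[OF m])
          next
            case 3
            then show ?thesis
              by (simp add: X1_bottom \<psi>_simps \<psi>_single assms(2) killed[OF m])
          qed
        qed
        have "Poly_Mapping.single \<alpha> c = scl c (mon \<alpha>)" by simp
        then show ?case
          unfolding X1_simps A1_simps \<psi>_simps * by (simp only: X1_simps A1_simps \<psi>_simps *)
      qed (simp_all add: X1_simps A1_simps \<psi>_simps)
    qed
  qed
  with g have "\<psi> \<theta> (X1 E f j g) = A1 f j (\<psi> \<theta> g)" for f j by blast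
  then show ?thesis unfolding X_def A_eq_A1[of f] \<psi>_simps by simp
qed

end

lemma (in glrep) vfrep_X: "vfrep (X E)"
  by unfold_locales (simp_all add: clin_X X_add_left X_scl_left X_bracket)

lemma lookup_dd_add [simp]: "Poly_Mapping.lookup (dd i g) (\<beta> + e1 i) = Poly_Mapping.lookup g \<beta>"
proof (induction g rule: pm_induct)
  case (single k m)
  show ?case by (auto simp: dd_single lookup_single when_def)
qed (simp_all add: dd_simps lookup_add)

lemma dd_eq_0_iff [simp]: "dd i g = 0 \<longleftrightarrow> g = 0"
proof
  assume *: "dd i g = 0"
  show "g = 0"
  proof (rule poly_mapping_eqI)
    fix \<beta> show "Poly_Mapping.lookup g \<beta> = Poly_Mapping.lookup 0 \<beta>"
      using lookup_dd_add[of i g \<beta>] * by simp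
  qed
qed (simp add: dd_simps)

lemma lookup_dd_0 [simp]: "Poly_Mapping.lookup (dd i g) 0 = 0"
proof (induction g rule: pm_induct)
  case (single k m)
  have "Poly_Mapping.lookup (k + e1 i) i \<noteq> Poly_Mapping.lookup 0 i" by (simp add: lookup_add)
  then have "k + e1 i \<noteq> 0" by metis
  then show ?case by (simp add: dd_single lookup_single)
qed (simp_all add: dd_simps lookup_add)

section \<open>The Euler field and bottom components\<close>

context glrep
begin

text \<open>On \<partial>^\<beta> the field t_j \<partial>_j acts in P0 by -\<beta>_j - 1, and the
  matrix units add their trace c. So different degrees have different eigenvalues.\<close>

lemma euler_eigen:
  assumes c: "\<And>m. m \<in> C \<Longrightarrow> (\<Sum>i\<in>UNIV. E i i m) = scl c m" and g: "g \<in> coeffs C"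
  shows "Poly_Mapping.lookup (X E tvar g) \<beta> =
    scl (c - of_nat CARD('n) - of_nat (deg \<beta>)) (Poly_Mapping.lookup g \<beta>)"
proof -
  have 1: "Poly_Mapping.lookup (T (tvar j) (dd j g)) \<beta> =
      scl (- of_nat (Poly_Mapping.lookup \<beta> j) - 1) (Poly_Mapping.lookup g \<beta>)" for j and g :: "('n \<Rightarrow>\<^sub>0 nat) \<Rightarrow>\<^sub>0 'w"
  proof (induction g rule: pm_induct)
    case (single k m)
    show ?case
      by (auto simp: dd_single T_tvar_single lookup_single when_def lookup_add algebra_simps)
  qed (simp_all add: T_simps dd_simps lookup_add scl_add_right)
  have "X E tvar g = (\<Sum>j\<in>UNIV. T (tvar j) (dd j g) + pmap (E j j) g)"
    unfolding X_def X1_tvar ..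
  then have "Poly_Mapping.lookup (X E tvar g) \<beta> =
      (\<Sum>j\<in>UNIV. scl (- of_nat (Poly_Mapping.lookup \<beta> j) - 1) (Poly_Mapping.lookup g \<beta>)) +
      (\<Sum>j\<in>UNIV. E j j (Poly_Mapping.lookup g \<beta>))"
    by (simp add: lookup_sum lookup_add 1 lookup_pmap clin_E sum.distrib)
  also have "(\<Sum>j\<in>UNIV. scl (- of_nat (Poly_Mapping.lookup \<beta> j) - 1) (Poly_Mapping.lookup g \<beta>)) =
      scl (- of_nat (deg \<beta>) - of_nat CARD('n)) (Poly_Mapping.lookup g \<beta>)"
    by (simp add: cvs.scale_sum_left[symmetric] sum_subtractf sum_negf deg_def)
  also have "(\<Sum>j\<in>UNIV. E j j (Poly_Mapping.lookup g \<beta>)) = scl c (Poly_Mapping.lookup g \<beta>)"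
    using g by (intro c) (simp add: coeffs_def)
  finally show ?thesis
    unfolding scl_add_left[symmetric] by (rule trans) (rule arg_cong[where f = "\<lambda>c. scl c _"], simp)
qed

text \<open>Subtracting from the Euler field its eigenvalue in degree K + 1 removes that degree and
  multiplies the bottom component by K + 1, which is nonzero. Repeating this leaves only the bottom
  component.\<close>

lemma euler_bottom:
  assumes c: "\<And>m. m \<in> C \<Longrightarrow> (\<Sum>i\<in>UNIV. E i i m) = scl c m"
    and N: "inv_sub (X E) N" "N \<subseteq> coeffs C" and g: "g \<in> N"
  shows "Poly_Mapping.single 0 (Poly_Mapping.lookup g 0) \<in> N"
proof -
  have "Poly_Mapping.single 0 (Poly_Mapping.lookup g 0) \<in> N"
    if "g \<in> N" "\<And>\<beta>. Poly_Mapping.lookup g \<beta> \<noteq> 0 \<Longrightarrow> deg \<beta> \<le> K" for g K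
    using that
  proof (induction K arbitrary: g)
    case 0
    have "g = Poly_Mapping.single 0 (Poly_Mapping.lookup g 0)"
      using 0(2) by (intro poly_mapping_eqI) (auto simp: lookup_single when_def deg_eq_0_iff)
    with 0(1) show ?case by simp
  next
    case (Suc K)
    define d where "d = c - of_nat CARD('n) - (of_nat (Suc K) :: complex)"
    define g' where "g' = X E tvar g - scl d g"
    have g': "Poly_Mapping.lookup g' \<beta> = scl (of_nat (Suc K) - of_nat (deg \<beta>)) (Poly_Mapping.lookup g \<beta>)" for \<beta>
      using Suc(2) N(2) by (simp add: g'_def d_def lookup_minus euler_eigen[OF c] subset_iff
          cvs.scale_left_diff_distrib[symmetric])
    have "g' \<in> N" unfolding g'_def
      using N(1) Suc(2) by (intro csub_diff csub_scl) (auto simp: inv_sub_def)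
    moreover have "deg \<beta> \<le> K" if "Poly_Mapping.lookup g' \<beta> \<noteq> 0" for \<beta>
    proof -
      from that have "Poly_Mapping.lookup g \<beta> \<noteq> 0" "deg \<beta> \<noteq> Suc K" unfolding g' by auto
      with Suc(3)[of \<beta>] show ?thesis by simp
    qed
    ultimately have "Poly_Mapping.single 0 (Poly_Mapping.lookup g' 0) \<in> N" by (rule Suc(1))
    then have "scl (of_nat (Suc K)) (Poly_Mapping.single 0 (Poly_Mapping.lookup g 0)) \<in> N"
      by (simp add: g')
    then show ?case using csub_sclD[OF inv_subD(1)[OF N(1)]] of_nat_neq_0 by blast
  qed
  from this[of g "Max (deg ` Poly_Mapping.keys g)"] g show ?thesis
    by (simp add: in_keys_iff)
qed

end

section \<open>Homomorphisms from tensor modules onto a simple module\<close>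

locale vhom = vfrep A + glrep E
  for A :: "('n::finite \<Rightarrow> 'n mpol) \<Rightarrow> 'v::cvs \<Rightarrow> 'v" and E :: "'n \<Rightarrow> 'n \<Rightarrow> 'w::cvs \<Rightarrow> 'w" +
  fixes C :: "'w set" and V :: "'v set" and \<theta> :: "'w \<Rightarrow> 'v"
  assumes inv_C: "inv_sub (case_prod E) C" and C_nonzero: "C \<noteq> {0}"
    and irr_V: "irr A V" and clin_\<theta>: "clin \<theta>"
    and \<theta>_E: "m \<in> C \<Longrightarrow> \<theta> (E i j m) = A1 (tvar i) j (\<theta> m) + (if i = j then \<theta> m else 0)"
    and \<theta>_killed: "m \<in> C \<Longrightarrow> deg \<alpha> \<ge> 2 \<Longrightarrow> A1 (mon \<alpha>) j (\<theta> m) = 0"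
    and \<theta>_V: "m \<in> C \<Longrightarrow> \<theta> m \<in> V"
    and \<theta>_inj: "m \<in> C \<Longrightarrow> \<theta> m = 0 \<Longrightarrow> m = 0"
begin

abbreviation "\<Psi> \<equiv> \<psi> \<theta>"

lemmas clin_\<Psi> = clin_\<psi>[OF clin_\<theta>]
lemmas \<Psi>_simps = clin_simps[OF clin_\<Psi>]
lemmas csub_C = inv_subD(1)[OF inv_C]

lemma csub_V: "csub V" and inv_V: "inv_sub A V"
  using irr_V by (auto simp: irr_def inv_sub_def)

lemma \<Psi>_hom: "g \<in> coeffs C \<Longrightarrow> \<Psi> (X E f g) = A f (\<Psi> g)"
  by (rule \<psi>_hom[OF glrep_axioms clin_\<theta> \<theta>_E \<theta>_killed])

lemma \<Psi>_bottom [simp]: "\<Psi> (Poly_Mapping.single 0 m) = \<theta> m"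
  by (simp add: \<psi>_single clin_\<theta>)

lemma \<Psi>_V: "g \<in> coeffs C \<Longrightarrow> \<Psi> g \<in> V"
proof -
  have "coeffs C \<subseteq> {g. \<Psi> g \<in> V}"
  proof (rule coeffs_gen)
    show "csub {g. \<Psi> g \<in> V}"
      using csub_vimage[OF clin_\<Psi> csub_V csub_UNIV] by simp
  qed (use inv_V \<theta>_V in \<open>auto simp: \<psi>_dd[OF clin_\<theta>] A1_def inv_sub_def\<close>)
  then show "g \<in> coeffs C \<Longrightarrow> \<Psi> g \<in> V" by blast
qed

lemma \<Psi>_image:
  assumes "N \<subseteq> coeffs C" "inv_sub (X E) N"
  shows "\<Psi> ` N = {0} \<or> \<Psi> ` N = V"
proof (rule irr_cases[OF irr_V])
  show "\<Psi> ` N \<subseteq> V" using assms(1) \<Psi>_V by blast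
  have "A f (\<Psi> g) \<in> \<Psi> ` N" if "g \<in> N" for f g
    using assms that \<Psi>_hom[of g f] inv_subD(2)[OF assms(2) that, of f] by (metis image_eqI subsetD)
  then show "inv_sub A (\<Psi> ` N)"
    unfolding inv_sub_def using csub_image[OF clin_\<Psi> inv_subD(1)[OF assms(2)]] by blast
qed

lemma \<Psi>_onto: "\<Psi> ` coeffs C = V"
proof -
  obtain m where m: "m \<in> C" "m \<noteq> 0" using C_nonzero csub_C csub_0 by blast
  then have "\<Psi> (Poly_Mapping.single 0 m) \<noteq> 0" "Poly_Mapping.single 0 m \<in> coeffs C"
    using \<theta>_inj csub_C by auto
  then have "\<Psi> ` coeffs C \<noteq> {0}" by blast
  with \<Psi>_image[OF _ inv_coeffs[OF inv_C]] show ?thesis by blast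
qed

definition "Ker = {g \<in> coeffs C. \<Psi> g = 0}"

lemma inv_Ker: "inv_sub (X E) Ker"
proof -
  have "csub Ker" unfolding Ker_def
    using csub_vimage[OF clin_\<Psi> csub_zero csub_coeffs[OF csub_C]] by simp
  moreover have "X E f g \<in> Ker" if "g \<in> Ker" for f g
    using that inv_coeffs[OF inv_C] by (auto simp: Ker_def \<Psi>_hom A_simps inv_sub_def)
  ultimately show ?thesis by (auto simp: inv_sub_def)
qed

lemma Ker_bottom: "m \<in> C \<Longrightarrow> Poly_Mapping.single 0 m \<in> Ker \<Longrightarrow> m = 0"
  using \<theta>_inj by (simp add: Ker_def)

text \<open>By the Euler field the kernel contains the bottom components of its elements, and
  \<theta> is injective on those.\<close>

lemma Ker_lookup_0:
  assumes "\<And>m. m \<in> C \<Longrightarrow> (\<Sum>i\<in>UNIV. E i i m) = scl c m" "g \<in> Ker"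
  shows "Poly_Mapping.lookup g 0 = 0"
proof -
  have "Poly_Mapping.single 0 (Poly_Mapping.lookup g 0) \<in> Ker"
    by (rule euler_bottom[OF assms(1) inv_Ker _ assms(2)]) (auto simp: Ker_def)
  then show ?thesis using assms(2) Ker_bottom by (auto simp: Ker_def coeffs_def)
qed

text \<open>If N were mapped onto V, some g in N would have the image \<theta> m. Then 1 \<otimes> m
  - g would lie in the kernel, whose elements have no bottom component, and g would have the bottom
  component m.\<close>

lemma not_onto:
  assumes c: "\<And>m. m \<in> C \<Longrightarrow> (\<Sum>i\<in>UNIV. E i i m) = scl c m"
    and N: "N \<subseteq> coeffs C" "inv_sub (X E) N" and m: "m \<in> C" "\<And>g. g \<in> N \<Longrightarrow> Poly_Mapping.lookup g 0 \<noteq> m"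
  shows "\<Psi> ` N = {0}"
proof -
  have "\<Psi> ` N \<noteq> V"
  proof
    assume "\<Psi> ` N = V"
    then obtain g where g: "g \<in> N" "\<Psi> g = \<theta> m" using \<theta>_V[OF m(1)] by (metis imageE)
    have "Poly_Mapping.single 0 m - g \<in> coeffs C"
      using N m(1) g(1) csub_C by (intro csub_diff csub_coeffs) auto
    then have "Poly_Mapping.single 0 m - g \<in> Ker"
      by (simp add: Ker_def \<Psi>_simps g)
    from Ker_lookup_0[OF c this] have "Poly_Mapping.lookup g 0 = m" by (simp add: lookup_minus)
    with m(2) g(1) show False by blast
  qed
  with \<Psi>_image[OF N] show ?thesis by blast
qed

text \<open>Kernel elements have coefficients in the common kernel C0 of the TT, as otherwise the
  kernel would contain a bottom vector. If P0 \<otimes> C0 were mapped onto V, every 1 \<otimes> m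
  would be congruent modulo the kernel to an element of P0 \<otimes> C0 and hence lie in it,
  contrary to TT m \<noteq> 0. So its image is 0, and injectivity of \<theta> gives C0 = 0. The same
  alternative for submodules S of C shows that C is irreducible.\<close>

lemma tensor_case:
  assumes "m \<in> C" "TT i l j k m \<noteq> 0"
  shows "Ker = {0}" "irr (case_prod E) C"
proof -
  define C0 where "C0 = {m \<in> C. \<forall>i l j k. TT i l j k m = 0}"
  have inv_C0: "inv_sub (case_prod E) C0" unfolding C0_def by (rule ker_TT_inv[OF inv_C])
  note csub_C0 = inv_subD(1)[OF inv_C0]
  have C0: "coeffs C0 \<subseteq> coeffs C" by (auto simp: coeffs_def C0_def)
  have 1: "Ker \<subseteq> coeffs C0"
  proof
    fix g assume g: "g \<in> Ker"
    then have gC: "g \<in> coeffs C" by (simp add: Ker_def)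
    have "TT i l j k (Poly_Mapping.lookup g \<beta>) = 0" for i l j k \<beta>
    proof (rule ccontr)
      assume "TT i l j k (Poly_Mapping.lookup g \<beta>) \<noteq> 0"
      from low_TT[OF inv_Ker inv_C g gC this] Ker_bottom show False by blast
    qed
    with gC show "g \<in> coeffs C0" by (auto simp: coeffs_def C0_def)
  qed
  have "\<Psi> ` coeffs C0 \<noteq> V"
  proof
    assume "\<Psi> ` coeffs C0 = V"
    then obtain g where g: "g \<in> coeffs C0" "\<Psi> g = \<theta> m" using \<theta>_V[OF assms(1)] by (metis imageE)
    have "Poly_Mapping.single 0 m - g \<in> coeffs C"
      using g C0 assms(1) csub_C by (intro csub_diff csub_coeffs) auto
    then have "Poly_Mapping.single 0 m - g \<in> coeffs C0"
      using 1 by (auto simp: Ker_def \<Psi>_simps g)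
    then have "(Poly_Mapping.single 0 m - g) + g \<in> coeffs C0"
      using g csub_coeffs[OF csub_C0] by (intro csub_add) auto
    then have "m \<in> C0" by (simp add: csub_C0)
    with assms(2) show False by (auto simp: C0_def)
  qed
  then have 2: "\<Psi> ` coeffs C0 = {0}" using \<Psi>_image[OF C0 inv_coeffs[OF inv_C0]] by blast
  have "C0 = {0}"
  proof -
    have "m = 0" if "m \<in> C0" for m
    proof -
      have "\<Psi> (Poly_Mapping.single 0 m) \<in> \<Psi> ` coeffs C0" using that csub_C0 by (intro imageI) simp
      with 2 that \<theta>_inj show ?thesis by (auto simp: C0_def)
    qed
    with csub_0[OF csub_C0] show ?thesis by blast
  qed
  then have "coeffs C0 = {0::('n \<Rightarrow>\<^sub>0 nat) \<Rightarrow>\<^sub>0 'w}"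
    by (auto simp: coeffs_def intro: poly_mapping_eqI)
  with 1 csub_0[OF inv_subD(1)[OF inv_Ker]] show Ker: "Ker = {0}" by blast
  have "S = {0} \<or> S = C" if S: "S \<subseteq> C" "inv_sub (case_prod E) S" for S
  proof -
    note csub_S = inv_subD(1)[OF S(2)]
    have SC: "coeffs S \<subseteq> coeffs C" using S by (auto simp: coeffs_def)
    consider "\<Psi> ` coeffs S = {0}" | "\<Psi> ` coeffs S = V"
      using \<Psi>_image[OF SC inv_coeffs[OF S(2)]] by blast
    then show ?thesis
    proof cases
      case 1
      have "m = 0" if "m \<in> S" for m
      proof -
        have "\<Psi> (Poly_Mapping.single 0 m) \<in> \<Psi> ` coeffs S" using that csub_S by (intro imageI) simp
        with 1 that \<theta>_inj S show ?thesis by auto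
      qed
      with csub_0[OF csub_S] show ?thesis by blast
    next
      case 2
      have "m \<in> S" if mC: "m \<in> C" for m
      proof -
        obtain g where g: "g \<in> coeffs S" "\<Psi> g = \<theta> m" using 2 \<theta>_V[OF mC] by (metis imageE)
        have "Poly_Mapping.single 0 m - g \<in> coeffs C"
          using g SC mC csub_C by (intro csub_diff csub_coeffs) auto
        then have "Poly_Mapping.single 0 m - g \<in> Ker" by (simp add: Ker_def \<Psi>_simps g)
        then have "g = Poly_Mapping.single 0 m" using Ker by simp
        with g csub_S show ?thesis by simp
      qed
      with S show ?thesis by blast
    qed
  qed
  then show "irr (case_prod E) C" using inv_C C_nonzero by (simp add: irr_def)
qed

end

section \<open>Vectors killed by the fields of positive or non-negative degree\<close>

context vfrep
begin

text \<open>The summand \<delta>_ij cancels the -\<delta>_ij from t_i \<partial>_j 1 in P0, so that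
  the inclusion of \<open>K1 V\<close> extends to a homomorphism from F(P0, K1 V).\<close>

definition EV :: "'n \<Rightarrow> 'n \<Rightarrow> 'v \<Rightarrow> 'v" where
  "EV i j v = A1 (tvar i) j v + (if i = j then v else 0)"

lemma glrep_EV: "glrep EV"
proof
  show "clin (EV i j)" for i j
    unfolding EV_def by (intro clin_plus clin_A1 clin_if clin_id clin_zero)
  show "EV i j (EV k l w) - EV k l (EV i j w) =
      (if j = k then EV i l w else 0) - (if l = i then EV k j w else 0)" for i j k l w
    by (auto simp: EV_def A1_bracket[of "tvar i" j "tvar k" l w] A1_simps pd_tvar)
qed

text \<open>Since t^\<alpha> \<partial>_j has degree |\<alpha>| - 1, these vectors are the ones
  killed by g_{\<ge>1}, and \<open>K0\<close> below belongs to g_{\<ge>0}.\<close>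

definition K1 :: "'v set \<Rightarrow> 'v set" where
  "K1 V = {v \<in> V. \<forall>\<alpha> j. deg \<alpha> \<ge> 2 \<longrightarrow> A1 (mon \<alpha>) j v = 0}"

definition K0 :: "'v set \<Rightarrow> 'v set" where
  "K0 V = {v \<in> V. \<forall>\<alpha> j. deg \<alpha> \<ge> 1 \<longrightarrow> A1 (mon \<alpha>) j v = 0}"

lemma A1_single: "A1 (Poly_Mapping.single \<alpha> c) j v = scl c (A1 (mon \<alpha>) j v)"
  using A1_simps(8)[of c "mon \<alpha>" j v] by simp

text \<open>Brackets with g_0 preserve the degree of a field: both t_i \<partial>_j(t^\<alpha>) and
  the other coefficient in the bracket are again of degree |\<alpha>|.\<close>

lemma K1_inv:
  assumes V: "inv_sub A V"
  shows "inv_sub (case_prod EV) (K1 V)"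
proof -
  have csub_V: "csub V" using V by (simp add: inv_sub_def)
  have "csub (K1 V)"
    using csub_V by (auto simp: csub_def K1_def A1_simps)
  moreover have "EV i j v \<in> K1 V" if v: "v \<in> K1 V" for i j v
  proof -
    have vV: "v \<in> V" using v by (simp add: K1_def)
    have kill: "A1 (Poly_Mapping.single \<alpha> c) j v = 0" if "deg \<alpha> \<ge> 2" for \<alpha> c j
      using v that by (subst A1_single) (simp add: K1_def)
    have 1: "A1 (tvar i) j v \<in> V" using V vV by (auto simp: A1_def inv_sub_def)
    have "A1 (mon \<alpha>) k (A1 (tvar i) j v) = 0" if \<alpha>: "deg \<alpha> \<ge> 2" for \<alpha> k
    proof -
      have "A1 (tvar i * pd j (mon \<alpha>)) k v = 0"
      proof (cases "Poly_Mapping.lookup \<alpha> j = 0")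
        case True
        then show ?thesis by (simp add: pd_single A1_simps)
      next
        case False
        then have "e1 i + \<alpha> - e1 j = e1 i + (\<alpha> - e1 j)" by (rule minus_e1_add(2))
        moreover have "\<alpha> = (\<alpha> - e1 j) + e1 j"
          using minus_e1_add(1)[OF False, of "e1 j"] by simp
        then have "deg \<alpha> = deg (\<alpha> - e1 j) + 1" by (metis deg_add deg_e1)
        ultimately show ?thesis using \<alpha>
          by (simp add: pd_single mult_single kill deg_add)
      qed
      moreover have "A1 (mon \<alpha> * pd k (tvar i)) j v = 0"
        using \<alpha> by (simp add: pd_tvar kill A1_simps)
      ultimately show ?thesis using \<alpha>
        by (simp add: A1_bracket[of "mon \<alpha>" k "tvar i" j] kill A1_simps)
    qed
    then have "A1 (tvar i) j v \<in> K1 V" using 1 by (simp add: K1_def)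
    then show ?thesis unfolding EV_def
      using v \<open>csub (K1 V)\<close> by (intro csub_add) (auto simp: csub_0)
  qed
  ultimately show ?thesis by (auto simp: inv_sub_def)
qed

text \<open>A vector killed by all fields of non-negative degree makes \<open>V\<close> a quotient of the tensor
  module with the determinant as coefficients, in which every field maps into the hyperplane of
  vanishing bottom component.\<close>

lemma K0_trivial:
  assumes V: "irr A V" and v: "v \<in> K0 V" "v \<noteq> 0" and u: "u \<in> V"
  shows "A f u = 0"
proof -
  define E :: "'n \<Rightarrow> 'n \<Rightarrow> complex \<Rightarrow> complex" where "E i j z = (if i = j then z else 0)" for i j z
  have v': "v \<in> V" "\<And>\<alpha> j. deg \<alpha> \<ge> 1 \<Longrightarrow> A1 (mon \<alpha>) j v = 0" using v by (auto simp: K0_def)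
  have clin_E: "clin (E i j)" for i j
    unfolding E_def by (intro clin_if clin_id clin_zero)
  interpret vhom A E UNIV V "\<lambda>z. scl z v"
  proof
    show "clin (E i j)" for i j by (rule clin_E)
    show "E i j (E k l w) - E k l (E i j w) =
        (if j = k then E i l w else 0) - (if l = i then E k j w else 0)" for i j k l w
      by (auto simp: E_def)
    show "inv_sub (case_prod E) UNIV" by (simp add: inv_sub_def csub_UNIV)
    show "(UNIV :: complex set) \<noteq> {0}" by (metis UNIV_I singletonD zero_neq_one)
    show "irr A V" by fact
    show "clin (\<lambda>z. scl z v)" by (simp add: clin_def scl_add_left)
    show "scl (E i j m) v = A1 (tvar i) j (scl m v) + (if i = j then scl m v else 0)" for i j m
      by (simp add: E_def A1_simps v'(2))
    show "A1 (mon \<alpha>) j (scl m v) = 0" if "2 \<le> deg \<alpha>" for \<alpha> j m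
      using that by (simp add: A1_simps v'(2))
    show "scl m v \<in> V" for m using V v' by (auto simp: irr_def inv_sub_def csub_def)
    show "m = 0" if "scl m v = 0" for m using that v(2) by simp
  qed
  let ?N = "{g :: ('n \<Rightarrow>\<^sub>0 nat) \<Rightarrow>\<^sub>0 complex. Poly_Mapping.lookup g 0 = 0}"
  have X: "Poly_Mapping.lookup (X E f g) 0 = 0" for f g
  proof -
    \<comment> \<open>With E_ij = \<delta>_ij the gl_n part of the action is multiplication by
      \<partial>_j p, so by the Leibniz rule the field acts as \<partial>_j after p and its image
      has no bottom component.\<close>
    have "X1 E p j g = dd j (T p g)" for p j
    proof -
      have "pmap (E i j) g = (if i = j then g else 0)" for i
        by (intro poly_mapping_eqI, subst lookup_pmap[OF clin_E]) (simp add: E_def)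
      then have "(\<Sum>i\<in>UNIV. T (pd i p) (pmap (E i j) g)) = (\<Sum>i\<in>UNIV. if i = j then T (pd j p) g else 0)"
        by (intro sum.cong) (auto simp: T_simps)
      then show ?thesis by (simp add: X1_def dd_T)
    qed
    then show ?thesis by (simp add: X_def lookup_sum)
  qed
  have N: "?N \<subseteq> coeffs UNIV" "inv_sub (X E) ?N"
    by (auto simp: coeffs_def inv_sub_def csub_def lookup_add X)
  have "\<Psi> ` ?N = {0}"
    by (rule not_onto[where c = "of_nat CARD('n)" and m = 1, OF _ N]) (simp_all add: E_def)
  moreover obtain g where "u = \<Psi> g" "g \<in> coeffs UNIV" using \<Psi>_onto u by blast
  moreover have "\<Psi> (X E f g) \<in> \<Psi> ` ?N" by (rule imageI) (simp add: X)
  ultimately show ?thesis using \<Psi>_hom[of g f] by auto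
qed

end

section \<open>The exterior algebra\<close>

text \<open>The sign that arises when \<epsilon>_k is moved from the front to its place in the
  increasing wedge over S.\<close>

definition sg :: "'n::{finite,linorder} \<Rightarrow> 'n set \<Rightarrow> complex" where
  "sg k S = (-1) ^ card {s \<in> S. s < k}"

lemma sg_insert: "j \<notin> S \<Longrightarrow> sg k (insert j S) = (if j < k then - sg k S else sg k S)"
proof -
  assume "j \<notin> S"
  moreover have "{s \<in> insert j S. s < k} = (if j < k then insert j {s \<in> S. s < k} else {s \<in> S. s < k})"
    by auto
  ultimately show ?thesis by (simp add: sg_def)
qed

lemma sg_remove: "j \<in> S \<Longrightarrow> sg k (S - {j}) = (if j < k then - sg k S else sg k S)"
  using sg_insert[of j "S - {j}" k] by (auto simp: insert_absorb)

lemma sg_sq: "sg k S * sg k S = 1" "sg k S * (sg k S * c) = c"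
  by (simp_all add: sg_def power_mult_distrib[symmetric] mult.assoc[symmetric] flip: power_add)

text \<open>\<open>cr k\<close> is the exterior product with \<epsilon>_k and \<open>an k\<close>
  below the contraction with the dual vector; they satisfy the canonical anticommutation relations,
  from which all identities of the exterior powers are derived.\<close>

definition cr :: "'n::{finite,linorder} \<Rightarrow> ('n set \<Rightarrow>\<^sub>0 complex) \<Rightarrow> 'n set \<Rightarrow>\<^sub>0 complex" where
  "cr k = pext (\<lambda>S c. if k \<in> S then 0 else Poly_Mapping.single (insert k S) (sg k S * c))"

definition an :: "'n::{finite,linorder} \<Rightarrow> ('n set \<Rightarrow>\<^sub>0 complex) \<Rightarrow> 'n set \<Rightarrow>\<^sub>0 complex" where
  "an k = pext (\<lambda>S c. if k \<in> S then Poly_Mapping.single (S - {k}) (sg k S * c) else 0)"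

lemma clin_cr: "clin (cr k)"
  unfolding cr_def by (rule clin_pext) (auto simp: clin_def single_add[symmetric] algebra_simps)

lemma clin_an: "clin (an k)"
  unfolding an_def by (rule clin_pext) (auto simp: clin_def single_add[symmetric] algebra_simps)

lemma cr_single: "cr k (Poly_Mapping.single S c) =
    (if k \<in> S then 0 else Poly_Mapping.single (insert k S) (sg k S * c))"
  unfolding cr_def by (subst pext_single) auto

lemma an_single: "an k (Poly_Mapping.single S c) =
    (if k \<in> S then Poly_Mapping.single (S - {k}) (sg k S * c) else 0)"
  unfolding an_def by (subst pext_single) auto

lemmas cr_simps = clin_simps[OF clin_cr]
lemmas an_simps = clin_simps[OF clin_an]

lemma cr_cr: "cr k (cr j w) = - cr j (cr k w)"
proof -
  have "cr k (cr j w) + cr j (cr k w) = 0"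
  proof (rule clin_eqI[where g = "\<lambda>_. 0" and f = "\<lambda>w. cr k (cr j w) + cr j (cr k w)"])
    fix S :: "'a set" and c
    have "k < j \<or> j < k \<or> k = j" by auto
    then show "cr k (cr j (Poly_Mapping.single S c)) + cr j (cr k (Poly_Mapping.single S c)) = 0"
      by (auto simp: cr_single cr_simps sg_insert insert_commute single_add[symmetric] algebra_simps)
  qed (intro clin_plus clin_comp[OF clin_cr] clin_cr clin_zero)+
  then show ?thesis by (simp add: eq_neg_iff_add_eq_0)
qed

lemma an_an: "an k (an j w) = - an j (an k w)"
proof -
  have "an k (an j w) + an j (an k w) = 0"
  proof (rule clin_eqI[where g = "\<lambda>_. 0" and f = "\<lambda>w. an k (an j w) + an j (an k w)"])
    fix S :: "'a set" and c
    have *: "S - {j} - {k} = S - {j, k}" "S - {k} - {j} = S - {j, k}" by auto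
    show "an k (an j (Poly_Mapping.single S c)) + an j (an k (Poly_Mapping.single S c)) = 0"
      by (cases k j rule: linorder_cases)
        (auto simp: an_single an_simps sg_remove * single_uminus mult.left_commute dest: order.asym)
  qed (intro clin_plus clin_comp[OF clin_an] clin_an clin_zero)+
  then show ?thesis by (simp add: eq_neg_iff_add_eq_0)
qed

lemma an_cr: "an j (cr k w) = (if j = k then w else 0) - cr k (an j w)"
proof -
  have "an j (cr k w) + cr k (an j w) = (if j = k then w else 0)"
  proof (rule clin_eqI[where g = "\<lambda>w. if j = k then w else 0" and f = "\<lambda>w. an j (cr k w) + cr k (an j w)"])
    fix S :: "'a set" and c
    have *: "insert k S - {j} = insert k (S - {j})" if "j \<noteq> k" using that by auto
    have "k < j \<or> j < k \<or> k = j" by auto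
    then show "an j (cr k (Poly_Mapping.single S c)) + cr k (an j (Poly_Mapping.single S c)) =
        (if j = k then Poly_Mapping.single S c else 0)"
      by (cases "k = j"; cases "j \<in> S"; cases "k \<in> S")
        (auto simp: an_single cr_single an_simps cr_simps sg_remove sg_insert * sg_sq insert_absorb
          single_add[symmetric] algebra_simps)
  qed (intro clin_plus clin_comp[OF clin_an] clin_comp[OF clin_cr] clin_an clin_cr clin_zero clin_if clin_id)+
  then show ?thesis by (simp add: algebra_simps)
qed

definition EL :: "'n::{finite,linorder} \<Rightarrow> 'n \<Rightarrow> ('n set \<Rightarrow>\<^sub>0 complex) \<Rightarrow> 'n set \<Rightarrow>\<^sub>0 complex" where
  "EL i j w = cr i (an j w)"

interpretation EL: glrep EL
proof
  show "clin (EL i j)" for i j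
    unfolding EL_def by (intro clin_comp[OF clin_cr] clin_an)
  \<comment> \<open>After normal ordering the quartic term is symmetric under exchange of the two
    matrix units, since creators and annihilators each contribute one sign. It cancels in the
    commutator.\<close>
  have EL_EL: "EL i j (EL k l w) = (if j = k then EL i l w else 0) + cr k (cr i (an j (an l w)))" for i j k l w
    by (simp add: EL_def an_cr cr_simps cr_cr[of i k])
  show "EL i j (EL k l w) - EL k l (EL i j w) =
      (if j = k then EL i l w else 0) - (if l = i then EL k j w else 0)" for i j k l w
    unfolding EL_EL by (subst cr_cr, subst an_an) (simp add: cr_simps)
qed

definition LL :: "nat \<Rightarrow> ('n::{finite,linorder} set \<Rightarrow>\<^sub>0 complex) set" where
  "LL r = {f. \<forall>S\<in>Poly_Mapping.keys f. card S = r}"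

lemma LL_iff: "f \<in> LL r \<longleftrightarrow> (\<forall>S. Poly_Mapping.lookup f S \<noteq> 0 \<longrightarrow> card S = r)"
  by (auto simp: LL_def in_keys_iff)

lemma csub_LL: "csub (LL r)"
proof -
  have "f + g \<in> LL r" if "f \<in> LL r" "g \<in> LL r" for f g :: "'a set \<Rightarrow>\<^sub>0 complex"
    unfolding LL_iff
  proof (intro allI impI)
    fix S assume "Poly_Mapping.lookup (f + g) S \<noteq> 0"
    then have "Poly_Mapping.lookup f S \<noteq> 0 \<or> Poly_Mapping.lookup g S \<noteq> 0"
      by (auto simp: lookup_add)
    with that show "card S = r" unfolding LL_iff by blast
  qed
  moreover have "0 \<in> LL r" "\<And>c f. f \<in> LL r \<Longrightarrow> scl c f \<in> LL r" for r by (simp_all add: LL_iff)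
  ultimately show ?thesis unfolding csub_def by blast
qed

lemma single_LL: "card S = r \<Longrightarrow> Poly_Mapping.single S c \<in> LL r"
  by (auto simp: LL_iff lookup_single when_def)

lemma LL_induct:
  assumes f: "f \<in> LL r" and N: "csub N" and "\<And>S c. card S = r \<Longrightarrow> Poly_Mapping.single S c \<in> N"
  shows "f \<in> N"
proof -
  have "(\<Sum>S\<in>Poly_Mapping.keys f. Poly_Mapping.single S (Poly_Mapping.lookup f S)) \<in> N"
    using f by (intro csub_sum N assms(3)) (auto simp: LL_def)
  then show ?thesis unfolding pm_expand[symmetric] .
qed

lemma cr_LL: "f \<in> LL r \<Longrightarrow> cr k f \<in> LL (Suc r)"
proof (erule LL_induct[where N = "{f. cr k f \<in> LL (Suc r)}", simplified])
  show "csub {f. cr k f \<in> LL (Suc r)}"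
    using csub_vimage[OF clin_cr csub_LL csub_UNIV] by simp
qed (auto simp: cr_single csub_0[OF csub_LL] intro: single_LL)

lemma an_LL: "f \<in> LL (Suc r) \<Longrightarrow> an k f \<in> LL r"
proof (erule LL_induct[where N = "{f. an k f \<in> LL r}", simplified])
  show "csub {f. an k f \<in> LL r}"
    using csub_vimage[OF clin_an csub_LL csub_UNIV] by simp
qed (auto simp: an_single csub_0[OF csub_LL] intro!: single_LL)

lemma an_LL_0: "f \<in> LL 0 \<Longrightarrow> an k f = 0"
proof (erule LL_induct[where N = "{f. an k f = 0}", simplified])
  show "csub {f. an k f = 0}"
    using csub_vimage[OF clin_an csub_zero csub_UNIV] by simp
qed (auto simp: an_single)

lemma EL_LL: "f \<in> LL r \<Longrightarrow> EL i j f \<in> LL r"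
  by (cases r) (auto simp: EL_def an_LL_0 cr_simps csub_0[OF csub_LL] intro: cr_LL an_LL)

lemma inv_LL: "inv_sub (case_prod EL) (LL r)"
  by (auto simp: inv_sub_def csub_LL EL_LL)

lemma lookup_EL_diag: "Poly_Mapping.lookup (EL k k f) S = (if k \<in> S then Poly_Mapping.lookup f S else 0)"
proof (induction f rule: pm_induct)
  case (single A c)
  show ?case
    by (auto simp: EL_def an_single cr_single cr_simps sg_remove sg_sq insert_absorb lookup_single when_def)
qed (simp_all add: EL.E_simps lookup_add)

lemma EL_trace: "f \<in> LL r \<Longrightarrow> (\<Sum>i\<in>UNIV. EL i i f) = scl (of_nat r) f"
proof (rule poly_mapping_eqI)
  fix S assume f: "f \<in> LL r"
  have "Poly_Mapping.lookup (\<Sum>i\<in>UNIV. EL i i f) S = of_nat (card S) * Poly_Mapping.lookup f S"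
    by (simp add: lookup_sum lookup_EL_diag sum.If_cases)
  then show "Poly_Mapping.lookup (\<Sum>i\<in>UNIV. EL i i f) S = Poly_Mapping.lookup (scl (of_nat r) f) S"
    using f by (auto simp: LL_iff)
qed

lemma EL_move: "i \<notin> S \<Longrightarrow> j \<in> S \<Longrightarrow> \<exists>c'. c' \<noteq> 0 \<and>
    EL i j (Poly_Mapping.single S c) = Poly_Mapping.single (insert i (S - {j})) (c' * c)"
  by (rule exI[of _ "sg i (S - {j}) * sg j S"])
    (auto simp: EL_def an_single cr_single mult.assoc, auto simp: sg_def)

text \<open>The unit E_kk projects onto the basis sets containing k, so a nonzero element of N of
  smallest support is a multiple of one basis vector. Off-diagonal units exchange one member of a
  set for another, which reaches all sets of size r.\<close>

lemma irr_LL: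
  assumes "r \<le> CARD('n::{finite,linorder})"
  shows "irr (case_prod EL) (LL r :: ('n set \<Rightarrow>\<^sub>0 complex) set)"
proof -
  obtain S0 :: "'n set" where S0: "card S0 = r" using obtain_subset_with_card_n[OF assms] by blast
  have "Poly_Mapping.single S0 1 \<in> LL r" "Poly_Mapping.single S0 (1::complex) \<noteq> 0"
    using S0 by (auto simp: single_LL)
  then have ne: "(LL r :: ('n set \<Rightarrow>\<^sub>0 complex) set) \<noteq> {0}" by blast
  have *: "N = {0} \<or> N = LL r" if N: "N \<subseteq> LL r" "inv_sub (case_prod EL) N" for N :: "('n set \<Rightarrow>\<^sub>0 complex) set"
  proof (cases "N = {0}")
    case False
    have csub_N: "csub N" and EL_N: "\<And>i j f. f \<in> N \<Longrightarrow> EL i j f \<in> N"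
      using N(2) by (auto simp: inv_sub_def)
    obtain f0 where "f0 \<in> N \<and> f0 \<noteq> 0" using False csub_0[OF csub_N] by blast
    define f where "f = arg_min (\<lambda>f. card (Poly_Mapping.keys f)) (\<lambda>f. f \<in> N \<and> f \<noteq> 0)"
    have f: "f \<in> N \<and> f \<noteq> 0"
      and min: "\<And>g. g \<in> N \<and> g \<noteq> 0 \<Longrightarrow> card (Poly_Mapping.keys f) \<le> card (Poly_Mapping.keys g)"
      unfolding f_def using \<open>f0 \<in> N \<and> f0 \<noteq> 0\<close>
        arg_min_nat_lemma[of "\<lambda>f. f \<in> N \<and> f \<noteq> 0" f0 "\<lambda>f. card (Poly_Mapping.keys f)"] by simp_all
    have "Poly_Mapping.keys f \<noteq> {}" using f by simp
    then obtain S where S: "S \<in> Poly_Mapping.keys f" by blast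
    have "B = S" if B: "B \<in> Poly_Mapping.keys f" for B
    proof (rule ccontr)
      assume "B \<noteq> S"
      then obtain k where "(k \<in> B) \<noteq> (k \<in> S)" by blast
      then obtain B1 B2 where "B1 \<in> Poly_Mapping.keys f" "k \<in> B1" "B2 \<in> Poly_Mapping.keys f" "k \<notin> B2"
        using B S by metis
      moreover have "Poly_Mapping.keys (EL k k f) = {x \<in> Poly_Mapping.keys f. k \<in> x}"
        by (auto simp: in_keys_iff lookup_EL_diag split: if_splits)
      ultimately have "B1 \<in> Poly_Mapping.keys (EL k k f)" "Poly_Mapping.keys (EL k k f) \<subset> Poly_Mapping.keys f"
        by auto
      then have "EL k k f \<noteq> 0" "card (Poly_Mapping.keys (EL k k f)) < card (Poly_Mapping.keys f)"
        by (auto intro: psubset_card_mono)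
      with min[of "EL k k f"] EL_N f show False by auto
    qed
    then have "f = Poly_Mapping.single S (Poly_Mapping.lookup f S)"
      by (intro poly_mapping_eqI) (auto simp: lookup_single when_def in_keys_iff)
    then have "scl (Poly_Mapping.lookup f S) (Poly_Mapping.single S 1) \<in> N" using f by simp
    then have eS: "Poly_Mapping.single S 1 \<in> N" using csub_sclD[OF csub_N] S by (auto simp: in_keys_iff)
    have card_S: "card S = r" using S f N by (auto simp: LL_def)
    have eB: "Poly_Mapping.single B 1 \<in> N" if "card B = r" for B
      using that
    proof (induction "card (B - S)" arbitrary: B)
      case 0
      then have "B = S" using card_S by (metis card_0_eq card_subset_eq finite Diff_eq_empty_iff)
      then show ?case using eS by simp
    next
      case (Suc q)
      then obtain b where b: "b \<in> B" "b \<notin> S" by (metis DiffE card.empty ex_in_conv nat.simps(3))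
      have "\<not> S \<subseteq> B" using b Suc(3) card_S card_subset_eq[of B S] by auto
      then obtain a where a: "a \<in> S" "a \<notin> B" by blast
      let ?B = "insert a (B - {b})"
      have "?B - S = (B - S) - {b}" using a by auto
      then have "q = card (?B - S)" using Suc(2) b by simp
      moreover have "card ?B = r" using a b Suc(3) card_Suc_Diff1[of B b] by simp
      ultimately have "Poly_Mapping.single ?B 1 \<in> N" by (rule Suc(1))
      then have "EL b a (Poly_Mapping.single ?B 1) \<in> N" by (rule EL_N)
      moreover obtain c' where "c' \<noteq> 0"
        "EL b a (Poly_Mapping.single ?B 1) = Poly_Mapping.single (insert b (?B - {a})) (c' * 1)"
        using EL_move[of b ?B a 1] a b by blast
      moreover have "insert b (?B - {a}) = B" using a b by auto
      ultimately have "scl c' (Poly_Mapping.single B 1) \<in> N" by simp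
      with \<open>c' \<noteq> 0\<close> show ?case using csub_sclD[OF csub_N] by blast
    qed
    have "LL r \<subseteq> N"
    proof
      fix f :: "'n set \<Rightarrow>\<^sub>0 complex" assume "f \<in> LL r"
      then show "f \<in> N"
      proof (rule LL_induct[OF _ csub_N])
        fix S :: "'n set" and c assume "card S = r"
        from csub_scl[OF csub_N eB[OF this], of c] show "Poly_Mapping.single S c \<in> N" by simp
      qed
    qed
    with N show ?thesis by blast
  qed simp
  show ?thesis unfolding irr_def by (intro conjI allI impI inv_LL ne *)
qed

section \<open>The Koszul differential\<close>

text \<open>The modules \<open>L_sub\<close> and \<open>L_tilde\<close> in positive degree will turn
  out to be the image and the kernel of this map in coordinates.\<close>

definition dext :: "(('n::{finite,linorder} \<Rightarrow>\<^sub>0 nat) \<Rightarrow>\<^sub>0 'n set \<Rightarrow>\<^sub>0 complex) \<Rightarrow> ('n \<Rightarrow>\<^sub>0 nat) \<Rightarrow>\<^sub>0 'n set \<Rightarrow>\<^sub>0 complex" where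
  "dext g = (\<Sum>k\<in>UNIV. dd k (pmap (cr k) g))"

lemma clin_dext: "clin dext"
  unfolding dext_def by (intro clin_sumf clin_comp[OF clin_dd] clin_pmap clin_cr)

lemmas dext_simps = clin_simps[OF clin_dext]

lemma dext_single: "dext (Poly_Mapping.single \<beta> w) = (\<Sum>k\<in>UNIV. Poly_Mapping.single (\<beta> + e1 k) (cr k w))"
  by (simp add: dext_def dd_single cr_simps)

lemma dext_coeffs: "g \<in> coeffs (LL r) \<Longrightarrow> dext g \<in> coeffs (LL (Suc r))"
  unfolding dext_def
  by (intro csub_sum csub_coeffs csub_LL dd_coeffs pmap_coeffs[where C = "LL r"] clin_cr cr_LL)

lemma dext_dext: "dext (dext g) = 0"
proof -
  let ?F = "\<lambda>k l. dd k (dd l (pmap (cr k) (pmap (cr l) g)))"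
  have anti: "pmap (cr k) (pmap (cr l) g) = - pmap (cr l) (pmap (cr k) g)" for k l
    by (rule poly_mapping_eqI) (simp add: lookup_pmap clin_cr cr_cr[of k l])
  have F: "?F k l = - ?F l k" for k l
    unfolding anti[of k l] dd_simps by (subst dd_commute) (rule refl)
  have *: "dext (dext g) = (\<Sum>k\<in>UNIV. \<Sum>l\<in>UNIV. ?F k l)"
    by (simp add: dext_def pmap_simps[OF clin_cr] pmap_dd clin_cr dd_simps)
  also have "\<dots> = (\<Sum>k\<in>UNIV. \<Sum>l\<in>UNIV. - ?F l k)" by (intro sum.cong refl F)
  also have "\<dots> = - (\<Sum>k\<in>UNIV. \<Sum>l\<in>UNIV. ?F k l)"
    by (subst sum.swap) (simp add: sum_negf)
  finally have "dext (dext g) = - dext (dext g)" unfolding * .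
  then have "scl 2 (dext (dext g)) = 0"
    using scl_add_left[of 1 1 "dext (dext g)"] by (simp add: eq_neg_iff_add_eq_0)
  then show ?thesis by simp
qed

text \<open>This is the anticommutation relation of \<open>cr\<close> and \<open>an\<close>, or
  Cartan's formula for the constant field \<partial>_j.\<close>

lemma dext_an: "dext (pmap (an j) g) = dd j g - pmap (an j) (dext g)"
proof -
  have "dext (pmap (an j) g) + pmap (an j) (dext g) = dd j g"
  proof -
    have "pmap (cr k) (pmap (an j) g) + pmap (an j) (pmap (cr k) g) = (if k = j then g else 0)" for k
      by (rule poly_mapping_eqI) (auto simp: lookup_pmap clin_cr clin_an lookup_add an_cr)
    then have "dext (pmap (an j) g) + pmap (an j) (dext g) = (\<Sum>k\<in>UNIV. dd k (if k = j then g else 0))"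
      by (simp add: dext_def pmap_simps[OF clin_an] pmap_dd clin_an sum.distrib[symmetric] dd_simps(1)[symmetric])
    also have "\<dots> = (\<Sum>k\<in>UNIV. if k = j then dd j g else 0)"
      by (rule sum.cong) (auto simp: dd_simps)
    finally show ?thesis by simp
  qed
  then show ?thesis by (simp only: eq_diff_eq)
qed

text \<open>Contraction with f \<partial>_j is \<open>an j\<close> followed by \<open>T f\<close>.
  Moving \<open>dext\<close> past \<open>T f\<close> produces the terms \<partial>_k f with
  \<open>cr k (an j w)\<close>, which are the gl_n part of the action; \<open>dext_an\<close>
  supplies the rest.\<close>

lemma cartan: "X1 EL f j g = T f (pmap (an j) (dext g)) + dext (T f (pmap (an j) g))"
proof -
  have EL: "pmap (EL k j) g = pmap (cr k) (pmap (an j) g)" for k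
    by (rule poly_mapping_eqI) (simp only: lookup_pmap[OF EL.clin_E] lookup_pmap[OF clin_cr]
        lookup_pmap[OF clin_an], simp only: EL_def)
  have "dext (T f (pmap (an j) g)) = T f (dext (pmap (an j) g)) + (\<Sum>k\<in>UNIV. T (pd k f) (pmap (EL k j) g))"
    by (simp add: dext_def pmap_T clin_cr dd_T sum.distrib T_simps EL)
  then show ?thesis by (simp add: X1_def dext_an T_simps)
qed

lemma dext_X1: "dext (X1 EL f j g) = X1 EL f j (dext g)"
  by (simp add: cartan dext_dext dext_simps pmap_simps[OF clin_an] T_simps)

lemma dext_X: "dext (X EL f g) = X EL f (dext g)"
  by (simp add: X_def dext_simps dext_X1)

lemma inv_ker_dext: "inv_sub (X EL) {g \<in> coeffs (LL r). dext g = 0}"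
  using csub_vimage[OF clin_dext csub_zero csub_coeffs[OF csub_LL]] EL.inv_coeffs[OF inv_LL]
  by (auto simp: inv_sub_def dext_X EL.X_simps)

lemma inv_image_dext: "inv_sub (X EL) (dext ` coeffs (LL r))"
  using csub_image[OF clin_dext csub_coeffs[OF csub_LL]] EL.inv_coeffs[OF inv_LL]
  by (auto simp: inv_sub_def dext_X[symmetric] intro!: imageI)

text \<open>Reading the term off Cartan's formula as a difference treats r = 0 together with r > 0;
  a direct argument would have to pass through degree r - 1.\<close>

lemma an_an_coeffs: "g \<in> coeffs (LL r) \<Longrightarrow> dext (T f (pmap (an j) g)) \<in> {g \<in> coeffs (LL r). dext g = 0}"
proof -
  assume g: "g \<in> coeffs (LL r)"
  have "X1 EL f j g - T f (pmap (an j) (dext g)) \<in> coeffs (LL r)"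
    by (intro csub_diff csub_coeffs csub_LL EL.X1_in[OF EL.inv_coeffs[OF inv_LL]] g T_coeffs
        pmap_coeffs[where C = "LL (Suc r)"] clin_an an_LL dext_coeffs)
  then show ?thesis by (simp add: cartan dext_dext)
qed

text \<open>The counterpart of \<open>low_TT\<close> when TT vanishes. In Cartan's formula for g the
  second summand is closed and thus in N, so N contains all polynomial multiples of a contraction of
  \<open>dext g\<close>; j is taken from a set in the support of \<open>dext g\<close>, which keeps
  the contraction nonzero.\<close>

lemma dext_lowers:
  assumes N: "inv_sub (X EL) N" "{g \<in> coeffs (LL r). dext g = 0} \<subseteq> N" "N \<subseteq> coeffs (LL r)"
    and g: "g \<in> N" "dext g \<noteq> 0"
  obtains w where "w \<in> LL r" "w \<noteq> 0" "Poly_Mapping.single 0 w \<in> N"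
proof -
  have csub_N: "csub N" using N by (simp add: inv_sub_def)
  have gL: "g \<in> coeffs (LL r)" using N g by blast
  obtain \<beta> S where \<beta>: "Poly_Mapping.lookup (Poly_Mapping.lookup (dext g) \<beta>) S \<noteq> 0"
    using g(2) by (metis poly_mapping_eqI lookup_zero)
  moreover have "Poly_Mapping.lookup (dext g) \<beta> \<in> LL (Suc r)"
    using dext_coeffs[OF gL] by (simp add: coeffs_def)
  ultimately have "card S = Suc r" by (auto simp: LL_iff)
  then obtain j where j: "j \<in> S" by fastforce
  have an: "Poly_Mapping.lookup (an j w) (S - {j}) = sg j S * Poly_Mapping.lookup w S" for w
  proof (induction w rule: pm_induct)
    case (single A c)
    have "A = S" if "j \<in> A" "A - {j} = S - {j}" using that j by blast
    then show ?case using j by (auto simp: an_single lookup_single when_def)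
  qed (simp_all add: an_simps lookup_add algebra_simps)
  have "sg j S \<noteq> 0" by (simp add: sg_def)
  then have "an j (Poly_Mapping.lookup (dext g) \<beta>) \<noteq> 0" using \<beta> an by (metis lookup_zero mult_eq_0_iff)
  define h where "h = pmap (an j) (dext g)"
  have "Poly_Mapping.lookup h \<beta> \<noteq> 0"
    unfolding h_def lookup_pmap[OF clin_an] by fact
  then have h: "h \<noteq> 0" by auto
  have Th: "T f h \<in> N" for f
  proof -
    have "X1 EL f j g - dext (T f (pmap (an j) g)) \<in> N"
      using an_an_coeffs[OF gL] N(2) by (intro csub_diff csub_N EL.X1_in N g) auto
    then show ?thesis by (simp add: cartan h_def)
  qed
  obtain \<gamma> where \<gamma>: "Poly_Mapping.lookup h \<gamma> \<noteq> 0" "Poly_Mapping.single 0 (Poly_Mapping.lookup h \<gamma>) \<in> N"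
    using T_lowers[OF h Th csub_N] by blast
  from subsetD[OF N(3) \<gamma>(2)] have "Poly_Mapping.lookup h \<gamma> \<in> LL r"
    by (simp only: single_coeffs[OF csub_LL])
  then show ?thesis using \<gamma> by (rule that)
qed

lemma dext_bottom_nonzero:
  fixes w :: "'n::{finite,linorder} set \<Rightarrow>\<^sub>0 complex"
  assumes "w \<in> LL r" "w \<noteq> 0" "r < CARD('n)"
  obtains k where "cr k w \<noteq> 0"
proof -
  obtain S where S: "Poly_Mapping.lookup w S \<noteq> 0" using assms(2) by (metis poly_mapping_eqI lookup_zero)
  then have "card S = r" using assms(1) by (auto simp: LL_iff)
  then have "S \<noteq> UNIV" using assms(3) by auto
  then obtain k where k: "k \<notin> S" by blast
  have "Poly_Mapping.lookup (cr k w) (insert k S) = sg k S * Poly_Mapping.lookup w S"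
  proof (induction w rule: pm_induct)
    case (single A c)
    have "A = S" if "k \<notin> A" "insert k A = insert k S" using that k insert_ident[of k A S] by simp
    then show ?case using k by (auto simp: cr_single lookup_single when_def)
  qed (simp_all add: cr_simps lookup_add algebra_simps)
  then have "cr k w \<noteq> 0" using S by (auto simp: sg_def)
  with that show ?thesis .
qed

text \<open>Only the exponent 0 can be raised to e_k. So the bottom coefficient of a closed element
  is killed by every \<open>cr k\<close>, which by \<open>dext_bottom_nonzero\<close> forces it to
  vanish in degrees below n.\<close>

lemma dext_lookup_e1:
  "Poly_Mapping.lookup (dext g) (e1 k) = cr k (Poly_Mapping.lookup g 0)"
proof (induction g rule: pm_induct)
  case (single \<beta> w)
  have "\<beta> + e1 l = e1 k \<longleftrightarrow> \<beta> = 0 \<and> l = k" for l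
  proof
    assume *: "\<beta> + e1 l = e1 k"
    then have "deg \<beta> = 0" by (metis add_diff_cancel_right' deg_add deg_e1 diff_self_eq_0)
    then have "\<beta> = 0" by (simp add: deg_eq_0_iff)
    with * show "\<beta> = 0 \<and> l = k" by (simp add: poly_mapping_eq_iff single.rep_eq fun_eq_iff when_def)
        (metis zero_neq_one)
  qed simp
  then show ?case
    by (simp add: dext_single lookup_sum lookup_single when_def cr_simps if_distrib[of "cr _"] cong: if_cong)
qed (simp_all add: dext_simps cr_simps lookup_add)

lemma dext_ker_0: "g \<in> coeffs (LL 0) \<Longrightarrow> dext g = 0 \<Longrightarrow> g = (0 :: ('n::{finite,linorder} \<Rightarrow>\<^sub>0 nat) \<Rightarrow>\<^sub>0 _)"
proof -
  assume g: "g \<in> coeffs (LL 0)" "dext g = 0"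
  obtain j :: 'n where True by blast
  have "pmap (an j) g = 0"
    using g(1) by (intro poly_mapping_eqI) (simp add: lookup_pmap clin_an coeffs_def an_LL_0)
  then show "g = 0" using dext_an[of j g] g(2) by (simp add: dext_simps pmap_simps[OF clin_an])
qed

text \<open>The preimage N of a submodule contains all closed elements, and a non-closed one if the
  submodule is nonzero. Then \<open>dext_lowers\<close> yields a bottom vector, and simplicity of
  the exterior power puts all bottom vectors into N.\<close>

lemma irr_dext:
  assumes r: "r < CARD('n::{finite,linorder})"
  shows "irr (X EL) (dext ` coeffs (LL r) :: (('n \<Rightarrow>\<^sub>0 nat) \<Rightarrow>\<^sub>0 'n set \<Rightarrow>\<^sub>0 complex) set)"
proof -
  let ?G = "coeffs (LL r) :: (('n \<Rightarrow>\<^sub>0 nat) \<Rightarrow>\<^sub>0 'n set \<Rightarrow>\<^sub>0 complex) set"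
  obtain S0 :: "'n set" where S0: "card S0 = r"
    using obtain_subset_with_card_n[of r UNIV] r by (meson less_imp_le)
  then have w: "Poly_Mapping.single S0 1 \<in> LL r" "Poly_Mapping.single S0 (1::complex) \<noteq> 0"
    by (auto simp: single_LL)
  then obtain k where "cr k (Poly_Mapping.single S0 1) \<noteq> 0" using dext_bottom_nonzero r by blast
  then have "dext (Poly_Mapping.single 0 (Poly_Mapping.single S0 1)) \<noteq> 0"
    using dext_lookup_e1[of "Poly_Mapping.single 0 (Poly_Mapping.single S0 1)" k] by auto
  then have ne: "dext ` ?G \<noteq> {0}" using w by (metis csub_LL imageI single_coeffs singletonD)
  have *: "S = {0} \<or> S = dext ` ?G" if S: "S \<subseteq> dext ` ?G" "inv_sub (X EL) S" for S
  proof (cases "S = {0}")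
    case False
    have csub_S: "csub S" using S by (simp add: inv_sub_def)
    define N where "N = {g \<in> ?G. dext g \<in> S}"
    have "csub N" unfolding N_def by (rule csub_vimage[OF clin_dext csub_S csub_coeffs[OF csub_LL]])
    then have N: "inv_sub (X EL) N"
      using S(2) EL.inv_coeffs[OF inv_LL] by (auto simp: inv_sub_def N_def dext_X)
    obtain s where "s \<in> S" "s \<noteq> 0" using False csub_0[OF csub_S] by blast
    then obtain g where g: "g \<in> N" "dext g \<noteq> 0" using S by (auto simp: N_def)
    have "{g \<in> ?G. dext g = 0} \<subseteq> N" "N \<subseteq> ?G" by (auto simp: N_def csub_0[OF csub_S])
    from dext_lowers[OF N this g] obtain w where "w \<in> LL r" "w \<noteq> 0" "Poly_Mapping.single 0 w \<in> N" .
    then have "{m \<in> LL r. Poly_Mapping.single 0 m \<in> N} = LL r"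
      using irr_cases[OF irr_LL _ EL.bottom_inv[OF N inv_LL]] r by (metis (mono_tags, lifting)
        mem_Collect_eq less_imp_le singletonD subsetI)
    then have "?G \<subseteq> N" by (intro EL.bottom_full[OF N]) blast
    with S show ?thesis by (auto simp: N_def)
  qed simp
  show ?thesis unfolding irr_def by (intro conjI allI impI inv_image_dext ne *)
qed

section \<open>Representations annihilated by the quadratic operators\<close>

lemma cvs_double: "x + x = y + y \<Longrightarrow> x = (y :: 'a::cvs)"
proof -
  assume "x + x = y + y"
  then have "scl 2 x = scl 2 y" using scl_add_left[of 1 1 x] scl_add_left[of 1 1 y] by simp
  then show "x = y" by simp
qed

lemma cvs_eq_minus: "x = - x \<Longrightarrow> x = (0 :: 'a::cvs)"
  using cvs_double[of x 0] by (simp add: eq_neg_iff_add_eq_0)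

section \<open>Subsets of a finite chain and moves to a neighbouring place\<close>

definition adj :: "'n::{finite,linorder} \<Rightarrow> 'n \<Rightarrow> bool" where
  "adj i j \<longleftrightarrow> i < j \<and> (\<forall>k. \<not> (i < k \<and> k < j))"

definition downset :: "'n::{finite,linorder} set \<Rightarrow> bool" where
  "downset A \<longleftrightarrow> (\<forall>i j. i < j \<longrightarrow> j \<in> A \<longrightarrow> i \<in> A)"

text \<open>The sum of the positions of the members, counted from 0. It drops when a member moves
  down, and serves as the measure for minimal choices and inductions.\<close>

definition wt :: "'n::{finite,linorder} set \<Rightarrow> nat" where
  "wt A = (\<Sum>a\<in>A. card {..<a})"

lemma adj_less: "adj i j \<Longrightarrow> s < j \<longleftrightarrow> s < i \<or> s = i"
  unfolding adj_def by (metis less_trans linorder_less_linear)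

lemma adjD: "adj i j \<Longrightarrow> i < j"
  by (simp add: adj_def)

lemma adj_unique: "adj i j \<Longrightarrow> adj i' j \<Longrightarrow> i = i'" "adj i j \<Longrightarrow> adj i j' \<Longrightarrow> j = j'"
  unfolding adj_def by (metis linorder_neqE)+

lemma card_lessThan_less: "i < j \<Longrightarrow> card {..<i} < card {..<j :: 'n::{finite,linorder}}"
  by (intro psubset_card_mono) auto

lemma wt_move: "i \<notin> A \<Longrightarrow> j \<in> A \<Longrightarrow> i < j \<Longrightarrow> wt (insert i (A - {j})) < wt A"
  using card_lessThan_less[of i j] by (simp add: wt_def sum.remove[of A j])

lemma card_move: "i \<notin> A \<Longrightarrow> j \<in> A \<Longrightarrow> card (insert i (A - {j})) = card (A :: 'n::finite set)"
  using card_Suc_Diff1[of A j] by simp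

lemma move_back: "i \<notin> A \<Longrightarrow> j \<in> A \<Longrightarrow> insert j (insert i (A - {j}) - {i}) = A"
  by auto

text \<open>Below a gap i < j take the smallest member k of A above i. Its immediate predecessor is
  not in A: it is at least i, it cannot be i inside A, and any member strictly between i and k would
  contradict the choice of k.\<close>

lemma not_downset:
  assumes "\<not> downset A"
  obtains i j where "adj i j" "i \<notin> A" "j \<in> A"
proof -
  from assms obtain i j where ij: "i < j" "j \<in> A" "i \<notin> A" by (auto simp: downset_def)
  define k where "k = Min {x \<in> A. i < x}"
  have "k \<in> {x \<in> A. i < x}" unfolding k_def using ij by (intro Min_in) auto
  then have k: "k \<in> A" "i < k" by auto
  have k_min: "k \<le> x" if "x \<in> A" "i < x" for x unfolding k_def using that by (intro Min_le) auto
  define p where "p = Max {x. x < k}"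
  have "p \<in> {x. x < k}" unfolding p_def using k(2) by (intro Max_in) auto
  then have p: "p < k" by simp
  have p_max: "x \<le> p" if "x < k" for x unfolding p_def using that by (intro Max_ge) auto
  have "p \<notin> A"
  proof
    assume "p \<in> A"
    moreover have "i \<le> p" by (rule p_max) (rule k)
    ultimately have "k \<le> p" using k_min ij(3) by (metis order.not_eq_order_implies_strict)
    with p show False by simp
  qed
  moreover have "adj p k" unfolding adj_def using p p_max by (metis leD)
  ultimately show ?thesis using that k by blast
qed

lemma downset_eq:
  assumes "downset A" "downset B" "card A = card (B :: 'n::{finite,linorder} set)"
  shows "A = B"
proof -
  have "A \<subseteq> B \<or> B \<subseteq> A"
  proof (rule ccontr)
    assume "\<not> ?thesis"
    then obtain a b where "a \<in> A" "a \<notin> B" "b \<in> B" "b \<notin> A" by blast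
    with assms(1,2) show False unfolding downset_def by (metis linorder_neqE)
  qed
  with assms(3) show ?thesis by (metis card_subset_eq finite)
qed

text \<open>m arises from v by moving members of A0 up by one place at a time. Moves to a
  neighbouring place carry no exterior sign (\<open>EL_adj\<close>), so signs never have to be
  tracked along a ladder.\<close>

inductive lad :: "('n::{finite,linorder} \<Rightarrow> 'n \<Rightarrow> 'w \<Rightarrow> 'w) \<Rightarrow> 'n set \<Rightarrow> 'w \<Rightarrow> 'n set \<Rightarrow> 'w \<Rightarrow> bool"
  for E A0 v where
  base: "lad E A0 v A0 v"
| step: "lad E A0 v A m \<Longrightarrow> adj i j \<Longrightarrow> i \<in> A \<Longrightarrow> j \<notin> A \<Longrightarrow>
    lad E A0 v (insert j (A - {i})) (E j i m)"

lemma EL_single: "i \<noteq> j \<Longrightarrow> EL i j (Poly_Mapping.single A c) =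
    (if i \<notin> A \<and> j \<in> A then Poly_Mapping.single (insert i (A - {j})) (sg i (A - {j}) * (sg j A * c)) else 0)"
  by (auto simp: EL_def an_single cr_single cr_simps)

text \<open>No index lies strictly between neighbours, so both signs count the same members of the
  set.\<close>

lemma sg_adj:
  assumes "adj i j"
  shows "i \<notin> A \<Longrightarrow> sg j A = sg i A" "sg j (A - {i}) = sg i A" "sg i (A - {j}) = sg i A"
proof -
  have "{s \<in> A. s < j} = {s \<in> A. s < i}" if "i \<notin> A"
    using adj_less[OF assms] that by auto
  then show "i \<notin> A \<Longrightarrow> sg j A = sg i A" by (simp add: sg_def)
  have "{s \<in> A - {i}. s < j} = {s \<in> A. s < i}"
    using adj_less[OF assms] by auto
  then show "sg j (A - {i}) = sg i A" by (simp add: sg_def)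
  have "{s \<in> A - {j}. s < i} = {s \<in> A. s < i}"
    using adjD[OF assms] by auto
  then show "sg i (A - {j}) = sg i A" by (simp add: sg_def)
qed

lemma EL_adj:
  assumes "adj i j"
  shows "EL i j (Poly_Mapping.single A c) =
      (if i \<notin> A \<and> j \<in> A then Poly_Mapping.single (insert i (A - {j})) c else 0)"
    and "EL j i (Poly_Mapping.single A c) =
      (if j \<notin> A \<and> i \<in> A then Poly_Mapping.single (insert j (A - {i})) c else 0)"
  using adjD[OF assms] sg_adj[OF assms, of A] by (auto simp: EL_single sg_sq)

section \<open>Weights with entries 0 and 1, and an embedded exterior power\<close>

locale tt_rep = glrep E
  for E :: "'n::{finite,linorder} \<Rightarrow> 'n \<Rightarrow> 'w::cvs \<Rightarrow> 'w" +
  fixes C :: "'w set"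
  assumes inv_C: "inv_sub (case_prod E) C" and C_nonzero: "C \<noteq> {0}"
    and TT_C: "m \<in> C \<Longrightarrow> TT i l j k m = 0"
begin

lemma E_C: "m \<in> C \<Longrightarrow> E i j m \<in> C"
  using inv_C by (auto simp: inv_sub_def)

lemma csub_C: "csub C"
  using inv_C by (simp add: inv_sub_def)

lemma rel: "m \<in> C \<Longrightarrow> E i j (E l k m) + E l j (E i k m) =
    (if i = j then E l k m else 0) + (if l = j then E i k m else 0)"
  using TT_C[of m i l j k] unfolding TT_def by (simp add: algebra_simps)

text \<open>With all four indices equal, the quadratic relation says that twice the square of E_kk
  is twice E_kk.\<close>

lemma idem: "m \<in> C \<Longrightarrow> E k k (E k k m) = E k k m"
  by (rule cvs_double) (simp add: rel)

lemma swap: "E i j (E k l m) = E k l (E i j m) + (if j = k then E i l m else 0) - (if l = i then E k j m else 0)"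
  using E_bracket[of i j k l m] by (simp add: algebra_simps)

definition D :: "'n set \<Rightarrow> 'w set" where
  "D A = {m \<in> C. \<forall>k. E k k m = (if k \<in> A then m else 0)}"

lemma D_C: "m \<in> D A \<Longrightarrow> m \<in> C" and D_E: "m \<in> D A \<Longrightarrow> E k k m = (if k \<in> A then m else 0)"
  by (auto simp: D_def)

text \<open>The image would have the weight entry 2 at i or -1 at j, and neither is an eigenvalue of
  an idempotent.\<close>

lemma E_zero:
  assumes m: "m \<in> D A" and ij: "i \<noteq> j" "i \<in> A \<or> j \<notin> A"
  shows "E i j m = 0"
proof -
  let ?x = "E i j m"
  have x: "?x \<in> C" using m by (intro E_C D_C)
  show ?thesis
  proof (cases "i \<in> A")
    case True
    have "E i i ?x = ?x + ?x" using ij m True by (simp add: swap[of i i i j] D_E)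
    with idem[OF x, of i] have "?x + ?x + (?x + ?x) = ?x + ?x" by (simp add: E_simps)
    then have "?x + ?x = 0 + 0" by simp
    then show ?thesis by (rule cvs_double)
  next
    case False
    then have "E j j ?x = - ?x" using ij m by (simp add: swap[of j j i j] D_E E_simps)
    with idem[OF x, of j] have "?x = - ?x" by (simp add: E_simps)
    then show ?thesis by (rule cvs_eq_minus)
  qed
qed

lemma E_D: "m \<in> D A \<Longrightarrow> i \<notin> A \<Longrightarrow> j \<in> A \<Longrightarrow> E i j m \<in> D (insert i (A - {j}))"
  unfolding D_def by (auto simp: E_C swap[of _ _ i j] E_simps)

text \<open>The quadratic relation for E_ji E_ij reduces to this by E_ii m = 0 and E_jj m =
  m.\<close>

lemma E_back:
  assumes m: "m \<in> D A" "i \<notin> A" "j \<in> A"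
  shows "E j i (E i j m) = m"
proof -
  have "i \<noteq> j" using m by blast
  with rel[OF D_C[OF m(1)], of j i i j] m show ?thesis by (auto simp: D_E E_simps)
qed

text \<open>Commuting idempotents have a common eigenvector in any nonzero space, of whatever
  dimension: go through the indices x and replace m by E_xx m whenever this is nonzero.\<close>

lemma ex_weight: "\<exists>A m. m \<in> D A \<and> m \<noteq> 0"
proof -
  obtain m0 where m0: "m0 \<in> C" "m0 \<noteq> 0" using C_nonzero csub_C csub_0 by blast
  have "\<exists>m\<in>C. m \<noteq> 0 \<and> (\<forall>k\<in>K. E k k m = m \<or> E k k m = 0)" if "finite K" for K
    using that
  proof (induction K)
    case empty
    then show ?case using m0 by blast
  next
    case (insert x K)
    then obtain m where m: "m \<in> C" "m \<noteq> 0" "\<forall>k\<in>K. E k k m = m \<or> E k k m = 0" by blast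
    show ?case
    proof (cases "E x x m = 0")
      case True
      with m show ?thesis by blast
    next
      case False
      have "E k k (E x x m) = E x x m \<or> E k k (E x x m) = 0" if "k \<in> insert x K" for k
      proof (cases "k = x")
        case True
        then show ?thesis using idem[OF m(1)] by simp
      next
        case False
        then have "E k k (E x x m) = E x x (E k k m)" using swap[of k k x x m] by simp
        moreover have "E k k m = m \<or> E k k m = 0" using m(3) that False by blast
        ultimately show ?thesis by (auto simp: E_simps)
      qed
      then have "\<forall>k\<in>insert x K. E k k (E x x m) = E x x m \<or> E k k (E x x m) = 0" by blast
      with False E_C[OF m(1)] show ?thesis by blast
    qed
  qed
  from this[of UNIV] obtain m where m: "m \<in> C" "m \<noteq> 0" "\<forall>k. E k k m = m \<or> E k k m = 0" by auto
  then have "m \<in> D {k. E k k m = m}" by (auto simp: D_def)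
  with m show ?thesis by blast
qed

text \<open>Take a weight A with minimal \<open>wt\<close>. If A had a gap below a member, a raising
  operator would give a weight with smaller \<open>wt\<close>; it does not kill the vector, by
  \<open>E_back\<close>.\<close>

lemma hw_weight:
  obtains A v where "v \<in> D A" "v \<noteq> 0" "downset A"
proof -
  define P where "P A \<longleftrightarrow> (\<exists>m. m \<in> D A \<and> m \<noteq> 0)" for A
  obtain A' where "P A'" using ex_weight unfolding P_def by blast
  define A where "A = arg_min wt P"
  have A: "\<exists>m. m \<in> D A \<and> m \<noteq> 0" and min': "\<And>B. P B \<Longrightarrow> wt A \<le> wt B"
    using arg_min_nat_lemma[of P A' wt, OF \<open>P A'\<close>] unfolding A_def P_def by auto
  have min: "\<not> (\<exists>m. m \<in> D B \<and> m \<noteq> 0)" if "wt B < wt A" for B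
    using min'[of B] that unfolding P_def by (meson leD)
  obtain v where v: "v \<in> D A" "v \<noteq> 0" using A by blast
  have "downset A"
  proof (rule ccontr)
    assume "\<not> downset A"
    then obtain i j where ij: "adj i j" "i \<notin> A" "j \<in> A" by (rule not_downset)
    have "E i j v \<noteq> 0" using E_back[OF v(1) ij(2,3)] v(2) by (auto simp: E_simps)
    with min[OF wt_move[OF ij(2,3) adjD[OF ij(1)]]] E_D[OF v(1) ij(2,3)] show False by blast
  qed
  with v that show ?thesis by blast
qed

text \<open>The basis vector of A is sent to the end of a ladder from A0 to A, once this end is
  known not to depend on the ladder. Neighbouring matrix units are respected by construction, the
  others as commutators, and injectivity follows from simplicity of the exterior power.\<close>

lemma intertwiner:
  assumes v: "v \<in> D A0" "v \<noteq> 0" and A0: "downset A0"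
  obtains \<theta> where "clin \<theta>" "\<And>f. f \<in> LL (card A0) \<Longrightarrow> \<theta> f \<in> C"
    "\<And>f i j. f \<in> LL (card A0) \<Longrightarrow> \<theta> (EL i j f) = E i j (\<theta> f)"
    "\<And>f. f \<in> LL (card A0) \<Longrightarrow> \<theta> f = 0 \<Longrightarrow> f = 0"
proof -
  let ?r = "card A0"
  have lad_D: "m \<in> D A \<and> card A = ?r" if "lad E A0 v A m" for A m
    using that
  proof induction
    case base
    show ?case using v by simp
  next
    case (step A m i j)
    then show ?case using E_D card_move by metis
  qed
  have lad_ex: "\<exists>m. lad E A0 v A m" if "card A = ?r" for A
    using that
  proof (induction "wt A" arbitrary: A rule: less_induct)
    case less
    show ?case
    proof (cases "downset A")
      case True
      with less(2) A0 have "A = A0" by (intro downset_eq)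
      then show ?thesis using lad.base[of E A0 v] by (intro exI[of _ v]) simp
    next
      case False
      then obtain i j where ij: "adj i j" "i \<notin> A" "j \<in> A" by (rule not_downset)
      have "card (insert i (A - {j})) = ?r" using card_move[OF ij(2,3)] less(2) by simp
      with less(1)[OF wt_move[OF ij(2,3) adjD[OF ij(1)]]] obtain m where "lad E A0 v (insert i (A - {j})) m" by blast
      from lad.step[OF this ij(1)] ij have "lad E A0 v (insert j (insert i (A - {j}) - {i})) (E j i m)" by auto
      then show ?thesis unfolding move_back[OF ij(2,3)] by blast
    qed
  qed
  have lad_cases: "(A = A0 \<and> m = v) \<or> (\<exists>i j m'. adj i j \<and> i \<notin> A \<and> j \<in> A \<and>
      lad E A0 v (insert i (A - {j})) m' \<and> m = E j i m')" if "lad E A0 v A m" for A m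
    using that
  proof cases
    case (step A' m' i j)
    then have "insert i (A - {j}) = A'" "i \<notin> A" "j \<in> A" using adjD by (auto dest: less_imp_neq)
    with step show ?thesis by metis
  qed simp
  \<comment> \<open>A diamond argument. Two different last moves, i to j and i' to j', involve four
    distinct indices; undoing both gives a set from which either order of moves leads to A, and E_ji
    commutes with E_j'i'.\<close>
  have lad_unique: "m = m'" if "lad E A0 v A m" "lad E A0 v A m'" for A m m'
    using that
  proof (induction "wt A" arbitrary: A m m' rule: less_induct)
    case less
    show ?case
    proof (cases "A = A0")
      case True
      \<comment> \<open>A downset has no gap below a member, so no ladder step can end in
        A0.\<close>
      then have "\<not> (adj i j \<and> i \<notin> A \<and> j \<in> A)" for i j
        using A0 adjD unfolding downset_def by blast
      then show ?thesis using lad_cases[OF less(2)] lad_cases[OF less(3)] by blast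
    next
      case False
      obtain i j n where n: "adj i j" "i \<notin> A" "j \<in> A" "lad E A0 v (insert i (A - {j})) n" "m = E j i n"
        using lad_cases[OF less(2)] False by blast
      obtain i' j' n' where n': "adj i' j'" "i' \<notin> A" "j' \<in> A" "lad E A0 v (insert i' (A - {j'})) n'" "m' = E j' i' n'"
        using lad_cases[OF less(3)] False by blast
      show ?thesis
      proof (cases "j = j'")
        case True
        then have "i = i'" using n(1) n'(1) adj_unique by blast
        then show ?thesis using True n n' less(1)[OF wt_move[OF n(2,3) adjD[OF n(1)]]] by blast
      next
        case False
        have ne: "i \<noteq> i'" using False n(1) n'(1) adj_unique by blast
        have ne': "i \<noteq> j'" "i' \<noteq> j" "i \<noteq> j" "i' \<noteq> j'" using n n' by auto
        let ?B = "insert i (insert i' (A - {j, j'}))"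
        have "?B = insert i' (insert i (A - {j}) - {j'})" using ne' by auto
        then have "card ?B = ?r"
          using card_move[of i' "insert i (A - {j})" j'] card_move[OF n(2,3)] lad_D[OF less(2)] ne ne' n n' False by auto
        then obtain q where q: "lad E A0 v ?B q" using lad_ex by blast
        have 1: "insert j' (?B - {i'}) = insert i (A - {j})" "insert j (?B - {i}) = insert i' (A - {j'})"
          using ne ne' n n' False by auto
        have "lad E A0 v (insert j' (?B - {i'})) (E j' i' q)"
          by (rule lad.step[OF q n'(1)]) (use ne' False n' in auto)
        then have "n = E j' i' q"
          using less(1)[OF wt_move[OF n(2,3) adjD[OF n(1)]] n(4)] unfolding 1 by blast
        moreover have "lad E A0 v (insert j (?B - {i})) (E j i q)"
          by (rule lad.step[OF q n(1)]) (use ne' False n in auto)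
        then have "n' = E j i q"
          using less(1)[OF wt_move[OF n'(2,3) adjD[OF n'(1)]] n'(4)] unfolding 1 by blast
        moreover have "E j i (E j' i' q) = E j' i' (E j i q)"
          using ne' by (simp add: swap[of j i j' i'])
        ultimately show ?thesis using n n' by simp
      qed
    qed
  qed
  define w where "w A = (THE m. lad E A0 v A m)" for A
  have w: "lad E A0 v A (w A)" if "card A = ?r" for A
    unfolding w_def using lad_ex[OF that] lad_unique by (metis theI)
  have w_eq: "w A = m" if "lad E A0 v A m" for A m
    using w lad_unique that lad_D by blast
  have w_D: "w A \<in> D A" if "card A = ?r" for A using lad_D[OF w[OF that]] by simp
  have w_up: "E j i (w A) = w (insert j (A - {i}))" if "adj i j" "i \<in> A" "j \<notin> A" "card A = ?r" for i j A
    using w_eq[OF lad.step[OF w[OF that(4)] that(1-3)]] by simp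
  have w_down: "E i j (w A) = w (insert i (A - {j}))" if "adj i j" "i \<notin> A" "j \<in> A" "card A = ?r" for i j A
  proof -
    let ?A = "insert i (A - {j})"
    have c: "card ?A = ?r" using card_move[OF that(2,3)] that(4) by simp
    have ij: "i \<in> ?A" "j \<notin> ?A" using that by auto
    have "w A = E j i (w ?A)"
      using w_up[OF that(1) ij c] unfolding move_back[OF that(2,3)] by simp
    then show ?thesis using E_back[OF w_D[OF c] ij(2,1)] by simp
  qed
  define \<theta> where "\<theta> = pext (\<lambda>A c. if card A = ?r then scl c (w A) else 0)"
  have lin: "clin \<theta>" unfolding \<theta>_def
    by (rule clin_pext) (auto simp: clin_def scl_add_left)
  have \<theta>_single: "\<theta> (Poly_Mapping.single A c) = scl c (w A)" if "card A = ?r" for A c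
    unfolding \<theta>_def using that by (subst pext_single) auto
  note \<theta>_simps = clin_simps[OF lin]
  define com where "com i j \<longleftrightarrow> (\<forall>f\<in>LL ?r. \<theta> (EL i j f) = E i j (\<theta> f))" for i j
  have comI: "com i j" if *: "\<And>A c. card A = ?r \<Longrightarrow> \<theta> (EL i j (Poly_Mapping.single A c)) = E i j (scl c (w A))" for i j
    unfolding com_def
  proof
    fix f :: "'n set \<Rightarrow>\<^sub>0 complex" assume "f \<in> LL ?r"
    then have "f \<in> {f. \<theta> (EL i j f) = E i j (\<theta> f)}"
    proof (rule LL_induct)
      show "csub {f. \<theta> (EL i j f) = E i j (\<theta> f)}"
        by (simp add: csub_def \<theta>_simps E_simps EL.E_simps)
    qed (simp add: * \<theta>_single)
    then show "\<theta> (EL i j f) = E i j (\<theta> f)" by simp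
  qed
  have com_diag: "com k k" for k
  proof (rule comI)
    fix A :: "'n set" and c assume A: "card A = ?r"
    have "EL k k (Poly_Mapping.single A c) = (if k \<in> A then Poly_Mapping.single A c else 0)"
      by (rule poly_mapping_eqI) (simp add: lookup_EL_diag lookup_single when_def)
    then show "\<theta> (EL k k (Poly_Mapping.single A c)) = E k k (scl c (w A))"
      using w_D[OF A] A by (simp add: \<theta>_single \<theta>_simps E_simps D_E)
  qed
  have com_adj: "com i j \<and> com j i" if ij: "adj i j" for i j
  proof (intro conjI comI)
    fix A :: "'n set" and c assume A: "card A = ?r"
    have ne: "i \<noteq> j" using adjD[OF ij] by simp
    show "\<theta> (EL i j (Poly_Mapping.single A c)) = E i j (scl c (w A))"
    proof (cases "i \<notin> A \<and> j \<in> A")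
      case True
      then show ?thesis
        using w_down[OF ij _ _ A] card_move[of i A j] A by (simp add: EL_adj[OF ij] \<theta>_single E_simps)
    next
      case False
      then show ?thesis using E_zero[OF w_D[OF A] ne] by (auto simp: EL_adj[OF ij] \<theta>_simps E_simps)
    qed
    show "\<theta> (EL j i (Poly_Mapping.single A c)) = E j i (scl c (w A))"
    proof (cases "j \<notin> A \<and> i \<in> A")
      case True
      then show ?thesis
        using w_up[OF ij _ _ A] card_move[of j A i] A by (simp add: EL_adj[OF ij] \<theta>_single E_simps)
    next
      case False
      then show ?thesis using E_zero[OF w_D[OF A] ne[symmetric]] by (auto simp: EL_adj[OF ij] \<theta>_simps E_simps)
    qed
  qed
  have com_trans: "com i j" if "com i k" "com k j" "i \<noteq> j" for i j k
    unfolding com_def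
  proof
    fix f :: "'n set \<Rightarrow>\<^sub>0 complex" assume f: "f \<in> LL ?r"
    have "EL i j f = EL i k (EL k j f) - EL k j (EL i k f)" using EL.E_bracket[of i k k j f] that(3) by simp
    moreover have "E i j (\<theta> f) = E i k (E k j (\<theta> f)) - E k j (E i k (\<theta> f))"
      using E_bracket[of i k k j "\<theta> f"] that(3) by simp
    ultimately show "\<theta> (EL i j f) = E i j (\<theta> f)"
      using that(1,2) f by (simp add: com_def \<theta>_simps EL_LL)
  qed
  have com_less: "com i j \<and> com j i" if "i < j" for i j
    using that
  proof (induction "card {i<..<j}" arbitrary: i j rule: less_induct)
    case less
    show ?case
    proof (cases "adj i j")
      case False
      with less(2) obtain k where k: "i < k" "k < j" by (auto simp: adj_def)
      have "card {i<..<k} < card {i<..<j}" "card {k<..<j} < card {i<..<j}"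
        using k by (auto intro!: psubset_card_mono)
      from less(1)[OF this(1) k(1)] less(1)[OF this(2) k(2)] less(2) show ?thesis
        using com_trans[of i k j] com_trans[of j k i] by auto
    qed (simp add: com_adj)
  qed
  have com: "com i j" for i j
    using com_less[of i j] com_less[of j i] com_diag[of i] by (cases i j rule: linorder_cases) auto
  have \<theta>_C: "\<theta> f \<in> C" if "f \<in> LL ?r" for f
  proof -
    from that have "f \<in> {f. \<theta> f \<in> C}"
    proof (rule LL_induct)
      show "csub {f. \<theta> f \<in> C}" using csub_vimage[OF lin csub_C csub_UNIV] by simp
    qed (simp add: \<theta>_single csub_scl[OF csub_C] D_C[OF w_D])
    then show ?thesis by simp
  qed
  let ?K = "{f \<in> LL ?r. \<theta> f = 0}"
  have "csub ?K" using csub_vimage[OF lin csub_zero csub_LL] by simp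
  moreover have "EL i j f \<in> ?K" if "f \<in> ?K" for i j f
    using that com[of i j] by (auto simp: com_def EL_LL E_simps)
  ultimately have inv_K: "inv_sub (case_prod EL) ?K" unfolding inv_sub_def by auto
  have "irr (case_prod EL) (LL ?r :: ('n set \<Rightarrow>\<^sub>0 complex) set)" by (rule irr_LL) (simp add: card_mono)
  from irr_cases[OF this _ inv_K] have "?K = {0} \<or> ?K = LL ?r" by blast
  moreover have "w A0 = v" by (rule w_eq) (rule lad.base)
  then have "Poly_Mapping.single A0 1 \<in> LL ?r" "Poly_Mapping.single A0 1 \<notin> ?K"
    using v by (auto simp: single_LL \<theta>_single)
  ultimately have "?K = {0}" by blast
  then have "\<And>f. f \<in> LL ?r \<Longrightarrow> \<theta> f = 0 \<Longrightarrow> f = 0" by blast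
  with lin \<theta>_C com show ?thesis by (intro that[of \<theta>]) (auto simp: com_def)
qed

end

section \<open>Highest weight vectors of weight \<open>\<delta>\<^sub>r\<close>\<close>

text \<open>The space U(n^-) Q generated by lowering operators, as an inductive set, so that ordered
  monomials never appear.\<close>

inductive_set lowspan :: "('n::linorder \<Rightarrow> 'n \<Rightarrow> 'w \<Rightarrow> 'w) \<Rightarrow> 'w::cvs set \<Rightarrow> 'w set" for E Q where
  base: "q \<in> Q \<Longrightarrow> q \<in> lowspan E Q"
| zero: "0 \<in> lowspan E Q"
| add: "u \<in> lowspan E Q \<Longrightarrow> u' \<in> lowspan E Q \<Longrightarrow> u + u' \<in> lowspan E Q"
| scl: "u \<in> lowspan E Q \<Longrightarrow> scl c u \<in> lowspan E Q"
| low: "u \<in> lowspan E Q \<Longrightarrow> j < i \<Longrightarrow> E i j u \<in> lowspan E Q"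

lemma csub_lowspan: "csub (lowspan E Q)"
  by (simp add: csub_def lowspan.intros)

text \<open>Since A0 is a downset, v has the weight (1, ..., 1, 0, ..., 0) with
  \<open>card A0\<close> ones: this is \<delta>_r on the coroots together with trace r, for r =
  \<open>card A0\<close>.\<close>

locale hw_rep = glrep E
  for E :: "'n::{finite,linorder} \<Rightarrow> 'n \<Rightarrow> 'w::cvs \<Rightarrow> 'w" +
  fixes C :: "'w set" and A0 :: "'n set" and v :: 'w
  assumes irr_C: "irr (case_prod E) C" and v_C: "v \<in> C" and v_nonzero: "v \<noteq> 0"
    and downset: "downset A0"
    and v_raise: "i < j \<Longrightarrow> E i j v = 0"
    and v_weight: "E k k v = (if k \<in> A0 then v else 0)"
begin

lemma inv_C: "inv_sub (case_prod E) C" and E_C: "m \<in> C \<Longrightarrow> E i j m \<in> C" and csub_C: "csub C"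
  using irr_C by (auto simp: irr_def inv_sub_def)

lemma swap: "E i j (E k l m) = E k l (E i j m) + (if j = k then E i l m else 0) - (if l = i then E k j m else 0)"
  using E_bracket[of i j k l m] by (simp add: algebra_simps)

text \<open>Commuting E_ij past a lowering operator leaves terms in which a matrix unit acts
  directly on the shorter vector u. The induction covers all i, j at once and so handles
  them.\<close>

lemma lowspan_inv:
  assumes stable: "\<And>q i j. q \<in> Q \<Longrightarrow> i \<le> j \<Longrightarrow> E i j q \<in> lowspan E Q"
  shows "u \<in> lowspan E Q \<Longrightarrow> E i j u \<in> lowspan E Q"
proof (induction arbitrary: i j rule: lowspan.induct)
  case (base q)
  show ?case
  proof (cases "i \<le> j")
    case True
    with stable base show ?thesis by blast
  next
    case False
    with base show ?thesis by (intro lowspan.low lowspan.base) auto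
  qed
next
  case (low u b a)
  then show ?case
    unfolding swap[of i j a b]
    by (intro csub_add[OF csub_lowspan] csub_diff[OF csub_lowspan]) (auto intro: lowspan.intros)
qed (auto simp: E_simps intro: lowspan.intros)

section \<open>A grading operator in place of weight spaces\<close>

definition h :: "'n \<Rightarrow> complex" where
  "h i = of_nat (card {..<i})"

text \<open>An element of the diagonal subalgebra for which E_ij shifts eigenvalues by the
  difference of the positions of i and j. Every lowering operator thus strictly increases the
  eigenvalue.\<close>

definition H :: "'w \<Rightarrow> 'w" where
  "H m = (\<Sum>k\<in>UNIV. scl (h k) (E k k m))"

lemma clin_H: "clin H"
  unfolding H_def by (intro clin_sumf clin_scale clin_E)

lemmas H_simps = clin_simps[OF clin_H]

lemma sum_delta_scl: "(\<Sum>k\<in>UNIV. scl (h k) (if k = a then x else 0)) = scl (h a) (x :: 'w)"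
  "(\<Sum>k\<in>UNIV. scl (h k) (if a = k then x else 0)) = scl (h a) (x :: 'w)"
  by (simp_all add: if_distrib[of "scl _"] cong: if_cong)

lemma H_E: "H (E i j m) = E i j (H m) + scl (h i - h j) (E i j m)"
proof -
  have "H (E i j m) = (\<Sum>k\<in>UNIV. scl (h k) (E i j (E k k m)) +
      scl (h k) (if k = i then E i j m else 0) - scl (h k) (if j = k then E i j m else 0))"
    unfolding H_def
    by (rule sum.cong) (auto simp: swap[of _ _ i j] scl_add_right cvs.scale_right_diff_distrib)
  then show ?thesis
    by (simp only: sum.distrib sum_subtractf sum_delta_scl)
      (simp add: H_def E_simps cvs.scale_left_diff_distrib)
qed

definition h0 :: complex where
  "h0 = (\<Sum>k\<in>A0. h k)"

lemma H_v: "H v = scl h0 v"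
proof -
  have "H v = (\<Sum>k\<in>UNIV. if k \<in> A0 then scl (h k) v else 0)"
    unfolding H_def by (rule sum.cong) (auto simp: v_weight)
  then show ?thesis by (simp add: sum.If_cases h0_def cvs.scale_sum_left)
qed

definition foldH :: "nat list \<Rightarrow> 'w \<Rightarrow> 'w" where
  "foldH = foldr (\<lambda>p x. H x - scl (h0 + of_nat p) x)"

lemma foldH_Nil [simp]: "foldH [] u = u"
  and foldH_Cons [simp]: "foldH (p # ps) u = H (foldH ps u) - scl (h0 + of_nat p) (foldH ps u)"
  and foldH_append: "foldH (ps @ qs) u = foldH ps (foldH qs u)"
  by (simp_all add: foldH_def)

lemma clin_foldH: "clin (foldH ps)"
proof (induction ps)
  case Nil
  then show ?case by (simp add: foldH_def clin_id id_def)
next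
  case (Cons p ps)
  have "foldH (p # ps) = (\<lambda>u. H (foldH ps u) - scl (h0 + of_nat p) (foldH ps u))"
    by (intro ext) simp
  then show ?case using clin_sub[OF clin_comp[OF clin_H Cons] clin_scale[OF Cons]] by simp
qed

lemma foldH_H: "foldH ps (H u) = H (foldH ps u)"
  by (induction ps) (simp_all add: H_simps)

lemma foldH_commute: "foldH ps (foldH qs u) = foldH qs (foldH ps u)"
  by (induction ps) (simp_all add: clin_simps[OF clin_foldH] foldH_H)

text \<open>Vectors whose H-eigenvalues all lie strictly above that of v, expressed by annihilating
  products of H - h0 - p with p > 0. This avoids decomposing a vector into weight
  components.\<close>

definition Z :: "'w set" where
  "Z = {u. \<exists>ps. (\<forall>p\<in>set ps. p \<ge> 1) \<and> foldH ps u = 0}"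

lemma lowspan_Z:
  assumes Q: "\<And>q. q \<in> Q \<Longrightarrow> \<exists>p\<ge>1. H q = scl (h0 + of_nat p) q"
  shows "u \<in> lowspan E Q \<Longrightarrow> u \<in> Z"
proof (induction rule: lowspan.induct)
  case (base q)
  then obtain p :: nat where "p \<ge> 1" "H q = scl (h0 + of_nat p) q" using Q by blast
  then show ?case unfolding Z_def by (intro CollectI exI[of _ "[p]"]) simp
next
  case zero
  show ?case unfolding Z_def by (intro CollectI exI[of _ "[]"]) simp
next
  case (add u u')
  then obtain ps qs where ps: "\<forall>p\<in>set ps. p \<ge> 1" "foldH ps u = 0"
    and qs: "\<forall>p\<in>set qs. p \<ge> 1" "foldH qs u' = 0" by (auto simp: Z_def)
  have "foldH (ps @ qs) (u + u') = 0"
    by (simp add: foldH_append clin_simps[OF clin_foldH] foldH_commute[of ps qs] ps qs)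
  with ps qs show ?case unfolding Z_def by (intro CollectI exI[of _ "ps @ qs"]) auto
next
  case (scl u c)
  then obtain ps where "\<forall>p\<in>set ps. p \<ge> 1" "foldH ps u = 0" by (auto simp: Z_def)
  then show ?case unfolding Z_def
    by (intro CollectI exI[of _ ps]) (simp add: clin_simps[OF clin_foldH])
next
  case (low u j i)
  then obtain ps where ps: "\<forall>p\<in>set ps. p \<ge> 1" "foldH ps u = 0" by (auto simp: Z_def)
  \<comment> \<open>E_ij turns H into H + d with d > 0, so adding d to every entry of the
    annihilating list gives an annihilating list for the lowered vector.\<close>
  define d where "d = card {..<i} - card {..<j}"
  have d: "h i - h j = of_nat d"
    using card_lessThan_less[OF low(2)] by (simp add: h_def d_def of_nat_diff)
  have "foldH (map (\<lambda>p. p + d) ps) (E i j u) = E i j (foldH ps u)"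
    by (induction ps) (simp_all add: H_E d E_simps scl_add_left algebra_simps)
  with ps have "foldH (map (\<lambda>p. p + d) ps) (E i j u) = 0" by (simp add: E_simps)
  with ps show ?case unfolding Z_def by (intro CollectI exI[of _ "map (\<lambda>p. p + d) ps"]) auto
qed

text \<open>On v each factor H - h0 - p acts by the nonzero number -p.\<close>

lemma v_not_Z: "v \<notin> Z"
proof -
  have "foldH ps v = scl (\<Prod>p\<leftarrow>ps. - of_nat p) v" for ps
    by (induction ps)
      (simp_all add: H_simps H_v mult.commute cvs.scale_left_diff_distrib[symmetric] algebra_simps)
  moreover have "(\<Prod>p\<leftarrow>ps. - of_nat p :: complex) \<noteq> 0" if "\<forall>p\<in>set ps. p \<ge> 1" for ps
    using that by (induction ps) auto
  ultimately show ?thesis using v_nonzero by (auto simp: Z_def)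
qed

text \<open>The lowering span of Q is a submodule, and the grading keeps v out of it; in an
  irreducible module it is therefore zero. Stability of Q under raising operators is only asked up
  to that span, so a whole family of vectors can be treated together.\<close>

lemma hw_vanish:
  assumes "Q \<subseteq> C" "\<And>q i j. q \<in> Q \<Longrightarrow> i \<le> j \<Longrightarrow> E i j q \<in> lowspan E Q"
    "\<And>q. q \<in> Q \<Longrightarrow> \<exists>p\<ge>1. H q = scl (h0 + of_nat p) q" "q \<in> Q"
  shows "q = 0"
proof -
  have "u \<in> C" if "u \<in> lowspan E Q" for u
    using that by induction (use assms(1) csub_C E_C in \<open>auto simp: csub_0 csub_add csub_scl\<close>)
  then have "lowspan E Q \<subseteq> C" by blast
  moreover have "inv_sub (case_prod E) (lowspan E Q)"
    unfolding inv_sub_def using csub_lowspan lowspan_inv[OF assms(2)] by auto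
  moreover have "lowspan E Q \<noteq> C" using lowspan_Z[OF assms(3)] v_not_Z v_C by blast
  ultimately have "lowspan E Q = {0}" using irr_cases[OF irr_C] by blast
  then show ?thesis using lowspan.base[OF assms(4), of E] by blast
qed

text \<open>The weight of v is constant on A0 and on its complement, so v should generate a trivial
  module for each of the two diagonal blocks. The vectors E_ij v of both blocks are taken as one
  family Q, because a raising operator turns one of them into others.\<close>

lemma E_v_same:
  assumes "j < i" "i \<in> A0 \<longleftrightarrow> j \<in> A0"
  shows "E i j v = 0"
proof (rule hw_vanish[where Q = "{E i j v | i j. j < i \<and> (i \<in> A0 \<longleftrightarrow> j \<in> A0)}"])
  let ?Q = "{E i j v | i j. j < i \<and> (i \<in> A0 \<longleftrightarrow> j \<in> A0)}"
  show "?Q \<subseteq> C" using E_C v_C by auto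
  show "\<exists>p\<ge>1. H q = scl (h0 + of_nat p) q" if "q \<in> ?Q" for q
  proof -
    from that obtain i j where q: "q = E i j v" "j < i" by blast
    have "h i - h j = of_nat (card {..<i} - card {..<j})"
      using card_lessThan_less[OF q(2)] by (simp add: h_def of_nat_diff)
    then have "H q = scl (h0 + of_nat (card {..<i} - card {..<j})) q"
      by (simp add: q(1) H_E H_v E_simps scl_add_left)
    then show ?thesis using card_lessThan_less[OF q(2)]
      by (intro exI[of _ "card {..<i} - card {..<j}"]) simp
  qed
  show "E a b q \<in> lowspan E ?Q" if "q \<in> ?Q" "a \<le> b" for q a b
  proof -
    from that obtain i j where q: "q = E i j v" "j < i" "i \<in> A0 \<longleftrightarrow> j \<in> A0" by blast
    \<comment> \<open>A downset and its complement are intervals, so the indices between j and i lie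
      on the same side of A0 as the two ends.\<close>
    have same: "k \<in> A0 \<longleftrightarrow> j \<in> A0" if "j \<le> k" "k \<le> i" for k
      using downset q(3) that unfolding downset_def by (metis order.not_eq_order_implies_strict)
    have in_Q: "E a b v \<in> lowspan E ?Q" if "b < a" "a \<in> A0 \<longleftrightarrow> b \<in> A0" for a b
      using that by (intro lowspan.base) blast
    have 1: "E i j (E a b v) \<in> lowspan E ?Q"
      using that(2) in_Q[OF q(2,3)] v_raise[of a b] v_weight[of a]
      by (cases "a = b") (auto simp: E_simps lowspan.zero)
    have 2: "E a j v \<in> lowspan E ?Q" if "b = i" "a \<noteq> j"
      using \<open>a \<le> b\<close> that in_Q[of j a] v_raise[of a j] same[of a] by (cases a j rule: linorder_cases) (auto simp: lowspan.zero)
    have 3: "E i b v \<in> lowspan E ?Q" if "a = j" "b \<noteq> i"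
      using \<open>a \<le> b\<close> that in_Q[of b i] v_raise[of i b] same[of b] q(3) by (cases i b rule: linorder_cases) (auto simp: lowspan.zero)
    show ?thesis
    proof (cases "b = i \<and> a = j")
      case True
      then show ?thesis unfolding q(1) swap[of a b i j]
        using 1 q(3) by (simp add: v_weight)
    next
      case False
      then show ?thesis unfolding q(1) swap[of a b i j]
        using 1 2 3 by (auto intro!: csub_add[OF csub_lowspan] csub_diff[OF csub_lowspan] simp: lowspan.zero)
    qed
  qed
  show "E i j v \<in> ?Q" using assms by blast
qed

lemma A0_less: "j \<in> A0 \<Longrightarrow> i \<notin> A0 \<Longrightarrow> j < i"
  using downset unfolding downset_def by (metis linorder_neqE)

lemma E_v: "i \<in> A0 \<or> j \<notin> A0 \<Longrightarrow> E i j v = (if i = j \<and> j \<in> A0 then v else 0)"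
proof (cases i j rule: linorder_cases)
  case greater
  assume "i \<in> A0 \<or> j \<notin> A0"
  then have "i \<in> A0 \<longleftrightarrow> j \<in> A0" using A0_less[of i j] greater by (auto dest: order.asym)
  with greater show ?thesis using E_v_same[of j i] by (auto dest: less_imp_neq)
qed (auto simp: v_raise v_weight dest: less_imp_neq)

lemma TT_sym: "TT i l j k m = TT l i j k m"
  by (simp add: TT_def algebra_simps)

text \<open>By \<open>E_v\<close>, apart from the diagonal units only E_ij with i outside A0 and j
  inside A0 can act nontrivially on v. Outside the excluded index pattern the linear terms of TT
  then cancel the quadratic ones, or all terms vanish.\<close>

lemma TT_v_zero: "\<not> (i \<notin> A0 \<and> l \<notin> A0 \<and> j \<in> A0 \<and> k \<in> A0) \<Longrightarrow> TT i l j k v = 0"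
proof -
  have A: "TT i l j k v = 0" if "k \<notin> A0" for i l j k
    using that by (simp add: TT_def E_v E_simps)
  have B: "TT i l j k v = 0" if "k \<in> A0" "i \<in> A0" for i l j k
  proof (cases "l \<in> A0")
    case True
    then show ?thesis using that by (auto simp: TT_def E_v E_simps)
  next
    case False
    then show ?thesis using that by (auto simp: TT_def swap[of i j l k] E_v E_simps)
  qed
  have C: "TT i l j k v = 0" if "k \<in> A0" "i \<notin> A0" "l \<notin> A0" "j \<notin> A0" for i l j k
    using that by (auto simp: TT_def swap[of i j l k] swap[of l j i k] E_v E_simps)
  assume "\<not> (i \<notin> A0 \<and> l \<notin> A0 \<and> j \<in> A0 \<and> k \<in> A0)"
  then consider "k \<notin> A0" | "k \<in> A0" "i \<in> A0" | "k \<in> A0" "l \<in> A0" |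
    "k \<in> A0" "i \<notin> A0" "l \<notin> A0" "j \<notin> A0" by blast
  then show ?thesis
  proof cases
    case 3
    then show ?thesis unfolding TT_sym[of i l] by (rule B)
  qed (fact A B C)+
qed

lemma H_TT: "H (TT i l j k m) = TT i l j k (H m) + scl (h i + h l - h j - h k) (TT i l j k m)"
proof -
  have "H (TT i l j k m) = (\<Sum>a\<in>UNIV. scl (h a) (TT i l j k (E a a m))
      + scl (h a) (if a = i then TT i l j k m else 0) + scl (h a) (if a = l then TT i l j k m else 0)
      - scl (h a) (if a = j then TT i l j k m else 0) - scl (h a) (if a = k then TT i l j k m else 0))"
    unfolding H_def TT_equivariant
    by (rule sum.cong) (auto simp: scl_add_right cvs.scale_right_diff_distrib)
  then show ?thesis
    by (simp only: sum.distrib sum_subtractf sum_delta_scl)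
      (simp add: H_def clin_simps[OF clin_TT] scl_add_left cvs.scale_left_diff_distrib)
qed

text \<open>The vectors left over have strictly larger H-eigenvalue than v, since each index outside
  A0 lies above each index inside. By equivariance of TT raising operators permute them up to
  vectors already known to vanish, so \<open>hw_vanish\<close> applies.\<close>

lemma TT_v: "TT i l j k v = 0"
proof (cases "i \<notin> A0 \<and> l \<notin> A0 \<and> j \<in> A0 \<and> k \<in> A0")
  case True
  let ?Q = "{TT i l j k v | i l j k. i \<notin> A0 \<and> l \<notin> A0 \<and> j \<in> A0 \<and> k \<in> A0}"
  show ?thesis
  proof (rule hw_vanish[where Q = ?Q])
    show "?Q \<subseteq> C" using TT_in[OF inv_C v_C] by auto
    show "\<exists>p\<ge>1. H q = scl (h0 + of_nat p) q" if "q \<in> ?Q" for q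
    proof -
      from that obtain i l j k where q: "q = TT i l j k v" "i \<notin> A0" "l \<notin> A0" "j \<in> A0" "k \<in> A0" by blast
      note less = card_lessThan_less[OF A0_less[OF q(4,2)]] card_lessThan_less[OF A0_less[OF q(5,3)]]
      let ?p = "(card {..<i} - card {..<j}) + (card {..<l} - card {..<k})"
      have "h i + h l - h j - h k = of_nat ?p"
        using less by (simp add: h_def of_nat_diff)
      then have "H q = scl (h0 + of_nat ?p) q"
        by (simp only: q(1) H_TT H_v clin_simps[OF clin_TT] scl_add_left)
      then show ?thesis using less by (intro exI[of _ ?p]) simp
    qed
    have in_Q: "TT i l j k v \<in> lowspan E ?Q" for i l j k
    proof (cases "i \<notin> A0 \<and> l \<notin> A0 \<and> j \<in> A0 \<and> k \<in> A0")
      case True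
      then show ?thesis by (intro lowspan.base) blast
    qed (simp add: TT_v_zero lowspan.zero)
    show "E a b q \<in> lowspan E ?Q" if "q \<in> ?Q" "a \<le> b" for q a b
    proof -
      from that obtain i l j k where q: "q = TT i l j k v" by blast
      have "TT i l j k (E a b v) \<in> lowspan E ?Q"
        using that(2) v_raise[of a b] v_weight[of a] in_Q
        by (cases "a = b") (auto simp: clin_simps[OF clin_TT] lowspan.zero)
      then show ?thesis unfolding q TT_equivariant
        by (intro csub_add[OF csub_lowspan] csub_diff[OF csub_lowspan]) (auto simp: in_Q lowspan.zero)
    qed
    show "TT i l j k v \<in> ?Q" using True by blast
  qed
qed (rule TT_v_zero)

lemma TT_C: "m \<in> C \<Longrightarrow> TT i l j k m = 0"
proof -
  have "{m \<in> C. \<forall>i l j k. TT i l j k m = 0} = C"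
    using irr_cases[OF irr_C _ ker_TT_inv[OF inv_C]] v_C v_nonzero TT_v by blast
  then show "m \<in> C \<Longrightarrow> TT i l j k m = 0" by blast
qed

end

section \<open>Classification of the quotients\<close>

lemma (in vfrep) classify:
  fixes V :: "'v set"
  assumes V: "irr A V" "K0 V = {0}" "K1 V \<noteq> {0}"
  shows "(\<exists>i l j k. \<exists>m\<in>K1 V. glrep.TT EV i l j k m \<noteq> 0) \<and> irr (case_prod EV) (K1 V) \<and>
      (\<exists>\<psi>. clin \<psi> \<and> (\<forall>g\<in>coeffs (K1 V). \<psi> g = 0 \<longleftrightarrow> g = 0) \<and> \<psi> ` coeffs (K1 V) = V \<and>
        (\<forall>f. \<forall>g\<in>coeffs (K1 V). \<psi> (X EV f g) = A f (\<psi> g))) \<or>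
    (\<forall>i l j k. \<forall>m\<in>K1 V. glrep.TT EV i l j k m = 0)"
proof -
  interpret EV: glrep EV by (rule glrep_EV)
  have inv: "inv_sub (case_prod EV) (K1 V)" using V by (intro K1_inv) (simp add: irr_def)
  show ?thesis
  proof (cases "\<forall>i l j k. \<forall>m\<in>K1 V. EV.TT i l j k m = 0")
    case False
    then obtain i l j k m where m: "m \<in> K1 V" "EV.TT i l j k m \<noteq> 0" by blast
    interpret vhom A EV "K1 V" V "\<lambda>v. v"
      by unfold_locales (use V inv in \<open>auto simp: clin_id EV_def K1_def\<close>)
    note t = tensor_case[OF m]
    have "\<forall>g\<in>coeffs (K1 V). \<Psi> g = 0 \<longleftrightarrow> g = 0" using t(1) by (auto simp: Ker_def \<Psi>_simps)
    with m t(2) clin_\<Psi> \<Psi>_onto \<Psi>_hom show ?thesis by blast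
  qed simp
qed

lemma classify_ext:
  fixes A :: "('n::{finite,linorder} \<Rightarrow> 'n mpol) \<Rightarrow> 'v::cvs \<Rightarrow> 'v" and V :: "'v set"
  assumes "vfrep A"
  assumes V: "irr A V" "vfrep.K0 A V = {0}" "vfrep.K1 A V \<noteq> {0}"
    and TT: "\<And>i l j k m. m \<in> vfrep.K1 A V \<Longrightarrow> glrep.TT (vfrep.EV A) i l j k m = 0"
  obtains r and \<psi> :: "(('n \<Rightarrow>\<^sub>0 nat) \<Rightarrow>\<^sub>0 'n set \<Rightarrow>\<^sub>0 complex) \<Rightarrow> 'v"
  where "r < CARD('n)" "clin \<psi>" "\<psi> ` coeffs (LL r) = V"
    "\<And>g. g \<in> coeffs (LL r) \<Longrightarrow> \<psi> g = 0 \<longleftrightarrow> dext g = 0"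
    "\<And>f g. g \<in> coeffs (LL r) \<Longrightarrow> \<psi> (X EL f g) = A f (\<psi> g)"
proof -
  interpret vfrep A by fact
  interpret EV: glrep EV by (rule glrep_EV)
  have inv: "inv_sub (case_prod EV) (K1 V)" using V by (intro K1_inv) (simp add: irr_def)
  interpret tt: tt_rep EV "K1 V" by unfold_locales (use V inv TT in auto)
  obtain A0 v where v: "v \<in> tt.D A0" "v \<noteq> 0" "downset A0" by (rule tt.hw_weight)
  define r where "r = card A0"
  obtain \<theta> where \<theta>: "clin \<theta>" "\<And>f. f \<in> LL r \<Longrightarrow> \<theta> f \<in> K1 V"
    "\<And>f i j. f \<in> LL r \<Longrightarrow> \<theta> (EL i j f) = EV i j (\<theta> f)"
    "\<And>f. f \<in> LL r \<Longrightarrow> \<theta> f = 0 \<Longrightarrow> f = 0"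
    unfolding r_def by (rule tt.intertwiner[OF v]) blast
  \<comment> \<open>If all weight entries were 1, undoing the trace twist would make every t_i
    \<partial>_j kill v. Then v would lie in \<open>K0 V\<close>, which is zero.\<close>
  have "A0 \<noteq> UNIV"
  proof
    assume UNIV: "A0 = UNIV"
    have vK: "v \<in> K1 V" using v(1) by (rule tt.D_C)
    have EVv: "EV i j v = (if i = j then v else 0)" for i j
      using tt.D_E[OF v(1), of i] tt.E_zero[OF v(1), of i j] UNIV by auto
    have "A1 (tvar i) j v = 0" for i j
      using EVv[of i j] by (auto simp: EV_def split: if_splits)
    then have "A1 (mon \<alpha>) j v = 0" if "deg \<alpha> \<ge> 1" for \<alpha> j
      using that vK deg_1[of \<alpha>] by (cases "deg \<alpha> = 1") (auto simp: K1_def)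
    then have "v \<in> K0 V" using vK by (auto simp: K0_def K1_def)
    with V(2) v(2) show False by blast
  qed
  then have "card A0 < card (UNIV :: 'n set)" by (intro psubset_card_mono) auto
  then have r: "r < CARD('n)" by (simp add: r_def)
  have LL_ne: "(LL r :: ('n set \<Rightarrow>\<^sub>0 complex) set) \<noteq> {0}"
    using irr_LL[of r, where 'n = 'n] r by (simp add: irr_def)
  interpret glrep "EL :: 'n \<Rightarrow> _" by (rule EL.glrep_axioms)
  interpret vhom A "EL :: 'n \<Rightarrow> _" "LL r" V \<theta>
  proof
    show "inv_sub (case_prod EL) (LL r)" by (rule inv_LL)
    show "(LL r :: ('n set \<Rightarrow>\<^sub>0 complex) set) \<noteq> {0}" by fact
    show "irr A V" by fact
    show "clin \<theta>" by fact
  qed (use \<theta> in \<open>auto simp: EV_def K1_def\<close>)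
  let ?K = "{g \<in> coeffs (LL r). dext g = 0} :: (('n \<Rightarrow>\<^sub>0 nat) \<Rightarrow>\<^sub>0 'n set \<Rightarrow>\<^sub>0 complex) set"
  obtain w :: "'n set \<Rightarrow>\<^sub>0 complex" where w: "w \<in> LL r" "w \<noteq> 0" using LL_ne csub_0[OF csub_LL] by blast
  obtain k where k: "cr k w \<noteq> 0" using dext_bottom_nonzero[OF w r] by blast
  \<comment> \<open>The bottom coefficient of a closed g is killed by \<open>cr k\<close>, whereas w
    is not. So \<open>not_onto\<close> applies to the submodule of closed elements and puts it into
    the kernel.\<close>
  have "Poly_Mapping.lookup g 0 \<noteq> w" if "g \<in> ?K" for g
  proof
    assume "Poly_Mapping.lookup g 0 = w"
    with dext_lookup_e1[of g k] that k show False by simp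
  qed
  then have "\<Psi> ` ?K = {0}"
    by (intro not_onto[OF EL_trace _ inv_ker_dext w(1)]) auto
  then have K: "?K \<subseteq> Ker" by (auto simp: Ker_def)
  \<comment> \<open>Conversely, a kernel element that is not closed would bring a bottom vector into
    the kernel.\<close>
  have "dext g = 0" if g: "g \<in> Ker" for g
  proof (rule ccontr)
    assume "dext g \<noteq> 0"
    then obtain w' where w': "w' \<in> LL r" "w' \<noteq> 0" "Poly_Mapping.single 0 w' \<in> Ker"
      using dext_lowers[OF inv_Ker K _ g] by (auto simp: Ker_def)
    with Ker_bottom show False by blast
  qed
  then have "\<Psi> g = 0 \<longleftrightarrow> dext g = 0" if "g \<in> coeffs (LL r)" for g
    using K that by (auto simp: Ker_def)
  with that[OF r clin_\<Psi> \<Psi>_onto _ \<Psi>_hom] show ?thesis by blast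
qed

text \<open>Two equivariant surjections from one space with equal kernels have isomorphic images. A
  simple V can so be compared with the image of \<open>dext\<close>, a subspace of a type, instead
  of with a quotient.\<close>

lemma surj_same_kernel:
  assumes G: "csub G" and p: "clin p" "p ` G = V1" and q: "clin q" "q ` G = V2"
    and ker: "\<And>g. g \<in> G \<Longrightarrow> p g = 0 \<longleftrightarrow> q g = 0"
    and x: "\<And>x g. g \<in> G \<Longrightarrow> Y x g \<in> G \<and> p (Y x g) = a1 x (p g) \<and> q (Y x g) = a2 x (q g)"
  obtains \<phi> where "bij_betw \<phi> V1 V2" "\<And>u v. u \<in> V1 \<Longrightarrow> v \<in> V1 \<Longrightarrow> \<phi> (u + v) = \<phi> u + \<phi> v"
    "\<And>c v. v \<in> V1 \<Longrightarrow> \<phi> (scl c v) = scl c (\<phi> v)" "\<And>x v. v \<in> V1 \<Longrightarrow> \<phi> (a1 x v) = a2 x (\<phi> v)"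
    "\<phi> 0 = 0"
proof -
  define \<phi> where "\<phi> u = q (SOME g. g \<in> G \<and> p g = u)" for u
  have *: "\<phi> (p g) = q g" if g: "g \<in> G" for g
  proof -
    let ?g = "SOME g'. g' \<in> G \<and> p g' = p g"
    have "?g \<in> G \<and> p ?g = p g" by (rule someI[where x = g]) (simp add: g)
    then have "?g - g \<in> G" "p (?g - g) = 0" using g G p(1) by (auto simp: clin_diff csub_diff)
    then have "q ?g - q g = 0" using ker q(1) by (metis clin_diff)
    then show ?thesis by (simp add: \<phi>_def)
  qed
  have "inj_on \<phi> V1"
  proof (rule inj_onI)
    fix u v assume "u \<in> V1" "v \<in> V1" and eq: "\<phi> u = \<phi> v"
    then obtain g h where g: "g \<in> G" "u = p g" and h: "h \<in> G" "v = p h" using p(2) by blast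
    then have "q (g - h) = 0" using eq * q(1) by (simp add: clin_diff)
    then have "p (g - h) = 0" using ker[OF csub_diff[OF G g(1) h(1)]] by simp
    then show "u = v" using g h p(1) by (simp add: clin_diff)
  qed
  moreover have "\<phi> ` V1 = V2" using * p(2) q(2) by (force simp: image_iff)
  ultimately have "bij_betw \<phi> V1 V2" by (simp add: bij_betw_def)
  moreover have "\<phi> (u + v) = \<phi> u + \<phi> v" if uv: "u \<in> V1" "v \<in> V1" for u v
  proof -
    obtain g h where g: "g \<in> G" "u = p g" and h: "h \<in> G" "v = p h" using uv p(2) by blast
    then show ?thesis
      using *[OF csub_add[OF G g(1) h(1)]] p(1) q(1) by (simp add: clin_add *)
  qed
  moreover have "\<phi> (scl c v) = scl c (\<phi> v)" if vV1: "v \<in> V1" for c v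
  proof -
    obtain g where g: "g \<in> G" "v = p g" using vV1 p(2) by blast
    then show ?thesis using *[OF csub_scl[OF G g(1), of c]] p(1) q(1) by (simp add: clin_scl *)
  qed
  moreover have "\<phi> (a1 x v) = a2 x (\<phi> v)" if vV1: "v \<in> V1" for x v
  proof -
    obtain g where g: "g \<in> G" "v = p g" using vV1 p(2) by blast
    then show ?thesis using x[OF g(1), of x] * by metis
  qed
  moreover have "\<phi> 0 = 0" using *[OF csub_0[OF G]] p(1) q(1) by (simp add: clin_0)
  ultimately show ?thesis using that by blast
qed

section \<open>Models of representations\<close>

lemma complex_ring_simps [simp]: "carrier complex_ring = UNIV" "\<zero>\<^bsub>complex_ring\<^esub> = 0"
  "\<one>\<^bsub>complex_ring\<^esub> = 1" "x \<oplus>\<^bsub>complex_ring\<^esub> y = x + y" "x \<otimes>\<^bsub>complex_ring\<^esub> y = x * y"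
  by (simp_all add: complex_ring_def)

lemma field_complex_ring: "field complex_ring"
proof -
  have "cring complex_ring"
    by (rule cringI, rule abelian_groupI, auto intro!: comm_monoidI simp: algebra_simps)
      (metis add.right_inverse)+
  then show ?thesis
    by (rule cring.cring_fieldI2) (auto intro: right_inverse)
qed

lemmas vs_criteria_complex = vs_criteria[OF field_complex_ring, simplified]

text \<open>The bridge between a module with a carrier and a subspace C of a vector space type, on
  which x acts by \<open>a x\<close>. The set S of acting elements varies: derivations, matrices,
  fields together with multiplications, or nothing when only the linear structure matters.\<close>

locale model =
  fixes S :: "'x set" and V :: "('x, 'v) rep" and f :: "'v \<Rightarrow> 'w::cvs" and C :: "'w set"
    and a :: "'x \<Rightarrow> 'w \<Rightarrow> 'w"
  assumes csub_C: "csub C" and bij: "bij_betw f (carrier V) C"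
    and zero_in: "\<zero>\<^bsub>V\<^esub> \<in> carrier V" and f_zero: "f \<zero>\<^bsub>V\<^esub> = 0"
    and add_in: "\<lbrakk>u \<in> carrier V; v \<in> carrier V\<rbrakk> \<Longrightarrow> u \<oplus>\<^bsub>V\<^esub> v \<in> carrier V"
    and f_add: "\<lbrakk>u \<in> carrier V; v \<in> carrier V\<rbrakk> \<Longrightarrow> f (u \<oplus>\<^bsub>V\<^esub> v) = f u + f v"
    and smult_in: "v \<in> carrier V \<Longrightarrow> c \<odot>\<^bsub>V\<^esub> v \<in> carrier V"
    and f_smult: "v \<in> carrier V \<Longrightarrow> f (c \<odot>\<^bsub>V\<^esub> v) = scl c (f v)"
    and act_in: "\<lbrakk>x \<in> S; v \<in> carrier V\<rbrakk> \<Longrightarrow> act V x v \<in> carrier V"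
    and f_act: "\<lbrakk>x \<in> S; v \<in> carrier V\<rbrakk> \<Longrightarrow> f (act V x v) = a x (f v)"
begin

lemma f_inj: "u \<in> carrier V \<Longrightarrow> v \<in> carrier V \<Longrightarrow> f u = f v \<longleftrightarrow> u = v"
  using bij by (auto simp: bij_betw_def inj_on_def)

lemma f_in: "v \<in> carrier V \<Longrightarrow> f v \<in> C"
  using bij by (auto simp: bij_betw_def)

lemma f_ex: "w \<in> C \<Longrightarrow> \<exists>v\<in>carrier V. f v = w"
  using bij by (auto simp: bij_betw_def)

lemma f_image: "f ` carrier V = C"
  using bij by (simp add: bij_betw_def)

lemma vectorspace: "vectorspace complex_ring V"
proof (rule vs_criteria_complex)
  show "\<forall>v\<in>carrier V. \<exists>neg_v\<in>carrier V. v \<oplus>\<^bsub>V\<^esub> neg_v = \<zero>\<^bsub>V\<^esub>"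
  proof
    fix v assume v: "v \<in> carrier V"
    then obtain u where u: "u \<in> carrier V" "f u = - f v" using f_ex[of "- f v"] f_in csub_minus[OF csub_C] by blast
    then have "f (v \<oplus>\<^bsub>V\<^esub> u) = f \<zero>\<^bsub>V\<^esub>" using v by (simp add: f_add f_zero)
    then show "\<exists>neg_v\<in>carrier V. v \<oplus>\<^bsub>V\<^esub> neg_v = \<zero>\<^bsub>V\<^esub>"
      using u v f_inj[OF add_in[OF v u(1)] zero_in] by blast
  qed
qed (auto simp: zero_in add_in smult_in f_add f_smult f_zero f_inj[symmetric] scl_add_right scl_add_left
    algebra_simps)

sublocale vs: vectorspace complex_ring V
  by (rule vectorspace)

lemma abelian_group: "abelian_group V"
  by (rule vs.M.abelian_group_axioms)

lemma f_minus: "u \<in> carrier V \<Longrightarrow> v \<in> carrier V \<Longrightarrow> f (u \<ominus>\<^bsub>V\<^esub> v) = f u - f v"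
proof -
  assume u: "u \<in> carrier V" and v: "v \<in> carrier V"
  have "f v + f (\<ominus>\<^bsub>V\<^esub> v) = 0" using v f_add[of v "\<ominus>\<^bsub>V\<^esub> v"] by (simp add: vs.M.r_neg f_zero)
  then show ?thesis using u v by (simp add: a_minus_def f_add eq_neg_iff_add_eq_0[symmetric] add.commute)
qed

lemma subspace_iff: "subspace complex_ring N V \<longleftrightarrow> N \<subseteq> carrier V \<and> csub (f ` N)"
proof
  assume "subspace complex_ring N V"
  then have N: "submodule complex_ring N V" by (simp add: subspace_def)
  then have sub: "N \<subseteq> carrier V" by (rule submodule.subset)
  have "0 \<in> f ` N" using submodule.zero_closed[OF N] f_zero by (metis imageI)
  moreover have "f u + f v \<in> f ` N" if "u \<in> N" "v \<in> N" for u v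
    using submodule.m_closed[OF N that] f_add[of u v] that sub by (metis imageI subsetD)
  moreover have "scl c (f u) \<in> f ` N" if "u \<in> N" for u c
    using submodule.smult_closed[OF N _ that, of c] f_smult[of u c] that sub by (metis complex_ring_simps(1) UNIV_I imageI subsetD)
  ultimately show "N \<subseteq> carrier V \<and> csub (f ` N)" using sub by (auto simp: csub_def)
next
  assume N: "N \<subseteq> carrier V \<and> csub (f ` N)"
  have in_N: "v \<in> N" if "v \<in> carrier V" "f v \<in> f ` N" for v
    using that N by (metis f_inj imageE subsetD)
  have "submodule complex_ring N V"
  proof
    show "u \<oplus>\<^bsub>V\<^esub> v \<in> N" if "u \<in> N" "v \<in> N" for u v
      using that N by (intro in_N) (auto simp: f_add csub_add subset_iff)
    show "\<zero>\<^bsub>V\<^esub> \<in> N" using N by (intro in_N) (auto simp: f_zero zero_in csub_0)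
    show "c \<odot>\<^bsub>V\<^esub> v \<in> N" if "v \<in> N" for c v
      using that N by (intro in_N) (auto simp: f_smult csub_scl subset_iff smult_in)
  qed (use N vs.module_axioms in auto)
  then show "subspace complex_ring N V" by (simp add: subspace_def vectorspace)
qed

lemma transfer_model:
  assumes "csub C'" "bij_betw \<phi> C C'" "\<And>u v. u \<in> C \<Longrightarrow> v \<in> C \<Longrightarrow> \<phi> (u + v) = \<phi> u + \<phi> v"
    "\<And>c v. v \<in> C \<Longrightarrow> \<phi> (scl c v) = scl c (\<phi> v)" "\<And>x v. x \<in> S \<Longrightarrow> v \<in> C \<Longrightarrow> \<phi> (a x v) = a' x (\<phi> v)" "\<phi> 0 = 0"
  shows "model S V (\<lambda>v. \<phi> (f v)) C' a'"
proof
  show "bij_betw (\<lambda>v. \<phi> (f v)) (carrier V) C'"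
    using bij_betw_trans[OF bij assms(2)] by (simp add: comp_def)
qed (use assms in \<open>auto simp: zero_in add_in smult_in act_in f_zero f_add f_smult f_act f_in\<close>)

end

text \<open>Every isomorphism of the classification is obtained by giving both modules the same
  coordinates C and a.\<close>

lemma model_iso:
  assumes "model (carrier L) V f C a" "model (carrier L) V' f' C a"
  shows "lie_iso L V V'"
proof -
  interpret V: model "carrier L" V f C a by fact
  interpret V': model "carrier L" V' f' C a by fact
  define g where "g v = inv_into (carrier V') f' (f v)" for v
  have g: "g v \<in> carrier V'" "f' (g v) = f v" if "v \<in> carrier V" for v
    using V.f_in[OF that] by (simp_all add: g_def V'.f_image[symmetric] inv_into_into f_inv_into_f)
  have eq: "g u = v" if "u \<in> carrier V" "v \<in> carrier V'" "f u = f' v" for u v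
    using that g V'.f_inj by metis
  have "bij_betw g (carrier V) (carrier V')"
    unfolding g_def using bij_betw_trans[OF V.bij bij_betw_inv_into[OF V'.bij]] by (simp add: comp_def)
  moreover have "g \<in> module_hom complex_ring V V'"
    unfolding module_hom_def
    by (auto intro!: eq simp: g V.add_in V'.add_in V.f_add V'.f_add V.smult_in V'.smult_in V.f_smult V'.f_smult)
  moreover have "g (act V x v) = act V' x (g v)" if "x \<in> carrier L" "v \<in> carrier V" for x v
    using that by (intro eq) (auto simp: g V.act_in V'.act_in V.f_act V'.f_act)
  ultimately show ?thesis unfolding lie_iso_def by blast
qed

text \<open>The cosets of N = ker h are the fibres of h, so the unions in \<open>quot_rep\<close>
  collapse to single fibres and h becomes the coordinate of the quotient. This serves for P0, for
  tensor products and for the quotients in the list.\<close>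

lemma quot_model:
  fixes V :: "('x, 'v) rep" and h :: "'v \<Rightarrow> 'w::cvs"
  assumes V: "abelian_group V" and smult_in: "\<And>c v. v \<in> carrier V \<Longrightarrow> c \<odot>\<^bsub>V\<^esub> v \<in> carrier V"
    and C: "csub C" "h ` carrier V = C"
    and h_add: "\<And>u v. u \<in> carrier V \<Longrightarrow> v \<in> carrier V \<Longrightarrow> h (u \<oplus>\<^bsub>V\<^esub> v) = h u + h v"
    and h_smult: "\<And>c v. v \<in> carrier V \<Longrightarrow> h (c \<odot>\<^bsub>V\<^esub> v) = scl c (h v)"
    and act_in: "\<And>x v. x \<in> S \<Longrightarrow> v \<in> carrier V \<Longrightarrow> act V x v \<in> carrier V"
    and h_act: "\<And>x v. x \<in> S \<Longrightarrow> v \<in> carrier V \<Longrightarrow> h (act V x v) = a x (h v)"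
    and N: "N = {v \<in> carrier V. h v = 0}"
  obtains f where "model S (quot_rep V N) f C a"
    "\<And>v. v \<in> carrier V \<Longrightarrow> N +>\<^bsub>V\<^esub> v \<in> carrier (quot_rep V N)"
    "\<And>v. v \<in> carrier V \<Longrightarrow> f (N +>\<^bsub>V\<^esub> v) = h v"
proof -
  interpret V: abelian_group V by fact
  let ?fib = "\<lambda>w. {u \<in> carrier V. h u = w}"
  have h0: "h \<zero>\<^bsub>V\<^esub> = 0" using h_add[of "\<zero>\<^bsub>V\<^esub>" "\<zero>\<^bsub>V\<^esub>"] by simp
  have h_minus: "h (\<ominus>\<^bsub>V\<^esub> v) = - h v" if "v \<in> carrier V" for v
    using h_add[of v "\<ominus>\<^bsub>V\<^esub> v"] that by (simp add: V.r_neg h0 eq_neg_iff_add_eq_0 add.commute)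
  have coset: "N +>\<^bsub>V\<^esub> v = ?fib (h v)" if v: "v \<in> carrier V" for v
  proof
    show "N +>\<^bsub>V\<^esub> v \<subseteq> ?fib (h v)" using v by (auto simp: a_r_coset_def' N h_add)
    show "?fib (h v) \<subseteq> N +>\<^bsub>V\<^esub> v"
    proof
      fix u assume u: "u \<in> ?fib (h v)"
      then have "u = (u \<ominus>\<^bsub>V\<^esub> v) \<oplus>\<^bsub>V\<^esub> v" using v by (simp add: a_minus_def V.a_assoc V.l_neg)
      moreover have "u \<ominus>\<^bsub>V\<^esub> v \<in> N" using u v by (simp add: N a_minus_def h_add h_minus)
      ultimately show "u \<in> N +>\<^bsub>V\<^esub> v" unfolding a_r_coset_def' by blast
    qed
  qed
  have carrier: "carrier (quot_rep V N) = ?fib ` C"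
  proof -
    have "carrier (quot_rep V N) = (\<Union>v\<in>carrier V. {N +>\<^bsub>V\<^esub> v})"
      by (simp add: quot_rep_def A_RCOSETS_def')
    also have "\<dots> = ?fib ` C" using coset C(2) by auto
    finally show ?thesis .
  qed
  define f where "f Z = (THE w. w \<in> C \<and> Z = ?fib w)" for Z
  have fib_inj: "w = w'" if "w \<in> C" "?fib w = ?fib w'" for w w'
    using that C(2) by (metis (mono_tags, lifting) image_iff mem_Collect_eq)
  have f: "f (?fib w) = w" if "w \<in> C" for w
    unfolding f_def using that fib_inj by (intro the_equality) auto
  have "model S (quot_rep V N) f C a"
  proof
    show "csub C" by fact
    show "bij_betw f (carrier (quot_rep V N)) C"
      unfolding carrier by (rule bij_betw_byWitness[where f' = ?fib]) (auto simp: f)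
    show zero: "\<zero>\<^bsub>quot_rep V N\<^esub> \<in> carrier (quot_rep V N)" "f \<zero>\<^bsub>quot_rep V N\<^esub> = 0"
      using csub_0[OF C(1)] f[of 0] unfolding carrier by (auto simp: quot_rep_def N)
    have add: "?fib w \<oplus>\<^bsub>quot_rep V N\<^esub> ?fib w' = ?fib (w + w')" if w: "w \<in> C" "w' \<in> C" for w w'
    proof -
      obtain v where v: "v \<in> carrier V" "h v = w" using w C(2) by blast
      have "?fib w <+>\<^bsub>V\<^esub> ?fib w' = ?fib (w + w')"
      proof
        show "?fib w <+>\<^bsub>V\<^esub> ?fib w' \<subseteq> ?fib (w + w')" by (auto simp: set_add_def' h_add)
        show "?fib (w + w') \<subseteq> ?fib w <+>\<^bsub>V\<^esub> ?fib w'"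
        proof
          fix u assume u: "u \<in> ?fib (w + w')"
          then have "u = v \<oplus>\<^bsub>V\<^esub> (u \<ominus>\<^bsub>V\<^esub> v)"
            using v by (simp add: a_minus_def V.a_lcomm V.r_neg)
          moreover have "u \<ominus>\<^bsub>V\<^esub> v \<in> ?fib w'" using u v by (simp add: a_minus_def h_add h_minus)
          ultimately show "u \<in> ?fib w <+>\<^bsub>V\<^esub> ?fib w'" using v unfolding set_add_def' by blast
        qed
      qed
      then show ?thesis by (simp add: quot_rep_def)
    qed
    show "u \<oplus>\<^bsub>quot_rep V N\<^esub> v \<in> carrier (quot_rep V N)" "f (u \<oplus>\<^bsub>quot_rep V N\<^esub> v) = f u + f v"
      if "u \<in> carrier (quot_rep V N)" "v \<in> carrier (quot_rep V N)" for u v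
      using that csub_add[OF C(1)] unfolding carrier by (auto simp: add f)
    have union: "(\<Union>v\<in>?fib w. N +>\<^bsub>V\<^esub> (g v)) = ?fib w'"
      if "w \<in> C" "\<And>v. v \<in> carrier V \<Longrightarrow> h v = w \<Longrightarrow> g v \<in> carrier V \<and> h (g v) = w'" for w w' g
    proof -
      have "?fib w \<noteq> {}" using that(1) C(2) by blast
      moreover have "N +>\<^bsub>V\<^esub> (g v) = ?fib w'" if "v \<in> ?fib w" for v
        using coset[of "g v"] that \<open>\<And>v. v \<in> carrier V \<Longrightarrow> h v = w \<Longrightarrow> g v \<in> carrier V \<and> h (g v) = w'\<close> by auto
      ultimately show ?thesis by auto
    qed
    have smult: "c \<odot>\<^bsub>quot_rep V N\<^esub> ?fib w = ?fib (scl c w)" if "w \<in> C" for c w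
      unfolding quot_rep_def by simp (rule union[OF that], auto simp: smult_in h_smult)
    then show "c \<odot>\<^bsub>quot_rep V N\<^esub> v \<in> carrier (quot_rep V N)" "f (c \<odot>\<^bsub>quot_rep V N\<^esub> v) = scl c (f v)"
      if "v \<in> carrier (quot_rep V N)" for c v
      using that csub_scl[OF C(1)] unfolding carrier by (auto simp: f)
    have a_C: "a x w \<in> C" if "x \<in> S" "w \<in> C" for x w
      using that C(2) h_act act_in by (metis imageE imageI)
    have act: "act (quot_rep V N) x (?fib w) = ?fib (a x w)" if "x \<in> S" "w \<in> C" for x w
      unfolding quot_rep_def by simp (rule union[OF that(2)], use that in \<open>auto simp: act_in h_act\<close>)
    then show "act (quot_rep V N) x v \<in> carrier (quot_rep V N)" "f (act (quot_rep V N) x v) = a x (f v)"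
      if "x \<in> S" "v \<in> carrier (quot_rep V N)" for x v
      using that a_C unfolding carrier by (auto simp: f)
  qed
  moreover have "N +>\<^bsub>V\<^esub> v \<in> carrier (quot_rep V N)" "f (N +>\<^bsub>V\<^esub> v) = h v" if "v \<in> carrier V" for v
    using that coset C(2) f unfolding carrier by auto
  ultimately show ?thesis using that by blast
qed

subsection \<open>Linear embedding of an abstract vector space\<close>

text \<open>Evaluation \<pi> of formal combinations maps onto V. Extending a basis of K = ker \<pi>
  gives a linear p that kills K and moves each vector only by an element of K, so applying p to
  \<open>single v 1\<close> gives a linear section of \<pi>. This works in every dimension.\<close>

lemma embed:
  assumes V: "vectorspace complex_ring V"
  obtains \<iota> :: "'v \<Rightarrow> 'v \<Rightarrow>\<^sub>0 complex" and \<pi> where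
    "\<And>x. \<pi> x \<in> carrier V" "\<And>x y. \<pi> (x + y) = \<pi> x \<oplus>\<^bsub>V\<^esub> \<pi> y" "\<And>c x. \<pi> (scl c x) = c \<odot>\<^bsub>V\<^esub> \<pi> x"
    "\<And>v. v \<in> carrier V \<Longrightarrow> \<pi> (\<iota> v) = v"
    "\<And>u v. u \<in> carrier V \<Longrightarrow> v \<in> carrier V \<Longrightarrow> \<iota> (u \<oplus>\<^bsub>V\<^esub> v) = \<iota> u + \<iota> v"
    "\<And>c v. v \<in> carrier V \<Longrightarrow> \<iota> (c \<odot>\<^bsub>V\<^esub> v) = scl c (\<iota> v)"
proof -
  interpret V: vectorspace complex_ring V by fact
  \<comment> \<open>Keys outside the carrier are dropped, so that \<pi> is linear on the whole
    type.\<close>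
  define \<pi> :: "('v \<Rightarrow>\<^sub>0 complex) \<Rightarrow> 'v" where
    "\<pi> x = V.lincomb (Poly_Mapping.lookup x) (Poly_Mapping.keys x \<inter> carrier V)" for x
  note smult0 = V.smult_l_null[simplified] and smult1 = V.smult_one[simplified]
  have \<pi>: "\<pi> x = V.lincomb (Poly_Mapping.lookup x) B"
    if B: "finite B" "B \<subseteq> carrier V" "Poly_Mapping.keys x \<inter> carrier V \<subseteq> B" for x B
  proof -
    let ?K = "Poly_Mapping.keys x \<inter> carrier V"
    have "B = ?K \<union> (B - ?K)" using B by blast
    then have "V.lincomb (Poly_Mapping.lookup x) B = V.lincomb (Poly_Mapping.lookup x) ?K \<oplus>\<^bsub>V\<^esub>
        V.lincomb (Poly_Mapping.lookup x) (B - ?K)"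
      using B V.lincomb_union[of ?K "B - ?K" "Poly_Mapping.lookup x"] by auto
    moreover have "V.lincomb (Poly_Mapping.lookup x) (B - ?K) = \<zero>\<^bsub>V\<^esub>"
      unfolding V.lincomb_def
      by (rule V.M.finsum_all0) (use B in \<open>auto simp: in_keys_iff smult0\<close>)
    ultimately show ?thesis by (simp add: \<pi>_def V.lincomb_closed)
  qed
  have in_V: "\<pi> x \<in> carrier V" for x unfolding \<pi>_def by (intro V.lincomb_closed) auto
  have add: "\<pi> (x + y) = \<pi> x \<oplus>\<^bsub>V\<^esub> \<pi> y" for x y
  proof -
    let ?B = "(Poly_Mapping.keys x \<union> Poly_Mapping.keys y) \<inter> carrier V"
    have "Poly_Mapping.keys (x + y) \<inter> carrier V \<subseteq> ?B" using Poly_Mapping.keys_add[of x y] by blast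
    then have "\<pi> (x + y) = V.lincomb (\<lambda>v. Poly_Mapping.lookup x v \<oplus>\<^bsub>complex_ring\<^esub> Poly_Mapping.lookup y v) ?B"
      by (subst \<pi>[of ?B]) (auto simp: lookup_add plus_poly_mapping.rep_eq)
    also have "\<dots> = V.lincomb (Poly_Mapping.lookup x) ?B \<oplus>\<^bsub>V\<^esub> V.lincomb (Poly_Mapping.lookup y) ?B"
      by (rule V.lincomb_sum) auto
    also have "\<dots> = \<pi> x \<oplus>\<^bsub>V\<^esub> \<pi> y" by (subst (1 2) \<pi>[of ?B]) auto
    finally show ?thesis .
  qed
  have smult: "\<pi> (scl c x) = c \<odot>\<^bsub>V\<^esub> \<pi> x" for c x
  proof -
    let ?B = "Poly_Mapping.keys x \<inter> carrier V"
    have "\<pi> (scl c x) = V.lincomb (\<lambda>v. c \<otimes>\<^bsub>complex_ring\<^esub> Poly_Mapping.lookup x v) ?B"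
    proof -
      have "Poly_Mapping.lookup (scl c x) = (\<lambda>v. c \<otimes>\<^bsub>complex_ring\<^esub> Poly_Mapping.lookup x v)" by (intro ext) simp
      moreover have "Poly_Mapping.keys (scl c x) \<inter> carrier V \<subseteq> ?B" by (auto simp: in_keys_iff)
      ultimately show ?thesis by (subst \<pi>[of ?B]) auto
    qed
    also have "\<dots> = c \<odot>\<^bsub>V\<^esub> V.lincomb (Poly_Mapping.lookup x) ?B"
      by (rule V.lincomb_smult) auto
    finally show ?thesis by (simp add: \<pi>_def)
  qed
  have single: "\<pi> (Poly_Mapping.single v 1) = v" if "v \<in> carrier V" for v
    using that by (subst \<pi>[of "{v}"]) (auto simp: V.lincomb_def smult1)
  have \<pi>0: "\<pi> 0 = \<zero>\<^bsub>V\<^esub>" by (simp add: \<pi>_def V.lincomb_def)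
  define K where "K = {x. \<pi> x = \<zero>\<^bsub>V\<^esub>}"
  have "csub K" by (auto simp: csub_def K_def \<pi>0 add smult V.smult_r_null)
  then have K: "cvs.subspace K" by (simp add: csub_eq_subspace)
  obtain B where B: "B \<subseteq> K" "\<not> cvs.dependent B" "cvs.span B = K"
    using cvs.basis_exists[of K] cvs.span_subspace[of _ K] K by metis
  define B' where "B' = cvs.extend_basis B"
  have B': "B \<subseteq> B'" "\<not> cvs.dependent B'" "cvs.span B' = UNIV"
    unfolding B'_def using cvs.extend_basis_superset[OF B(2)] cvs.independent_extend_basis[OF B(2)]
      cvs.span_extend_basis[OF B(2)] by auto
  interpret pair: vector_space_pair "scl :: complex \<Rightarrow> ('v \<Rightarrow>\<^sub>0 complex) \<Rightarrow> _" "scl :: complex \<Rightarrow> ('v \<Rightarrow>\<^sub>0 complex) \<Rightarrow> _"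
    by unfold_locales
  obtain p where p: "Vector_Spaces.linear scl scl p" "\<forall>b\<in>B'. p b = (if b \<in> B then 0 else b)"
    using pair.linear_independent_extend[OF B'(2), of "\<lambda>b. if b \<in> B then 0 else b"] by blast
  interpret p: Vector_Spaces.linear "scl :: complex \<Rightarrow> ('v \<Rightarrow>\<^sub>0 complex) \<Rightarrow> _" scl p by (rule p(1))
  have lin: "clin p" by (simp add: clin_def p.add p.scale)
  have p0: "p x = 0" if "x \<in> K" for x
  proof -
    have "cvs.span B \<subseteq> {x. p x = 0}"
      using p(2) B'(1) csub_vimage[OF lin csub_zero csub_UNIV]
      by (intro cvs.span_minimal) (auto simp: csub_eq_subspace[symmetric])
    with that B(3) show ?thesis by blast
  qed
  have pK: "x - p x \<in> K" for x
  proof -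
    have "cvs.span B' \<subseteq> {x. x - p x \<in> K}"
    proof (rule cvs.span_minimal)
      show "B' \<subseteq> {x. x - p x \<in> K}" using p(2) B(1) cvs.subspace_0[OF K] by auto
      show "cvs.subspace {x. x - p x \<in> K}"
        using csub_vimage[OF clin_sub[OF clin_id lin] \<open>csub K\<close> csub_UNIV] by (simp add: csub_eq_subspace)
    qed
    with B'(3) show ?thesis by blast
  qed
  have diff: "\<pi> x = \<pi> y" if "x - y \<in> K" for x y
  proof -
    have "\<pi> x = \<pi> (x - y) \<oplus>\<^bsub>V\<^esub> \<pi> y" using add[of "x - y" y] by simp
    with that in_V show ?thesis by (simp add: K_def)
  qed
  have eqK: "p x = p y" if "\<pi> x = \<pi> y" for x y
  proof -
    have "\<pi> (x - y) = \<pi> x \<oplus>\<^bsub>V\<^esub> (-1) \<odot>\<^bsub>V\<^esub> \<pi> y" using add[of x "scl (-1) y"] smult[of "-1" y] by simp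
    also have "\<dots> = (1 + (-1)) \<odot>\<^bsub>V\<^esub> \<pi> y"
      using V.smult_l_distr[of 1 "-1" "\<pi> y"] in_V that by (simp add: smult1)
    also have "\<dots> = \<zero>\<^bsub>V\<^esub>" using in_V by (simp add: smult0)
    finally have "p (x - y) = 0" by (intro p0) (simp add: K_def)
    then show ?thesis using lin by (simp add: clin_diff)
  qed
  show ?thesis
  proof (rule that[of \<pi> "\<lambda>v. p (Poly_Mapping.single v 1)"])
    show "\<pi> (p (Poly_Mapping.single v 1)) = v" if "v \<in> carrier V" for v
      using diff[OF pK[of "Poly_Mapping.single v 1"]] single[OF that] by simp
    show "p (Poly_Mapping.single (u \<oplus>\<^bsub>V\<^esub> v) 1) = p (Poly_Mapping.single u 1) + p (Poly_Mapping.single v 1)"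
      if "u \<in> carrier V" "v \<in> carrier V" for u v
    proof -
      have "p (Poly_Mapping.single (u \<oplus>\<^bsub>V\<^esub> v) 1) = p (Poly_Mapping.single u 1 + Poly_Mapping.single v 1)"
        using that by (intro eqK) (simp add: add single)
      then show ?thesis using lin by (simp add: clin_add)
    qed
    show "p (Poly_Mapping.single (c \<odot>\<^bsub>V\<^esub> v) 1) = scl c (p (Poly_Mapping.single v 1))" if "v \<in> carrier V" for c v
    proof -
      have "p (Poly_Mapping.single (c \<odot>\<^bsub>V\<^esub> v) 1) = p (scl c (Poly_Mapping.single v 1))"
        using that by (intro eqK) (simp only: smult single V.smult_closed complex_ring_simps UNIV_I)
      then show ?thesis using lin by (simp only: clin_scl)
    qed
  qed (rule in_V add smult)+
qed

section \<open>Representations of the vector fields\<close>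

definition fl :: "('n mpol \<Rightarrow> 'n mpol) \<Rightarrow> 'n \<Rightarrow> 'n mpol" where
  "fl D j = D (tvar j)"

lemma fl_vf [simp]: "fl (vf f) = f"
  by (intro ext) (simp add: fl_def)

lemma vf_fl [simp]: "D \<in> derivs \<Longrightarrow> vf (fl D) = D"
proof -
  assume D: "D \<in> derivs"
  have "fl D = (\<lambda>j. D (tvar j))" by (intro ext) (rule fl_def)
  then show "vf (fl D) = D" using derivs_vf[OF D] by simp
qed

lemma vectorspace_derivations: "vectorspace complex_ring (derivations :: ('n::finite mpol \<Rightarrow> 'n mpol) lie_alg)"
proof (rule vs_criteria_complex)
  show "\<forall>D\<in>derivs. \<exists>D'\<in>derivs. D \<oplus>\<^bsub>derivations\<^esub> D' = \<zero>\<^bsub>derivations :: ('n mpol \<Rightarrow> 'n mpol) lie_alg\<^esub>"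
  proof
    fix D :: "'n mpol \<Rightarrow> 'n mpol" assume "D \<in> derivs"
    then obtain f where "D = vf f" by (rule derivs_cases)
    then have "D \<oplus>\<^bsub>derivations\<^esub> vf (\<lambda>j. - f j) = \<zero>\<^bsub>derivations\<^esub>" by (simp add: add_derivs zero_derivs)
    then show "\<exists>D'\<in>derivs. D \<oplus>\<^bsub>derivations\<^esub> D' = \<zero>\<^bsub>derivations\<^esub>" using vf_derivs by blast
  qed
qed (auto elim!: derivs_cases simp: add_derivs smult_derivs zero_derivs scl_add_right scl_add_left ac_simps)

interpretation derivations: vectorspace complex_ring "derivations :: ('n::finite mpol \<Rightarrow> 'n mpol) lie_alg"
  by (rule vectorspace_derivations)

lemma mon_pd: "(\<lambda>p. mon \<alpha> * pd i p) = vf (fld i (mon \<alpha>))"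
  by (intro ext) (simp add: vf_def fld_def if_distrib[of "\<lambda>x. x * _"] cong: if_cong)

lemma grade_eq: "grade k = module.span complex_ring derivations
    {vf (fld i (mon \<alpha>)) | \<alpha> i. int (deg \<alpha>) = k + 1}"
  unfolding grade_def mon_pd deg_def ..

lemma grade_derivs: "grade k \<subseteq> derivs"
  unfolding grade_eq by (rule derivations.span_is_subset2) auto

context vfrep
begin

lemma span_kill:
  assumes "Sg \<subseteq> derivs"
  shows "(\<forall>x\<in>module.span complex_ring derivations Sg. A (fl x) w = 0) \<longleftrightarrow> (\<forall>x\<in>Sg. A (fl x) w = 0)"
proof
  assume *: "\<forall>x\<in>Sg. A (fl x) w = 0"
  let ?N = "{D \<in> derivs. A (fl D) w = 0}"
  have "submodule complex_ring ?N derivations"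
  proof
    show "?N \<subseteq> derivs" by blast
    show "D \<oplus>\<^bsub>derivations\<^esub> D' \<in> ?N" if "D \<in> ?N" "D' \<in> ?N" for D D'
      using that by (auto elim!: derivs_cases simp: add_derivs A_add)
    show "\<zero>\<^bsub>derivations\<^esub> \<in> ?N" by (simp add: zero_derivs A_zero)
    show "c \<odot>\<^bsub>derivations\<^esub> D \<in> ?N" if "D \<in> ?N" for c D
      using that by (auto elim!: derivs_cases simp: smult_derivs A_scl)
  qed
  then have "module.span complex_ring derivations Sg \<subseteq> ?N"
    using assms * by (intro derivations.span_is_subset) auto
  then show "\<forall>x\<in>module.span complex_ring derivations Sg. A (fl x) w = 0" by blast
next
  assume "\<forall>x\<in>module.span complex_ring derivations Sg. A (fl x) w = 0"
  then show "\<forall>x\<in>Sg. A (fl x) w = 0" using derivations.in_own_span[OF assms] by blast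
qed

lemma grade_kill: "(\<forall>x\<in>grade k. A (fl x) w = 0) \<longleftrightarrow> (\<forall>\<alpha> j. int (deg \<alpha>) = k + 1 \<longrightarrow> A1 (mon \<alpha>) j w = 0)"
proof -
  let ?Sg = "{vf (fld i (mon \<alpha>)) | \<alpha> i. int (deg \<alpha>) = k + 1}"
  have "(\<forall>x\<in>?Sg. A (fl x) w = 0) \<longleftrightarrow> (\<forall>\<alpha> j. int (deg \<alpha>) = k + 1 \<longrightarrow> A1 (mon \<alpha>) j w = 0)"
  proof (intro iffI allI impI)
    fix \<alpha> :: "'n \<Rightarrow>\<^sub>0 nat" and j
    assume "\<forall>x\<in>?Sg. A (fl x) w = 0" "int (deg \<alpha>) = k + 1"
    then have "A (fl (vf (fld j (mon \<alpha>)))) w = 0" by blast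
    then show "A1 (mon \<alpha>) j w = 0" by (simp add: A1_def)
  qed (auto simp: A1_def)
  then show ?thesis unfolding grade_eq by (subst span_kill) auto
qed

lemma grade_ge_kill: "(\<forall>x\<in>grade_ge r. A (fl x) w = 0) \<longleftrightarrow> (\<forall>\<alpha> j. int (deg \<alpha>) \<ge> r + 1 \<longrightarrow> A1 (mon \<alpha>) j w = 0)"
proof -
  have "(\<forall>x\<in>grade_ge r. A (fl x) w = 0) \<longleftrightarrow> (\<forall>k\<ge>r. \<forall>x\<in>grade k. A (fl x) w = 0)"
    unfolding grade_ge_def by (subst span_kill) (use grade_derivs in auto)
  also have "\<dots> \<longleftrightarrow> (\<forall>k\<ge>r. \<forall>\<alpha> j. int (deg \<alpha>) = k + 1 \<longrightarrow> A1 (mon \<alpha>) j w = 0)"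
    unfolding grade_kill ..
  also have "\<dots> \<longleftrightarrow> (\<forall>\<alpha> j. int (deg \<alpha>) \<ge> r + 1 \<longrightarrow> A1 (mon \<alpha>) j w = 0)"
  proof (intro iffI allI impI)
    fix \<alpha> :: "'n \<Rightarrow>\<^sub>0 nat" and j assume *: "\<forall>k\<ge>r. \<forall>\<alpha> j. int (deg \<alpha>) = k + 1 \<longrightarrow> A1 (mon \<alpha>) j w = 0" "int (deg \<alpha>) \<ge> r + 1"
    from *(1)[rule_format, of "int (deg \<alpha>) - 1" \<alpha> j] *(2) show "A1 (mon \<alpha>) j w = 0" by simp
  qed auto
  finally show ?thesis .
qed

end

lemma grade_ge_derivs: "grade_ge r \<subseteq> derivs"
  unfolding grade_ge_def by (rule derivations.span_is_subset2) (use grade_derivs in blast)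

context model
begin

lemma f_eq_0: "v \<in> carrier V \<Longrightarrow> f v = 0 \<longleftrightarrow> v = \<zero>\<^bsub>V\<^esub>"
  using f_inj[OF _ zero_in] f_zero by simp

lemma image_eq_0_iff:
  assumes "N \<subseteq> carrier V"
  shows "f ` N = {0} \<longleftrightarrow> N = {\<zero>\<^bsub>V\<^esub>}"
proof
  assume *: "f ` N = {0}"
  then have "v = \<zero>\<^bsub>V\<^esub>" if "v \<in> N" for v using that assms f_eq_0 by blast
  moreover have "N \<noteq> {}" using * by blast
  ultimately show "N = {\<zero>\<^bsub>V\<^esub>}" by blast
qed (simp add: f_zero)

lemma image_eq_C_iff:
  assumes "N \<subseteq> carrier V"
  shows "f ` N = C \<longleftrightarrow> N = carrier V"
proof
  assume "f ` N = C"
  then have "v \<in> N" if "v \<in> carrier V" for v using that assms f_in[OF that] f_inj by blast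
  with assms show "N = carrier V" by blast
qed (simp add: f_image)

text \<open>P stands for the notion of submodule, so that one argument covers both vector fields and
  gl_n.\<close>

lemma invariant_subspaces:
  assumes P: "\<And>N. P N \<longleftrightarrow> N \<subseteq> carrier V \<and> inv_sub b (f ` N)" and C: "inv_sub b C"
  shows "carrier V \<noteq> {\<zero>\<^bsub>V\<^esub>} \<and> (\<forall>N. P N \<longrightarrow> N = {\<zero>\<^bsub>V\<^esub>} \<or> N = carrier V) \<longleftrightarrow> irr b C"
proof -
  have "(\<forall>N. P N \<longrightarrow> N = {\<zero>\<^bsub>V\<^esub>} \<or> N = carrier V) \<longleftrightarrow> (\<forall>S\<subseteq>C. inv_sub b S \<longrightarrow> S = {0} \<or> S = C)"
  proof
    assume *: "\<forall>N. P N \<longrightarrow> N = {\<zero>\<^bsub>V\<^esub>} \<or> N = carrier V"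
    show "\<forall>S\<subseteq>C. inv_sub b S \<longrightarrow> S = {0} \<or> S = C"
    proof (intro allI impI)
      fix S assume S: "S \<subseteq> C" "inv_sub b S"
      let ?N = "{v \<in> carrier V. f v \<in> S}"
      have N: "?N \<subseteq> carrier V" by blast
      have fN: "f ` ?N = S" using S(1) f_ex by blast
      then have "P ?N" unfolding P using S by auto
      with * have "?N = {\<zero>\<^bsub>V\<^esub>} \<or> ?N = carrier V" by blast
      then show "S = {0} \<or> S = C"
        using image_eq_0_iff[OF N] image_eq_C_iff[OF N] unfolding fN by blast
    qed
  next
    assume *: "\<forall>S\<subseteq>C. inv_sub b S \<longrightarrow> S = {0} \<or> S = C"
    show "\<forall>N. P N \<longrightarrow> N = {\<zero>\<^bsub>V\<^esub>} \<or> N = carrier V"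
    proof (intro allI impI)
      fix N assume "P N"
      then have N: "N \<subseteq> carrier V" "inv_sub b (f ` N)" unfolding P by auto
      have "f ` N \<subseteq> C" using N f_image by blast
      with * N have "f ` N = {0} \<or> f ` N = C" by blast
      then show "N = {\<zero>\<^bsub>V\<^esub>} \<or> N = carrier V"
        using image_eq_0_iff[OF N(1)] image_eq_C_iff[OF N(1)] by blast
    qed
  qed
  moreover have "carrier V = {\<zero>\<^bsub>V\<^esub>} \<longleftrightarrow> C = {0}"
    using image_eq_0_iff[OF subset_refl] f_image by simp
  ultimately show ?thesis using C by (simp add: irr_def)
qed

end

locale dmodel = model derivs V f C "\<lambda>D. A (fl D)" + vfrep A
  for V :: "('n::finite, 'v) op_rep" and f :: "'v \<Rightarrow> 'w::cvs" and C :: "'w set"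
    and A :: "('n \<Rightarrow> 'n mpol) \<Rightarrow> 'w \<Rightarrow> 'w"
begin

lemma A_C: "w \<in> C \<Longrightarrow> A h w \<in> C"
proof -
  assume "w \<in> C"
  then obtain v where "v \<in> carrier V" "f v = w" using f_ex by blast
  then show "A h w \<in> C" using f_act[of "vf h" v] f_in[OF act_in[of "vf h" v]] by simp
qed

lemma inv_C: "inv_sub A C"
  by (simp add: inv_sub_def csub_C A_C)

lemma lie_module: "lie_module derivations V"
proof -
  have eq: "u = v" if "u \<in> carrier V" "v \<in> carrier V" "f u = f v" for u v
    using that f_inj by blast
  show ?thesis
  proof (intro lie_module.intro lie_module_axioms.intro vectorspace)
    show "act V (bracket derivations x y) v = act V x (act V y v) \<ominus>\<^bsub>V\<^esub> act V y (act V x v)"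
      if "x \<in> derivs" "y \<in> derivs" "v \<in> carrier V" for x y v
    proof -
      from that obtain g h where gh: "x = vf g" "y = vf h" by (auto elim!: derivs_cases)
      show ?thesis unfolding gh bracket_derivs
        using that(3) by (intro eq) (simp_all add: act_in f_act f_minus A_bracket vs.M.minus_closed)
    qed
    show "act V (x \<oplus>\<^bsub>derivations\<^esub> y) v = act V x v \<oplus>\<^bsub>V\<^esub> act V y v"
      if "x \<in> derivs" "y \<in> derivs" "v \<in> carrier V" for x y v
    proof -
      from that obtain g h where gh: "x = vf g" "y = vf h" by (auto elim!: derivs_cases)
      show ?thesis unfolding gh add_derivs
        using that(3) by (intro eq) (simp_all add: act_in add_in f_act f_add A_add)
    qed
    show "act V (c \<odot>\<^bsub>derivations\<^esub> x) v = c \<odot>\<^bsub>V\<^esub> act V x v"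
      if "x \<in> derivs" "v \<in> carrier V" for x v c
    proof -
      from that obtain g where g: "x = vf g" by (auto elim!: derivs_cases)
      show ?thesis unfolding g smult_derivs
        using that(2) by (intro eq) (simp_all add: act_in smult_in f_act f_smult A_scl)
    qed
  qed (auto intro!: eq simp: act_in add_in smult_in f_act f_add f_smult A_simps)
qed

lemma lie_submodule_iff: "lie_submodule derivations V N \<longleftrightarrow> N \<subseteq> carrier V \<and> inv_sub A (f ` N)"
proof -
  have "(\<forall>x\<in>derivs. \<forall>v\<in>N. act V x v \<in> N) \<longleftrightarrow> (\<forall>h. \<forall>w\<in>f ` N. A h w \<in> f ` N)" if N: "N \<subseteq> carrier V"
  proof
    assume *: "\<forall>x\<in>derivs. \<forall>v\<in>N. act V x v \<in> N"
    show "\<forall>h. \<forall>w\<in>f ` N. A h w \<in> f ` N"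
    proof (intro allI ballI)
      fix h w assume "w \<in> f ` N"
      then obtain v where v: "v \<in> N" "w = f v" by blast
      then have "f (act V (vf h) v) = A h w" using N by (auto simp: f_act)
      with * v show "A h w \<in> f ` N" by (metis imageI vf_derivs)
    qed
  next
    assume *: "\<forall>h. \<forall>w\<in>f ` N. A h w \<in> f ` N"
    show "\<forall>x\<in>derivs. \<forall>v\<in>N. act V x v \<in> N"
    proof (intro ballI)
      fix x :: "'n mpol \<Rightarrow> 'n mpol" and v assume x: "x \<in> derivs" "v \<in> N"
      then have "f (act V x v) \<in> f ` N" using * N by (auto simp: f_act)
      then obtain u where "u \<in> N" "f (act V x v) = f u" by blast
      then show "act V x v \<in> N" using x N f_inj[OF act_in] by blast
    qed
  qed
  then show ?thesis unfolding lie_submodule_def subspace_iff inv_sub_def by blast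
qed

lemma simple_iff: "simple_lie_module derivations V \<longleftrightarrow> irr A C"
  unfolding simple_lie_module_def using lie_module invariant_subspaces[OF lie_submodule_iff inv_C] by simp

lemma trivialI: "(\<And>h w. w \<in> C \<Longrightarrow> A h w = 0) \<Longrightarrow> trivial_lie_module derivations V"
  unfolding trivial_lie_module_def
  using f_eq_0[OF act_in] f_in by (auto simp: f_act)

lemma smooth_iff: "smooth V \<longleftrightarrow> (\<forall>w\<in>C. \<exists>m. \<forall>\<alpha> j. deg \<alpha> \<ge> m \<longrightarrow> A1 (mon \<alpha>) j w = 0)"
proof -
  have 1: "(\<forall>x\<in>grade i. act V x v = \<zero>\<^bsub>V\<^esub>) \<longleftrightarrow> (\<forall>\<alpha> j. int (deg \<alpha>) = i + 1 \<longrightarrow> A1 (mon \<alpha>) j (f v) = 0)"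
    if v: "v \<in> carrier V" for v i
  proof -
    have "act V x v = \<zero>\<^bsub>V\<^esub> \<longleftrightarrow> A (fl x) (f v) = 0" if "x \<in> grade i" for x
      using that grade_derivs v f_eq_0[OF act_in[of x v]] f_act[of x v] by auto
    then show ?thesis unfolding grade_kill[symmetric] by blast
  qed
  have 2: "(\<exists>m::nat. \<forall>i\<ge>int m. \<forall>\<alpha> j. int (deg \<alpha>) = i + 1 \<longrightarrow> A1 (mon \<alpha>) j w = 0) \<longleftrightarrow>
      (\<exists>m. \<forall>\<alpha> j. deg \<alpha> \<ge> m \<longrightarrow> A1 (mon \<alpha>) j w = 0)" for w
  proof
    assume "\<exists>m::nat. \<forall>i\<ge>int m. \<forall>\<alpha> j. int (deg \<alpha>) = i + 1 \<longrightarrow> A1 (mon \<alpha>) j w = 0"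
    then obtain m :: nat where m: "\<forall>i\<ge>int m. \<forall>\<alpha> j. int (deg \<alpha>) = i + 1 \<longrightarrow> A1 (mon \<alpha>) j w = 0" by blast
    have "A1 (mon \<alpha>) j w = 0" if "deg \<alpha> \<ge> m + 1" for \<alpha> j
      using m[rule_format, of "int (deg \<alpha>) - 1" \<alpha> j] that by simp
    then show "\<exists>m. \<forall>\<alpha> j. deg \<alpha> \<ge> m \<longrightarrow> A1 (mon \<alpha>) j w = 0" by blast
  next
    assume "\<exists>m. \<forall>\<alpha> j. deg \<alpha> \<ge> m \<longrightarrow> A1 (mon \<alpha>) j w = 0"
    then obtain m where m: "\<forall>\<alpha> j. deg \<alpha> \<ge> m \<longrightarrow> A1 (mon \<alpha>) j w = 0" by blast
    show "\<exists>m::nat. \<forall>i\<ge>int m. \<forall>\<alpha> j. int (deg \<alpha>) = i + 1 \<longrightarrow> A1 (mon \<alpha>) j w = 0"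
      by (rule exI[of _ m]) (use m in auto)
  qed
  have "smooth V \<longleftrightarrow> (\<forall>v\<in>carrier V. \<exists>m::nat. \<forall>i\<ge>int m. \<forall>\<alpha> j. int (deg \<alpha>) = i + 1 \<longrightarrow> A1 (mon \<alpha>) j (f v) = 0)"
    unfolding smooth_def by (intro ball_cong refl) (simp only: 1)
  then show ?thesis unfolding 2 f_image[symmetric] by blast
qed

lemma killed_iff: "killed_ge V r = {v \<in> carrier V. \<forall>\<alpha> j. deg \<alpha> \<ge> r + 1 \<longrightarrow> A1 (mon \<alpha>) j (f v) = 0}"
proof -
  have "(\<forall>x\<in>grade_ge (int r). act V x v = \<zero>\<^bsub>V\<^esub>) \<longleftrightarrow> (\<forall>\<alpha> j. deg \<alpha> \<ge> r + 1 \<longrightarrow> A1 (mon \<alpha>) j (f v) = 0)"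
    if v: "v \<in> carrier V" for v
  proof -
    have "act V x v = \<zero>\<^bsub>V\<^esub> \<longleftrightarrow> A (fl x) (f v) = 0" if "x \<in> grade_ge (int r)" for x
      using that grade_ge_derivs v f_eq_0[OF act_in[of x v]] f_act[of x v] by auto
    moreover have "int (deg \<alpha>) \<ge> int r + 1 \<longleftrightarrow> deg \<alpha> \<ge> r + 1" for \<alpha> :: "'n \<Rightarrow>\<^sub>0 nat" by linarith
    ultimately show ?thesis using grade_ge_kill[of "int r" "f v"] by simp
  qed
  then show ?thesis unfolding killed_ge_def by blast
qed

lemma zero_killed: "\<zero>\<^bsub>V\<^esub> \<in> killed_ge V r"
  by (simp add: killed_iff zero_in f_zero A1_simps)

lemma killed_eq:
  "killed_ge V 0 \<noteq> {\<zero>\<^bsub>V\<^esub>} \<longleftrightarrow> K0 C \<noteq> {0}" "killed_ge V 1 \<noteq> {\<zero>\<^bsub>V\<^esub>} \<longleftrightarrow> K1 C \<noteq> {0}"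
proof -
  have *: "S \<noteq> {\<zero>\<^bsub>V\<^esub>} \<longleftrightarrow> f ` S \<noteq> {0}" if "S \<subseteq> carrier V" "\<zero>\<^bsub>V\<^esub> \<in> S" for S
    using that f_eq_0 f_zero by (auto simp: image_iff)
  have "f ` killed_ge V 0 = K0 C" "f ` killed_ge V 1 = K1 C"
    unfolding killed_iff K0_def K1_def f_image[symmetric] by auto
  then show "killed_ge V 0 \<noteq> {\<zero>\<^bsub>V\<^esub>} \<longleftrightarrow> K0 C \<noteq> {0}" "killed_ge V 1 \<noteq> {\<zero>\<^bsub>V\<^esub>} \<longleftrightarrow> K1 C \<noteq> {0}"
    using *[OF _ zero_killed[of 0]] *[OF _ zero_killed[of 1]] by (auto simp: killed_iff)
qed

lemma height_1I: "K0 C = {0} \<Longrightarrow> K1 C \<noteq> {0} \<Longrightarrow> height V = 1"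
proof -
  assume K: "K0 C = {0}" "K1 C \<noteq> {0}"
  show "height V = 1"
    unfolding height_def
  proof (rule Least_equality)
    show "killed_ge V 1 \<noteq> {\<zero>\<^bsub>V\<^esub>}" using K killed_eq by blast
    fix r assume "killed_ge V r \<noteq> {\<zero>\<^bsub>V\<^esub>}"
    with K killed_eq have "r \<noteq> 0" by metis
    then show "1 \<le> r" by simp
  qed
qed

text \<open>Smoothness of a nonzero vector supplies some r with a nonzero killed space; only then
  does the \<open>LEAST\<close> in \<open>height\<close> carry information.\<close>

lemma height_1D:
  assumes "height V = 1" "smooth V" "C \<noteq> {0}"
  shows "K0 C = {0}" "K1 C \<noteq> {0}"
proof -
  obtain w where w: "w \<in> C" "w \<noteq> 0" using assms(3) csub_0[OF csub_C] by blast
  then obtain m where m: "\<And>\<alpha> j. deg \<alpha> \<ge> m \<Longrightarrow> A1 (mon \<alpha>) j w = 0"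
    using assms(2) unfolding smooth_iff by blast
  obtain v where v: "v \<in> carrier V" "f v = w" using f_ex w by blast
  then have "v \<in> killed_ge V m" using m by (simp add: killed_iff)
  moreover have "v \<noteq> \<zero>\<^bsub>V\<^esub>" using v w f_zero by auto
  ultimately have "killed_ge V m \<noteq> {\<zero>\<^bsub>V\<^esub>}" by blast
  then have "killed_ge V (height V) \<noteq> {\<zero>\<^bsub>V\<^esub>}" unfolding height_def by (rule LeastI)
  then show "K1 C \<noteq> {0}" using assms(1) killed_eq by simp
  show "K0 C = {0}"
    using assms(1) not_less_Least[of 0 "\<lambda>r. killed_ge V r \<noteq> {\<zero>\<^bsub>V\<^esub>}"] killed_eq unfolding height_def by auto
qed

text \<open>A nonzero vector in \<open>K0 C\<close> would make a simple module trivial by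
  \<open>K0_trivial\<close>. For a nontrivial one the height is therefore 1 as soon as
  \<open>K1 C\<close> is nonzero.\<close>

lemma simple_smooth_height:
  assumes "irr A C" "K1 C \<noteq> {0}" "\<And>w. w \<in> C \<Longrightarrow> \<exists>m. \<forall>\<alpha> j. deg \<alpha> \<ge> m \<longrightarrow> A1 (mon \<alpha>) j w = 0"
    "\<not> trivial_lie_module derivations V"
  shows "simple_lie_module derivations V \<and> smooth V \<and> height V = 1"
proof -
  have "K0 C = {0}"
  proof (rule ccontr)
    assume "K0 C \<noteq> {0}"
    moreover have "0 \<in> K0 C" using csub_0[OF csub_C] by (simp add: K0_def A1_simps)
    ultimately obtain v where "v \<in> K0 C" "v \<noteq> 0" by blast
    have "trivial_lie_module derivations V" by (rule trivialI) (rule K0_trivial[OF assms(1) \<open>v \<in> K0 C\<close> \<open>v \<noteq> 0\<close>])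
    with assms(4) show False by blast
  qed
  moreover have "smooth V" unfolding smooth_iff using assms(3) by blast
  ultimately show ?thesis using assms(1,2) height_1I simple_iff by blast
qed

end

lemma lie_module_embed:
  fixes V :: "('n::finite, 'v) op_rep"
  assumes "lie_module derivations V"
  obtains f :: "'v \<Rightarrow> 'v \<Rightarrow>\<^sub>0 complex" and C A where "dmodel V f C A"
proof -
  interpret V: lie_module derivations V by fact
  obtain \<iota> :: "'v \<Rightarrow> 'v \<Rightarrow>\<^sub>0 complex" and \<pi> where
    \<pi>: "\<And>x. \<pi> x \<in> carrier V" "\<And>x y. \<pi> (x + y) = \<pi> x \<oplus>\<^bsub>V\<^esub> \<pi> y" "\<And>c x. \<pi> (scl c x) = c \<odot>\<^bsub>V\<^esub> \<pi> x"
    and \<pi>\<iota>: "\<And>v. v \<in> carrier V \<Longrightarrow> \<pi> (\<iota> v) = v"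
    and \<iota>: "\<And>u v. u \<in> carrier V \<Longrightarrow> v \<in> carrier V \<Longrightarrow> \<iota> (u \<oplus>\<^bsub>V\<^esub> v) = \<iota> u + \<iota> v"
      "\<And>c v. v \<in> carrier V \<Longrightarrow> \<iota> (c \<odot>\<^bsub>V\<^esub> v) = scl c (\<iota> v)"
    by (rule embed[OF V.vectorspace_axioms], rule that)
  define A where "A h x = \<iota> (act V (vf h) (\<pi> x))" for h x
  have \<iota>0: "\<iota> \<zero>\<^bsub>V\<^esub> = 0" using \<iota>(1)[of "\<zero>\<^bsub>V\<^esub>" "\<zero>\<^bsub>V\<^esub>"] by simp
  have \<iota>m: "\<iota> (u \<ominus>\<^bsub>V\<^esub> v) = \<iota> u - \<iota> v" if "u \<in> carrier V" "v \<in> carrier V" for u v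
  proof -
    have "u = (u \<ominus>\<^bsub>V\<^esub> v) \<oplus>\<^bsub>V\<^esub> v" using that by (simp add: a_minus_def V.M.a_assoc V.M.l_neg)
    then show ?thesis using \<iota>(1)[of "u \<ominus>\<^bsub>V\<^esub> v" v] that by (simp add: eq_diff_eq)
  qed
  have "dmodel V \<iota> (\<iota> ` carrier V) A"
  proof
    show "csub (\<iota> ` carrier V)"
      unfolding csub_def
    proof (intro conjI ballI allI)
      show "0 \<in> \<iota> ` carrier V" using \<iota>0 V.M.zero_closed by (metis imageI)
      show "x + y \<in> \<iota> ` carrier V" if "x \<in> \<iota> ` carrier V" "y \<in> \<iota> ` carrier V" for x y
        using that \<iota>(1) V.M.add.m_closed by (metis (no_types, lifting) imageE imageI)
      show "scl c x \<in> \<iota> ` carrier V" if "x \<in> \<iota> ` carrier V" for c x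
        using that \<iota>(2) V.smult_closed by (metis (no_types, lifting) imageE imageI complex_ring_simps(1) UNIV_I)
    qed
    show "bij_betw \<iota> (carrier V) (\<iota> ` carrier V)"
      using \<pi>\<iota> by (intro inj_on_imp_bij_betw inj_on_inverseI)
    show "\<iota> (act V x v) = A (fl x) (\<iota> v)" if "x \<in> derivs" "v \<in> carrier V" for x v
      using that by (simp add: A_def \<pi>\<iota>)
    show "clin (A h)" for h
      unfolding A_def
      by (rule clinI) (simp_all add: \<pi> \<iota> V.act_closed V.act_add V.act_smult)
    show "A (\<lambda>k. h k + h' k) v = A h v + A h' v" for h h' v
      unfolding A_def by (simp add: add_derivs[symmetric] V.add_act \<pi> \<iota> V.act_closed)
    show "A (\<lambda>k. scl c (h k)) v = scl c (A h v)" for h c v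
      unfolding A_def by (simp add: smult_derivs[symmetric] V.smult_act \<pi> \<iota> V.act_closed)
    show "A (vbr h h') v = A h (A h' v) - A h' (A h v)" for h h' v
      unfolding A_def by (simp add: bracket_derivs[symmetric] V.bracket_act \<pi> \<iota>m V.act_closed \<pi>\<iota>)
  qed (auto simp: \<iota>0 \<iota> V.act_closed)
  with that show ?thesis by blast
qed

lemma dmodel_iso: "dmodel V f C A \<Longrightarrow> dmodel V' f' C A \<Longrightarrow> lie_iso derivations V V'"
  unfolding dmodel_def by (blast intro: model_iso)

context glrep
begin

lemma X1_high: "deg \<alpha> \<ge> deg \<beta> + 2 \<Longrightarrow> X1 E (mon \<alpha>) j (Poly_Mapping.single \<beta> m) = 0"
proof -
  assume \<alpha>: "deg \<alpha> \<ge> deg \<beta> + 2"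
  have "T (pd i (mon \<alpha>)) (Poly_Mapping.single \<beta> m') = 0" for i and m' :: 'w
  proof (cases "Poly_Mapping.lookup \<alpha> i = 0")
    case True
    then show ?thesis by (simp add: pd_single T_simps)
  next
    case False
    then have "\<alpha> = (\<alpha> - e1 i) + e1 i" using minus_e1_add(1)[OF False, of "e1 i"] by simp
    then have "deg \<alpha> = deg (\<alpha> - e1 i) + 1" by (metis deg_add deg_e1)
    with \<alpha> show ?thesis unfolding pd_single by (intro T_mon_single_0) simp
  qed
  moreover have "T (mon \<alpha>) (Poly_Mapping.single (\<beta> + e1 j) m) = 0"
    using \<alpha> by (intro T_mon_single_0) (simp add: deg_add)
  ultimately show ?thesis by (simp add: X1_def dd_single E_simps)
qed

lemma smooth_X: "\<exists>m. \<forall>\<alpha> j. deg \<alpha> \<ge> m \<longrightarrow> X1 E (mon \<alpha>) j g = 0"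
proof (induction g rule: pm_induct)
  case zero
  show ?case by (simp add: X1_simps)
next
  case (single \<beta> m)
  show ?case using X1_high by blast
next
  case (add g h)
  then obtain m m' where "\<forall>\<alpha> j. deg \<alpha> \<ge> m \<longrightarrow> X1 E (mon \<alpha>) j g = 0" "\<forall>\<alpha> j. deg \<alpha> \<ge> m' \<longrightarrow> X1 E (mon \<alpha>) j h = 0"
    by blast
  then show ?case by (intro exI[of _ "max m m'"]) (simp add: X1_simps)
qed

lemma A1_X: "vfrep.A1 (X E) p j g = X1 E p j g"
  using X_single_field[of j p g] vfrep_X by (simp add: vfrep.A1_def fld_def)

end

section \<open>Representations of the general linear Lie algebra\<close>

definition glact :: "('n::finite \<Rightarrow> 'n \<Rightarrow> 'w::cvs \<Rightarrow> 'w) \<Rightarrow> 'n sq_matrix \<Rightarrow> 'w \<Rightarrow> 'w" where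
  "glact E B w = (\<Sum>i\<in>UNIV. \<Sum>j\<in>UNIV. scl (B $ i $ j) (E i j w))"

lemma gl_simps [simp]: "carrier gl = UNIV" "x \<oplus>\<^bsub>gl\<^esub> y = x + y" "c \<odot>\<^bsub>gl\<^esub> x = (\<chi> i j. c * x $ i $ j)"
  "bracket gl x y = x ** y - y ** x"
  by (simp_all add: gl_def)

context glrep
begin

lemma glact_matunit: "glact E (matunit i j) w = E i j w"
proof -
  have "glact E (matunit i j) w = (\<Sum>a\<in>UNIV. \<Sum>b\<in>UNIV. if b = j then (if a = i then E i j w else 0) else 0)"
    unfolding glact_def by (intro sum.cong refl) (auto simp: matunit_def)
  then show ?thesis by simp
qed

lemma clin_glact: "clin (glact E B)"
  unfolding glact_def by (intro clin_sumf clin_scale clin_E)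

lemma glact_add: "glact E (B + B') w = glact E B w + glact E B' w"
  by (simp add: glact_def scl_add_left sum.distrib)

lemma glact_scl: "glact E (\<chi> i j. c * B $ i $ j) w = scl c (glact E B w)"
  by (simp add: glact_def scl_sum)

lemma glact_bracket: "glact E (B ** B' - B' ** B) w = glact E B (glact E B' w) - glact E B' (glact E B w)"
proof -
  let ?S = "\<lambda>B B' F. \<Sum>i\<in>UNIV. \<Sum>j\<in>UNIV. \<Sum>k\<in>UNIV. \<Sum>l\<in>UNIV. scl (B $ i $ j * B' $ k $ l) (F i j k l)"
  have 1: "glact E B (glact E B' w) = ?S B B' (\<lambda>i j k l. E i j (E k l w))" for B B'
    by (simp add: glact_def E_simps scl_sum)
  have swap: "?S B' B (\<lambda>i j k l. F i j k l) = ?S B B' (\<lambda>i j k l. F k l i j)" for F :: "'n \<Rightarrow> 'n \<Rightarrow> 'n \<Rightarrow> 'n \<Rightarrow> 'w"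
  proof -
    let ?f = "\<lambda>i j k l. scl (B' $ i $ j * B $ k $ l) (F i j k l)"
    have "?S B' B (\<lambda>i j k l. F i j k l) = (\<Sum>i\<in>UNIV. \<Sum>k\<in>UNIV. \<Sum>j\<in>UNIV. \<Sum>l\<in>UNIV. ?f i j k l)"
      by (rule sum.cong[OF refl], rule sum.swap)
    also have "\<dots> = (\<Sum>i\<in>UNIV. \<Sum>k\<in>UNIV. \<Sum>l\<in>UNIV. \<Sum>j\<in>UNIV. ?f i j k l)"
      by (rule sum.cong[OF refl], rule sum.cong[OF refl], rule sum.swap)
    also have "\<dots> = (\<Sum>k\<in>UNIV. \<Sum>i\<in>UNIV. \<Sum>l\<in>UNIV. \<Sum>j\<in>UNIV. ?f i j k l)" by (rule sum.swap)
    also have "\<dots> = (\<Sum>k\<in>UNIV. \<Sum>l\<in>UNIV. \<Sum>i\<in>UNIV. \<Sum>j\<in>UNIV. ?f i j k l)"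
      by (rule sum.cong[OF refl], rule sum.swap)
    finally show ?thesis by (simp add: mult.commute)
  qed
  have "glact E B (glact E B' w) - glact E B' (glact E B w) =
      ?S B B' (\<lambda>i j k l. (if k = j then E i l w else 0) - (if l = i then E k j w else 0))"
    unfolding 1 swap[of "\<lambda>i j k l. E i j (E k l w)"]
    by (simp add: sum_subtractf[symmetric] cvs.scale_right_diff_distrib[symmetric] E_bracket eq_commute)
  also have "\<dots> = (\<Sum>i\<in>UNIV. \<Sum>j\<in>UNIV. \<Sum>l\<in>UNIV. scl (B $ i $ j * B' $ j $ l) (E i l w))
      - (\<Sum>i\<in>UNIV. \<Sum>j\<in>UNIV. \<Sum>k\<in>UNIV. scl (B $ i $ j * B' $ k $ i) (E k j w))"
  proof -
    have "(\<Sum>k\<in>UNIV. \<Sum>l\<in>UNIV. scl (B $ i $ j * B' $ k $ l) (if k = j then E i l w else 0)) =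
        (\<Sum>l\<in>UNIV. scl (B $ i $ j * B' $ j $ l) (E i l w))" for i j
      by (subst sum.swap) (simp add: if_distrib[of "scl _"] cong: if_cong)
    moreover have "(\<Sum>k\<in>UNIV. \<Sum>l\<in>UNIV. scl (B $ i $ j * B' $ k $ l) (if l = i then E k j w else 0)) =
        (\<Sum>k\<in>UNIV. scl (B $ i $ j * B' $ k $ i) (E k j w))" for i j
      by (simp add: if_distrib[of "scl _"] cong: if_cong)
    ultimately show ?thesis by (simp add: cvs.scale_right_diff_distrib sum_subtractf)
  qed
  also have "\<dots> = glact E (B ** B') w - glact E (B' ** B) w"
  proof -
    have "(\<Sum>i\<in>UNIV. \<Sum>j\<in>UNIV. \<Sum>l\<in>UNIV. scl (B $ i $ j * B' $ j $ l) (E i l w)) = glact E (B ** B') w"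
      unfolding glact_def matrix_matrix_mult_def
      by (rule sum.cong[OF refl], subst sum.swap) (simp add: cvs.scale_sum_left)
    moreover have "(\<Sum>i\<in>UNIV. \<Sum>j\<in>UNIV. \<Sum>k\<in>UNIV. scl (B $ i $ j * B' $ k $ i) (E k j w)) = glact E (B' ** B) w"
    proof -
      have "(\<Sum>i\<in>UNIV. \<Sum>j\<in>UNIV. \<Sum>k\<in>UNIV. scl (B $ i $ j * B' $ k $ i) (E k j w)) =
          (\<Sum>i\<in>UNIV. \<Sum>k\<in>UNIV. \<Sum>j\<in>UNIV. scl (B $ i $ j * B' $ k $ i) (E k j w))"
        by (rule sum.cong[OF refl], rule sum.swap)
      also have "\<dots> = (\<Sum>k\<in>UNIV. \<Sum>i\<in>UNIV. \<Sum>j\<in>UNIV. scl (B $ i $ j * B' $ k $ i) (E k j w))"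
        by (rule sum.swap)
      also have "\<dots> = (\<Sum>k\<in>UNIV. \<Sum>j\<in>UNIV. \<Sum>i\<in>UNIV. scl (B $ i $ j * B' $ k $ i) (E k j w))"
        by (rule sum.cong[OF refl], rule sum.swap)
      also have "\<dots> = glact E (B' ** B) w"
        by (simp add: glact_def matrix_matrix_mult_def cvs.scale_sum_left mult.commute)
      finally show ?thesis .
    qed
    ultimately show ?thesis by simp
  qed
  also have "\<dots> = glact E (B ** B' - B' ** B) w"
    using glact_add[of "B ** B' - B' ** B" "B' ** B" w] by (simp add: algebra_simps)
  finally show ?thesis ..
qed

end

locale gmodel = model "UNIV :: 'n sq_matrix set" M f C "glact E" + glrep E
  for M :: "('n::finite, 'm) gl_rep" and f :: "'m \<Rightarrow> 'w::cvs" and C :: "'w set" and E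
begin

lemma f_E: "m \<in> carrier M \<Longrightarrow> f (act M (matunit i j) m) = E i j (f m)"
  by (simp add: f_act glact_matunit)

lemma E_C: "w \<in> C \<Longrightarrow> E i j w \<in> C"
proof -
  assume "w \<in> C"
  then obtain m where m: "m \<in> carrier M" "f m = w" using f_ex by blast
  then show "E i j w \<in> C" using f_E[OF m(1), of i j] f_in[OF act_in[of "matunit i j" m]] by simp
qed

lemma inv_C: "inv_sub (case_prod E) C"
  by (auto simp: inv_sub_def csub_C E_C)

lemma lie_module: "lie_module gl M"
proof -
  have eq: "u = v" if "u \<in> carrier M" "v \<in> carrier M" "f u = f v" for u v
    using that f_inj by blast
  show ?thesis
  proof (intro lie_module.intro lie_module_axioms.intro vectorspace)
    fix x y :: "'n sq_matrix" and v w c assume v: "v \<in> carrier M"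
    show "act M x v \<in> carrier M" using v by (simp add: act_in)
    show "act M (x \<oplus>\<^bsub>gl\<^esub> y) v = act M x v \<oplus>\<^bsub>M\<^esub> act M y v"
      using v by (intro eq) (simp_all add: act_in add_in f_act f_add glact_add)
    show "act M (c \<odot>\<^bsub>gl\<^esub> x) v = c \<odot>\<^bsub>M\<^esub> act M x v"
      using v by (intro eq) (simp_all add: act_in smult_in f_act f_smult glact_scl)
    show "act M x (c \<odot>\<^bsub>M\<^esub> v) = c \<odot>\<^bsub>M\<^esub> act M x v"
      using v by (intro eq) (simp_all add: act_in smult_in f_act f_smult clin_simps[OF clin_glact])
    show "act M (bracket gl x y) v = act M x (act M y v) \<ominus>\<^bsub>M\<^esub> act M y (act M x v)"
      unfolding gl_simps
      using v by (intro eq) (simp_all add: act_in vs.M.minus_closed f_act f_minus glact_bracket)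
    assume w: "w \<in> carrier M"
    show "act M x (v \<oplus>\<^bsub>M\<^esub> w) = act M x v \<oplus>\<^bsub>M\<^esub> act M x w"
      using v w by (intro eq) (simp_all add: act_in add_in f_act f_add clin_simps[OF clin_glact])
  qed
qed

lemma lie_submodule_iff: "lie_submodule gl M N \<longleftrightarrow> N \<subseteq> carrier M \<and> inv_sub (case_prod E) (f ` N)"
proof -
  have "(\<forall>x. \<forall>v\<in>N. act M x v \<in> N) \<longleftrightarrow> (\<forall>i j. \<forall>w\<in>f ` N. E i j w \<in> f ` N)"
    if N: "N \<subseteq> carrier M" "csub (f ` N)"
  proof
    assume *: "\<forall>x. \<forall>v\<in>N. act M x v \<in> N"
    show "\<forall>i j. \<forall>w\<in>f ` N. E i j w \<in> f ` N"
    proof (intro allI ballI)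
      fix i j w assume "w \<in> f ` N"
      then obtain v where v: "v \<in> N" "w = f v" by blast
      then have "f (act M (matunit i j) v) = E i j w" using N(1) f_E by blast
      moreover have "act M (matunit i j) v \<in> N" using * v by blast
      ultimately show "E i j w \<in> f ` N" by (metis imageI)
    qed
  next
    assume *: "\<forall>i j. \<forall>w\<in>f ` N. E i j w \<in> f ` N"
    show "\<forall>x. \<forall>v\<in>N. act M x v \<in> N"
    proof (intro allI ballI)
      fix x v assume v: "v \<in> N"
      have "glact E x (f v) \<in> f ` N" unfolding glact_def using * v
        by (intro csub_sum[OF N(2)] csub_scl[OF N(2)]) blast
      then have "f (act M x v) \<in> f ` N" using v N by (auto simp: f_act)
      then obtain u where "u \<in> N" "f (act M x v) = f u" by blast
      then show "act M x v \<in> N" using v N(1) f_inj[OF act_in[of x v]] by blast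
    qed
  qed
  then show ?thesis unfolding lie_submodule_def subspace_iff inv_sub_def by auto
qed

lemma simple_iff: "simple_lie_module gl M \<longleftrightarrow> irr (case_prod E) C"
  unfolding simple_lie_module_def using lie_module invariant_subspaces[OF lie_submodule_iff inv_C] by simp

end

lemma matunit_mult: "matunit i j ** matunit k l = (if j = k then matunit i l else 0)"
  by (auto simp: matunit_def matrix_matrix_mult_def vec_eq_iff if_distrib[of "\<lambda>x. x * _"] cong: if_cong)

lemma gl_module_embed:
  fixes M :: "('n::finite, 'm) gl_rep"
  assumes "lie_module gl M"
  obtains f :: "'m \<Rightarrow> 'm \<Rightarrow>\<^sub>0 complex" and C E where "gmodel M f C E"
proof -
  interpret V: lie_module gl M by fact
  note acts = V.act_closed[simplified] V.act_add[simplified] V.act_smult[simplified]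
  obtain \<iota> :: "'m \<Rightarrow> 'm \<Rightarrow>\<^sub>0 complex" and \<pi> where
    \<pi>: "\<And>x. \<pi> x \<in> carrier M" "\<And>x y. \<pi> (x + y) = \<pi> x \<oplus>\<^bsub>M\<^esub> \<pi> y" "\<And>c x. \<pi> (scl c x) = c \<odot>\<^bsub>M\<^esub> \<pi> x"
    and \<pi>\<iota>: "\<And>v. v \<in> carrier M \<Longrightarrow> \<pi> (\<iota> v) = v"
    and \<iota>: "\<And>u v. u \<in> carrier M \<Longrightarrow> v \<in> carrier M \<Longrightarrow> \<iota> (u \<oplus>\<^bsub>M\<^esub> v) = \<iota> u + \<iota> v"
      "\<And>c v. v \<in> carrier M \<Longrightarrow> \<iota> (c \<odot>\<^bsub>M\<^esub> v) = scl c (\<iota> v)"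
    by (rule embed[OF V.vectorspace_axioms], rule that)
  define a where "a B x = \<iota> (act M B (\<pi> x))" for B x
  define E where "E i j = a (matunit i j)" for i j
  have \<iota>0: "\<iota> \<zero>\<^bsub>M\<^esub> = 0" using \<iota>(1)[of "\<zero>\<^bsub>M\<^esub>" "\<zero>\<^bsub>M\<^esub>"] by simp
  have \<iota>m: "\<iota> (u \<ominus>\<^bsub>M\<^esub> v) = \<iota> u - \<iota> v" if "u \<in> carrier M" "v \<in> carrier M" for u v
  proof -
    have "u = (u \<ominus>\<^bsub>M\<^esub> v) \<oplus>\<^bsub>M\<^esub> v" using that by (simp add: a_minus_def V.M.a_assoc V.M.l_neg)
    then show ?thesis using \<iota>(1)[of "u \<ominus>\<^bsub>M\<^esub> v" v] that by (simp add: eq_diff_eq)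
  qed
  have a_add: "a (B + B') x = a B x + a B' x" for B B' x
    using V.add_act[of B B' "\<pi> x"] by (simp add: a_def \<pi> \<iota> acts)
  have a_scl: "a (\<chi> i j. c * B $ i $ j) x = scl c (a B x)" for c B x
    using V.smult_act[of B "\<pi> x" c] by (simp add: a_def \<pi> \<iota> acts)
  have a_bracket: "a (B ** B' - B' ** B) x = a B (a B' x) - a B' (a B x)" for B B' x
    using V.bracket_act[of B B' "\<pi> x"] by (simp add: a_def \<pi> \<iota>m acts \<pi>\<iota>)
  have clin_a: "clin (a B)" for B
    unfolding a_def by (rule clinI) (simp_all add: \<pi> \<iota> acts)
  have a0: "a 0 x = 0" for x using a_add[of 0 0 x] by simp
  have a_minus: "a (B - B') x = a B x - a B' x" for B B' x
    using a_add[of "B - B'" B' x] by simp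
  have a_sum: "a (sum g S) x = (\<Sum>s\<in>S. a (g s) x)" for g :: "'n \<Rightarrow> 'n sq_matrix" and S x
    by (induction S rule: infinite_finite_induct) (simp_all add: a0 a_add)
  have a_glact: "a B = glact E B" for B
  proof
    fix x
    have "(\<Sum>i\<in>UNIV. \<Sum>j\<in>UNIV. (\<chi> k l. B $ i $ j * matunit i j $ k $ l)) $ k $ l = B $ k $ l" for k l
    proof -
      have "(\<Sum>i\<in>UNIV. \<Sum>j\<in>UNIV. (\<chi> k l. B $ i $ j * matunit i j $ k $ l)) $ k $ l =
          (\<Sum>i\<in>UNIV. \<Sum>j\<in>UNIV. B $ i $ j * matunit i j $ k $ l)"
        by (simp add: sum_component)
      also have "\<dots> = (\<Sum>i\<in>UNIV. \<Sum>j\<in>UNIV. if j = l then (if i = k then B $ k $ l else 0) else 0)"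
        by (intro sum.cong refl) (auto simp: matunit_def)
      finally show ?thesis by simp
    qed
    then have "B = (\<Sum>i\<in>UNIV. \<Sum>j\<in>UNIV. (\<chi> k l. B $ i $ j * matunit i j $ k $ l))"
      by (simp add: vec_eq_iff)
    then have "a B x = a (\<Sum>i\<in>UNIV. \<Sum>j\<in>UNIV. (\<chi> k l. B $ i $ j * matunit i j $ k $ l)) x" by simp
    also have "\<dots> = glact E B x" by (simp only: a_sum a_scl glact_def E_def)
    finally show "a B x = glact E B x" .
  qed
  have "gmodel M \<iota> (\<iota> ` carrier M) E"
  proof
    show "csub (\<iota> ` carrier M)"
      unfolding csub_def
    proof (intro conjI ballI allI)
      show "0 \<in> \<iota> ` carrier M" using \<iota>0 V.M.zero_closed by (metis imageI)
      show "x + y \<in> \<iota> ` carrier M" if "x \<in> \<iota> ` carrier M" "y \<in> \<iota> ` carrier M" for x y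
        using that \<iota>(1) V.M.add.m_closed by (metis (no_types, lifting) imageE imageI)
      show "scl c x \<in> \<iota> ` carrier M" if "x \<in> \<iota> ` carrier M" for c x
        using that \<iota>(2) V.smult_closed by (metis (no_types, lifting) imageE imageI complex_ring_simps(1) UNIV_I)
    qed
    show "bij_betw \<iota> (carrier M) (\<iota> ` carrier M)"
      using \<pi>\<iota> by (intro inj_on_imp_bij_betw inj_on_inverseI)
    show "\<iota> (act M x v) = glact E x (\<iota> v)" if "v \<in> carrier M" for x v
      using that by (simp add: a_glact[symmetric] a_def \<pi>\<iota>)
    show "clin (E i j)" for i j unfolding E_def by (rule clin_a)
    show "E i j (E k l w) - E k l (E i j w) =
        (if j = k then E i l w else 0) - (if l = i then E k j w else 0)" for i j k l w
      unfolding E_def a_bracket[symmetric] matunit_mult by (simp add: a_minus a0)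
  qed (auto simp: \<iota>0 \<iota> acts)
  with that show ?thesis by blast
qed

text \<open>The carrier stays in the type of \<open>V\<close>, where the classification has to find \<open>M\<close>.\<close>

lemma (in dmodel) coefficient_module:
  obtains M :: "('n, 'v) gl_rep" where "gmodel M f (K1 C) EV"
proof -
  interpret EV: glrep EV by (rule glrep_EV)
  define g where "g = inv_into (carrier V) f"
  have g: "g w \<in> carrier V" "f (g w) = w" if "w \<in> C" for w
    using that f_image by (auto simp: g_def inv_into_into f_inv_into_f)
  have inv: "inv_sub (case_prod EV) (K1 C)" by (rule K1_inv[OF inv_C])
  have csub_K: "csub (K1 C)" and EV_K: "\<And>i j w. w \<in> K1 C \<Longrightarrow> EV i j w \<in> K1 C"
    using inv by (auto simp: inv_sub_def)
  have act_K: "glact EV B w \<in> K1 C" if "w \<in> K1 C" for B w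
    unfolding glact_def by (intro csub_sum csub_scl csub_K EV_K that)
  have K_C: "K1 C \<subseteq> C" by (auto simp: K1_def)
  define M :: "('n, 'v) gl_rep" where "M = \<lparr>carrier = {v \<in> carrier V. f v \<in> K1 C}, mult = undefined,
    one = undefined, zero = \<zero>\<^bsub>V\<^esub>, add = (\<oplus>\<^bsub>V\<^esub>), smult = (\<odot>\<^bsub>V\<^esub>), act = (\<lambda>B v. g (glact EV B (f v)))\<rparr>"
  have "gmodel M f (K1 C) EV"
  proof
    show "bij_betw f (carrier M) (K1 C)"
      using bij K_C by (auto simp: M_def bij_betw_def inj_on_def image_iff)
  qed (auto simp: M_def csub_K zero_in f_zero csub_0 add_in f_add csub_add smult_in f_smult csub_scl
      g act_K subsetD[OF K_C] EV.clin_E EV.E_bracket)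
  with that show ?thesis by blast
qed

section \<open>Coordinates on \<open>P\<^sub>0\<close>\<close>

text \<open>Polynomials form a representation of the fields, which makes
  \<open>vf.dpw \<beta>\<close> the differential operator \<partial>^\<beta>.\<close>

interpretation vf: vfrep vf
proof
  show "clin (vf f)" for f :: "'n::finite \<Rightarrow> 'n mpol"
    by (rule clinI) (simp_all only: vf_add vf_cst cst_mult[symmetric])
  show "vf (\<lambda>k. f k + h k) v = vf f v + vf h v" for f h :: "'n::finite \<Rightarrow> 'n mpol" and v
    by (simp add: vf_def algebra_simps sum.distrib)
  show "vf (\<lambda>k. scl c (f k)) v = scl c (vf f v)" for f :: "'n::finite \<Rightarrow> 'n mpol" and c v
    by (simp add: vf_def scl_mult_left scl_sum)
  show "vf (vbr f h) v = vf f (vf h v) - vf h (vf f v)" for f h :: "'n::finite \<Rightarrow> 'n mpol" and v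
    by (rule vf_vbr)
qed

lemma vf_AD: "vf.AD i p = pd i p"
proof -
  have "fld i 1 = (\<lambda>j. if j = i then 1 else 0)" by (intro ext) (simp add: fld_def)
  then show ?thesis by (simp add: vf.A1_def pd_vf)
qed

lemma clin_mult: "clin (\<lambda>q :: 'n mpol. f * q)"
  by (rule clinI) (simp_all add: distrib_left scl_mult_left[symmetric] mult.commute[of f])

lemma clin_mult_right: "clin (\<lambda>q :: 'n mpol. q * f)"
  using clin_mult[of f] by (simp add: mult.commute)

lemma dpw_tvar: "vf.dpw \<beta> (tvar i * p) =
    tvar i * vf.dpw \<beta> p + scl (of_nat (Poly_Mapping.lookup \<beta> i)) (vf.dpw (\<beta> - e1 i) p)"
proof (induction "deg \<beta>" arbitrary: \<beta>)
  case 0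
  then show ?case by (simp add: deg_eq_0_iff)
next
  case (Suc n)
  then have "deg \<beta> \<noteq> 0" by simp
  then obtain k \<gamma> where \<gamma>: "\<beta> = \<gamma> + e1 k" "deg \<beta> = Suc (deg \<gamma>)" by (rule deg_Suc)
  note IH = Suc(1)[of \<gamma>]
  have "vf.dpw \<beta> (tvar i * p) = pd k (tvar i * vf.dpw \<gamma> p +
      scl (of_nat (Poly_Mapping.lookup \<gamma> i)) (vf.dpw (\<gamma> - e1 i) p))"
    using IH Suc(2) \<gamma> by (simp add: vf.dpw_add_e1 vf_AD)
  also have "\<dots> = tvar i * vf.dpw \<beta> p + (if k = i then vf.dpw \<gamma> p else 0) +
      scl (of_nat (Poly_Mapping.lookup \<gamma> i)) (vf.dpw (\<gamma> - e1 i + e1 k) p)"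
    by (simp add: clin_simps[OF clin_pd] pd_mult pd_tvar \<gamma>(1) vf.dpw_add_e1 vf_AD)
  also have "\<dots> = tvar i * vf.dpw \<beta> p + scl (of_nat (Poly_Mapping.lookup \<beta> i)) (vf.dpw (\<beta> - e1 i) p)"
  proof (cases "Poly_Mapping.lookup \<gamma> i = 0")
    case True
    then show ?thesis by (auto simp: \<gamma>(1) lookup_add lookup_single when_def)
  next
    case False
    then have eq: "\<gamma> - e1 i + e1 k = \<gamma> + e1 k - e1 i" by (simp add: minus_e1_add(1))
    show ?thesis
      unfolding \<gamma>(1) eq by (auto simp: lookup_add lookup_single when_def scl_add_left)
  qed
  finally show ?case .
qed

text \<open>\<open>dop u\<close> is the differential operator with symbol \<open>u\<close>, polynomial coefficients on the left.\<close>

definition dop :: "(('n::finite \<Rightarrow>\<^sub>0 nat) \<Rightarrow>\<^sub>0 'n mpol) \<Rightarrow> 'n mpol \<Rightarrow> 'n mpol" where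
  "dop u p = pext (\<lambda>\<beta> f. f * vf.dpw \<beta> p) u"

lemma clin_dop_left: "clin (\<lambda>u. dop u p)"
  unfolding dop_def by (intro clin_pext clin_mult_right)

lemma clin_dop: "clin (dop u)"
  unfolding dop_def pext_def by (intro clin_sumf clin_comp[OF clin_mult vf.clin_dpw])

lemmas dop_simps = clin_simps[OF clin_dop] clin_simps[OF clin_dop_left]

lemma dop_single: "dop (Poly_Mapping.single \<beta> f) p = f * vf.dpw \<beta> p"
  by (simp add: dop_def)

lemma dop_id: "dop (Poly_Mapping.single 0 1) = id"
  by (intro ext) (simp only: dop_single vf.dpw_zero id_apply mult_1_left)

lemma dop_mult: "f * dop u p = dop (pmap (\<lambda>q. f * q) u) p"
  by (rule clin_eqI[OF clin_comp[OF clin_mult clin_dop_left] clin_comp[OF clin_dop_left clin_pmap[OF clin_mult]]])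
    (simp add: dop_single mult.assoc)

lemma dop_pd: "pd i (dop u p) = dop (pmap (pd i) u + dd i u) p"
  by (rule clin_eqI[OF clin_comp[OF clin_pd clin_dop_left]
        clin_comp[OF clin_dop_left clin_plus[OF clin_pmap[OF clin_pd] clin_dd]]])
    (simp add: dop_single dop_simps dd_single pd_mult vf.dpw_add_e1 vf_AD clin_simps[OF clin_pd])

text \<open>\<open>T (tvar i)\<close> on symbols already contains the factor -\<beta>_i of P0,
  whereas \<partial>^\<beta> t_i produces +\<beta>_i; hence the minus sign.\<close>

lemma dop_tvar: "dop u (tvar i * p) = dop (pmap (\<lambda>q. tvar i * q) u - T (tvar i) u) p"
  by (rule clin_eqI[OF clin_dop_left clin_comp[OF clin_dop_left clin_sub[OF clin_pmap[OF clin_mult] clin_T]]])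
    (simp add: dop_single dop_simps T_tvar_single dpw_tvar distrib_left mult.assoc mult.left_commute
      scl_mult_left clin_simps[OF clin_mult])

text \<open>By \<open>dop_tvar\<close>, \<open>T (tvar i)\<close> acts on symbols as the commutator
  of t_i with the operator. The symbols of the zero operator are thus stable under all T, and
  \<open>T_lowers\<close> leads to a nonzero symbol of order 0, which p = 1 detects.\<close>

lemma dop_eq_0:
  assumes "\<And>p. dop u p = 0"
  shows "u = 0"
proof (rule ccontr)
  assume u: "u \<noteq> 0"
  let ?N = "{u. \<forall>p. dop u p = 0}"
  have "\<forall>u\<in>?N. T f u \<in> ?N" for f
  proof (induction f rule: mpol_induct)
    case (tvar i)
    have "dop (T (tvar i) u) p = 0" if "u \<in> ?N" for u p
      using that dop_tvar[of u i p] dop_mult[of "tvar i" u p] by (simp add: dop_simps)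
    then show ?case by blast
  qed (simp_all add: T_cst T_mult T_simps dop_simps)
  then have "T f u \<in> ?N" for f using assms by blast
  moreover have "csub ?N" by (simp add: csub_def dop_simps)
  ultimately obtain \<gamma> where \<gamma>: "Poly_Mapping.lookup u \<gamma> \<noteq> 0"
    "Poly_Mapping.single 0 (Poly_Mapping.lookup u \<gamma>) \<in> ?N"
    by (rule T_lowers[OF u])
  then have "dop (Poly_Mapping.single 0 (Poly_Mapping.lookup u \<gamma>)) 1 = 0" by blast
  with \<gamma>(1) show False by (simp add: dop_single)
qed

lemma dop_inj: "dop u = dop v \<longleftrightarrow> u = v"
proof
  assume "dop u = dop v"
  then have "dop (u - v) p = 0" for p by (simp add: dop_simps)
  then have "u - v = 0" by (rule dop_eq_0)
  then show "u = v" by simp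
qed simp

lemma mult_weyl: "(\<lambda>p. f * p) \<in> weyl"
proof (induction f rule: mpol_induct)
  case (cst c)
  show ?case by (rule weyl.const)
next
  case (tvar i)
  show ?case by (rule weyl.var)
next
  case (add f g)
  then show ?case using weyl.add by (simp add: distrib_right)
next
  case (mult f g)
  show ?case using weyl.comp[OF mult] by (simp add: comp_def mult.assoc)
qed

lemma dpw_weyl: "vf.dpw \<beta> \<in> weyl"
proof (induction "deg \<beta>" arbitrary: \<beta>)
  case 0
  have "vf.dpw \<beta> = (\<lambda>p. 1 * p)" using 0 by (intro ext) (simp add: deg_eq_0_iff)
  then show ?case by (simp only: mult_weyl)
next
  case (Suc n)
  then have "deg \<beta> \<noteq> 0" by simp
  then obtain k \<gamma> where \<gamma>: "\<beta> = \<gamma> + e1 k" "deg \<beta> = Suc (deg \<gamma>)" by (rule deg_Suc)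
  have "vf.dpw \<beta> = pd k \<circ> vf.dpw \<gamma>" by (intro ext) (simp add: \<gamma>(1) vf.dpw_add_e1 vf_AD)
  moreover have "vf.dpw \<gamma> \<in> weyl" using Suc \<gamma> by simp
  ultimately show ?case using weyl.comp[OF weyl.pd] by simp
qed

lemma dop_weyl: "dop u \<in> weyl"
proof (induction u rule: pm_induct)
  case zero
  have "dop 0 = (\<lambda>p :: 'a mpol. 0 * p)" by (intro ext) (simp add: dop_simps)
  then show ?case by (simp only: mult_weyl)
next
  case (single \<beta> f)
  have "dop (Poly_Mapping.single \<beta> f) = (\<lambda>p. f * p) \<circ> vf.dpw \<beta>" by (intro ext) (simp add: dop_single)
  then show ?case by (simp only: weyl.comp[OF mult_weyl dpw_weyl])
next
  case (add u v)
  have "dop (u + v) = (\<lambda>p. dop u p + dop v p)" by (intro ext) (simp add: dop_simps)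
  then show ?case by (simp only: weyl.add[OF add])
qed

text \<open>The induction on A concerns all composites with some \<open>dop v\<close>, so only left
  multiplication by generators has to be brought into normal form; taking the identity for
  \<open>dop v\<close> gives the claim.\<close>

lemma weyl_eq: "weyl = range dop"
proof
  have "A \<in> weyl \<Longrightarrow> \<exists>w. A \<circ> dop v = dop w" for A :: "'a mpol \<Rightarrow> 'a mpol" and v
  proof (induction A arbitrary: v rule: weyl.induct)
    case (add A B)
    then obtain a b where "A \<circ> dop v = dop a" "B \<circ> dop v = dop b" by blast
    then have "(\<lambda>p. A p + B p) \<circ> dop v = dop (a + b)" by (simp add: fun_eq_iff dop_simps)
    then show ?case ..
  next
    case (comp A B)
    then obtain b where "B \<circ> dop v = dop b" by blast
    moreover obtain a where "A \<circ> dop b = dop a" using comp by blast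
    ultimately have "A \<circ> B \<circ> dop v = dop a" by (simp add: comp_assoc)
    then show ?case ..
  qed (auto simp: fun_eq_iff dop_mult dop_pd intro!: exI)
  from this[of _ "Poly_Mapping.single 0 1"] show "(weyl :: ('a mpol \<Rightarrow> 'a mpol) set) \<subseteq> range dop"
    unfolding dop_id by auto
qed (use dop_weyl in blast)

text \<open>\<open>residue u\<close> are the coordinates of \<open>dop u\<close> modulo the left ideal generated by the \<open>t\<^sub>i\<close>.\<close>

definition residue :: "(('n::finite \<Rightarrow>\<^sub>0 nat) \<Rightarrow>\<^sub>0 'n mpol) \<Rightarrow> ('n \<Rightarrow>\<^sub>0 nat) \<Rightarrow>\<^sub>0 complex" where
  "residue = pext (\<lambda>\<beta> f. T f (Poly_Mapping.single \<beta> 1))"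

lemma clin_residue: "clin residue"
  unfolding residue_def by (intro clin_pext clin_T_left)

lemmas residue_simps = clin_simps[OF clin_residue]

lemma residue_single: "residue (Poly_Mapping.single \<beta> f) = T f (Poly_Mapping.single \<beta> 1)"
  by (simp add: residue_def T_simps)

lemma residue_mult: "residue (pmap (\<lambda>q. f * q) u) = T f (residue u)"
  by (rule clin_eqI[OF clin_comp[OF clin_residue clin_pmap[OF clin_mult]] clin_comp[OF clin_T clin_residue]])
    (simp add: residue_single T_mult)

lemma residue_pd: "residue (pmap (pd i) u + dd i u) = dd i (residue u)"
  by (rule clin_eqI[OF clin_comp[OF clin_residue clin_plus[OF clin_pmap[OF clin_pd] clin_dd]]
        clin_comp[OF clin_dd clin_residue]])
    (simp add: residue_single residue_simps dd_single dd_T clin_simps[OF clin_pd])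

lemma residue_T: "residue (T (tvar i) u) = T (tvar i) (residue u)"
proof (rule clin_eqI[OF clin_comp[OF clin_residue clin_T] clin_comp[OF clin_T clin_residue]])
  fix \<beta> :: "'a \<Rightarrow>\<^sub>0 nat" and f :: "'a mpol"
  let ?c = "- of_nat (Poly_Mapping.lookup \<beta> i) :: complex"
  have "T (tvar i) (residue (Poly_Mapping.single \<beta> f)) = T f (Poly_Mapping.single (\<beta> - e1 i) (scl ?c 1))"
    unfolding residue_single T_commute[of "tvar i"] T_tvar_single ..
  also have "\<dots> = scl ?c (T f (mon (\<beta> - e1 i)))"
    unfolding scl_single[symmetric] by (rule clin_scl[OF clin_T])
  also have "\<dots> = residue (T (tvar i) (Poly_Mapping.single \<beta> f))"
    unfolding T_tvar_single residue_single by (rule clin_scl[OF clin_T_left, symmetric])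
  finally show "residue (T (tvar i) (Poly_Mapping.single \<beta> f)) = T (tvar i) (residue (Poly_Mapping.single \<beta> f))" ..
qed

lemma clin_cst: "clin (cst :: complex \<Rightarrow> 'n mpol)"
  by (rule clin_single)

lemma residue_cst: "residue (pmap cst g) = g"
  by (rule clin_eqI[OF clin_comp[OF clin_residue clin_pmap[OF clin_cst]] clin_id])
    (simp add: residue_single T_cst)

lemma weyl_ideal_eq: "weyl_ideal = {dop (\<Sum>i\<in>UNIV. pmap (\<lambda>q. tvar i * q) (u i) - T (tvar i) (u i)) | u. True}"
proof -
  have *: "(\<lambda>p. \<Sum>i\<in>UNIV. dop (u i) (tvar i * p)) =
      dop (\<Sum>i\<in>UNIV. pmap (\<lambda>q. tvar i * q) (u i) - T (tvar i) (u i))" for u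
    by (intro ext) (simp add: dop_tvar clin_sum[OF clin_dop_left])
  show ?thesis
  proof (intro equalityI subsetI)
    fix x assume "x \<in> weyl_ideal"
    then obtain A where A: "x = (\<lambda>p. \<Sum>i\<in>UNIV. A i (tvar i * p))" "\<forall>i. A i \<in> range dop"
      unfolding weyl_ideal_def weyl_eq by blast
    from A(2) have "\<exists>u. \<forall>i. A i = dop (u i)" by (intro choice) blast
    then obtain u where "\<And>i. A i = dop (u i)" by blast
    then show "x \<in> {dop (\<Sum>i\<in>UNIV. pmap (\<lambda>q. tvar i * q) (u i) - T (tvar i) (u i)) | u. True}"
      unfolding A(1) using * by auto
  next
    fix x assume "x \<in> {dop (\<Sum>i\<in>UNIV. pmap (\<lambda>q. tvar i * q) (u i) - T (tvar i) (u i)) | u. True}"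
    then obtain u where "x = (\<lambda>p. \<Sum>i\<in>UNIV. dop (u i) (tvar i * p))" unfolding *[symmetric] by blast
    then show "x \<in> weyl_ideal" unfolding weyl_ideal_def
      using dop_weyl by (intro CollectI exI[of _ "\<lambda>i. dop (u i)"]) auto
  qed
qed

text \<open>The residue vanishes on the generators of the ideal. Conversely J w, the difference
  between w and its residue with constant coefficients, lies in the ideal: it is 0 for w =
  \<partial>^\<beta>, and the property survives multiplication by polynomials because t_i x - x t_i
  and t_i x differ by elements of known type, namely by the generator \<open>gen\<close>.\<close>

lemma weyl_ideal_iff: "dop u \<in> weyl_ideal \<longleftrightarrow> residue u = 0"
proof
  assume "dop u \<in> weyl_ideal"
  then obtain v where "u = (\<Sum>i\<in>UNIV. pmap (\<lambda>q. tvar i * q) (v i) - T (tvar i) (v i))"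
    unfolding weyl_ideal_eq by (auto simp: dop_inj)
  then show "residue u = 0" by (simp add: residue_simps residue_mult residue_T)
next
  assume u: "residue u = 0"
  let ?k = "\<lambda>v :: 'a \<Rightarrow> ('a \<Rightarrow>\<^sub>0 nat) \<Rightarrow>\<^sub>0 'a mpol. \<Sum>i\<in>UNIV. pmap (\<lambda>q. tvar i * q) (v i) - T (tvar i) (v i)"
  define I where "I = range ?k"
  have clin: "clin (\<lambda>w. pmap (\<lambda>q. tvar i * q) w - T (tvar i) w)" for i :: 'a
    by (intro clin_sub clin_pmap clin_mult clin_T)
  have m: "?k v \<in> range ?k" for v by (rule rangeI)
  have I: "csub I"
    unfolding csub_def I_def
  proof (intro conjI ballI allI)
    have "?k (\<lambda>_. 0) = 0" by (simp only: clin_0[OF clin] sum.neutral_const)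
    with m[of "\<lambda>_. 0"] show "0 \<in> range ?k" by simp
    fix x y c assume "x \<in> range ?k"
    then obtain v where v: "x = ?k v" by blast
    have "?k (\<lambda>i. scl c (v i)) = scl c (?k v)" by (simp only: clin_scl[OF clin] scl_sum)
    with m[of "\<lambda>i. scl c (v i)"] show "scl c x \<in> range ?k" unfolding v by simp
    assume "y \<in> range ?k"
    then obtain w where w: "y = ?k w" by blast
    have "?k (\<lambda>i. v i + w i) = ?k v + ?k w" by (simp only: clin_add[OF clin] sum.distrib)
    with m[of "\<lambda>i. v i + w i"] show "x + y \<in> range ?k" unfolding v w by simp
  qed
  have gen: "pmap (\<lambda>q. tvar i * q) w - T (tvar i) w \<in> I" for i w
  proof -
    have "?k (\<lambda>j. if j = i then w else 0) = (\<Sum>j\<in>UNIV. if j = i then pmap (\<lambda>q. tvar i * q) w - T (tvar i) w else 0)"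
      by (rule sum.cong[OF refl]) (simp add: T_simps)
    also have "\<dots> = pmap (\<lambda>q. tvar i * q) w - T (tvar i) w" by simp
    finally show ?thesis unfolding I_def using m[of "\<lambda>j. if j = i then w else 0"] by simp
  qed
  have mult_I: "pmap (\<lambda>q. f * q) w \<in> I" if "w \<in> I" for f w
  proof -
    have c: "pmap (\<lambda>q. f * q) (pmap (\<lambda>q. tvar i * q) x) = pmap (\<lambda>q. tvar i * q) (pmap (\<lambda>q. f * q) x)" for i x
      by (rule clin_eqI[OF clin_comp[OF clin_pmap clin_pmap] clin_comp[OF clin_pmap clin_pmap], OF clin_mult clin_mult clin_mult clin_mult])
        (simp add: mult.left_commute)
    from that obtain v where v: "w = ?k v" unfolding I_def by blast
    have "pmap (\<lambda>q. f * q) w = ?k (\<lambda>i. pmap (\<lambda>q. f * q) (v i))"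
      unfolding v clin_sum[OF clin_pmap[OF clin_mult]] clin_diff[OF clin_pmap[OF clin_mult]] c
        pmap_T[OF clin_mult] ..
    with m[of "\<lambda>i. pmap (\<lambda>q. f * q) (v i)"] show ?thesis unfolding I_def by simp
  qed
  define J where "J w = w - pmap cst (residue w)" for w :: "('a \<Rightarrow>\<^sub>0 nat) \<Rightarrow>\<^sub>0 'a mpol"
  have clin_J: "clin J"
    unfolding J_def by (intro clin_sub clin_id clin_comp[OF clin_pmap[OF clin_cst] clin_residue])
  have J_mult: "\<forall>w. J w \<in> I \<longrightarrow> J (pmap (\<lambda>q. f * q) w) \<in> I" for f
  proof (induction f rule: mpol_induct)
    case (cst c)
    have "pmap (\<lambda>q. cst c * q) w = scl c w" for w :: "('a \<Rightarrow>\<^sub>0 nat) \<Rightarrow>\<^sub>0 'a mpol"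
      by (rule clin_eqI[OF clin_pmap[OF clin_mult] clin_scale[OF clin_id]]) (simp add: cst_mult)
    then show ?case using I by (simp add: clin_scl[OF clin_J] csub_scl)
  next
    case (tvar i)
    have "J (pmap (\<lambda>q. tvar i * q) w) = pmap (\<lambda>q. tvar i * q) (J w) +
        (pmap (\<lambda>q. tvar i * q) (pmap cst (residue w)) - T (tvar i) (pmap cst (residue w)))" for w
      by (simp add: J_def residue_mult pmap_T[OF clin_cst] clin_diff[OF clin_pmap[OF clin_mult]])
    then show ?case using csub_add[OF I mult_I gen] by simp
  next
    case (add f g)
    have "pmap (\<lambda>q. (f + g) * q) w = pmap (\<lambda>q. f * q) w + pmap (\<lambda>q. g * q) w" for w :: "('a \<Rightarrow>\<^sub>0 nat) \<Rightarrow>\<^sub>0 'a mpol"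
      by (rule clin_eqI[OF clin_pmap[OF clin_mult] clin_plus[OF clin_pmap[OF clin_mult] clin_pmap[OF clin_mult]]])
        (simp add: distrib_right single_add)
    then show ?case using add I by (simp add: clin_add[OF clin_J] csub_add)
  next
    case (mult f g)
    have "pmap (\<lambda>q. (f * g) * q) w = pmap (\<lambda>q. f * q) (pmap (\<lambda>q. g * q) w)" for w :: "('a \<Rightarrow>\<^sub>0 nat) \<Rightarrow>\<^sub>0 'a mpol"
      by (rule clin_eqI[OF clin_pmap[OF clin_mult] clin_comp[OF clin_pmap[OF clin_mult] clin_pmap[OF clin_mult]]])
        (simp add: mult.assoc)
    then show ?case using mult by simp
  qed
  have "J w \<in> I" for w
  proof (induction w rule: pm_induct)
    case (single \<beta> f)
    have "J (Poly_Mapping.single \<beta> 1) = 0" by (simp add: J_def residue_single single_one)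
    then have "J (Poly_Mapping.single \<beta> 1) \<in> I" using csub_0[OF I] by simp
    then have "J (pmap (\<lambda>q. f * q) (Poly_Mapping.single \<beta> 1)) \<in> I" using J_mult by blast
    then show ?case by simp
  qed (simp_all add: clin_simps[OF clin_J] csub_intros I)
  then have "J u \<in> I" .
  then have "u \<in> I" using u by (simp add: J_def)
  then show "dop u \<in> weyl_ideal" unfolding weyl_ideal_eq I_def by blast
qed

lemma weyl_regular_simps [simp]: "carrier weyl_regular = range dop"
  "dop u \<oplus>\<^bsub>weyl_regular\<^esub> dop v = dop (u + v)" "c \<odot>\<^bsub>weyl_regular\<^esub> dop u = dop (scl c u)"
  "\<zero>\<^bsub>weyl_regular\<^esub> = dop 0" "act weyl_regular A B = A \<circ> B"
  by (simp_all add: weyl_regular_def weyl_eq fun_eq_iff dop_simps cst_mult)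

lemma inv_dop [simp]: "inv_into UNIV dop (dop u) = u"
  by (rule inv_into_f_f) (simp_all add: inj_def dop_inj)

lemma abelian_group_weyl: "abelian_group (weyl_regular :: ('n::finite, _) op_rep)"
proof -
  interpret model "{} :: ('n mpol \<Rightarrow> 'n mpol) set" weyl_regular "inv_into UNIV dop" UNIV "\<lambda>_ w. w"
  proof
    show "bij_betw (inv_into UNIV dop) (carrier (weyl_regular :: ('n, _) op_rep)) UNIV"
      by (rule bij_betw_byWitness[where f' = dop]) auto
  qed (auto simp: csub_UNIV simp del: weyl_regular_simps(4) simp: weyl_regular_simps(4))
  show ?thesis by (rule abelian_group)
qed

lemma dop_vf: "vf f \<circ> dop u = dop (\<Sum>j\<in>UNIV. pmap (\<lambda>q. f j * q) (pmap (pd j) u + dd j u))"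
  by (intro ext) (simp add: vf_def dop_pd dop_mult clin_sum[OF clin_dop_left])

lemma X_zero:
  fixes g :: "('n::finite \<Rightarrow>\<^sub>0 nat) \<Rightarrow>\<^sub>0 'w::cvs"
  shows "X (\<lambda>_ _ _. 0) f g = (\<Sum>j\<in>UNIV. T (f j) (dd j g))"
proof -
  have "pmap (\<lambda>_. 0 :: 'w) g = 0" by (simp add: pext_def)
  then have "X1 (\<lambda>_ _ _. 0) p j g = T p (dd j g)" for p j by (simp only: X1_def T_simps sum.neutral_const add_0_right)
  then show ?thesis by (simp only: X_def)
qed

text \<open>The action on F(P0, M) involves multiplication by polynomials on P0 as well as fields,
  so the quotient is given coordinates for both kinds of operators at once.\<close>

lemma p0_exists: "\<exists>f :: _ \<Rightarrow> ('n \<Rightarrow>\<^sub>0 nat) \<Rightarrow>\<^sub>0 complex.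
    model derivs (P0 :: ('n::finite, _) op_rep) f UNIV (\<lambda>D. X (\<lambda>_ _ _. 0) (fl D)) \<and>
    (\<forall>q. \<forall>g\<in>carrier P0. act P0 (\<lambda>p. q * p) g \<in> carrier P0 \<and> f (act P0 (\<lambda>p. q * p) g) = T q (f g))"
proof -
  define S :: "('n::finite mpol \<Rightarrow> 'n mpol) set" where "S = derivs \<union> range (\<lambda>q p. q * p)"
  define a where "a D = (if D \<in> derivs then X (\<lambda>_ _ _. 0 :: complex) (fl D) else T (D 1))"
    for D :: "'n::finite mpol \<Rightarrow> 'n mpol"
  \<comment> \<open>The two clauses of a overlap only in the zero operator: multiplication by q
    sends 1 to q, while a derivation sends 1 to 0.\<close>
  have a_mult: "a (\<lambda>p. q * p) = T q" for q :: "'n mpol"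
  proof (cases "(\<lambda>p. q * p) \<in> derivs")
    case True
    then obtain f where "(\<lambda>p. q * p) = vf f" by (rule derivs_cases)
    then have "q * 1 = vf f 1" by metis
    then have "q = 0" by (simp add: vf_def)
    moreover have "fl (\<lambda>p. 0) = (\<lambda>j. 0 :: 'n mpol)" by (intro ext) (simp add: fl_def)
    ultimately show ?thesis using True by (simp add: a_def fun_eq_iff X_zero T_simps)
  qed (simp add: a_def)
  obtain f where f: "model S (quot_rep weyl_regular weyl_ideal) f UNIV a"
  proof (rule quot_model[where V = "weyl_regular :: ('n, _) op_rep" and S = S and h = "\<lambda>A. residue (inv_into UNIV dop A)"
        and C = UNIV and a = a and N = weyl_ideal])
    show "abelian_group (weyl_regular :: ('n, _) op_rep)" by (rule abelian_group_weyl)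
    show "csub UNIV" by (rule csub_UNIV)
    show "(\<lambda>A. residue (inv_into UNIV dop A)) ` carrier (weyl_regular :: ('n, _) op_rep) = UNIV"
    proof (intro equalityI subsetI)
      fix g :: "('n \<Rightarrow>\<^sub>0 nat) \<Rightarrow>\<^sub>0 complex"
      have "g = residue (inv_into UNIV dop (dop (pmap cst g)))" by (simp add: residue_cst)
      then show "g \<in> (\<lambda>A. residue (inv_into UNIV dop A)) ` carrier (weyl_regular :: ('n, _) op_rep)"
        by (intro image_eqI) auto
    qed simp
    show "(weyl_ideal :: ('n mpol \<Rightarrow> 'n mpol) set) = {v \<in> carrier weyl_regular. residue (inv_into UNIV dop v) = 0}"
    proof -
      have sub: "(weyl_ideal :: ('n mpol \<Rightarrow> 'n mpol) set) \<subseteq> range dop" unfolding weyl_ideal_eq by blast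
      have "dop u \<in> weyl_ideal \<longleftrightarrow> residue (inv_into UNIV dop (dop u)) = 0" for u :: "('n \<Rightarrow>\<^sub>0 nat) \<Rightarrow>\<^sub>0 'n mpol"
        by (simp add: weyl_ideal_iff)
      note iff = this
      show ?thesis
      proof (intro equalityI subsetI)
        fix x :: "'n mpol \<Rightarrow> 'n mpol" assume x: "x \<in> weyl_ideal"
        with sub obtain u where "x = dop u" by blast
        with x show "x \<in> {v \<in> carrier weyl_regular. residue (inv_into UNIV dop v) = 0}" using iff[of u] by simp
      next
        fix x :: "'n mpol \<Rightarrow> 'n mpol" assume x: "x \<in> {v \<in> carrier weyl_regular. residue (inv_into UNIV dop v) = 0}"
        then obtain u where "x = dop u" by auto
        with x show "x \<in> weyl_ideal" using iff[of u] by simp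
      qed
    qed
    fix u v :: "'n mpol \<Rightarrow> 'n mpol" and c
    assume "v \<in> carrier weyl_regular"
    then obtain y where y: "v = dop y" by auto
    show "c \<odot>\<^bsub>weyl_regular\<^esub> v \<in> carrier weyl_regular" by (simp add: y)
    show "residue (inv_into UNIV dop (c \<odot>\<^bsub>weyl_regular\<^esub> v)) = scl c (residue (inv_into UNIV dop v))"
      by (simp add: y residue_simps)
    show "u \<in> carrier weyl_regular \<Longrightarrow> residue (inv_into UNIV dop (u \<oplus>\<^bsub>weyl_regular\<^esub> v)) = residue (inv_into UNIV dop u) + residue (inv_into UNIV dop v)"
      by (auto simp: y residue_simps)
    fix x assume "x \<in> S"
    then consider f where "x = vf f" | q where "x = (\<lambda>p. q * p)" unfolding S_def by (auto elim!: derivs_cases)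
    then have "act weyl_regular x v \<in> carrier weyl_regular \<and> residue (inv_into UNIV dop (act weyl_regular x v)) = a x (residue (inv_into UNIV dop v))"
    proof cases
      case 1
      then show ?thesis
        by (simp add: y dop_vf residue_simps(6) residue_mult residue_pd a_def X_zero)
    next
      case 2
      have "(\<lambda>p. q * p) \<circ> dop y = dop (pmap (\<lambda>r. q * r) y)" by (intro ext) (simp add: dop_mult)
      then show ?thesis unfolding 2 a_mult by (simp add: y residue_mult)
    qed
    then show "act weyl_regular x v \<in> carrier weyl_regular"
      "residue (inv_into UNIV dop (act weyl_regular x v)) = a x (residue (inv_into UNIV dop v))" by auto
  qed
  interpret f: model S "quot_rep weyl_regular weyl_ideal" f UNIV a by (rule f)
  show ?thesis
  proof (intro exI[of _ f] conjI allI ballI)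
    show "model derivs (P0 :: ('n, _) op_rep) f UNIV (\<lambda>D. X (\<lambda>_ _ _. 0) (fl D))"
    proof
      show "bij_betw f (carrier (P0 :: ('n, _) op_rep)) UNIV" unfolding P0_def by (rule f.bij)
      fix x :: "'n mpol \<Rightarrow> 'n mpol" and v :: "('n mpol \<Rightarrow> 'n mpol) set"
      assume x: "x \<in> derivs" "v \<in> carrier P0"
      then have "x \<in> S" by (simp add: S_def)
      then show "act P0 x v \<in> carrier P0" "f (act P0 x v) = X (\<lambda>_ _ _. 0) (fl x) (f v)"
        using x f.act_in[of x v] f.f_act[of x v] unfolding P0_def by (simp_all add: a_def)
    qed (simp_all add: csub_UNIV P0_def f.zero_in f.f_zero f.add_in f.f_add f.smult_in f.f_smult)
    fix q :: "'n mpol" and g :: "('n mpol \<Rightarrow> 'n mpol) set" assume g: "g \<in> carrier P0"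
    have "(\<lambda>p. q * p) \<in> S" by (simp add: S_def)
    then show "act P0 (\<lambda>p. q * p) g \<in> carrier P0" "f (act P0 (\<lambda>p. q * p) g) = T q (f g)"
      using g f.act_in[of "\<lambda>p. q * p" g] f.f_act[of "\<lambda>p. q * p" g] unfolding P0_def by (simp_all only: a_mult)
  qed
qed

definition p0 :: "('n::finite mpol \<Rightarrow> 'n mpol) set \<Rightarrow> ('n \<Rightarrow>\<^sub>0 nat) \<Rightarrow>\<^sub>0 complex" where
  "p0 = (SOME f. model derivs P0 f UNIV (\<lambda>D. X (\<lambda>_ _ _. 0) (fl D)) \<and>
    (\<forall>q. \<forall>g\<in>carrier P0. act P0 (\<lambda>p. q * p) g \<in> carrier P0 \<and> f (act P0 (\<lambda>p. q * p) g) = T q (f g)))"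

lemma p0: "model derivs (P0 :: ('n::finite, _) op_rep) p0 UNIV (\<lambda>D. X (\<lambda>_ _ _. 0) (fl D)) \<and>
    (\<forall>q. \<forall>g\<in>carrier (P0 :: ('n, _) op_rep). act P0 (\<lambda>p. q * p) g \<in> carrier P0 \<and> p0 (act P0 (\<lambda>p. q * p) g) = T q (p0 g))"
  using someI_ex[OF p0_exists] unfolding p0_def[symmetric] .

lemma glrep_zero: "glrep (\<lambda>_ _ _. 0)"
  by standard (simp_all add: clin_zero)

interpretation P0: dmodel P0 p0 UNIV "X (\<lambda>_ _ _. 0)"
  unfolding dmodel_def by (rule conjI[OF conjunct1[OF p0] glrep.vfrep_X[OF glrep_zero]])

lemma P0_mult: "g \<in> carrier P0 \<Longrightarrow> act P0 (\<lambda>p. q * p) g \<in> carrier P0"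
  "g \<in> carrier P0 \<Longrightarrow> p0 (act P0 (\<lambda>p. q * p) g) = T q (p0 g)"
  using p0 by blast+

lemma P0_pd: "g \<in> carrier P0 \<Longrightarrow> p0 (act P0 (pd k) g) = dd k (p0 g)"
  using P0.f_act[of "pd k" g] by (simp add: pd_vf X_zero if_distrib[of "\<lambda>f. T f _"] T_simps cong: if_cong)

section \<open>The modules \<open>F(P\<^sub>0, M)\<close> in coordinates\<close>

context model
begin

abbreviation fi :: "'w \<Rightarrow> 'v" where
  "fi \<equiv> inv_into (carrier V) f"

lemma fi_in: "w \<in> C \<Longrightarrow> fi w \<in> carrier V"
  by (rule inv_into_into) (simp add: f_image)

lemma f_fi: "w \<in> C \<Longrightarrow> f (fi w) = w"
  by (rule f_inv_into_f) (simp add: f_image)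

lemma fi_f: "v \<in> carrier V \<Longrightarrow> fi (f v) = v"
  using bij by (intro inv_into_f_f) (auto simp: bij_betw_def)

lemma fi_eqI: "v \<in> carrier V \<Longrightarrow> f v = w \<Longrightarrow> fi w = v"
  using fi_f by blast

lemma fi_add: "w \<in> C \<Longrightarrow> w' \<in> C \<Longrightarrow> fi (w + w') = fi w \<oplus>\<^bsub>V\<^esub> fi w'"
  by (intro fi_eqI add_in fi_in) (simp_all add: f_add fi_in f_fi)

lemma fi_scl: "w \<in> C \<Longrightarrow> fi (scl c w) = c \<odot>\<^bsub>V\<^esub> fi w"
  by (intro fi_eqI smult_in fi_in) (simp_all add: f_smult fi_in f_fi)

lemma f_finsum: "finite Z \<Longrightarrow> (\<And>s. s \<in> Z \<Longrightarrow> g s \<in> carrier V) \<Longrightarrow> f (\<Oplus>\<^bsub>V\<^esub>s\<in>Z. g s) = (\<Sum>s\<in>Z. f (g s))"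
proof (induction Z rule: finite_induct)
  case (insert x Z)
  then have "g \<in> Z \<rightarrow> carrier V" "g x \<in> carrier V" by auto
  with insert show ?case by (simp add: vs.M.finsum_insert f_add vs.M.finsum_closed)
qed (simp add: f_zero)

lemma f_span:
  assumes B: "B \<subseteq> carrier V" and Z: "csub Z" "Z \<subseteq> C" and fB: "f ` B \<subseteq> Z"
  shows "f ` module.span complex_ring V B \<subseteq> Z"
proof -
  let ?N = "{v \<in> carrier V. f v \<in> Z}"
  have "f ` ?N = Z" using Z(2) f_ex by blast
  then have "subspace complex_ring ?N V" using Z(1) by (simp add: subspace_iff)
  then have "module.span complex_ring V B \<subseteq> ?N"
    using B fB by (intro vs.span_is_subset) (auto simp: subspace_def)
  then show ?thesis by blast
qed

lemma span_carrier: "B \<subseteq> carrier V \<Longrightarrow> module.span complex_ring V B \<subseteq> carrier V"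
  by (rule vs.span_is_subset2)

lemma csub_f_span: "B \<subseteq> carrier V \<Longrightarrow> csub (f ` module.span complex_ring V B)"
  using vs.span_is_submodule[of B] subspace_iff[of "module.span complex_ring V B"] vectorspace
  by (simp add: subspace_def)

end

section \<open>Pure tensors in coordinates\<close>

definition tens :: "('b \<Rightarrow>\<^sub>0 complex) \<Rightarrow> 'w::cvs \<Rightarrow> 'b \<Rightarrow>\<^sub>0 'w" where
  "tens q w = pmap (\<lambda>c. scl c w) q"

lemma clin_scl_left: "clin (\<lambda>c. scl c w)"
  by (rule clinI) (simp_all add: scl_add_left)

lemma lookup_tens: "Poly_Mapping.lookup (tens q w) \<beta> = scl (Poly_Mapping.lookup q \<beta>) w"
  unfolding tens_def by (rule lookup_pmap[OF clin_scl_left])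

lemma clin_tens: "clin (tens q)"
  by (rule clinI; rule poly_mapping_eqI) (simp_all add: lookup_tens lookup_add scl_add_right mult.commute)

lemma clin_tens_left: "clin (\<lambda>q. tens q w)"
  unfolding tens_def by (rule clin_pmap[OF clin_scl_left])

lemma tens_single: "tens (Poly_Mapping.single \<beta> c) w = Poly_Mapping.single \<beta> (scl c w)"
  by (simp add: tens_def)

lemma T_tens: "T f (tens q w) = tens (T f q) w"
  unfolding tens_def by (rule pmap_T[OF clin_scl_left, symmetric])

lemma dd_tens: "dd i (tens q w) = tens (dd i q) w"
  unfolding tens_def by (rule pmap_dd[OF clin_scl_left, symmetric])

lemma pmap_tens: "clin S \<Longrightarrow> pmap S (tens q w) = tens q (S w)"
  by (rule poly_mapping_eqI) (simp add: lookup_pmap lookup_tens clin_scl)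

lemma tens_coeffs: "csub C \<Longrightarrow> w \<in> C \<Longrightarrow> tens q w \<in> coeffs C"
  by (simp add: coeffs_def lookup_tens csub_scl)

lemma (in glrep) X_tens: "X E f (tens q w) = tens (X (\<lambda>_ _ _. 0) f q) w +
    (\<Sum>i\<in>UNIV. \<Sum>j\<in>UNIV. tens (T (pd i (f j)) q) (E i j w))"
proof -
  have "X E f (tens q w) = (\<Sum>j\<in>UNIV. tens (T (f j) (dd j q)) w) +
      (\<Sum>j\<in>UNIV. \<Sum>i\<in>UNIV. tens (T (pd i (f j)) q) (E i j w))"
    by (simp add: X_def X1_def dd_tens T_tens pmap_tens[OF clin_E] sum.distrib)
  also have "(\<Sum>j\<in>UNIV. \<Sum>i\<in>UNIV. tens (T (pd i (f j)) q) (E i j w)) =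
      (\<Sum>i\<in>UNIV. \<Sum>j\<in>UNIV. tens (T (pd i (f j)) q) (E i j w))" by (rule sum.swap)
  finally show ?thesis by (simp add: X_zero clin_sum[OF clin_tens_left])
qed

lemma F_free_simps [simp]: "carrier (F_free P M) = {f. Poly_Mapping.keys f \<subseteq> carrier P \<times> carrier M}"
  "\<zero>\<^bsub>F_free P M\<^esub> = 0" "x \<oplus>\<^bsub>F_free P M\<^esub> y = x + y" "c \<odot>\<^bsub>F_free P M\<^esub> x = scl c x"
  by (simp_all add: F_free_def scale_eq_scl)

definition F_gen :: "('n::finite, 'p) op_rep \<Rightarrow> ('n, 'm) gl_rep \<Rightarrow> ('n mpol \<Rightarrow> 'n mpol) \<Rightarrow>
    'p \<Rightarrow> 'm \<Rightarrow> 'p \<times> 'm \<Rightarrow>\<^sub>0 complex" where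
  "F_gen P M D g v = Poly_Mapping.single (act P D g, v) 1 + (\<Sum>i\<in>UNIV. \<Sum>j\<in>UNIV.
     Poly_Mapping.single (act P (\<lambda>p. pd i (D (tvar j)) * p) g, act M (matunit i j) v) 1)"

lemma F_free_act: "act (F_free P M) D f =
    (\<Sum>k\<in>Poly_Mapping.keys f. scl (Poly_Mapping.lookup f k) (F_gen P M D (fst k) (snd k)))"
  by (simp add: F_free_def scale_eq_scl F_gen_def case_prod_beta)

lemma csub_keys: "csub {f :: 'a \<Rightarrow>\<^sub>0 complex. Poly_Mapping.keys f \<subseteq> S}"
proof -
  have "Poly_Mapping.keys (f + g) \<subseteq> S" if "Poly_Mapping.keys f \<subseteq> S" "Poly_Mapping.keys g \<subseteq> S"
    for f g :: "'a \<Rightarrow>\<^sub>0 complex"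
    using that Poly_Mapping.keys_add[of f g] by blast
  moreover have "Poly_Mapping.keys (scl c f) \<subseteq> S" if "Poly_Mapping.keys f \<subseteq> S" for f :: "'a \<Rightarrow>\<^sub>0 complex" and c
    using that by (auto simp: in_keys_iff)
  ultimately show ?thesis by (simp add: csub_def)
qed

section \<open>The tensor product as a quotient of the free space\<close>

locale F_model = M: gmodel M \<iota> C E
  for M :: "('n::finite, 'm) gl_rep" and \<iota> :: "'m \<Rightarrow> 'w::cvs" and C E
begin

abbreviation Fr :: "('n, ('n mpol \<Rightarrow> 'n mpol) set \<times> 'm \<Rightarrow>\<^sub>0 complex) op_rep" where
  "Fr \<equiv> F_free P0 M"

abbreviation (input) pt :: "('n mpol \<Rightarrow> 'n mpol) set \<Rightarrow> 'm \<Rightarrow> ('n mpol \<Rightarrow> 'n mpol) set \<times> 'm \<Rightarrow>\<^sub>0 complex" where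
  "pt g v \<equiv> Poly_Mapping.single (g, v) 1"

sublocale Fr: model "{} :: ('n mpol \<Rightarrow> 'n mpol) set" Fr "\<lambda>x. x"
  "{f. Poly_Mapping.keys f \<subseteq> carrier P0 \<times> carrier M}" "\<lambda>_ x. x"
proof
  show "bij_betw (\<lambda>x. x) (carrier Fr) {f. Poly_Mapping.keys f \<subseteq> carrier P0 \<times> carrier M}"
    by (simp add: bij_betw_def)
next
  show "csub {f :: ('n mpol \<Rightarrow> 'n mpol) set \<times> 'm \<Rightarrow>\<^sub>0 complex. Poly_Mapping.keys f \<subseteq> carrier P0 \<times> carrier M}"
    by (rule csub_keys)
  show "u \<oplus>\<^bsub>Fr\<^esub> v \<in> carrier Fr" if "u \<in> carrier Fr" "v \<in> carrier Fr" for u v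
    using csub_add[OF csub_keys, of u "carrier P0 \<times> carrier M" v] that by simp
  show "a \<odot>\<^bsub>Fr\<^esub> u \<in> carrier Fr" if "u \<in> carrier Fr" for u a
    using csub_scl[OF csub_keys, of u "carrier P0 \<times> carrier M" a] that by simp
qed auto

abbreviation N :: "(('n mpol \<Rightarrow> 'n mpol) set \<times> 'm \<Rightarrow>\<^sub>0 complex) set" where
  "N \<equiv> module.span complex_ring Fr (bilinear_relations P0 M)"

definition t :: "('n mpol \<Rightarrow> 'n mpol) set \<Rightarrow> 'm \<Rightarrow> ('n \<Rightarrow>\<^sub>0 nat) \<Rightarrow>\<^sub>0 'w" where
  "t g v = tens (p0 g) (\<iota> v)"

definition h :: "(('n mpol \<Rightarrow> 'n mpol) set \<times> 'm \<Rightarrow>\<^sub>0 complex) \<Rightarrow> ('n \<Rightarrow>\<^sub>0 nat) \<Rightarrow>\<^sub>0 'w" where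
  "h = pext (\<lambda>k c. scl c (t (fst k) (snd k)))"

lemma clin_h: "clin h"
  unfolding h_def by (intro clin_pext clin_scl_left)

lemma h_single: "h (Poly_Mapping.single (g, v) c) = scl c (t g v)"
  unfolding h_def by (subst pext_single) auto

lemma h_sum: "h x = (\<Sum>k\<in>Poly_Mapping.keys x. scl (Poly_Mapping.lookup x k) (t (fst k) (snd k)))"
  by (simp add: h_def pext_def)

lemma t_coeffs: "v \<in> carrier M \<Longrightarrow> t g v \<in> coeffs C"
  unfolding t_def by (intro tens_coeffs M.csub_C M.f_in)

lemma h_gen: 
  assumes "D \<in> derivs" "g \<in> carrier P0" "v \<in> carrier M"
  shows "h (F_gen P0 M D g v) = X E (fl D) (t g v)" "F_gen P0 M D g v \<in> carrier Fr"
proof -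
  show "h (F_gen P0 M D g v) = X E (fl D) (t g v)"
    using assms by (simp add: F_gen_def clin_simps[OF clin_h] h_single t_def M.X_tens P0.f_act P0_mult M.f_E fl_def)
  have "pt g' v' \<in> carrier Fr" if "g' \<in> carrier P0" "v' \<in> carrier M" for g' v'
    using that by simp
  note * = this[unfolded F_free_simps(1)]
  show "F_gen P0 M D g v \<in> carrier Fr"
    unfolding F_gen_def F_free_simps(1)
    by (intro csub_add[OF csub_keys] csub_sum[OF csub_keys] *) (simp_all add: P0.act_in P0_mult M.act_in assms)
qed

lemma h_act:
  assumes D: "D \<in> derivs" and x: "x \<in> carrier Fr"
  shows "act Fr D x \<in> carrier Fr" "h (act Fr D x) = X E (fl D) (h x)"
proof -
  have k: "fst k \<in> carrier P0" "snd k \<in> carrier M" if "k \<in> Poly_Mapping.keys x" for k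
    using x that by auto
  show "act Fr D x \<in> carrier Fr"
    unfolding F_free_act F_free_simps(1)
    by (intro csub_sum[OF csub_keys] csub_scl[OF csub_keys] h_gen(2)[OF D, unfolded F_free_simps(1)] k)
  show "h (act Fr D x) = X E (fl D) (h x)"
    unfolding F_free_act h_sum[of x] using k
    by (simp add: clin_simps[OF clin_h] clin_simps[OF M.clin_X] h_gen(1)[OF D])
qed

lemma h_image: "h ` carrier Fr = coeffs C"
proof (intro equalityI subsetI)
  fix y assume "y \<in> h ` carrier Fr"
  then show "y \<in> coeffs C"
    by (auto simp: h_sum intro!: csub_sum csub_scl csub_coeffs M.csub_C t_coeffs)
next
  fix y :: "('n \<Rightarrow>\<^sub>0 nat) \<Rightarrow>\<^sub>0 'w" assume y: "y \<in> coeffs C"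
  define x where "x = (\<Sum>\<beta>\<in>Poly_Mapping.keys y. pt (P0.fi (Poly_Mapping.single \<beta> 1)) (M.fi (Poly_Mapping.lookup y \<beta>)))"
  have C: "Poly_Mapping.lookup y \<beta> \<in> C" for \<beta> using y by (simp add: coeffs_def)
  have "x \<in> carrier Fr"
    unfolding x_def F_free_simps(1)
    by (intro csub_sum[OF csub_keys]) (simp add: P0.fi_in M.fi_in C)
  moreover have "h x = y"
    unfolding x_def by (subst (3) pm_expand)
      (simp add: clin_simps[OF clin_h] h_single t_def tens_single P0.f_fi M.f_fi C)
  ultimately show "y \<in> h ` carrier Fr" by blast
qed

lemma relations_carrier: "bilinear_relations P0 M \<subseteq> carrier Fr"
proof -
  have k3: "Poly_Mapping.keys (Poly_Mapping.single a (1::complex) - Poly_Mapping.single b 1 - Poly_Mapping.single c 1) \<subseteq> {a, b, c}"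
    for a b c :: "('n mpol \<Rightarrow> 'n mpol) set \<times> 'm"
    by (auto simp: in_keys_iff lookup_minus lookup_single when_def split: if_splits)
  have k2: "Poly_Mapping.keys (Poly_Mapping.single a (1::complex) - Poly_Mapping.single b x) \<subseteq> {a, b}"
    for a b :: "('n mpol \<Rightarrow> 'n mpol) set \<times> 'm" and x
    by (auto simp: in_keys_iff lookup_minus lookup_single when_def split: if_splits)
  show ?thesis
    unfolding bilinear_relations_def F_free_simps(1)
    by (intro Un_least subsetI; elim CollectE exE conjE; hypsubst; intro CollectI;
        rule order_trans[OF k3] order_trans[OF k2]; simp add: P0.add_in P0.smult_in M.add_in M.smult_in)
qed

lemma csub_N: "csub N"
  using Fr.csub_f_span[OF relations_carrier] by simp

lemma in_N: "x \<in> bilinear_relations P0 M \<Longrightarrow> x \<in> N"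
  using Fr.vs.in_own_span[OF relations_carrier] by blast

lemma N_relations:
  assumes g: "g \<in> carrier P0" and v: "v \<in> carrier M"
  shows "g' \<in> carrier P0 \<Longrightarrow> pt (g \<oplus>\<^bsub>P0\<^esub> g') v - pt g v - pt g' v \<in> N"
    "v' \<in> carrier M \<Longrightarrow> pt g (v \<oplus>\<^bsub>M\<^esub> v') - pt g v - pt g v' \<in> N"
    "pt (c \<odot>\<^bsub>P0\<^esub> g) v - scl c (pt g v) \<in> N"
    "pt g (c \<odot>\<^bsub>M\<^esub> v) - scl c (pt g v) \<in> N"
proof -
  show "g' \<in> carrier P0 \<Longrightarrow> pt (g \<oplus>\<^bsub>P0\<^esub> g') v - pt g v - pt g' v \<in> N"
    by (rule in_N) (use g v in \<open>unfold bilinear_relations_def, blast\<close>)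
  show "v' \<in> carrier M \<Longrightarrow> pt g (v \<oplus>\<^bsub>M\<^esub> v') - pt g v - pt g v' \<in> N"
    by (rule in_N) (use g v in \<open>unfold bilinear_relations_def, blast\<close>)
  have c: "scl c (pt g v) = Poly_Mapping.single (g, v) c" by simp
  show "pt (c \<odot>\<^bsub>P0\<^esub> g) v - scl c (pt g v) \<in> N" unfolding c
    by (rule in_N) (use g v in \<open>unfold bilinear_relations_def, blast\<close>)
  show "pt g (c \<odot>\<^bsub>M\<^esub> v) - scl c (pt g v) \<in> N" unfolding c
    by (rule in_N) (use g v in \<open>unfold bilinear_relations_def, blast\<close>)
qed

lemma N_h: "x \<in> N \<Longrightarrow> h x = 0"
proof -
  have ker: "csub {x \<in> carrier Fr. h x = 0}"
    using csub_vimage[OF clin_h csub_zero csub_keys] by simp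
  have "bilinear_relations P0 M \<subseteq> {x. h x = 0}"
    unfolding bilinear_relations_def
    by (intro Un_least subsetI; elim CollectE exE conjE; hypsubst; intro CollectI;
        simp add: clin_simps[OF clin_h] h_single t_def P0.f_add P0.f_smult M.f_add M.f_smult
        clin_simps[OF clin_tens] clin_simps[OF clin_tens_left])
  then have "(\<lambda>x. x) ` N \<subseteq> {x \<in> carrier Fr. h x = 0}"
    using relations_carrier by (intro Fr.f_span ker) auto
  then show "x \<in> N \<Longrightarrow> h x = 0" by auto
qed

text \<open>Modulo the relations, an element \<open>x\<close> of the free space only depends on \<open>h x\<close>, because it is
  congruent to a combination of tensors of basis elements of \<open>P\<^sub>0\<close> with the coefficients of \<open>h x\<close>.\<close>

lemma kernel_N:
  assumes x: "x \<in> carrier Fr" and hx: "h x = 0"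
  shows "x \<in> N"
proof -
  define B where "B = (\<Union>k\<in>Poly_Mapping.keys x. Poly_Mapping.keys (p0 (fst k)))"
  have B: "finite B" by (simp add: B_def)
  define \<delta> where "\<delta> \<beta> = P0.fi (Poly_Mapping.single \<beta> 1)" for \<beta> :: "'n \<Rightarrow>\<^sub>0 nat"
  have \<delta>: "\<delta> \<beta> \<in> carrier P0" for \<beta> unfolding \<delta>_def by (rule P0.fi_in) simp
  define s where "s y = (\<Sum>\<beta>\<in>B. pt (\<delta> \<beta>) (M.fi (Poly_Mapping.lookup y \<beta>)))" for y
  have C: "Poly_Mapping.lookup y \<beta> \<in> C" if "y \<in> coeffs C" for y and \<beta> :: "'n \<Rightarrow>\<^sub>0 nat"
    using that by (simp add: coeffs_def)
  have s_add: "s (y + y') - s y - s y' \<in> N" if "y \<in> coeffs C" "y' \<in> coeffs C" for y y'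
    unfolding s_def sum_subtractf[symmetric] lookup_add
    using that by (intro csub_sum[OF csub_N]) (simp add: M.fi_add C N_relations \<delta> M.fi_in)
  have s_scl: "s (scl c y) - scl c (s y) \<in> N" if "y \<in> coeffs C" for c y
    unfolding s_def scl_sum sum_subtractf[symmetric] lookup_scl
    using that by (intro csub_sum[OF csub_N]) (simp only: M.fi_scl C N_relations \<delta> M.fi_in)
  have s_0: "s 0 \<in> N" using s_scl[of 0 0] csub_0[OF csub_coeffs[OF M.csub_C]] by simp
  have h_C: "h y \<in> coeffs C" if "y \<in> carrier Fr" for y using that h_image by blast
  let ?D = "{y \<in> carrier Fr. y - s (h y) \<in> N}"
  have D: "csub ?D"
    unfolding csub_def
  proof (intro conjI ballI allI)
    show "0 \<in> ?D" using csub_minus[OF csub_N s_0] clin_0[OF clin_h] by simp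
    fix y y' c assume y: "y \<in> ?D"
    have "scl c (y - s (h y)) - (s (scl c (h y)) - scl c (s (h y))) \<in> N"
      using y by (intro csub_diff[OF csub_N csub_scl[OF csub_N] s_scl] h_C) auto
    then have "scl c y - s (h (scl c y)) \<in> N"
      by (simp add: cvs.scale_right_diff_distrib clin_scl[OF clin_h])
    moreover have "scl c y \<in> carrier Fr" using Fr.smult_in[of y c] y by simp
    ultimately show "scl c y \<in> ?D" by blast
    assume y': "y' \<in> ?D"
    have "(y - s (h y)) + (y' - s (h y')) - (s (h y + h y') - s (h y) - s (h y')) \<in> N"
      using y y' by (intro csub_diff[OF csub_N csub_add[OF csub_N] s_add] h_C) auto
    then have "y + y' - s (h (y + y')) \<in> N" by (simp add: clin_add[OF clin_h] algebra_simps)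
    moreover have "y + y' \<in> carrier Fr" using Fr.add_in[of y y'] y y' by simp
    ultimately show "y + y' \<in> ?D" by blast
  qed
  have "Poly_Mapping.single k 1 \<in> ?D" if k: "k \<in> Poly_Mapping.keys x" for k
  proof -
    obtain g v where gv: "k = (g, v)" by force
    have g: "g \<in> carrier P0" and v: "v \<in> carrier M" using x k by (auto simp: gv)
    define \<phi> where "\<phi> q = pt (P0.fi q) v" for q
    define l where "l = pext (\<lambda>\<beta> c. scl c (\<phi> (Poly_Mapping.single \<beta> 1)))"
    have clin_l: "clin l" unfolding l_def by (intro clin_pext clin_scl_left)
    have \<phi>_add: "\<phi> (q + q') - \<phi> q - \<phi> q' \<in> N" for q q'
      unfolding \<phi>_def by (subst P0.fi_add) (simp_all add: N_relations P0.fi_in v)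
    have \<phi>_scl: "\<phi> (scl c q) - scl c (\<phi> q) \<in> N" for c q
      unfolding \<phi>_def by (subst P0.fi_scl) (simp_all only: N_relations P0.fi_in v UNIV_I)
    have "\<phi> q - l q \<in> N" for q
    proof (induction q rule: pm_induct)
      case zero
      show ?case using \<phi>_scl[of 0 0] by (simp add: clin_0[OF clin_l])
    next
      case (single \<beta> c)
      have "l (Poly_Mapping.single \<beta> c) = scl c (\<phi> (Poly_Mapping.single \<beta> 1))"
        unfolding l_def by (subst pext_single) auto
      then show ?case using \<phi>_scl[of c "Poly_Mapping.single \<beta> 1"] by simp
    next
      case (add q q')
      have "(\<phi> (q + q') - \<phi> q - \<phi> q') + (\<phi> q - l q) + (\<phi> q' - l q') \<in> N"
        by (intro csub_add csub_N \<phi>_add add)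
      then show ?case by (simp add: clin_add[OF clin_l] algebra_simps)
    qed
    then have 1: "pt g v - l (p0 g) \<in> N" using P0.fi_f[OF g] unfolding \<phi>_def by metis
    have l: "l (p0 g) = (\<Sum>\<beta>\<in>B. scl (Poly_Mapping.lookup (p0 g) \<beta>) (pt (\<delta> \<beta>) v))"
      unfolding l_def \<phi>_def \<delta>_def
      by (rule pext_superset) (use B k gv in \<open>auto simp: B_def\<close>)
    have "s (t g v) - l (p0 g) \<in> N"
      unfolding s_def l sum_subtractf[symmetric] t_def lookup_tens
      by (intro csub_sum[OF csub_N])
        (simp only: M.fi_scl M.f_in[OF v] M.fi_f[OF v] N_relations \<delta> v)
    then have "(pt g v - l (p0 g)) - (s (t g v) - l (p0 g)) \<in> N" by (rule csub_diff[OF csub_N 1])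
    then show ?thesis using g v by (simp add: gv h_single)
  qed
  then have "(\<Sum>k\<in>Poly_Mapping.keys x. scl (Poly_Mapping.lookup x k) (Poly_Mapping.single k 1)) \<in> ?D"
    by (intro csub_sum csub_scl D)
  then have "x \<in> ?D" using pm_expand[of x] by simp
  then have "x - s 0 \<in> N" by (simp add: hx)
  then have "(x - s 0) + s 0 \<in> N" by (intro csub_add csub_N s_0)
  then show "x \<in> N" by simp
qed

lemma F_mod_model:
  obtains f where "dmodel (F_mod P0 M) f (coeffs C) (X E)"
    "\<And>g v. g \<in> carrier P0 \<Longrightarrow> v \<in> carrier M \<Longrightarrow> pure_tensor P0 M g v \<in> carrier (F_mod P0 M)"
    "\<And>g v. g \<in> carrier P0 \<Longrightarrow> v \<in> carrier M \<Longrightarrow> f (pure_tensor P0 M g v) = tens (p0 g) (\<iota> v)"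
proof -
  have N_eq: "N = {x \<in> carrier Fr. h x = 0}"
    using Fr.span_carrier[OF relations_carrier] N_h kernel_N by blast
  obtain f where f: "model derivs (quot_rep Fr N) f (coeffs C) (\<lambda>D. X E (fl D))"
    "\<And>v. v \<in> carrier Fr \<Longrightarrow> N +>\<^bsub>Fr\<^esub> v \<in> carrier (quot_rep Fr N)"
    "\<And>v. v \<in> carrier Fr \<Longrightarrow> f (N +>\<^bsub>Fr\<^esub> v) = h v"
  proof (rule quot_model[where V = Fr and S = derivs and h = h and C = "coeffs C"
        and a = "\<lambda>D. X E (fl D)" and N = N])
    show "csub (coeffs C :: (('n \<Rightarrow>\<^sub>0 nat) \<Rightarrow>\<^sub>0 'w) set)" by (rule csub_coeffs[OF M.csub_C])
    show "h (u \<oplus>\<^bsub>Fr\<^esub> v) = h u + h v" for u v by (simp add: clin_add[OF clin_h])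
    show "h (c \<odot>\<^bsub>Fr\<^esub> v) = scl c (h v)" for c v by (simp add: clin_scl[OF clin_h])
  qed (assumption | rule Fr.abelian_group Fr.smult_in h_image h_act N_eq that)+
  have "dmodel (F_mod P0 M) f (coeffs C) (X E)"
    unfolding dmodel_def F_mod_def using f(1) M.vfrep_X by simp
  moreover have "pure_tensor P0 M g v \<in> carrier (F_mod P0 M) \<and> f (pure_tensor P0 M g v) = tens (p0 g) (\<iota> v)"
    if "g \<in> carrier P0" "v \<in> carrier M" for g v
    using f(2,3)[of "pt g v"] that by (simp add: pure_tensor_def F_mod_def h_single t_def)
  ultimately show ?thesis using that by blast
qed

end

section \<open>Exterior powers\<close>

lemma wedge_Nil: "wedge [] = Poly_Mapping.single {} 1"
  by (simp add: wedge_def)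

text \<open>The inversions of \<open>k # xs\<close> are those with the head, which make up
  \<open>sg k (set xs)\<close>, and those of xs with positions shifted by one.\<close>

lemma wedge_Cons: "wedge (k # xs) = cr k (wedge xs)"
proof (cases "distinct xs \<and> k \<notin> set xs")
  case False
  then show ?thesis by (auto simp: wedge_def cr_simps cr_single)
next
  case True
  let ?I = "\<lambda>xs. {(a, b). a < b \<and> b < length xs \<and> xs ! b < xs ! a}"
  let ?J = "{b. b < length xs \<and> xs ! b < k}"
  have "?I (k # xs) = Pair 0 ` Suc ` ?J \<union> (\<lambda>(a, b). (Suc a, Suc b)) ` ?I xs"
  proof (intro equalityI subsetI)
    fix x assume "x \<in> ?I (k # xs)"
    then obtain a b where x: "x = (a, b)" "a < b" "b < Suc (length xs)" "(k # xs) ! b < (k # xs) ! a" by auto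
    then obtain b' where b: "b = Suc b'" by (cases b) auto
    show "x \<in> Pair 0 ` Suc ` ?J \<union> (\<lambda>(a, b). (Suc a, Suc b)) ` ?I xs"
      using x by (cases a) (auto simp: b)
  qed auto
  moreover have "finite (?I xs)"
    by (rule finite_subset[of _ "{..<length xs} \<times> {..<length xs}"]) auto
  then have "card (Pair 0 ` Suc ` ?J \<union> (\<lambda>(a, b). (Suc a, Suc b)) ` ?I xs) =
      card (Pair (0::nat) ` Suc ` ?J) + card ((\<lambda>(a, b). (Suc a, Suc b)) ` ?I xs)"
    by (intro card_Un_disjoint) auto
  moreover have "card (Pair (0::nat) ` Suc ` ?J) = card ?J" by (simp add: card_image inj_on_def)
  moreover have "card ((\<lambda>(a, b). (Suc a, Suc b)) ` ?I xs) = card (?I xs)"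
    by (rule card_image) (auto simp: inj_on_def)
  ultimately have "card (?I (k # xs)) = card ?J + card (?I xs)" by (simp only:)
  moreover have "card ?J = card {s \<in> set xs. s < k}"
  proof (rule bij_betw_same_card)
    show "bij_betw ((!) xs) ?J {s \<in> set xs. s < k}"
      using True by (auto simp: bij_betw_def inj_on_def nth_eq_iff_index_eq in_set_conv_nth)
  qed
  ultimately show ?thesis using True by (simp add: wedge_def cr_single sg_def power_add)
qed

lemma wedge_sorted: "wedge (sorted_list_of_set S) = Poly_Mapping.single S 1" for S :: "'n::{finite,linorder} set"
proof -
  let ?xs = "sorted_list_of_set S"
  have "{(a, b). a < b \<and> b < length ?xs \<and> ?xs ! b < ?xs ! a} = {}"
    using sorted_nth_mono[OF sorted_sorted_list_of_set, of _ _ S] by (auto simp: not_less[symmetric] less_imp_le)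
  then have "card {(a, b). a < b \<and> b < length ?xs \<and> ?xs ! b < ?xs ! a} = 0" by (simp only: card.empty)
  then show ?thesis by (simp add: wedge_def)
qed

lemma wedge_LL: "wedge xs \<in> LL (length xs)"
  by (auto simp: wedge_def csub_0[OF csub_LL] distinct_card intro!: single_LL)

lemma EL_cr: "EL i j (cr k w) = (if j = k then cr i w else 0) + cr k (EL i j w)"
  by (simp add: EL_def an_cr cr_simps cr_cr[of i k])

lemma EL_wedge: "EL i j (wedge xs) = (\<Sum>s<length xs. if xs ! s = j then wedge (xs[s := i]) else 0)"
proof (induction xs)
  case Nil
  show ?case by (simp add: wedge_Nil EL_def an_single cr_simps)
next
  case (Cons k xs)
  have "(\<Sum>s<length (k # xs). if (k # xs) ! s = j then wedge ((k # xs)[s := i]) else 0) =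
      (if k = j then cr i (wedge xs) else 0) + (\<Sum>s<length xs. if xs ! s = j then cr k (wedge (xs[s := i])) else 0)"
    by (simp add: sum.lessThan_Suc_shift wedge_Cons del: sum.lessThan_Suc cong: if_cong)
  also have "(\<Sum>s<length xs. if xs ! s = j then cr k (wedge (xs[s := i])) else 0) = cr k (EL i j (wedge xs))"
    unfolding Cons cr_simps(6) by (intro sum.cong refl) (simp add: cr_simps)
  finally show ?case by (simp add: wedge_Cons EL_cr eq_commute)
qed

lemma glact_wedge: "glact EL A (wedge xs) =
    (\<Sum>s<length xs. \<Sum>i\<in>UNIV. scl (A $ i $ (xs ! s)) (wedge (xs[s := i])))"
proof -
  have "(\<Sum>j\<in>UNIV. scl (A $ i $ j) (EL i j (wedge xs))) =
      (\<Sum>s<length xs. scl (A $ i $ (xs ! s)) (wedge (xs[s := i])))" for i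
  proof -
    have "(\<Sum>j\<in>UNIV. scl (A $ i $ j) (EL i j (wedge xs))) =
        (\<Sum>j\<in>UNIV. \<Sum>s<length xs. if j = xs ! s then scl (A $ i $ (xs ! s)) (wedge (xs[s := i])) else 0)"
      unfolding EL_wedge scl_sum by (intro sum.cong refl) simp
    also have "\<dots> = (\<Sum>s<length xs. \<Sum>j\<in>UNIV. if j = xs ! s then scl (A $ i $ (xs ! s)) (wedge (xs[s := i])) else 0)"
      by (rule sum.swap)
    finally show ?thesis by simp
  qed
  then have "glact EL A (wedge xs) = (\<Sum>i\<in>UNIV. \<Sum>s<length xs. scl (A $ i $ (xs ! s)) (wedge (xs[s := i])))"
    by (simp add: glact_def)
  also have "\<dots> = (\<Sum>s<length xs. \<Sum>i\<in>UNIV. scl (A $ i $ (xs ! s)) (wedge (xs[s := i])))" by (rule sum.swap)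
  finally show ?thesis .
qed

lemma carrier_ext_power [simp]: "carrier (ext_power r) = LL r"
  by (simp add: ext_power_def LL_def)

lemma act_ext_power:
  assumes f: "f \<in> LL r"
  shows "act (ext_power r) A f = glact EL A f"
proof -
  have "glact EL A f = glact EL A (\<Sum>S\<in>Poly_Mapping.keys f. scl (Poly_Mapping.lookup f S) (Poly_Mapping.single S 1))"
    using pm_expand[of f] by simp
  also have "\<dots> = (\<Sum>S\<in>Poly_Mapping.keys f. scl (Poly_Mapping.lookup f S) (glact EL A (wedge (sorted_list_of_set S))))"
    unfolding wedge_sorted by (simp only: clin_sum[OF EL.clin_glact] clin_scl[OF EL.clin_glact])
  also have "\<dots> = act (ext_power r) A f"
    unfolding ext_power_def rep.simps
    by (rule sum.cong[OF refl]) (use f in \<open>simp add: glact_wedge scale_eq_scl scl_sum Let_def LL_def\<close>)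
  finally show ?thesis ..
qed

lemma gmodel_ext_power: "gmodel (ext_power r :: ('n::{finite,linorder}, _) gl_rep) (\<lambda>x. x) (LL r) EL"
proof
  show "bij_betw (\<lambda>x. x) (carrier (ext_power r :: ('n, _) gl_rep)) (LL r :: ('n set \<Rightarrow>\<^sub>0 complex) set)" by (simp add: bij_betw_def)
  fix A :: "'n sq_matrix" and f :: "'n set \<Rightarrow>\<^sub>0 complex" assume "f \<in> carrier (ext_power r)"
  then have f: "f \<in> LL r" by simp
  show "act (ext_power r) A f = glact EL A f" by (rule act_ext_power[OF f])
  have "glact EL A f \<in> LL r" unfolding glact_def
    by (intro csub_sum csub_scl csub_LL EL_LL f)
  then show "act (ext_power r) A f \<in> carrier (ext_power r)" by (simp add: act_ext_power[OF f])
qed (simp_all add: csub_LL, simp_all add: ext_power_def scale_eq_scl LL_def[symmetric] csub_0[OF csub_LL] csub_add[OF csub_LL] csub_scl[OF csub_LL])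

section \<open>Exact and closed elements in the modules of exterior powers\<close>

locale ext_model = dmodel "F_ext r" f "coeffs (LL r)" "X EL" for r :: nat and f :: "'n::{finite,linorder} F_ext \<Rightarrow> _" +
  assumes pure_in: "\<lbrakk>g \<in> carrier P0; w \<in> (LL r :: ('n set \<Rightarrow>\<^sub>0 complex) set)\<rbrakk> \<Longrightarrow> pure_tensor P0 (ext_power r) g w \<in> carrier (F_ext r)"
    and f_pure: "\<lbrakk>g \<in> carrier P0; w \<in> LL r\<rbrakk> \<Longrightarrow> f (pure_tensor P0 (ext_power r) g w) = tens (p0 g) w"

lemma ext_model: obtains f :: "'n::{finite,linorder} F_ext \<Rightarrow> ('n \<Rightarrow>\<^sub>0 nat) \<Rightarrow>\<^sub>0 'n set \<Rightarrow>\<^sub>0 complex" where "ext_model r f"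
proof -
  interpret F_model "ext_power r :: ('n, _) gl_rep" "\<lambda>x. x" "LL r" EL
    unfolding F_model_def by (rule gmodel_ext_power)
  show ?thesis
    by (rule F_mod_model)
      (rule that, rule ext_model.intro, assumption, rule ext_model_axioms.intro, simp_all)
qed

lemma dext_tens: "dext (tens q w) = (\<Sum>k\<in>UNIV. tens (dd k q) (cr k w))"
  by (simp add: dext_def pmap_tens[OF clin_cr] dd_tens)

lemma lookup_dext_0: "Poly_Mapping.lookup (dext g) 0 = 0"
  by (simp add: dext_def lookup_sum lookup_dd_0)

text \<open>On closed elements only the exact summand of Cartan's formula survives.\<close>

lemma X_exact: "g \<in> coeffs (LL (Suc q)) \<Longrightarrow> dext g = 0 \<Longrightarrow> X EL h g \<in> dext ` coeffs (LL q)"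
proof -
  assume g: "g \<in> coeffs (LL (Suc q))" "dext g = 0"
  have "X EL h g = dext (\<Sum>j\<in>UNIV. T (h j) (pmap (an j) g))"
    by (simp add: X_def cartan g(2) clin_simps[OF clin_pmap[OF clin_an]] T_simps dext_simps)
  moreover have "(\<Sum>j\<in>UNIV. T (h j) (pmap (an j) g)) \<in> coeffs (LL q)"
    by (intro csub_sum csub_coeffs csub_LL T_coeffs pmap_coeffs[where C = "LL (Suc q)"] clin_an an_LL g(1))
  ultimately show ?thesis by blast
qed

lemma (in model) eq_vimage: "N \<subseteq> carrier V \<Longrightarrow> f ` N = D \<Longrightarrow> N = {v \<in> carrier V. f v \<in> D}"
proof -
  assume N: "N \<subseteq> carrier V" and D: "f ` N = D"
  have "v \<in> N" if v: "v \<in> carrier V" "f v \<in> D" for v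
  proof -
    obtain u where u: "u \<in> N" "f v = f u" using v(2) D by blast
    then show ?thesis using f_inj[OF v(1), of u] N by blast
  qed
  with N D show ?thesis by blast
qed

context ext_model
begin

lemma csub_image_dext: "csub (dext ` coeffs (LL q) :: (('n \<Rightarrow>\<^sub>0 nat) \<Rightarrow>\<^sub>0 'n set \<Rightarrow>\<^sub>0 complex) set)"
  by (rule csub_image[OF clin_dext csub_coeffs[OF csub_LL]])

text \<open>Since \<open>wedge (k # is)\<close> is \<open>cr k (wedge is)\<close>, the generator
  belonging to p and \<open>is\<close> is \<open>dext\<close> of the pure tensor of p and
  \<open>wedge is\<close>; these tensors span P0 \<otimes> \<open>LL q\<close>.\<close>

lemma L_sub_image:
  assumes r: "r = Suc q"
  shows "(L_sub r :: 'n F_ext set) \<subseteq> carrier (F_ext r)" "f ` L_sub r = dext ` coeffs (LL q)"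
proof -
  define G :: "('n mpol \<Rightarrow> 'n mpol) set \<Rightarrow> 'n list \<Rightarrow> 'n F_ext" where
    "G p is = (\<Oplus>\<^bsub>F_ext r\<^esub>k\<in>UNIV. pure_tensor P0 (ext_power r) (act P0 (pd k) p) (wedge (k # is)))" for p "is"
  define B where "B = {G p is | p is. p \<in> carrier P0 \<and> Suc (length is) = r}"
  have L_sub: "(L_sub r :: 'n F_ext set) = module.span complex_ring (F_ext r) B"
    unfolding L_sub_def B_def G_def ..
  have gen: "G p is \<in> carrier (F_ext r)" "f (G p is) = dext (tens (p0 p) (wedge is))"
    if p: "p \<in> carrier P0" and l: "Suc (length is) = r" for p "is"
  proof -
    have k: "act P0 (pd k) p \<in> carrier P0" "wedge (k # is) \<in> LL r" for k
      using P0.act_in[of "pd k" p] p wedge_LL[of "k # is"] l by (simp_all add: pd_vf)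
    have in_V: "pure_tensor P0 (ext_power r) (act P0 (pd k) p) (wedge (k # is)) \<in> carrier (F_ext r)" for k
      by (intro pure_in k)
    then show "G p is \<in> carrier (F_ext r)"
      unfolding G_def by (intro vs.M.finsum_closed) blast
    have "f (G p is) = (\<Sum>k\<in>UNIV. f (pure_tensor P0 (ext_power r) (act P0 (pd k) p) (wedge (k # is))))"
      unfolding G_def by (rule f_finsum[OF finite in_V])
    then show "f (G p is) = dext (tens (p0 p) (wedge is))"
      unfolding f_pure[OF k] dext_tens by (simp only: P0_pd[OF p] wedge_Cons)
  qed
  have B: "B \<subseteq> carrier (F_ext r)" unfolding B_def using gen(1) by auto
  have wedge_coeffs: "tens q' (wedge is) \<in> coeffs (LL q)" if "Suc (length is) = r"
    for q' :: "('n \<Rightarrow>\<^sub>0 nat) \<Rightarrow>\<^sub>0 complex" and "is" :: "'n list"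
    using that r wedge_LL[of "is"] by (intro tens_coeffs csub_LL) simp
  show "(L_sub r :: 'n F_ext set) \<subseteq> carrier (F_ext r)" unfolding L_sub by (rule span_carrier[OF B])
  show "f ` L_sub r = dext ` coeffs (LL q)"
  proof
    have "dext ` coeffs (LL q) \<subseteq> coeffs (LL r :: ('n set \<Rightarrow>\<^sub>0 complex) set)" using dext_coeffs r by blast
    moreover have "f ` B \<subseteq> dext ` coeffs (LL q)"
      unfolding B_def using gen(2) wedge_coeffs by auto
    ultimately show "f ` L_sub r \<subseteq> dext ` coeffs (LL q)"
      unfolding L_sub by (intro f_span B csub_image_dext)
    let ?N = "{g :: ('n \<Rightarrow>\<^sub>0 nat) \<Rightarrow>\<^sub>0 'n set \<Rightarrow>\<^sub>0 complex. dext g \<in> f ` L_sub r}"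
    have L: "csub (f ` L_sub r)" unfolding L_sub by (rule csub_f_span[OF B])
    have N: "csub ?N" using csub_vimage[OF clin_dext L csub_UNIV] by simp
    have 1: "Poly_Mapping.single \<beta> (Poly_Mapping.single S c) \<in> ?N" if S: "card S = q" for \<beta> S c
    proof -
      let ?p = "P0.fi (Poly_Mapping.single \<beta> c)" and ?is = "sorted_list_of_set S"
      have p: "?p \<in> carrier P0" "p0 ?p = Poly_Mapping.single \<beta> c" by (simp_all add: P0.fi_in P0.f_fi)
      have l: "Suc (length ?is) = r" using S r by simp
      have "G ?p ?is \<in> B" unfolding B_def using p(1) l by blast
      then have "dext (tens (p0 ?p) (wedge ?is)) \<in> f ` B" using gen(2)[OF p(1) l] by (metis imageI)
      moreover have "f ` B \<subseteq> f ` L_sub r" unfolding L_sub using vs.in_own_span[OF B] by blast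
      moreover have "tens (p0 ?p) (wedge ?is) = Poly_Mapping.single \<beta> (Poly_Mapping.single S c)"
        by (simp add: p(2) wedge_sorted tens_single)
      ultimately show ?thesis by auto
    qed
    have 2: "Poly_Mapping.single \<beta> w \<in> ?N" if w: "w \<in> LL q" for \<beta> w
    proof -
      have "w \<in> {w. Poly_Mapping.single \<beta> w \<in> ?N}"
      proof (rule LL_induct[OF w])
        show "csub {w. Poly_Mapping.single \<beta> w \<in> ?N}"
          using csub_vimage[OF clin_single[of \<beta>] N csub_UNIV] by simp
      qed (use 1 in simp)
      then show ?thesis by blast
    qed
    have "g \<in> ?N" if "g \<in> coeffs (LL q)" for g
      by (subst pm_expand, intro csub_sum N 2) (use that in \<open>simp add: coeffs_def\<close>)
    then show "dext ` coeffs (LL q) \<subseteq> f ` L_sub r" by blast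
  qed
qed

text \<open>One field \<partial>_j already suffices for closedness: it commutes with
  \<open>dext\<close>, exact elements are closed, and \<open>dd j\<close> is injective. The converse
  is \<open>X_exact\<close>.\<close>

lemma L_tilde_eq:
  assumes r: "r = Suc q"
  shows "(L_tilde r :: 'n F_ext set) = {v \<in> carrier (F_ext r). dext (f v) = 0}"
proof -
  note L = L_sub_image[OF r]
  note L_iff = eq_vimage[OF L]
  have "(\<forall>x\<in>derivs. act (F_ext r) x v \<in> L_sub r) \<longleftrightarrow> dext (f v) = 0" if v: "v \<in> carrier (F_ext r)" for v
  proof
    assume *: "\<forall>x\<in>derivs. act (F_ext r) x v \<in> L_sub r"
    obtain j :: 'n where True by simp
    have "act (F_ext r) (vf (fld j 1)) v \<in> L_sub r" using * by simp
    then have "X EL (fld j 1) (f v) \<in> dext ` coeffs (LL q)" using L_iff f_act[of "vf (fld j 1)" v] v by auto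
    then have "dext (X EL (fld j 1) (f v)) = 0" by (auto simp: dext_dext)
    then have 1: "X EL (fld j 1) (dext (f v)) = 0" by (simp only: dext_X)
    have "X EL (fld j 1) g = dd j g" for g
      using EL.A1_X[of 1 j g] EL.X1_one[of j g] by (simp add: vfrep.A1_def[OF EL.vfrep_X])
    with 1 have "dd j (dext (f v)) = 0" by simp
    then show "dext (f v) = 0" by simp
  next
    assume d: "dext (f v) = 0"
    show "\<forall>x\<in>derivs. act (F_ext r) x v \<in> L_sub r"
    proof
      fix x :: "'n mpol \<Rightarrow> 'n mpol" assume x: "x \<in> derivs"
      have "f (act (F_ext r) x v) \<in> dext ` coeffs (LL q)"
        using X_exact[of "f v" q "fl x"] f_in[OF v] d r f_act[OF x v] by simp
      then show "act (F_ext r) x v \<in> L_sub r" using L_iff act_in[OF x v] by blast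
    qed
  qed
  then show ?thesis unfolding L_tilde_def by blast
qed

text \<open>The submodule divided out is the kernel of \<open>dext\<close>, so \<open>dext\<close>
  itself gives the coordinates of the quotient, with values one exterior degree higher.\<close>

lemma quot_L_tilde:
  assumes r: "r = Suc q"
  obtains k where "dmodel (quot_rep (F_ext r) (L_tilde r) :: ('n, 'n F_ext set) op_rep) k (dext ` coeffs (LL r)) (X EL)"
proof (rule quot_model[where V = "F_ext r :: ('n, 'n F_ext) op_rep" and S = derivs and h = "\<lambda>v. dext (f v)" and C = "dext ` coeffs (LL r)"
      and a = "\<lambda>D. X EL (fl D)" and N = "L_tilde r"])
  show "(\<lambda>v. dext (f v)) ` carrier (F_ext r) = dext ` coeffs (LL r)"
    unfolding f_image[symmetric] by (simp add: image_image)
  show "(L_tilde r :: 'n F_ext set) = {v \<in> carrier (F_ext r). dext (f v) = 0}" by (rule L_tilde_eq[OF r])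
  fix k assume "model derivs (quot_rep (F_ext r) (L_tilde r) :: ('n, 'n F_ext set) op_rep) k (dext ` coeffs (LL r)) (\<lambda>D. X EL (fl D))"
  then show thesis using EL.vfrep_X by (intro that[of k]) (simp add: dmodel_def)
qed (simp_all add: abelian_group csub_image_dext smult_in f_add f_smult dext_simps act_in f_act dext_X)

end

lemma LL_top: "w \<in> LL CARD('n) \<Longrightarrow> w = Poly_Mapping.single (UNIV :: 'n::{finite,linorder} set) (Poly_Mapping.lookup w UNIV)"
proof (rule poly_mapping_eqI)
  fix S assume w: "w \<in> LL CARD('n)"
  show "Poly_Mapping.lookup w S = Poly_Mapping.lookup (Poly_Mapping.single UNIV (Poly_Mapping.lookup w UNIV)) S"
  proof (cases "S = UNIV")
    case False
    then have "card S \<noteq> CARD('n)" by (metis card_eq_UNIV_imp_eq_UNIV finite)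
    then have "Poly_Mapping.lookup w S = 0" using w by (auto simp: LL_iff)
    with False show ?thesis by (simp add: lookup_single)
  qed simp
qed

lemma LL_above_top: "w \<in> LL (Suc CARD('n)) \<Longrightarrow> w = (0 :: 'n::{finite,linorder} set \<Rightarrow>\<^sub>0 complex)"
proof (rule poly_mapping_eqI)
  fix S :: "'n set" assume "w \<in> LL (Suc CARD('n))"
  moreover have "card S \<noteq> Suc CARD('n)" using card_mono[of UNIV S] by simp
  ultimately show "Poly_Mapping.lookup w S = Poly_Mapping.lookup 0 S" by (auto simp: LL_iff)
qed

lemma dext_top: "g \<in> coeffs (LL CARD('n)) \<Longrightarrow> dext g = (0 :: ('n::{finite,linorder} \<Rightarrow>\<^sub>0 nat) \<Rightarrow>\<^sub>0 _)"
proof -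
  assume g: "g \<in> coeffs (LL CARD('n))"
  have "Poly_Mapping.lookup (dext g) \<beta> = 0" for \<beta>
    using dext_coeffs[OF g] by (intro LL_above_top) (simp add: coeffs_def)
  then show "dext g = 0" by (intro poly_mapping_eqI) simp
qed

text \<open>In top degree \<open>cr i (an i w)\<close> is w, and \<open>cr k (an i w)\<close>
  vanishes for k \<noteq> i. So \<partial>^\<beta> \<otimes> w with \<beta> \<noteq> 0 is exact:
  split one \<partial>_i off \<beta> and contract w by i. Only the line of bottom coefficients
  remains.\<close>

lemma top_exact:
  assumes n: "CARD('n::{finite,linorder}) = Suc q" and g: "g \<in> coeffs (LL CARD('n))"
  shows "g \<in> dext ` coeffs (LL q) \<longleftrightarrow> Poly_Mapping.lookup (Poly_Mapping.lookup g (0 :: 'n \<Rightarrow>\<^sub>0 nat)) (UNIV :: 'n set) = 0"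
proof
  assume "g \<in> dext ` coeffs (LL q)"
  then show "Poly_Mapping.lookup (Poly_Mapping.lookup g 0) UNIV = 0" by (auto simp: lookup_dext_0)
next
  let ?D = "dext ` coeffs (LL q) :: (('n \<Rightarrow>\<^sub>0 nat) \<Rightarrow>\<^sub>0 'n set \<Rightarrow>\<^sub>0 complex) set"
  have D: "csub ?D" by (rule csub_image[OF clin_dext csub_coeffs[OF csub_LL]])
  have C: "Poly_Mapping.lookup g \<beta> \<in> LL CARD('n)" for \<beta> using g by (simp add: coeffs_def)
  assume "Poly_Mapping.lookup (Poly_Mapping.lookup g 0) UNIV = 0"
  then have g0: "Poly_Mapping.lookup g 0 = 0" using LL_top[OF C[of 0]] by simp
  have "Poly_Mapping.single \<beta> (Poly_Mapping.lookup g \<beta>) \<in> ?D" if "\<beta> \<in> Poly_Mapping.keys g" for \<beta>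
  proof -
    let ?w = "Poly_Mapping.lookup g \<beta>"
    have "\<beta> \<noteq> 0" using that g0 by (auto simp: in_keys_iff)
    then obtain i \<gamma> where \<gamma>: "\<beta> = \<gamma> + e1 i" by (metis deg_Suc deg_eq_0_iff)
    have "cr k (an i ?w) = (if k = i then ?w else 0)" for k
      using an_cr[of i k ?w] LL_above_top[OF cr_LL[OF C[of \<beta>]], of k] by (auto simp: an_simps split: if_splits)
    then have "dext (Poly_Mapping.single \<gamma> (an i ?w)) = (\<Sum>k\<in>UNIV. if k = i then Poly_Mapping.single \<beta> ?w else 0)"
      unfolding dext_single \<gamma> by (intro sum.cong refl) simp
    then have "dext (Poly_Mapping.single \<gamma> (an i ?w)) = Poly_Mapping.single \<beta> ?w" by simp
    moreover have "Poly_Mapping.single \<gamma> (an i ?w) \<in> coeffs (LL q)"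
      using an_LL[of ?w q i] C[of \<beta>] n by (auto simp: coeffs_def lookup_single when_def csub_0[OF csub_LL])
    ultimately show ?thesis by (intro image_eqI[of _ dext]) simp_all
  qed
  then have "(\<Sum>\<beta>\<in>Poly_Mapping.keys g. Poly_Mapping.single \<beta> (Poly_Mapping.lookup g \<beta>)) \<in> ?D"
    by (intro csub_sum D)
  then show "g \<in> ?D" using pm_expand[of g] by simp
qed

text \<open>The bottom coefficient is the coordinate of the quotient. In top degree everything is
  closed, so fields map into the exact elements and act on the quotient by 0.\<close>

lemma quot_L_sub_top:
  obtains k where "dmodel (quot_rep (F_ext CARD('n)) (L_sub CARD('n)) :: ('n::{finite,linorder}, _) op_rep) k (UNIV :: complex set) (\<lambda>_ _. 0)"
proof -
  obtain q where q: "CARD('n) = Suc q" using gr0_implies_Suc[of "CARD('n)"] by auto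
  obtain f :: "'n F_ext \<Rightarrow> _" where "ext_model CARD('n) f" by (rule ext_model)
  then interpret ext_model "CARD('n)" f .
  let ?h = "\<lambda>v. Poly_Mapping.lookup (Poly_Mapping.lookup (f v) 0) UNIV"
  note L = L_sub_image[OF q]
  show ?thesis
  proof (rule quot_model[where V = "F_ext CARD('n) :: ('n, _) op_rep" and S = derivs and h = ?h and C = UNIV
        and a = "\<lambda>_ _. 0" and N = "L_sub CARD('n)"])
    show "?h ` carrier (F_ext CARD('n)) = UNIV"
    proof (intro equalityI subsetI)
      fix c :: complex
      have "Poly_Mapping.single 0 (Poly_Mapping.single UNIV c) \<in> coeffs (LL CARD('n) :: ('n set \<Rightarrow>\<^sub>0 complex) set)"
        by (auto simp: coeffs_def lookup_single when_def csub_0[OF csub_LL] intro: single_LL)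
      then obtain v where v: "v \<in> carrier (F_ext CARD('n))" "f v = Poly_Mapping.single 0 (Poly_Mapping.single UNIV c)"
        using f_ex by blast
      have "c = ?h v" by (simp add: v(2))
      with v(1) show "c \<in> ?h ` carrier (F_ext CARD('n))" by blast
    qed simp
    show "L_sub CARD('n) = {v \<in> carrier (F_ext CARD('n)). ?h v = 0}"
      by (subst eq_vimage[OF L], rule Collect_cong, rule conj_cong[OF refl], rule top_exact[OF q f_in])
    show "?h (act (F_ext CARD('n)) x v) = 0" if "x \<in> derivs" "v \<in> carrier (F_ext CARD('n))" for x v
    proof -
      have "X EL (fl x) (f v) \<in> dext ` coeffs (LL q)"
        using f_in[OF that(2)] dext_top[OF f_in[OF that(2)]] q by (intro X_exact) simp_all
      then show ?thesis using f_act[OF that] by (auto simp: lookup_dext_0)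
    qed
    fix k assume "model derivs (quot_rep (F_ext CARD('n)) (L_sub CARD('n)) :: ('n, _) op_rep) k (UNIV :: complex set) (\<lambda>_ _. 0)"
    moreover have "vfrep (\<lambda>(_ :: 'n \<Rightarrow> 'n mpol) (_ :: complex). 0 :: complex)" by standard (simp_all add: clin_zero)
    ultimately show ?thesis by (intro that) (simp add: dmodel_def)
  qed (simp_all add: abelian_group csub_UNIV smult_in f_add f_smult act_in lookup_add)
qed

section \<open>Highest weight modules\<close>

lemma nth_index_less: "1 \<le> k \<Longrightarrow> k < l \<Longrightarrow> l \<le> CARD('n) \<Longrightarrow> (nth_index k :: 'n::{finite,linorder}) < nth_index l"
  unfolding nth_index_def
  by (rule sorted_wrt_nth_less[OF strict_sorted_list_of_set]) auto

lemma bij_nth_index: "bij_betw (nth_index :: nat \<Rightarrow> 'n::{finite,linorder}) {1..CARD('n)} UNIV"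
proof -
  have inj: "inj_on (nth_index :: nat \<Rightarrow> 'n) {1..CARD('n)}"
  proof (rule inj_onI)
    fix k l assume kl: "k \<in> {1..CARD('n)}" "l \<in> {1..CARD('n)}" "(nth_index k :: 'n) = nth_index l"
    have "\<not> k < l" using nth_index_less[of k l, where 'n = 'n] kl by fastforce
    moreover have "\<not> l < k" using nth_index_less[of l k, where 'n = 'n] kl by fastforce
    ultimately show "k = l" by simp
  qed
  then have "card ((nth_index :: nat \<Rightarrow> 'n) ` {1..CARD('n)}) = CARD('n)"
    using card_image[OF inj] by simp
  then have "(nth_index :: nat \<Rightarrow> 'n) ` {1..CARD('n)} = UNIV"
    by (rule card_eq_UNIV_imp_eq_UNIV[OF finite])
  then show ?thesis by (rule bij_betw_imageI[OF inj])
qed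

lemma downset_nth_index:
  assumes A: "downset (A :: 'n::{finite,linorder} set)" and k: "k \<in> {1..CARD('n)}"
  shows "nth_index k \<in> A \<longleftrightarrow> k \<le> card A"
proof -
  define S where "S = {k \<in> {1..CARD('n)}. (nth_index k :: 'n) \<in> A}"
  have "bij_betw nth_index S A"
  proof (rule bij_betw_imageI)
    show "inj_on (nth_index :: nat \<Rightarrow> 'n) S"
      using bij_nth_index[where 'n = 'n] by (rule inj_on_subset[OF bij_betw_imp_inj_on]) (auto simp: S_def)
    show "nth_index ` S = A"
    proof (intro equalityI subsetI)
      fix a assume a: "a \<in> A"
      obtain k where "k \<in> {1..CARD('n)}" "a = nth_index k"
        using bij_betw_imp_surj_on[OF bij_nth_index[where 'n = 'n]] by blast
      with a show "a \<in> nth_index ` S" by (auto simp: S_def)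
    qed (auto simp: S_def)
  qed
  then have card: "card S = card A" by (rule bij_betw_same_card)
  have down: "l \<in> S" if "m \<in> S" "l \<in> {1..m}" for l m
  proof (cases "l = m")
    case False
    with that have "(nth_index l :: 'n) < nth_index m" by (intro nth_index_less) (auto simp: S_def)
    then have "(nth_index l :: 'n) \<in> A" using A that unfolding downset_def S_def by blast
    then show ?thesis using that by (auto simp: S_def)
  qed (use that in simp)
  show ?thesis
  proof
    assume "nth_index k \<in> A"
    then have "k \<in> S" using k by (simp add: S_def)
    then have "{1..k} \<subseteq> S" using down by blast
    from card_mono[OF _ this] show "k \<le> card A" using card by (simp add: S_def)
  next
    assume *: "k \<le> card A"
    show "nth_index k \<in> A"
    proof (rule ccontr)
      assume "nth_index k \<notin> A"
      then have k': "k \<notin> S" by (simp add: S_def)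
      have "S \<subseteq> {1..<k}"
      proof
        fix m assume m: "m \<in> S"
        then have "\<not> k \<le> m" using down[OF m, of k] k k' by auto
        then show "m \<in> {1..<k}" using m by (auto simp: S_def)
      qed
      from card_mono[OF _ this] have "card A \<le> k - 1" using card by simp
      with * k show False by auto
    qed
  qed
qed

context glrep
begin

lemma glact_diff: "glact E (B - B') w = glact E B w - glact E B' w"
  using glact_add[of "B - B'" B' w] by (simp add: algebra_simps)

lemma glact_mat_1: "glact E (mat 1) w = (\<Sum>i\<in>UNIV. E i i w)"
proof -
  have "(\<Sum>j\<in>UNIV. scl (mat 1 $ i $ j) (E i j w)) = (\<Sum>j\<in>UNIV. if j = i then E i i w else 0)" for i
    by (intro sum.cong refl) (simp add: mat_def)
  then show ?thesis by (simp add: glact_def)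
qed

end

lemma glact_coroot:
  fixes E :: "'n::{finite,linorder} \<Rightarrow> 'n \<Rightarrow> 'w::cvs \<Rightarrow> 'w"
  assumes "glrep E"
  shows "glact E (coroot k) w =
    E (nth_index k) (nth_index k) w - E (nth_index (k + 1)) (nth_index (k + 1)) w"
  by (simp add: coroot_def glrep.glact_diff[OF assms] glrep.glact_matunit[OF assms])

lemma is_V_imp_TT:
  fixes M :: "('n::{finite,linorder}, 'm) gl_rep"
  assumes gm: "gmodel M f C E" and irr: "irr (case_prod E) C" and r: "r \<le> CARD('n)"
    and V: "is_V (fundamental_weight r) (of_nat r) M" and m: "m \<in> C"
  shows "glrep.TT E i l j k m = 0"
proof -
  interpret gmodel M f C E by (rule gm)
  obtain v where v: "v \<in> carrier M" "v \<noteq> \<zero>\<^bsub>M\<^esub>" "\<And>i j. i < j \<Longrightarrow> act M (matunit i j) v = \<zero>\<^bsub>M\<^esub>"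
    "\<And>k. k \<in> {1..CARD('n) - 1} \<Longrightarrow> act M (coroot k) v = fundamental_weight r k \<odot>\<^bsub>M\<^esub> v"
    "act M (mat 1) v = of_nat r \<odot>\<^bsub>M\<^esub> v"
    using V unfolding is_V_def by blast
  define w where "w = f v"
  define x :: "nat \<Rightarrow> 'n" where "x = nth_index"
  \<comment> \<open>b k is the deviation of E_kk w from the expected weight. The coroots make it
    independent of k and the scalar of the identity matrix makes its sum over k zero, so it
    vanishes.\<close>
  define b where "b k = E (x k) (x k) w - (if k \<le> r then w else 0)" for k
  have w: "w \<in> C" "w \<noteq> 0" using v(1,2) f_in f_eq_0 by (auto simp: w_def)
  have raise: "E i j w = 0" if "i < j" for i j
    using v(3)[OF that] f_E[OF v(1)] f_zero by (metis w_def)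
  have d: "E (x k) (x k) w - E (x (k + 1)) (x (k + 1)) w = scl (fundamental_weight r k) w"
    if "k \<in> {1..CARD('n) - 1}" for k
    using f_act[OF UNIV_I v(1), of "coroot k"] v(4)[OF that] f_smult[OF v(1)]
    by (simp add: w_def x_def glact_coroot[OF glrep_axioms])
  have e: "E (x k) (x k) w = E (x (Suc k)) (x (Suc k)) w + scl (fundamental_weight r k) w"
    if "k \<in> {1..CARD('n) - 1}" for k
    unfolding Suc_eq_plus1 d[OF that, symmetric] by simp
  have step: "b (Suc k) = b k" if "k \<in> {1..CARD('n) - 1}" for k
    unfolding b_def e[OF that] by (cases k r rule: linorder_cases) (simp_all add: fundamental_weight_def)
  have const: "k \<in> {1..CARD('n)} \<Longrightarrow> b k = b 1" for k
  proof (induction k)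
    case (Suc k)
    then show ?case using step[of k] by (cases "k = 0") (auto simp: One_nat_def)
  qed simp
  have "(\<Sum>i\<in>UNIV. E i i w) = scl (of_nat r) w"
    using f_act[OF UNIV_I v(1), of "mat 1"] v(5) f_smult[OF v(1)] by (simp add: w_def glact_mat_1)
  moreover have "(\<Sum>i\<in>UNIV. E i i w) = (\<Sum>k\<in>{1..CARD('n)}. E (x k) (x k) w)"
    using sum.reindex_bij_betw[OF bij_nth_index[where 'n = 'n], of "\<lambda>i. E i i w"] by (simp add: x_def)
  moreover have "(\<Sum>k\<in>{1..CARD('n)}. if k \<le> r then w else 0) = scl (of_nat r) w"
  proof -
    have "(\<Sum>k\<in>{1..CARD('n)}. if k \<le> r then w else 0) = (\<Sum>k\<in>{1..r}. scl 1 w)"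
      using r by (intro sum.mono_neutral_cong_right) auto
    also have "\<dots> = scl (\<Sum>k\<in>{1..r}. 1) w" by (rule cvs.scale_sum_left[symmetric])
    finally show ?thesis by simp
  qed
  ultimately have s0: "(\<Sum>k\<in>{1..CARD('n)}. b k) = 0" by (simp add: b_def sum_subtractf)
  have "(\<Sum>k\<in>{1..CARD('n)}. b k) = (\<Sum>k\<in>{1..CARD('n)}. scl 1 (b 1))"
    by (rule sum.cong[OF refl]) (simp only: const cvs.scale_one)
  also have "\<dots> = scl (\<Sum>k\<in>{1..CARD('n)}. 1) (b 1)" by (rule cvs.scale_sum_left[symmetric])
  finally have "scl (\<Sum>k\<in>{1..CARD('n)}. 1) (b 1) = 0" unfolding s0 by (rule sym)
  then have b1: "b 1 = 0" by simp
  have b: "b k = 0" if "k \<in> {1..CARD('n)}" for k unfolding const[OF that] by (rule b1)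
  define A0 where "A0 = x ` {1..r}"
  have inj: "inj_on x {1..CARD('n)}" using bij_nth_index[where 'n = 'n] by (simp add: x_def bij_betw_def)
  have surj: "\<exists>k\<in>{1..CARD('n)}. i = x k" for i
    using bij_nth_index[where 'n = 'n] by (auto simp: x_def bij_betw_def)
  have A0: "x k \<in> A0 \<longleftrightarrow> k \<le> r" if "k \<in> {1..CARD('n)}" for k
    using inj_on_image_mem_iff[OF inj that, of "{1..r}"] r that by (auto simp: A0_def)
  have "downset A0"
    unfolding downset_def
  proof (intro allI impI)
    fix i j assume ij: "i < j" "j \<in> A0"
    obtain k l where k: "k \<in> {1..CARD('n)}" "i = x k" and l: "l \<in> {1..CARD('n)}" "j = x l" using surj by metis
    have "\<not> l \<le> k"
    proof
      assume "l \<le> k"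
      then have "x l \<le> x k" using nth_index_less[of l k, where 'n = 'n] k(1) l(1) by (cases "l = k") (auto simp: x_def)
      with ij(1) k(2) l(2) show False by simp
    qed
    with ij(2) A0[OF k(1)] A0[OF l(1)] show "i \<in> A0" by (simp add: k(2) l(2))
  qed
  moreover have "E i i w = (if i \<in> A0 then w else 0)" for i
  proof -
    obtain k where k: "k \<in> {1..CARD('n)}" "i = x k" using surj by blast
    then show ?thesis using b[OF k(1)] A0[OF k(1)] by (simp add: b_def split: if_splits)
  qed
  ultimately interpret hw_rep E C A0 w
    by unfold_locales (use irr w raise in auto)
  show ?thesis by (rule TT_C[OF m])
qed

lemma sl_simps [simp]: "carrier sl = {A. trace A = 0}" "x \<oplus>\<^bsub>sl\<^esub> y = x + y"
  "c \<odot>\<^bsub>sl\<^esub> x = (\<chi> i j. c * x $ i $ j)" "bracket sl x y = x ** y - y ** x"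
  by (simp_all add: sl_def gl_def)

lemma lie_module_sl: "lie_module gl M \<Longrightarrow> lie_module sl M"
proof -
  assume "lie_module gl M"
  then interpret lie_module gl M .
  show "lie_module sl M"
    using act_closed act_add act_smult add_act smult_act bracket_act
    by (intro lie_module.intro lie_module_axioms.intro vectorspace_axioms) simp_all
qed

lemma TT_imp_is_V:
  fixes M :: "('n::{finite,linorder}, 'm) gl_rep"
  assumes gm: "gmodel M f C E" and irr: "irr (case_prod E) C"
    and TT: "\<And>i l j k m. m \<in> C \<Longrightarrow> glrep.TT E i l j k m = 0"
  shows "\<exists>r\<in>{0..CARD('n)}. is_V (fundamental_weight r) (of_nat r) M"
proof -
  interpret gmodel M f C E by (rule gm)
  interpret tt: tt_rep E C
    by unfold_locales (use irr TT in \<open>auto simp: irr_def\<close>)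
  obtain A w where w: "w \<in> tt.D A" "w \<noteq> 0" "downset A" by (rule tt.hw_weight)
  define r where "r = card A"
  have r: "r \<le> CARD('n)" unfolding r_def by (rule card_mono) auto
  have wC: "w \<in> C" by (rule tt.D_C[OF w(1)])
  define v where "v = fi w"
  have v: "v \<in> carrier M" "f v = w" by (simp_all add: v_def fi_in f_fi wC)
  have eqI: "u = u'" if "u \<in> carrier M" "u' \<in> carrier M" "f u = f u'" for u u'
    using that f_inj by blast
  \<comment> \<open>The eigenspace of the trace for the eigenvalue r is a submodule containing w,
    hence all of C; this is valid in any dimension.\<close>
  have trace: "(\<Sum>i\<in>UNIV. E i i m) = scl (of_nat r) m" if "m \<in> C" for m
  proof -
    let ?S = "{m \<in> C. (\<Sum>i\<in>UNIV. E i i m) = scl (of_nat r) m}"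
    have clin: "clin (\<lambda>m. (\<Sum>i\<in>UNIV. E i i m) - scl (of_nat r) m)"
      by (intro clin_sub clin_sumf clin_E clin_scale clin_id)
    have S: "?S = {m \<in> C. (\<Sum>i\<in>UNIV. E i i m) - scl (of_nat r) m \<in> {0}}" by auto
    have "csub ?S" unfolding S by (rule csub_vimage[OF clin csub_zero csub_C])
    moreover have "E i j m \<in> ?S" if m: "m \<in> ?S" for i j m
    proof -
      have "(\<Sum>k\<in>UNIV. E k k (E i j m)) - E i j (\<Sum>k\<in>UNIV. E k k m) =
          (\<Sum>k\<in>UNIV. (if k = i then E i j m else 0) - (if k = j then E i j m else 0))"
        unfolding clin_sum[OF clin_E] sum_subtractf[symmetric] E_bracket
        by (intro sum.cong refl) auto
      then have "(\<Sum>k\<in>UNIV. E k k (E i j m)) = E i j (\<Sum>k\<in>UNIV. E k k m)" by (simp add: sum_subtractf)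
      then show ?thesis using m E_C by (simp add: clin_scl[OF clin_E])
    qed
    ultimately have inv: "inv_sub (case_prod E) ?S" unfolding inv_sub_def by auto
    have "(\<Sum>i\<in>UNIV. E i i w) = (\<Sum>i\<in>UNIV. if i \<in> A then scl 1 w else 0)"
      by (intro sum.cong refl) (simp add: tt.D_E[OF w(1)])
    also have "\<dots> = (\<Sum>i\<in>A. scl 1 w)" by (simp add: sum.If_cases)
    also have "\<dots> = scl (\<Sum>i\<in>A. 1) w" by (rule cvs.scale_sum_left[symmetric])
    finally have "w \<in> ?S" using wC by (simp add: r_def)
    then have "?S = C" using irr_cases[OF irr _ inv] w(2) by blast
    with that show ?thesis by blast
  qed
  have mat1: "act M (mat 1) u = of_nat r \<odot>\<^bsub>M\<^esub> u" if "u \<in> carrier M" for u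
    using that by (intro eqI) (simp_all add: act_in smult_in f_act f_smult glact_mat_1 trace f_in)
  have raise: "act M (matunit i j) v = \<zero>\<^bsub>M\<^esub>" if "i < j" for i j
  proof -
    have "E i j w = 0" using that w(3) by (intro tt.E_zero[OF w(1)]) (auto simp: downset_def)
    then show ?thesis using v f_E[OF v(1)] by (intro eqI) (simp_all add: act_in zero_in f_zero)
  qed
  have coroot: "act M (coroot k) v = fundamental_weight r k \<odot>\<^bsub>M\<^esub> v" if k: "k \<in> {1..CARD('n) - 1}" for k
  proof (rule eqI)
    have "(nth_index k \<in> A) = (k \<le> r)" "(nth_index (k + 1) \<in> A) = (k + 1 \<le> r)"
      unfolding r_def using k by (intro downset_nth_index[OF w(3)]; auto)+
    then show "f (act M (coroot k) v) = f (fundamental_weight r k \<odot>\<^bsub>M\<^esub> v)"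
      using v by (simp add: f_act f_smult glact_coroot[OF glrep_axioms] tt.D_E[OF w(1)] fundamental_weight_def)
  qed (use v in \<open>simp_all add: act_in smult_in\<close>)
  have simple: "simple_lie_module sl M"
    unfolding simple_lie_module_def
  proof (intro conjI allI impI)
    show "lie_module sl M" by (rule lie_module_sl[OF lie_module])
    show "carrier M \<noteq> {\<zero>\<^bsub>M\<^esub>}"
      using v w(2) f_eq_0[OF v(1)] by blast
    fix N assume "lie_submodule sl M N"
    then have N: "N \<subseteq> carrier M" "csub (f ` N)" and sl: "\<And>B u. trace B = 0 \<Longrightarrow> u \<in> N \<Longrightarrow> act M B u \<in> N"
      by (auto simp: lie_submodule_def subspace_iff)
    have "E i j m \<in> f ` N" if mN: "m \<in> f ` N" for i j m
    proof -
      obtain u where u: "u \<in> N" "m = f u" using mN by blast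
      then have uM: "u \<in> carrier M" using N(1) by blast
      show ?thesis
      proof (cases "i = j")
        case False
        then have "trace (matunit i j :: 'n sq_matrix) = 0" by (auto simp: trace_def matunit_def intro!: sum.neutral)
        then have "act M (matunit i j) u \<in> N" using u by (intro sl)
        from imageI[OF this, of f] show ?thesis using uM u by (simp add: f_E)
      next
        case True
        \<comment> \<open>Subtracting 1/n times the identity makes E_ii traceless. As the identity
          acts by the scalar r, a subspace stable under sl is stable under E_ii as well.\<close>
        define c :: complex where "c = 1 / of_nat CARD('n)"
        define B :: "'n sq_matrix" where "B = matunit i i - (\<chi> k l. c * mat 1 $ k $ l)"
        have "trace B = (\<Sum>k\<in>UNIV. (if k = i then 1 else 0) - c)"
          unfolding trace_def by (intro sum.cong refl) (simp add: B_def matunit_def mat_def)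
        then have "trace B = 0" by (simp add: sum_subtractf c_def)
        then have "f (act M B u) \<in> f ` N" using u sl by blast
        moreover have "f (act M B u) = E i i m - scl c (scl (of_nat r) m)"
          using uM u f_in[OF uM]
          by (simp add: f_act B_def glact_diff glact_matunit glact_scl glact_mat_1 trace del: cvs.scale_scale)
        ultimately have "E i i m - scl c (scl (of_nat r) m) \<in> f ` N" by simp
        moreover have "scl c (scl (of_nat r) m) \<in> f ` N" by (intro csub_scl N(2) mN)
        ultimately have "(E i i m - scl c (scl (of_nat r) m)) + scl c (scl (of_nat r) m) \<in> f ` N"
          by (rule csub_add[OF N(2)])
        then show ?thesis using True by simp
      qed
    qed
    then have "inv_sub (case_prod E) (f ` N)" using N(2) by (auto simp: inv_sub_def)
    moreover have "f ` N \<subseteq> C" using N(1) f_image by blast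
    ultimately have "f ` N = {0} \<or> f ` N = C" using irr_cases[OF irr] by blast
    then show "N = {\<zero>\<^bsub>M\<^esub>} \<or> N = carrier M"
      using image_eq_0_iff[OF N(1)] image_eq_C_iff[OF N(1)] by blast
  qed
  have "v \<noteq> \<zero>\<^bsub>M\<^esub>" using v w(2) f_zero by auto
  then have "is_V (fundamental_weight r) (of_nat r) M"
    unfolding is_V_def using lie_module simple v(1) raise coroot mat1 by blast
  with r show ?thesis by auto
qed

section \<open>The classification\<close>

lemma (in dmodel) transfer:
  assumes "vfrep A'" "csub C'" "bij_betw \<phi> C C'" "\<And>u v. u \<in> C \<Longrightarrow> v \<in> C \<Longrightarrow> \<phi> (u + v) = \<phi> u + \<phi> v"
    "\<And>c v. v \<in> C \<Longrightarrow> \<phi> (scl c v) = scl c (\<phi> v)" "\<And>h v. v \<in> C \<Longrightarrow> \<phi> (A h v) = A' h (\<phi> v)"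
  shows "dmodel V (\<lambda>v. \<phi> (f v)) C' A'"
proof -
  have "\<phi> 0 = 0" using assms(5)[of 0 0] csub_0[OF csub_C] by simp
  then show ?thesis unfolding dmodel_def using assms by (intro conjI transfer_model) auto
qed

lemma (in dmodel) transfer_clin:
  assumes "vfrep A'" "clin \<phi>" "\<And>v. v \<in> C \<Longrightarrow> \<phi> v = 0 \<Longrightarrow> v = 0" "\<And>h v. v \<in> C \<Longrightarrow> \<phi> (A h v) = A' h (\<phi> v)"
  shows "dmodel V (\<lambda>v. \<phi> (f v)) (\<phi> ` C) A'"
proof (rule transfer[OF assms(1)])
  show "csub (\<phi> ` C)" by (rule csub_image[OF assms(2) csub_C])
  have "inj_on \<phi> C"
  proof (rule inj_onI)
    fix u v assume uv: "u \<in> C" "v \<in> C" "\<phi> u = \<phi> v"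
    then have "\<phi> (u - v) = 0" using assms(2) by (simp add: clin_diff)
    then have "u - v = 0" using assms(3)[OF csub_diff[OF csub_C uv(1,2)]] by blast
    then show "u = v" by simp
  qed
  then show "bij_betw \<phi> C (\<phi> ` C)" by (rule inj_on_imp_bij_betw)
qed (use assms in \<open>simp_all add: clin_simps\<close>)

lemma (in glrep) K1_coeffs:
  assumes "csub C" "m \<in> C" "m \<noteq> 0"
  shows "vfrep.K1 (X E) (coeffs C) \<noteq> {0}"
proof -
  have "Poly_Mapping.single 0 m \<in> vfrep.K1 (X E) (coeffs C)"
    using assms by (simp add: vfrep.K1_def[OF vfrep_X] A1_X X1_high)
  moreover have "Poly_Mapping.single 0 m \<noteq> 0" using assms(3) by simp
  ultimately show ?thesis by blast
qed

lemma tensor_simple: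
  fixes M :: "('n::{finite,linorder}, 'm) gl_rep"
  assumes M: "simple_lie_module gl M" and V: "\<forall>r\<in>{0..CARD('n)}. \<not> is_V (fundamental_weight r) (of_nat r) M"
    and nt: "\<not> trivial_lie_module derivations (F_mod P0 M)"
  shows "simple_lie_module derivations (F_mod P0 M) \<and> smooth (F_mod P0 M) \<and> height (F_mod P0 M) = 1"
proof -
  have "lie_module gl M" using M by (simp add: simple_lie_module_def)
  then obtain f :: "'m \<Rightarrow> 'm \<Rightarrow>\<^sub>0 complex" and C E where gm: "gmodel M f C E" by (rule gl_module_embed)
  interpret M: gmodel M f C E by (rule gm)
  have irr: "irr (case_prod E) C" using M M.simple_iff by simp
  obtain m i l j k where m: "m \<in> C" "M.TT i l j k m \<noteq> 0" using TT_imp_is_V[OF gm irr] V by blast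
  interpret F: F_model M f C E unfolding F_model_def by (rule gm)
  obtain g where "dmodel (F_mod P0 M) g (coeffs C) (X E)" by (rule F.F_mod_model)
  then interpret dmodel "F_mod P0 M" g "coeffs C" "X E" .
  have "m \<noteq> 0" using m(2) clin_0[OF M.clin_TT] by blast
  then have "K1 (coeffs C) \<noteq> {0}" by (rule M.K1_coeffs[OF M.csub_C m(1)])
  moreover have "\<exists>m. \<forall>\<alpha> j. m \<le> deg \<alpha> \<longrightarrow> A1 (mon \<alpha>) j w = 0" for w
    unfolding M.A1_X by (rule M.smooth_X)
  ultimately show ?thesis by (intro simple_smooth_height M.irr_coeffs[OF irr m] nt)
qed

lemma dext_simple:
  fixes V :: "('n::{finite,linorder}, 'v) op_rep"
  assumes dm: "dmodel V k (dext ` coeffs (LL r)) (X EL)" and r: "r < CARD('n)"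
    and nt: "\<not> trivial_lie_module derivations V"
  shows "simple_lie_module derivations V \<and> smooth V \<and> height V = 1"
proof -
  interpret dmodel V k "dext ` coeffs (LL r)" "X EL" by (rule dm)
  obtain S :: "'n set" where S: "card S = r" using obtain_subset_with_card_n[OF less_imp_le[OF r]] by blast
  let ?w = "Poly_Mapping.single S (1 :: complex)"
  let ?g = "Poly_Mapping.single (0 :: 'n \<Rightarrow>\<^sub>0 nat) ?w"
  have w: "?w \<in> LL r" "?w \<noteq> 0" using S by (simp_all add: single_LL)
  obtain i where i: "cr i ?w \<noteq> 0" by (rule dext_bottom_nonzero[OF w r])
  have "Poly_Mapping.lookup (dext ?g) (e1 i) \<noteq> 0" unfolding dext_lookup_e1 using i by simp
  then have "dext ?g \<noteq> 0" by auto
  moreover have "?g \<in> coeffs (LL r)" by (simp only: single_coeffs[OF csub_LL] w(1))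
  then have "dext ?g \<in> K1 (dext ` coeffs (LL r))"
  proof -
    assume g: "?g \<in> coeffs (LL r)"
    have "X1 EL (mon \<alpha>) j (dext ?g) = 0" if "deg \<alpha> \<ge> 2" for \<alpha> j
      unfolding dext_X1[symmetric] using that by (subst EL.X1_high) (simp_all add: dext_simps)
    with g show ?thesis unfolding K1_def EL.A1_X by blast
  qed
  ultimately have "K1 (dext ` coeffs (LL r)) \<noteq> {0}" by blast
  moreover have "\<exists>m. \<forall>\<alpha> j. m \<le> deg \<alpha> \<longrightarrow> A1 (mon \<alpha>) j w = 0" for w
    unfolding EL.A1_X by (rule EL.smooth_X)
  ultimately show ?thesis by (intro simple_smooth_height irr_dext[OF r] nt)
qed

text \<open>\<open>dext\<close> is injective in degree 0, so this module too is an image of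
  \<open>dext\<close> and can be treated like the quotients with r > 0.\<close>

lemma F_ext_0_model:
  obtains k where "dmodel (F_ext 0 :: ('n::{finite,linorder}, _) op_rep) k (dext ` coeffs (LL 0)) (X EL)"
proof -
  obtain f :: "'n F_ext \<Rightarrow> _" where "ext_model 0 f" by (rule ext_model)
  then interpret ext_model 0 f .
  have "dmodel (F_ext 0 :: ('n, _) op_rep) (\<lambda>v. dext (f v)) (dext ` coeffs (LL 0)) (X EL)"
    by (rule transfer_clin[OF EL.vfrep_X clin_dext dext_ker_0 dext_X])
  then show ?thesis by (rule that)
qed

lemma F_ext_0_iso: "lie_iso derivations (F_ext 0 :: ('n::{finite,linorder}, _) op_rep) P0"
proof -
  obtain f :: "'n F_ext \<Rightarrow> _" where "ext_model 0 f" by (rule ext_model)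
  then interpret ext_model 0 f .
  define \<phi> :: "(('n \<Rightarrow>\<^sub>0 nat) \<Rightarrow>\<^sub>0 'n set \<Rightarrow>\<^sub>0 complex) \<Rightarrow> ('n \<Rightarrow>\<^sub>0 nat) \<Rightarrow>\<^sub>0 complex"
    where "\<phi> = pmap (\<lambda>w :: 'n set \<Rightarrow>\<^sub>0 complex. Poly_Mapping.lookup w {})"
  have l: "clin (\<lambda>w :: 'n set \<Rightarrow>\<^sub>0 complex. Poly_Mapping.lookup w {})" by (rule clinI) (simp_all add: lookup_add)
  have \<phi>: "clin \<phi>" unfolding \<phi>_def by (rule clin_pmap[OF l])
  have zero: "w = 0" if w: "w \<in> LL 0" "Poly_Mapping.lookup w {} = 0" for w :: "'n set \<Rightarrow>\<^sub>0 complex"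
  proof (rule poly_mapping_eqI)
    fix S show "Poly_Mapping.lookup w S = Poly_Mapping.lookup 0 S"
      using w by (cases "S = {}") (auto simp: LL_iff)
  qed
  have "\<phi> ` coeffs (LL 0) = (UNIV :: (('n \<Rightarrow>\<^sub>0 nat) \<Rightarrow>\<^sub>0 complex) set)"
  proof (intro equalityI subsetI)
    fix q :: "('n \<Rightarrow>\<^sub>0 nat) \<Rightarrow>\<^sub>0 complex"
    let ?w = "Poly_Mapping.single ({} :: 'n set) (1 :: complex)"
    have "\<phi> (tens q ?w) = q"
      unfolding \<phi>_def by (rule poly_mapping_eqI) (simp add: lookup_pmap[OF l] lookup_tens)
    moreover have "tens q ?w \<in> coeffs (LL 0)" by (intro tens_coeffs csub_LL single_LL) simp
    ultimately show "q \<in> \<phi> ` coeffs (LL 0)" by (metis imageI)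
  qed simp
  moreover have "dmodel (F_ext 0 :: ('n, _) op_rep) (\<lambda>v. \<phi> (f v)) (\<phi> ` coeffs (LL 0)) (X (\<lambda>_ _ _. 0))"
  proof (rule transfer_clin[OF glrep.vfrep_X[OF glrep_zero] \<phi>])
    fix g :: "('n \<Rightarrow>\<^sub>0 nat) \<Rightarrow>\<^sub>0 'n set \<Rightarrow>\<^sub>0 complex" assume g: "g \<in> coeffs (LL 0)"
    then have C: "Poly_Mapping.lookup g \<beta> \<in> LL 0" for \<beta> by (simp add: coeffs_def)
    show "g = 0" if "\<phi> g = 0"
    proof (rule poly_mapping_eqI)
      fix \<beta>
      have "Poly_Mapping.lookup (\<phi> g) \<beta> = Poly_Mapping.lookup (Poly_Mapping.lookup g \<beta>) {}"
        unfolding \<phi>_def by (rule lookup_pmap[OF l])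
      then show "Poly_Mapping.lookup g \<beta> = Poly_Mapping.lookup 0 \<beta>" using zero[OF C[of \<beta>]] that by simp
    qed
    have "pmap (EL i j) g = 0" for i j
      by (rule poly_mapping_eqI, unfold lookup_pmap[OF EL.clin_E]) (simp add: EL_def an_LL_0[OF C] cr_simps)
    then have "X EL h g = (\<Sum>j\<in>UNIV. T (h j) (dd j g))" for h
      by (simp add: X_def X1_def T_simps)
    then show "\<phi> (X EL h g) = X (\<lambda>_ _ _. 0) h (\<phi> g)" for h
      by (simp add: X_zero clin_sum[OF \<phi>]) (simp add: \<phi>_def pmap_T[OF l] pmap_dd[OF l])
  qed
  ultimately have "dmodel (F_ext 0 :: ('n, _) op_rep) (\<lambda>v. \<phi> (f v)) UNIV (X (\<lambda>_ _ _. 0))" by simp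
  then show ?thesis by (rule dmodel_iso[OF _ P0.dmodel_axioms])
qed

lemma dext_iso:
  fixes V :: "('n::{finite,linorder}, 'v) op_rep" and W :: "('n, 'w) op_rep"
    and \<psi> :: "(('n \<Rightarrow>\<^sub>0 nat) \<Rightarrow>\<^sub>0 'n set \<Rightarrow>\<^sub>0 complex) \<Rightarrow> 'c::cvs"
  assumes dm: "dmodel V f C A" and \<psi>: "clin \<psi>" "\<psi> ` coeffs (LL r) = C"
      "\<And>g. g \<in> coeffs (LL r) \<Longrightarrow> \<psi> g = 0 \<longleftrightarrow> dext g = 0"
      "\<And>h g. g \<in> coeffs (LL r) \<Longrightarrow> \<psi> (X EL h g) = A h (\<psi> g)"
    and W: "dmodel W k (dext ` coeffs (LL r)) (X EL)"
  shows "lie_iso derivations V W"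
proof -
  interpret V: dmodel V f C A by (rule dm)
  interpret W: dmodel W k "dext ` coeffs (LL r)" "X EL" by (rule W)
  let ?G = "coeffs (LL r) :: (('n \<Rightarrow>\<^sub>0 nat) \<Rightarrow>\<^sub>0 'n set \<Rightarrow>\<^sub>0 complex) set"
  show ?thesis
  proof (rule surj_same_kernel[of ?G dext "dext ` ?G" \<psi> C "X EL" "X EL" A])
    show "csub ?G" by (rule csub_coeffs[OF csub_LL])
    show "X EL h g \<in> ?G \<and> dext (X EL h g) = X EL h (dext g) \<and> \<psi> (X EL h g) = A h (\<psi> g)"
      if "g \<in> ?G" for h g
      using that \<psi>(4) EL.inv_coeffs[OF inv_LL, of r] by (auto simp: inv_sub_def dext_X)
    fix \<phi>
    assume \<phi>: "bij_betw \<phi> (dext ` ?G) C"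
      "\<And>u v. u \<in> dext ` ?G \<Longrightarrow> v \<in> dext ` ?G \<Longrightarrow> \<phi> (u + v) = \<phi> u + \<phi> v"
      "\<And>c v. v \<in> dext ` ?G \<Longrightarrow> \<phi> (scl c v) = scl c (\<phi> v)"
      "\<And>h v. v \<in> dext ` ?G \<Longrightarrow> \<phi> (X EL h v) = A h (\<phi> v)"
    have "dmodel W (\<lambda>v. \<phi> (k v)) C A"
      by (rule W.transfer[OF V.vfrep_axioms V.csub_C]) (fact \<phi>)+
    then show ?thesis by (rule dmodel_iso[OF dm])
  qed (use \<psi> clin_dext in auto)
qed

text \<open>Three alternatives suffice: the exterior powers found by \<open>classify_ext\<close>
  have r < n, so the top quotient, which is trivial and thus of height 0, does not occur.\<close>

lemma classification:
  fixes V :: "('n::{finite,linorder}, 'v) op_rep"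
  assumes V: "simple_lie_module derivations V" "smooth V" "height V = 1"
  shows "(\<exists>M :: ('n, 'v) gl_rep. simple_lie_module gl M \<and>
       (\<forall>r\<in>{0..CARD('n)}. \<not> is_V (fundamental_weight r) (of_nat r) M) \<and>
       lie_iso derivations V (F_mod P0 M)) \<or>
    lie_iso derivations V (F_ext 0) \<or>
    (\<exists>r\<in>{1..CARD('n) - 1}. lie_iso derivations V (quot_rep (F_ext r) (L_tilde r)))"
proof -
  have "lie_module derivations V" using V by (simp add: simple_lie_module_def)
  then obtain f :: "'v \<Rightarrow> 'v \<Rightarrow>\<^sub>0 complex" and C A where dm: "dmodel V f C A" by (rule lie_module_embed)
  interpret dmodel V f C A by (rule dm)
  have irr: "irr A C" using V simple_iff by simp
  then have "C \<noteq> {0}" by (simp add: irr_def)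
  note K = height_1D[OF V(3,2) this]
  interpret EV: glrep EV by (rule glrep_EV)
  from classify[OF irr K] show ?thesis
  proof (elim disjE conjE exE bexE)
    fix i l j k m \<psi>
    assume m: "m \<in> K1 C" "EV.TT i l j k m \<noteq> 0" and irrK: "irr (case_prod EV) (K1 C)"
      and \<psi>: "clin \<psi>" "\<forall>g\<in>coeffs (K1 C). (\<psi> g = 0) = (g = 0)" "\<psi> ` coeffs (K1 C) = C"
        "\<forall>h. \<forall>g\<in>coeffs (K1 C). \<psi> (X EV h g) = A h (\<psi> g)"
    obtain M :: "('n, 'v) gl_rep" where gm: "gmodel M f (K1 C) EV" by (rule coefficient_module)
    interpret M: gmodel M f "K1 C" EV by (rule gm)
    interpret F: F_model M f "K1 C" EV unfolding F_model_def by (rule gm)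
    obtain g where "dmodel (F_mod P0 M) g (coeffs (K1 C)) (X EV)" by (rule F.F_mod_model)
    then interpret G: dmodel "F_mod P0 M" g "coeffs (K1 C)" "X EV" .
    have "dmodel (F_mod P0 M) (\<lambda>v. \<psi> (g v)) (\<psi> ` coeffs (K1 C)) A"
      by (rule G.transfer_clin[OF vfrep_axioms \<psi>(1)]) (use \<psi> in auto)
    then have "lie_iso derivations V (F_mod P0 M)" unfolding \<psi>(3) by (rule dmodel_iso[OF dm])
    moreover have "simple_lie_module gl M" using M.simple_iff irrK by simp
    moreover have "\<not> is_V (fundamental_weight r) (of_nat r) M" if "r \<in> {0..CARD('n)}" for r
    proof
      assume V: "is_V (fundamental_weight r) (of_nat r) M"
      have "r \<le> CARD('n)" using that by simp
      with m(2) show False using is_V_imp_TT[OF gm irrK _ V m(1), of i l j k] by blast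
    qed
    ultimately show ?thesis by blast
  next
    assume TT: "\<forall>i l j k. \<forall>m\<in>K1 C. EV.TT i l j k m = 0"
    obtain r and \<psi> :: "(('n \<Rightarrow>\<^sub>0 nat) \<Rightarrow>\<^sub>0 'n set \<Rightarrow>\<^sub>0 complex) \<Rightarrow> 'v \<Rightarrow>\<^sub>0 complex"
      where r: "r < CARD('n)" and \<psi>: "clin \<psi>" "\<psi> ` coeffs (LL r) = C"
        "\<And>g. g \<in> coeffs (LL r) \<Longrightarrow> \<psi> g = 0 \<longleftrightarrow> dext g = 0"
        "\<And>h g. g \<in> coeffs (LL r) \<Longrightarrow> \<psi> (X EL h g) = A h (\<psi> g)"
      by (rule classify_ext[OF vfrep_axioms irr K]) (use TT in \<open>auto intro: that\<close>)
    show ?thesis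
    proof (cases r)
      case 0
      obtain k where "dmodel (F_ext 0 :: ('n, _) op_rep) k (dext ` coeffs (LL 0)) (X EL)" by (rule F_ext_0_model)
      then have "dmodel (F_ext 0 :: ('n, _) op_rep) k (dext ` coeffs (LL r)) (X EL)" by (simp only: 0)
      then have "lie_iso derivations V (F_ext 0)"
        by (intro dext_iso[OF dm \<psi>(1,2)]) (erule \<psi>(3), erule \<psi>(4))
      then show ?thesis by blast
    next
      case (Suc q)
      obtain f' :: "'n F_ext \<Rightarrow> _" where "ext_model r f'" by (rule ext_model)
      then interpret E: ext_model r f' .
      obtain k where "dmodel (quot_rep (F_ext r) (L_tilde r) :: ('n, 'n F_ext set) op_rep) k (dext ` coeffs (LL r)) (X EL)"
        by (rule E.quot_L_tilde[OF Suc])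
      then have "lie_iso derivations V (quot_rep (F_ext r) (L_tilde r))"
        by (intro dext_iso[OF dm \<psi>(1,2)]) (erule \<psi>(3), erule \<psi>(4))
      moreover have "r \<in> {1..CARD('n) - 1}" using r Suc by auto
      ultimately show ?thesis by blast
    qed
  qed
qed

text \<open>All fields act by 0, so the assertion about nontrivial modules holds vacuously for this
  member of the list.\<close>

lemma top_quotient:
  fixes V :: "('n::{finite,linorder}, 'n F_ext set) op_rep"
  assumes V: "V = quot_rep (F_ext CARD('n)) (L_sub CARD('n))"
  shows "lie_module derivations V" "vectorspace.fin_dim complex_ring V" "vectorspace.dim complex_ring V = 1"
    "trivial_lie_module derivations V"
proof -
  obtain k where "dmodel V k (UNIV :: complex set) (\<lambda>_ _. 0)"
    unfolding V by (rule quot_L_sub_top)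
  then interpret dmodel V k "UNIV :: complex set" "\<lambda>_ _. 0" .
  show "lie_module derivations V" by (rule lie_module)
  show "trivial_lie_module derivations V" by (rule trivialI) simp
  define v where "v = fi 1"
  have v: "v \<in> carrier V" "k v = 1" by (simp_all add: v_def fi_in f_fi)
  have span: "vs.span {v} = carrier V"
  proof
    show sub: "vs.span {v} \<subseteq> carrier V" using v by (intro span_carrier) simp
    show "carrier V \<subseteq> vs.span {v}"
    proof
      fix u assume u: "u \<in> carrier V"
      have "v \<in> vs.span {v}" using vs.in_own_span[of "{v}"] v by simp
      then have "scl (k u) (k v) \<in> k ` vs.span {v}"
        using csub_scl[OF csub_f_span[of "{v}"]] v by blast
      then obtain u' where "u' \<in> vs.span {v}" "k u = k u'" using v by auto
      then show "u \<in> vs.span {v}" using u sub f_inj[of u u'] by auto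
    qed
  qed
  have "v \<noteq> \<zero>\<^bsub>V\<^esub>" using v(2) f_zero by auto
  then show "vs.dim = 1" using vs.dim1I[OF span] v(1) by simp
  show "vs.fin_dim" unfolding vs.fin_dim_def using span v(1) by (intro exI[of _ "{v}"]) simp
qed

theorem theorem5p5:
  assumes "CARD('n::{finite,linorder}) \<ge> 2"
  shows
    "(\<forall>V :: ('n, 'v) op_rep.
        simple_lie_module derivations V \<and> smooth V \<and> height V = 1 \<longrightarrow>
          (\<exists>M :: ('n, 'v) gl_rep. simple_lie_module gl M \<and>
             (\<forall>r\<in>{0..CARD('n)}. \<not> is_V (fundamental_weight r) (of_nat r) M) \<and>
             lie_iso derivations V (F_mod P0 M)) \<or>
          lie_iso derivations V (F_ext 0) \<or>
          (\<exists>r\<in>{1..CARD('n) - 1}. lie_iso derivations V (quot_rep (F_ext r) (L_tilde r))) \<or>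
          lie_iso derivations V (quot_rep (F_ext CARD('n)) (L_sub CARD('n)))) \<and>
     (\<forall>M :: ('n, 'm) gl_rep. simple_lie_module gl M \<and>
        (\<forall>r\<in>{0..CARD('n)}. \<not> is_V (fundamental_weight r) (of_nat r) M) \<and>
        \<not> trivial_lie_module derivations (F_mod P0 M) \<longrightarrow>
          simple_lie_module derivations (F_mod P0 M) \<and> smooth (F_mod P0 M) \<and> height (F_mod P0 M) = 1) \<and>
     (let V = F_ext 0 :: ('n, 'n F_ext) op_rep in
        lie_iso derivations V P0 \<and>
        (\<not> trivial_lie_module derivations V \<longrightarrow>
          simple_lie_module derivations V \<and> smooth V \<and> height V = 1)) \<and>
     (\<forall>r\<in>{1..CARD('n) - 1}.
        let V = quot_rep (F_ext r) (L_tilde r) :: ('n, 'n F_ext set) op_rep in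
          \<not> trivial_lie_module derivations V \<longrightarrow>
            simple_lie_module derivations V \<and> smooth V \<and> height V = 1) \<and>
     (let V = quot_rep (F_ext CARD('n)) (L_sub CARD('n)) :: ('n, 'n F_ext set) op_rep in
        lie_module derivations V \<and>
        vectorspace.fin_dim complex_ring V \<and> vectorspace.dim complex_ring V = 1 \<and>
        (\<not> trivial_lie_module derivations V \<longrightarrow>
          simple_lie_module derivations V \<and> smooth V \<and> height V = 1))"
proof (intro conjI)
  show "\<forall>V :: ('n, 'v) op_rep.
        simple_lie_module derivations V \<and> smooth V \<and> height V = 1 \<longrightarrow>
          (\<exists>M :: ('n, 'v) gl_rep. simple_lie_module gl M \<and>
             (\<forall>r\<in>{0..CARD('n)}. \<not> is_V (fundamental_weight r) (of_nat r) M) \<and>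
             lie_iso derivations V (F_mod P0 M)) \<or>
          lie_iso derivations V (F_ext 0) \<or>
          (\<exists>r\<in>{1..CARD('n) - 1}. lie_iso derivations V (quot_rep (F_ext r) (L_tilde r))) \<or>
          lie_iso derivations V (quot_rep (F_ext CARD('n)) (L_sub CARD('n)))"
  proof (intro allI impI, elim conjE)
    fix V :: "('n, 'v) op_rep"
    assume "simple_lie_module derivations V" "smooth V" "height V = 1"
    from classification[OF this] show "(\<exists>M :: ('n, 'v) gl_rep. simple_lie_module gl M \<and>
             (\<forall>r\<in>{0..CARD('n)}. \<not> is_V (fundamental_weight r) (of_nat r) M) \<and>
             lie_iso derivations V (F_mod P0 M)) \<or>
          lie_iso derivations V (F_ext 0) \<or>
          (\<exists>r\<in>{1..CARD('n) - 1}. lie_iso derivations V (quot_rep (F_ext r) (L_tilde r))) \<or>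
          lie_iso derivations V (quot_rep (F_ext CARD('n)) (L_sub CARD('n)))"
      by (elim disjE) (rule disjI1, assumption, rule disjI2, rule disjI1, assumption,
        rule disjI2, rule disjI2, rule disjI1, assumption)
  qed
  show "\<forall>M :: ('n, 'm) gl_rep. simple_lie_module gl M \<and>
        (\<forall>r\<in>{0..CARD('n)}. \<not> is_V (fundamental_weight r) (of_nat r) M) \<and>
        \<not> trivial_lie_module derivations (F_mod P0 M) \<longrightarrow>
          simple_lie_module derivations (F_mod P0 M) \<and> smooth (F_mod P0 M) \<and> height (F_mod P0 M) = 1"
    by (intro allI impI, elim conjE) (rule tensor_simple)
  show "let V = F_ext 0 :: ('n, 'n F_ext) op_rep in
        lie_iso derivations V P0 \<and>
        (\<not> trivial_lie_module derivations V \<longrightarrow>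
          simple_lie_module derivations V \<and> smooth V \<and> height V = 1)"
    unfolding Let_def
  proof (intro conjI[OF F_ext_0_iso] impI)
    assume nt: "\<not> trivial_lie_module derivations (F_ext 0 :: ('n, 'n F_ext) op_rep)"
    obtain k where "dmodel (F_ext 0 :: ('n, 'n F_ext) op_rep) k (dext ` coeffs (LL 0)) (X EL)"
      by (rule F_ext_0_model)
    then show "simple_lie_module derivations (F_ext 0 :: ('n, 'n F_ext) op_rep) \<and>
        smooth (F_ext 0 :: ('n, 'n F_ext) op_rep) \<and> height (F_ext 0 :: ('n, 'n F_ext) op_rep) = 1"
      using nt by (rule dext_simple[OF _ zero_less_card_finite])
  qed
  show "\<forall>r\<in>{1..CARD('n) - 1}.
        let V = quot_rep (F_ext r) (L_tilde r) :: ('n, 'n F_ext set) op_rep in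
          \<not> trivial_lie_module derivations V \<longrightarrow>
            simple_lie_module derivations V \<and> smooth V \<and> height V = 1"
    unfolding Let_def
  proof (intro ballI impI)
    fix r assume r: "r \<in> {1..CARD('n) - 1}"
      and nt: "\<not> trivial_lie_module derivations (quot_rep (F_ext r) (L_tilde r) :: ('n, 'n F_ext set) op_rep)"
    obtain q where q: "r = Suc q" using r by (cases r) auto
    obtain f :: "'n F_ext \<Rightarrow> _" where "ext_model r f" by (rule ext_model)
    then interpret ext_model r f .
    obtain k where k: "dmodel (quot_rep (F_ext r) (L_tilde r) :: ('n, 'n F_ext set) op_rep) k (dext ` coeffs (LL r)) (X EL)"
      by (rule quot_L_tilde[OF q])
    have "r < CARD('n)" using r by auto
    from dext_simple[OF k this nt]
    show "simple_lie_module derivations (quot_rep (F_ext r) (L_tilde r) :: ('n, 'n F_ext set) op_rep) \<and>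
        smooth (quot_rep (F_ext r) (L_tilde r) :: ('n, 'n F_ext set) op_rep) \<and>
        height (quot_rep (F_ext r) (L_tilde r) :: ('n, 'n F_ext set) op_rep) = 1" .
  qed
  show "let V = quot_rep (F_ext CARD('n)) (L_sub CARD('n)) :: ('n, 'n F_ext set) op_rep in
        lie_module derivations V \<and>
        vectorspace.fin_dim complex_ring V \<and> vectorspace.dim complex_ring V = 1 \<and>
        (\<not> trivial_lie_module derivations V \<longrightarrow>
          simple_lie_module derivations V \<and> smooth V \<and> height V = 1)"
    unfolding Let_def using top_quotient[OF refl, where 'n = 'n] by blast
qed

end
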